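(* Let $k$ be a field, $A$ an LFD $k$-algebra and $K$ a field extension of $k$ such that either $t.d.(A:k)<\infty$ or $t.d.(K:k)<\infty$. Let $B$ be a transcendence basis of $K$ over $k$, and let $L$ be the separable algebraic closure of $k(B)$ in $K$. Assume that $[L:k(B)]<\infty$. If $A$ is a stably strong S-ring (resp., $A$ is universally catenarian and $K\otimes_k A$ satisfies MPC), then $K\otimes_k A$ is a stably strong S-ring (resp., universally catenarian).
   Context: All rings and algebras are commutative with identity and non-zero. For a $k$-algebra $A$, $t.d.(A:k)=\sup\{t.d.(A/p:k): p\in \mathrm{Spec}(A)\}$, where for a domain $D$ containing $k$, $t.d.(D:k)$ is the transcendence degree over $k$ of its quotient field. $\mathrm{ht}$ denotes height and $\subset$ denotes proper inclusion. A ring is LFD (locally finite-dimensional) if its localization at every prime ideal has finite Krull dimension. A domain $D$ is an S-domain if for each height-one prime ideal $p$ of $D$, the ideal $pD[X]$ of the polynomial ring $D[X]$ has height $1$. A ring $R$ is a strong S-ring if $R/p$ is an S-domain for each $p\in \mathrm{Spec}(R)$; $R$ is a stably strong S-ring if $R[X_1,\dots,X_n]$ is a strong S-ring for each positive integer $n$. A ring satisfies MPC if its minimal prime ideals are pairwise comaximal (i.e., each maximal ideal contains only one minimal prime ideal). A ring $R$ is catenarian if it satisfies MPC, is LFD, and $\mathrm{ht}(Q)=1+\mathrm{ht}(P)$ for each pair $P\subset Q$ of adjacent prime ideals of $R$; $R$ is universally catenarian if $R[X_1,\dots,X_n]$ is catenarian for each positive integer $n$. *)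

theory Defs
  imports "HOL-Algebra.Algebra" "HOL-Algebra.UnivPoly" "HOL-Library.Extended_Nat"
begin

section \<open>Prime ideals, height and dimension\<close>

locale nonzero_cring = cring +
  assumes one_not_zero: "\<one> \<noteq> \<zero>"

definition spec :: "('a, 'm) ring_scheme \<Rightarrow> 'a set set"
  where "spec R = {p. primeideal p R}"

text \<open>A chain of length \<open>n\<close> consists of \<open>n + 1\<close> primes.\<close>

definition prime_chain :: "('a, 'm) ring_scheme \<Rightarrow> nat \<Rightarrow> (nat \<Rightarrow> 'a set) \<Rightarrow> bool"
  where "prime_chain R n c \<longleftrightarrow> (\<forall>i\<le>n. c i \<in> spec R) \<and> (\<forall>i<n. c i \<subset> c (Suc i))"

definition krull_dim :: "('a, 'm) ring_scheme \<Rightarrow> enat"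
  where "krull_dim R = (SUP n\<in>{n. \<exists>c. prime_chain R n c}. enat n)"

definition prime_height :: "('a, 'm) ring_scheme \<Rightarrow> 'a set \<Rightarrow> enat"
  where "prime_height R p = (SUP n\<in>{n. \<exists>c. prime_chain R n c \<and> c n = p}. enat n)"

definition ideal_height :: "('a, 'm) ring_scheme \<Rightarrow> 'a set \<Rightarrow> enat"
  where "ideal_height R I = (INF p\<in>{p \<in> spec R. I \<subseteq> p}. prime_height R p)"

definition minimal_primes :: "('a, 'm) ring_scheme \<Rightarrow> 'a set set"
  where "minimal_primes R = {p \<in> spec R. \<forall>q\<in>spec R. q \<subseteq> p \<longrightarrow> q = p}"

definition adjacent_primes :: "('a, 'm) ring_scheme \<Rightarrow> 'a set \<Rightarrow> 'a set \<Rightarrow> bool"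
  where "adjacent_primes R P Q \<longleftrightarrow>
    P \<in> spec R \<and> Q \<in> spec R \<and> P \<subset> Q \<and> \<not> (\<exists>N\<in>spec R. P \<subset> N \<and> N \<subset> Q)"


section \<open>Localization and quotient fields\<close>

text \<open>The ring of fractions \<open>S\<inverse>R\<close> for a multiplicative subset \<open>S\<close>; the pair \<open>(a, s)\<close>
  stands for \<open>a / s\<close>. The operations on classes are given by unions over all representatives.\<close>

definition frac_rel :: "('a, 'm) ring_scheme \<Rightarrow> 'a set \<Rightarrow> (('a \<times> 'a) \<times> ('a \<times> 'a)) set"
  where "frac_rel R S = {((a, s), (b, t)). (a, s) \<in> carrier R \<times> S \<and> (b, t) \<in> carrier R \<times> S \<and>
    (\<exists>u\<in>S. u \<otimes>\<^bsub>R\<^esub> (a \<otimes>\<^bsub>R\<^esub> t) = u \<otimes>\<^bsub>R\<^esub> (b \<otimes>\<^bsub>R\<^esub> s))}"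

definition fraction :: "('a, 'm) ring_scheme \<Rightarrow> 'a set \<Rightarrow> 'a \<Rightarrow> 'a \<Rightarrow> ('a \<times> 'a) set"
  where "fraction R S a s = frac_rel R S `` {(a, s)}"

definition fraction_ring :: "('a, 'm) ring_scheme \<Rightarrow> 'a set \<Rightarrow> ('a \<times> 'a) set ring"
  where "fraction_ring R S = \<lparr>
    carrier = (carrier R \<times> S) // frac_rel R S,
    monoid.mult = (\<lambda>U V. \<Union>(a, s)\<in>U. \<Union>(b, t)\<in>V. fraction R S (a \<otimes>\<^bsub>R\<^esub> b) (s \<otimes>\<^bsub>R\<^esub> t)),
    monoid.one = fraction R S \<one>\<^bsub>R\<^esub> \<one>\<^bsub>R\<^esub>,
    ring.zero = fraction R S \<zero>\<^bsub>R\<^esub> \<one>\<^bsub>R\<^esub>,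
    ring.add = (\<lambda>U V. \<Union>(a, s)\<in>U. \<Union>(b, t)\<in>V.
      fraction R S ((a \<otimes>\<^bsub>R\<^esub> t) \<oplus>\<^bsub>R\<^esub> (b \<otimes>\<^bsub>R\<^esub> s)) (s \<otimes>\<^bsub>R\<^esub> t))\<rparr>"

definition localization_at :: "('a, 'm) ring_scheme \<Rightarrow> 'a set \<Rightarrow> ('a \<times> 'a) set ring"
  where "localization_at R p = fraction_ring R (carrier R - p)"

definition quotient_field :: "('a, 'm) ring_scheme \<Rightarrow> ('a \<times> 'a) set ring"
  where "quotient_field D = fraction_ring D (carrier D - {\<zero>\<^bsub>D\<^esub>})"

definition to_quotient_field :: "('a, 'm) ring_scheme \<Rightarrow> 'a \<Rightarrow> ('a \<times> 'a) set"
  where "to_quotient_field D a = fraction D (carrier D - {\<zero>\<^bsub>D\<^esub>}) a \<one>\<^bsub>D\<^esub>"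


section \<open>Polynomial rings in finitely many variables\<close>

text \<open>\<open>R[X\<^sub>0, \<dots>, X\<^sub>n\<^sub>-\<^sub>1]\<close> on top of the library's indexed polynomials, which come without a
  multiplication. A monomial is a multiset of variables, so its divisors are its submultisets.\<close>

definition mpoly_ring :: "('a, 'm) ring_scheme \<Rightarrow> nat \<Rightarrow> (nat multiset \<Rightarrow> 'a) ring"
  where "mpoly_ring R n = \<lparr>
    carrier = ring.indexed_pset R {..<n} (carrier R),
    monoid.mult = (\<lambda>P Q m. \<Oplus>\<^bsub>R\<^esub>d\<in>{d. d \<subseteq># m}. P d \<otimes>\<^bsub>R\<^esub> Q (m - d)),
    monoid.one = ring.indexed_const R \<one>\<^bsub>R\<^esub>,
    ring.zero = ring.indexed_const R \<zero>\<^bsub>R\<^esub>,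
    ring.add = ring.indexed_padd R\<rparr>"


section \<open>LFD, strong S-rings and catenarian rings\<close>

definition LFD :: "('a, 'm) ring_scheme \<Rightarrow> bool"
  where "LFD R \<longleftrightarrow> (\<forall>p\<in>spec R. krull_dim (localization_at R p) < \<infinity>)"

definition extended_ideal :: "('a, 'm) ring_scheme \<Rightarrow> 'a set \<Rightarrow> (nat \<Rightarrow> 'a) set"
  where "extended_ideal R I = Idl\<^bsub>UP R\<^esub> ((\<lambda>a. up_ring.monom (UP R) a 0) ` I)"

definition S_domain :: "('a, 'm) ring_scheme \<Rightarrow> bool"
  where "S_domain D \<longleftrightarrow> domain D \<and>
    (\<forall>p\<in>spec D. prime_height D p = 1 \<longrightarrow> ideal_height (UP D) (extended_ideal D p) = 1)"

definition strong_S_ring :: "('a, 'm) ring_scheme \<Rightarrow> bool"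
  where "strong_S_ring R \<longleftrightarrow> nonzero_cring R \<and> (\<forall>p\<in>spec R. S_domain (R Quot p))"

definition stably_strong_S_ring :: "('a, 'm) ring_scheme \<Rightarrow> bool"
  where "stably_strong_S_ring R \<longleftrightarrow> nonzero_cring R \<and> (\<forall>n\<ge>1. strong_S_ring (mpoly_ring R n))"

definition MPC :: "('a, 'm) ring_scheme \<Rightarrow> bool"
  where "MPC R \<longleftrightarrow>
    (\<forall>p\<in>minimal_primes R. \<forall>q\<in>minimal_primes R. p \<noteq> q \<longrightarrow> p <+>\<^bsub>R\<^esub> q = carrier R)"

definition catenarian :: "('a, 'm) ring_scheme \<Rightarrow> bool"
  where "catenarian R \<longleftrightarrow> nonzero_cring R \<and> MPC R \<and> LFD R \<and>
    (\<forall>P Q. adjacent_primes R P Q \<longrightarrow> prime_height R Q = 1 + prime_height R P)"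

definition universally_catenarian :: "('a, 'm) ring_scheme \<Rightarrow> bool"
  where "universally_catenarian R \<longleftrightarrow> nonzero_cring R \<and> (\<forall>n\<ge>1. catenarian (mpoly_ring R n))"


section \<open>Transcendence degree\<close>

definition monomial_value :: "('a, 'm) ring_scheme \<Rightarrow> 'a multiset \<Rightarrow> 'a"
  where "monomial_value L m = (\<Otimes>\<^bsub>L\<^esub>x\<in>set_mset m. x [^]\<^bsub>L\<^esub> count m x)"

text \<open>A polynomial in variables indexed by \<open>B\<close>, evaluated by sending each \<open>b \<in> B\<close> to itself.\<close>

definition mpoly_value :: "('a, 'm) ring_scheme \<Rightarrow> ('a multiset \<Rightarrow> 'a) \<Rightarrow> 'a"
  where "mpoly_value L P = (\<Oplus>\<^bsub>L\<^esub>m\<in>{m. P m \<noteq> \<zero>\<^bsub>L\<^esub>}. P m \<otimes>\<^bsub>L\<^esub> monomial_value L m)"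

definition algebraically_independent :: "('a, 'm) ring_scheme \<Rightarrow> 'a set \<Rightarrow> 'a set \<Rightarrow> bool"
  where "algebraically_independent L F B \<longleftrightarrow> B \<subseteq> carrier L \<and>
    (\<forall>P\<in>ring.indexed_pset L B F. mpoly_value L P = \<zero>\<^bsub>L\<^esub> \<longrightarrow> P = ring.indexed_const L \<zero>\<^bsub>L\<^esub>)"

abbreviation adjoin :: "('a, 'm) ring_scheme \<Rightarrow> 'a set \<Rightarrow> 'a set \<Rightarrow> 'a set"
  where "adjoin L F B \<equiv> generate_field L (F \<union> B)"

definition transcendence_basis :: "('a, 'm) ring_scheme \<Rightarrow> 'a set \<Rightarrow> 'a set \<Rightarrow> bool"
  where "transcendence_basis L F B \<longleftrightarrow> algebraically_independent L F B \<and>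
    (\<forall>x\<in>carrier L. (ring.algebraic L over adjoin L F B) x)"

definition ecard :: "'a set \<Rightarrow> enat"
  where "ecard B = (if finite B then enat (card B) else \<infinity>)"

text \<open>All transcendence bases of \<open>L\<close> over \<open>F\<close> have the same cardinality, so the supremum below is
  their common cardinality, with all infinite cardinals identified.\<close>

definition field_trdeg :: "('a, 'm) ring_scheme \<Rightarrow> 'a set \<Rightarrow> enat"
  where "field_trdeg L F = (SUP B\<in>{B. transcendence_basis L F B}. ecard B)"

definition domain_trdeg :: "('a, 'm) ring_scheme \<Rightarrow> 'a set \<Rightarrow> enat"
  where "domain_trdeg D F = field_trdeg (quotient_field D) (to_quotient_field D ` F)"

text \<open>For an algebra \<open>A\<close> over the field with underlying set \<open>k\<close>: the image of \<open>k\<close> in \<open>A / p\<close>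
  consists of the cosets of the elements \<open>c \<cdot> 1\<close>.\<close>

definition algebra_trdeg :: "('k, 'a, 'm) module_scheme \<Rightarrow> 'k set \<Rightarrow> enat"
  where "algebra_trdeg A k =
    (SUP p\<in>spec A. domain_trdeg (A Quot p) ((\<lambda>c. p +>\<^bsub>A\<^esub> (c \<odot>\<^bsub>A\<^esub> \<one>\<^bsub>A\<^esub>)) ` k))"


section \<open>Separable algebraic closure in an extension field\<close>

text \<open>A polynomial over \<open>F\<close> is separable if its roots in an algebraic closure of \<open>F\<close> are simple;
  \<open>indexed_const\<close> is the embedding of \<open>F\<close> into the library's algebraic closure.\<close>

definition separable_poly :: "('a, 'm) ring_scheme \<Rightarrow> 'a list \<Rightarrow> bool"
  where "separable_poly F f \<longleftrightarrow>
    (\<forall>a\<in>carrier (field.alg_closure F).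
      ring.alg_mult (field.alg_closure F) (map (ring.indexed_const F) f) a \<le> 1)"

definition separable_closure_in :: "('a, 'm) ring_scheme \<Rightarrow> 'a set \<Rightarrow> 'a set"
  where "separable_closure_in K E = {x \<in> carrier K.
    (ring.algebraic K over E) x \<and> separable_poly (K\<lparr>carrier := E\<rparr>) (ring.Irr K E x)}"


section \<open>The tensor product\<close>

text \<open>\<open>K \<otimes>\<^sub>k A\<close> for a subring \<open>k\<close> of \<open>K\<close> and a \<open>k\<close>-algebra \<open>A\<close>: the free abelian group on
  \<open>K \<times> A\<close>, with multiplication extended bilinearly from \<open>(x, a) (y, b) = (x y, a b)\<close>, modulo the
  usual bilinearity relations. In the quotient, \<open>x \<otimes> a\<close> is the coset of the generator \<open>(x, a)\<close>.\<close>

definition pair_ring ::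
    "('b, 'n) ring_scheme \<Rightarrow> ('a, 'm) ring_scheme \<Rightarrow> ('b \<times> 'a \<Rightarrow>\<^sub>0 int) ring"
  where "pair_ring K A = \<lparr>
    carrier = {f. Poly_Mapping.keys f \<subseteq> carrier K \<times> carrier A},
    monoid.mult = (\<lambda>f g.
      frag_extend (\<lambda>(x, a). frag_extend (\<lambda>(y, b). frag_of (x \<otimes>\<^bsub>K\<^esub> y, a \<otimes>\<^bsub>A\<^esub> b)) g) f),
    monoid.one = frag_of (\<one>\<^bsub>K\<^esub>, \<one>\<^bsub>A\<^esub>),
    ring.zero = 0,
    ring.add = (+)\<rparr>"

definition tensor_relations ::
    "'b set \<Rightarrow> ('b, 'n) ring_scheme \<Rightarrow> ('b, 'a, 'm) module_scheme \<Rightarrow> ('b \<times> 'a \<Rightarrow>\<^sub>0 int) set"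
  where "tensor_relations k K A =
    {frag_of (x \<oplus>\<^bsub>K\<^esub> y, a) - frag_of (x, a) - frag_of (y, a) | x y a.
      x \<in> carrier K \<and> y \<in> carrier K \<and> a \<in> carrier A} \<union>
    {frag_of (x, a \<oplus>\<^bsub>A\<^esub> b) - frag_of (x, a) - frag_of (x, b) | x a b.
      x \<in> carrier K \<and> a \<in> carrier A \<and> b \<in> carrier A} \<union>
    {frag_of (x \<otimes>\<^bsub>K\<^esub> c, a) - frag_of (x, c \<odot>\<^bsub>A\<^esub> a) | x c a.
      x \<in> carrier K \<and> c \<in> k \<and> a \<in> carrier A}"

definition tensor_product ::
    "'b set \<Rightarrow> ('b, 'n) ring_scheme \<Rightarrow> ('b, 'a, 'm) module_scheme \<Rightarrow> ('b \<times> 'a \<Rightarrow>\<^sub>0 int) set ring"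
  where "tensor_product k K A =
    pair_ring K A Quot (Idl\<^bsub>pair_ring K A\<^esub> (tensor_relations k K A))"

end

theory Submission
  imports Defs
begin

text \<open>Let \<open>L\<close> be spanned over \<open>k(B)\<close> by a finite set \<open>\<Theta>\<close>. Every element of \<open>K\<close> has a power \<open>x\<^sup>q\<close> in
  \<open>L\<close>, where \<open>q\<close> is \<open>1\<close> or a power of the characteristic, so the map
  \<open>\<phi> : A[X\<^sub>0, \<dots>, X\<^sub>n\<^sub>-\<^sub>1, (Y\<^sub>b)\<^sub>b, (Z\<^sub>\<theta>)\<^sub>\<theta>] \<rightarrow> (K \<otimes> A)[X\<^sub>0, \<dots>, X\<^sub>n\<^sub>-\<^sub>1]\<close> is surjective up to units and such powers.
  Pulling back along \<open>\<phi>\<close> therefore embeds the spectrum of the target into that of a polynomial ring over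
  \<open>A\<close> and preserves adjacent primes, and the same holds after adjoining one more variable.

  It remains to replace the possibly infinite set \<open>B\<close> by finitely many variables. If \<open>A\<close> has finite
  transcendence degree, chains of primes \<open>\<phi>\<^sup>-\<^sup>1(P)\<close> over a fixed prime of \<open>A\<close> have bounded length, because
  these primes contain no nonzero polynomial with coefficients in \<open>k\<close> in the variables \<open>Y\<^sub>b\<close>. Hence each \<open>\<phi>\<^sup>-\<^sup>1(P)\<close> is
  the smallest prime with a given contraction to some polynomial subring in finitely many variables, and
  adjacent primes contract to adjacent primes of this subring. In this way both the strong S-property and
  the equality of lengths of saturated chains are inherited from \<open>A[X\<^sub>1, \<dots>, X\<^sub>N]\<close>.\<close>

section \<open>Contraction of prime ideals\<close>

text \<open>The obstacle is an infinite \<open>B\<close>: adjacency is in general lost when primes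
  are contracted to fewer variables, while the hypotheses on \<open>A\<close> speak about finitely
  many variables. What bounds chains is that a chain of primes of \<open>G[x]\<close> over one prime
  of \<open>G\<close> has at most two members, so each further generator at most doubles their
  number. The generators counted are the \<open>X_j\<close>, the \<open>Z_\<theta>\<close> and
  finitely many elements of \<open>A\<close> over whose images \<open>A/p\<close> is algebraic; the
  \<open>Y_b\<close> are not counted, so the bound is independent of \<open>B\<close>. Finiteness of
  \<open>[L : k(B)]\<close> keeps the \<open>Z_\<theta>\<close> finite in number, and finite
  transcendence degree of \<open>A\<close> supplies the elements of \<open>A\<close>. If instead
  \<open>K\<close> has finite transcendence degree, then \<open>B\<close> is finite from the outset.
  A prime between two contractions extends to a least prime over it, which lies below the upper
  prime automatically and above the lower one by the leastness of the latter. MPC of the tensor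
  product makes the longest chains to two adjacent primes start at the same minimal prime, so that
  their lengths can be compared.\<close>

definition contract :: "('a, 'm) ring_scheme \<Rightarrow> ('a \<Rightarrow> 'b) \<Rightarrow> 'b set \<Rightarrow> 'a set"
  where "contract R h P = {r \<in> carrier R. h r \<in> P}"

lemma contract_iff [simp]: "r \<in> contract R h P \<longleftrightarrow> r \<in> carrier R \<and> h r \<in> P"
  by (auto simp: contract_def)

lemma spec_iff: "p \<in> spec R \<longleftrightarrow> primeideal p R"
  by (simp add: spec_def)

lemma contract_spec:
  assumes "ring_hom_cring R S h" "P \<in> spec S"
  shows "contract R h P \<in> spec R"
proof -
  interpret ring_hom_cring R S h by fact
  show ?thesis
    using ring.primeideal_vimage[of P] assms(2) by (simp add: contract_def spec_iff R.is_cring)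
qed

context primeideal
begin

lemma one_notin [simp]: "\<one> \<notin> I"
  using I_notcarr one_imp_carrier by blast

lemma mult_in_iff: "a \<in> carrier R \<Longrightarrow> b \<in> carrier R \<Longrightarrow> a \<otimes> b \<in> I \<longleftrightarrow> a \<in> I \<or> b \<in> I"
  using I_prime[of a b] I_l_closed[of b a] I_r_closed[of a b] by auto

lemma pow_in: "a \<in> carrier R \<Longrightarrow> a [^] (n::nat) \<in> I \<Longrightarrow> a \<in> I"
  by (induct n) (auto simp: mult_in_iff)

lemma pow_in_iff: "a \<in> carrier R \<Longrightarrow> n > 0 \<Longrightarrow> a [^] (n::nat) \<in> I \<longleftrightarrow> a \<in> I"
proof (induct n)
  case (Suc n)
  then show ?case by (cases n) (auto simp: mult_in_iff)
qed simp

lemma Units_notin: "u \<in> Units R \<Longrightarrow> u \<notin> I"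
  by (metis I_l_closed Units_closed Units_inv_closed Units_l_inv one_notin)

lemma Units_mult_in_iff: "u \<in> Units R \<Longrightarrow> a \<in> carrier R \<Longrightarrow> u \<otimes> a \<in> I \<longleftrightarrow> a \<in> I"
  using mult_in_iff Units_notin by blast

lemma add_in: "a \<in> I \<Longrightarrow> b \<in> I \<Longrightarrow> a \<oplus> b \<in> I"
  by (rule additive_subgroup.a_closed[OF is_additive_subgroup])

lemma neg_in: "a \<in> I \<Longrightarrow> \<ominus> a \<in> I"
  by (rule additive_subgroup.a_inv_closed[OF is_additive_subgroup])

lemma minus_in_iff: "a \<in> carrier R \<Longrightarrow> b \<in> carrier R \<Longrightarrow> a \<ominus> b \<in> I \<Longrightarrow> a \<in> I \<longleftrightarrow> b \<in> I"
proof -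
  assume ab: "a \<in> carrier R" "b \<in> carrier R" "a \<ominus> b \<in> I"
  have "a = (a \<ominus> b) \<oplus> b" "b = a \<oplus> (\<ominus> (a \<ominus> b))" using ab(1,2) by algebra+
  then show ?thesis using ab add_in neg_in by metis
qed

lemma add_in_iff: "a \<in> carrier R \<Longrightarrow> b \<in> I \<Longrightarrow> a \<oplus> b \<in> I \<longleftrightarrow> a \<in> I"
proof -
  assume a: "a \<in> carrier R" "b \<in> I"
  have b: "b \<in> carrier R" using a Icarr by blast
  have "a = (a \<oplus> b) \<oplus> (\<ominus> b)" using a(1) b by algebra
  then show ?thesis using a add_in neg_in by metis
qed

lemma finsum_in: "(\<And>i. i \<in> A \<Longrightarrow> f i \<in> I) \<Longrightarrow> (\<Oplus>i\<in>A. f i) \<in> I"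
proof (induct A rule: infinite_finite_induct)
  case (insert x F)
  then have "f \<in> F \<rightarrow> carrier R" "f x \<in> carrier R" using Icarr by auto
  then show ?case using insert by (simp add: add_in)
qed auto

end

subsection \<open>Frobenius exponents\<close>

text \<open>Exponents for which the power map is additive: \<open>1\<close> and, in prime characteristic \<open>p\<close>, the powers of
  \<open>p\<close>. This treats characteristic zero and prime characteristic uniformly.\<close>

definition frob :: "('a, 'm) ring_scheme \<Rightarrow> nat set"
  where "frob R = {q. q > 0 \<and> (\<forall>x\<in>carrier R. \<forall>y\<in>carrier R.
    (x \<oplus>\<^bsub>R\<^esub> y) [^]\<^bsub>R\<^esub> q = x [^]\<^bsub>R\<^esub> q \<oplus>\<^bsub>R\<^esub> y [^]\<^bsub>R\<^esub> q)}"

lemma (in cring) frob_one: "1 \<in> frob R"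
  by (simp add: frob_def)

lemma (in cring) frob_mult: "q \<in> frob R \<Longrightarrow> q' \<in> frob R \<Longrightarrow> q * q' \<in> frob R"
  by (auto simp: frob_def nat_pow_pow[symmetric])

lemma (in cring) frob_power: "q \<in> frob R \<Longrightarrow> q ^ e \<in> frob R"
  using frob_one by (induct e) (auto intro: frob_mult)

lemma (in cring) frob_pos: "q \<in> frob R \<Longrightarrow> q > 0"
  by (simp add: frob_def)

lemma (in cring) frob_add: "q \<in> frob R \<Longrightarrow> x \<in> carrier R \<Longrightarrow> y \<in> carrier R \<Longrightarrow>
    (x \<oplus> y) [^] q = x [^] q \<oplus> y [^] q"
  by (simp add: frob_def)

lemma (in cring) frob_minus: "q \<in> frob R \<Longrightarrow> x \<in> carrier R \<Longrightarrow> (\<ominus> x) [^] q = \<ominus> (x [^] q)"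
  using frob_add[of q "\<ominus> x" x] frob_pos[of q] by (simp add: l_neg nat_pow_zero minus_equality)

lemma (in cring) binomial:
  assumes "x \<in> carrier R" "y \<in> carrier R"
  shows "(x \<oplus> y) [^] (n::nat) = (\<Oplus>i\<in>{..n}. add_pow R (n choose i) (x [^] i \<otimes> y [^] (n - i)))"
proof (induct n)
  case (Suc n)
  let ?t = "\<lambda>m i. add_pow R (m choose i) (x [^] i \<otimes> y [^] (m - i))"
  have c: "?t m i \<in> carrier R" for m i using assms by simp
  have "(x \<oplus> y) [^] Suc n = (\<Oplus>i\<in>{..n}. ?t n i) \<otimes> x \<oplus> (\<Oplus>i\<in>{..n}. ?t n i) \<otimes> y"
    using Suc assms c by (simp add: r_distr Pi_def)
  also have "(\<Oplus>i\<in>{..n}. ?t n i) \<otimes> x = (\<Oplus>i\<in>{..n}. add_pow R (n choose i) (x [^] Suc i \<otimes> y [^] (n - i)))"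
  proof -
    have "?t n i \<otimes> x = add_pow R (n choose i) (x [^] Suc i \<otimes> y [^] (n - i))" for i
    proof -
      have "x [^] i \<otimes> y [^] (n - i) \<otimes> x = x [^] Suc i \<otimes> y [^] (n - i)"
        using assms by (simp add: m_ac)
      then show ?thesis using assms by (simp add: add_pow_ldistr)
    qed
    then show ?thesis using assms c by (simp add: finsum_ldistr Pi_def)
  qed
  also have "(\<Oplus>i\<in>{..n}. ?t n i) \<otimes> y = (\<Oplus>i\<in>{..n}. add_pow R (n choose i) (x [^] i \<otimes> y [^] (Suc n - i)))"
  proof -
    have "?t n i \<otimes> y = add_pow R (n choose i) (x [^] i \<otimes> y [^] (Suc n - i))" if "i \<le> n" for i
    proof -
      have "x [^] i \<otimes> y [^] (n - i) \<otimes> y = x [^] i \<otimes> y [^] (Suc n - i)"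
        using assms that by (simp add: m_assoc Suc_diff_le)
      then show ?thesis using assms by (simp add: add_pow_ldistr)
    qed
    then have "(\<Oplus>i\<in>{..n}. ?t n i \<otimes> y) = (\<Oplus>i\<in>{..n}. add_pow R (n choose i) (x [^] i \<otimes> y [^] (Suc n - i)))"
      using assms by (intro finsum_cong') (auto simp: Pi_def)
    then show ?thesis using assms c by (simp add: finsum_ldistr Pi_def)
  qed
  \<comment> \<open>The additional summand has coefficient \<open>n choose Suc n\<close>, which is
    zero. It aligns the index ranges, so that after a shift Pascal's rule applies term by
    term.\<close>
  also have "\<dots> = (\<Oplus>i\<in>{..Suc n}. add_pow R (n choose i) (x [^] i \<otimes> y [^] (Suc n - i)))"
    using assms by (simp add: Pi_def binomial_eq_0)
  also have "\<dots> = (\<Oplus>i\<in>{..n}. add_pow R (n choose Suc i) (x [^] Suc i \<otimes> y [^] (n - i))) \<oplus> add_pow R (n choose 0) (x [^] (0::nat) \<otimes> y [^] (Suc n))"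
    using assms by (subst finsum_Suc2) (auto simp: Pi_def)
  finally have "(x \<oplus> y) [^] Suc n =
     (\<Oplus>i\<in>{..n}. add_pow R (n choose i) (x [^] Suc i \<otimes> y [^] (n - i))) \<oplus>
     ((\<Oplus>i\<in>{..n}. add_pow R (n choose Suc i) (x [^] Suc i \<otimes> y [^] (n - i))) \<oplus> add_pow R (n choose 0) (x [^] (0::nat) \<otimes> y [^] (Suc n)))" .
  also have "\<dots> = (\<Oplus>i\<in>{..n}. add_pow R (n choose i) (x [^] Suc i \<otimes> y [^] (n - i)) \<oplus> add_pow R (n choose Suc i) (x [^] Suc i \<otimes> y [^] (n - i)))
       \<oplus> add_pow R (n choose 0) (x [^] (0::nat) \<otimes> y [^] (Suc n))"
    using assms by (subst finsum_addf) (auto simp: Pi_def a_assoc)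
  also have "\<dots> = (\<Oplus>i\<in>{..n}. ?t (Suc n) (Suc i)) \<oplus> ?t (Suc n) 0"
    using assms by (simp add: add.nat_pow_mult)
  also have "\<dots> = (\<Oplus>i\<in>{..Suc n}. ?t (Suc n) i)"
    using assms by (subst finsum_Suc2) (auto simp: Pi_def)
  finally show ?case .
qed (use assms in simp)

lemma (in cring) prime_in_frob:
  fixes p :: nat
  assumes "Factorial_Ring.prime p" "add_pow R p \<one> = \<zero>"
  shows "p \<in> frob R"
proof -
  have z: "add_pow R m z = \<zero>" if d: "p dvd m" and zc: "z \<in> carrier R" for m z
  proof -
    obtain k where k: "m = p * k" using d by (auto elim: dvdE)
    have "add_pow R m z = (add_pow R p \<one>) \<otimes> (add_pow R k z)"
      using zc k by (simp add: add_pow_ldistr add.nat_pow_pow mult.commute)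
    then show ?thesis using assms zc by simp
  qed
  have p0: "p > 0" using assms prime_gt_0_nat by blast
  have "(x \<oplus> y) [^] p = x [^] p \<oplus> y [^] p" if xy: "x \<in> carrier R" "y \<in> carrier R" for x y
  proof -
    let ?t = "\<lambda>i. add_pow R (p choose i) (x [^] i \<otimes> y [^] (p - i))"
    have "(x \<oplus> y) [^] p = (\<Oplus>i\<in>{..p}. ?t i)" using binomial xy by blast
    also have "\<dots> = (\<Oplus>i\<in>{0,p}. ?t i)"
    proof (rule add.finprod_mono_neutral_cong_right)
      show "\<And>i. i \<in> {..p} - {0, p} \<Longrightarrow> ?t i = \<zero>"
      proof -
        fix i assume "i \<in> {..p} - {0, p}"
        then have i: "0 < i" "i < p" by auto
        \<comment> \<open>By this absorption identity \<open>p\<close> divides the left side; being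
          prime and larger than \<open>i\<close>, it divides \<open>p choose i\<close>.\<close>
        have "i * (p choose i) = p * (p - 1 choose (i - 1))"
          using i by (metis Suc_diff_1 binomial_absorption diff_Suc_1 p0)
        then have "p dvd (p choose i)"
          using assms(1) i by (metis dvd_triv_left nat_dvd_not_less prime_dvd_mult_iff)
        then show "?t i = \<zero>" using z xy by simp
      qed
    qed (use xy in auto)
    also have "\<dots> = x [^] p \<oplus> y [^] p" using xy p0 by (simp add: Pi_def a_comm)
    finally show ?thesis .
  qed
  then show ?thesis using p0 by (auto simp: frob_def)
qed

subsection \<open>Homomorphisms that are surjective up to units and Frobenius exponents\<close>

text \<open>A common generalization of quotients, localizations and purely inseparable extensions. As for these,
  contraction identifies the primes of the target with a convex set of primes of the source.\<close>

definition ess_image :: "('a, 'm) ring_scheme \<Rightarrow> ('b, 'n) ring_scheme \<Rightarrow> ('a \<Rightarrow> 'b) \<Rightarrow> 'b set"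
  where "ess_image R S h = {t \<in> carrier S. \<exists>q\<in>frob S. \<exists>s\<in>carrier R. \<exists>r\<in>carrier R.
    h s \<in> Units S \<and> h s \<otimes>\<^bsub>S\<^esub> t [^]\<^bsub>S\<^esub> q = h r}"

definition ess_surj :: "('a, 'm) ring_scheme \<Rightarrow> ('b, 'n) ring_scheme \<Rightarrow> ('a \<Rightarrow> 'b) \<Rightarrow> bool"
  where "ess_surj R S h \<longleftrightarrow> ring_hom_cring R S h \<and> ess_image R S h = carrier S"

context ring_hom_cring
begin

lemma hom_npow: "x \<in> carrier R \<Longrightarrow> h (x [^] (n::nat)) = h x [^]\<^bsub>S\<^esub> n"
  by (induct n) auto

lemma Units_pow: "u \<in> Units S \<Longrightarrow> u [^]\<^bsub>S\<^esub> (n::nat) \<in> Units S"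
  by (induct n) auto

text \<open>Raising each equation to the exponent of the other makes both exponents
  \<open>q1 * q2\<close>; multiplying across by powers of the other denominator makes the units
  equal. Ring operations are checked on such common representations.\<close>

lemma ess_common:
  assumes "t1 \<in> ess_image R S h" "t2 \<in> ess_image R S h"
  obtains q s r1 r2 where "q \<in> frob S" "s \<in> carrier R" "h s \<in> Units S" "r1 \<in> carrier R" "r2 \<in> carrier R"
    "h s \<otimes>\<^bsub>S\<^esub> t1 [^]\<^bsub>S\<^esub> q = h r1" "h s \<otimes>\<^bsub>S\<^esub> t2 [^]\<^bsub>S\<^esub> q = h r2"
proof -
  obtain q1 s1 r1 where 1: "q1 \<in> frob S" "s1 \<in> carrier R" "h s1 \<in> Units S" "r1 \<in> carrier R"
    "h s1 \<otimes>\<^bsub>S\<^esub> t1 [^]\<^bsub>S\<^esub> q1 = h r1" "t1 \<in> carrier S"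
    using assms(1) unfolding ess_image_def by auto
  obtain q2 s2 r2 where 2: "q2 \<in> frob S" "s2 \<in> carrier R" "h s2 \<in> Units S" "r2 \<in> carrier R"
    "h s2 \<otimes>\<^bsub>S\<^esub> t2 [^]\<^bsub>S\<^esub> q2 = h r2" "t2 \<in> carrier S"
    using assms(2) by (auto simp: ess_image_def)
  have A: "h s1 [^]\<^bsub>S\<^esub> q2 \<otimes>\<^bsub>S\<^esub> t1 [^]\<^bsub>S\<^esub> (q1 * q2) = h r1 [^]\<^bsub>S\<^esub> q2"
    using 1 by (simp add: S.nat_pow_distrib[symmetric] S.nat_pow_pow[symmetric])
  have B: "h s2 [^]\<^bsub>S\<^esub> q1 \<otimes>\<^bsub>S\<^esub> t2 [^]\<^bsub>S\<^esub> (q1 * q2) = h r2 [^]\<^bsub>S\<^esub> q1"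
    using 2 by (simp add: S.nat_pow_distrib[symmetric] S.nat_pow_pow[symmetric] mult.commute[of q1])
  have cc: "h s1 [^]\<^bsub>S\<^esub> q2 \<in> carrier S" "h s2 [^]\<^bsub>S\<^esub> q1 \<in> carrier S"
     "t1 [^]\<^bsub>S\<^esub> (q1 * q2) \<in> carrier S" "t2 [^]\<^bsub>S\<^esub> (q1 * q2) \<in> carrier S" using 1 2 by auto
  show thesis
  proof (rule that)
    show "q1 * q2 \<in> frob S" using 1 2 S.frob_mult by blast
    show "s1 [^] q2 \<otimes> s2 [^] q1 \<in> carrier R" using 1 2 by simp
    show "h (s1 [^] q2 \<otimes> s2 [^] q1) \<in> Units S" using 1 2 by (simp add: hom_npow Units_pow)
    show "r1 [^] q2 \<otimes> s2 [^] q1 \<in> carrier R" "r2 [^] q1 \<otimes> s1 [^] q2 \<in> carrier R" using 1 2 by simp_all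
    show "h (s1 [^] q2 \<otimes> s2 [^] q1) \<otimes>\<^bsub>S\<^esub> t1 [^]\<^bsub>S\<^esub> (q1 * q2) = h (r1 [^] q2 \<otimes> s2 [^] q1)"
      using 1 2 cc by (simp add: hom_npow A[symmetric] S.m_ac)
    show "h (s1 [^] q2 \<otimes> s2 [^] q1) \<otimes>\<^bsub>S\<^esub> t2 [^]\<^bsub>S\<^esub> (q1 * q2) = h (r2 [^] q1 \<otimes> s1 [^] q2)"
      using 1 2 cc by (simp add: hom_npow B[symmetric] S.m_ac)
  qed
qed

lemma ess_imageI: "t \<in> carrier S \<Longrightarrow> q \<in> frob S \<Longrightarrow> s \<in> carrier R \<Longrightarrow> r \<in> carrier R \<Longrightarrow> h s \<in> Units S \<Longrightarrow>
    h s \<otimes>\<^bsub>S\<^esub> t [^]\<^bsub>S\<^esub> q = h r \<Longrightarrow> t \<in> ess_image R S h"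
  by (auto simp: ess_image_def)

lemma image_ess: "r \<in> carrier R \<Longrightarrow> h r \<in> ess_image R S h"
  by (rule ess_imageI[of _ 1 \<one> r]) (use S.frob_one in auto)

lemma frac_add:
  assumes "q \<in> frob S" "s \<in> carrier R" "r1 \<in> carrier R" "r2 \<in> carrier R" "t1 \<in> carrier S" "t2 \<in> carrier S"
    "h s \<otimes>\<^bsub>S\<^esub> t1 [^]\<^bsub>S\<^esub> q = h r1" "h s \<otimes>\<^bsub>S\<^esub> t2 [^]\<^bsub>S\<^esub> q = h r2"
  shows "h s \<otimes>\<^bsub>S\<^esub> (t1 \<oplus>\<^bsub>S\<^esub> t2) [^]\<^bsub>S\<^esub> q = h (r1 \<oplus> r2)"
  using assms by (simp add: S.frob_add S.r_distr)

lemma frac_mult: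
  assumes "s \<in> carrier R" "r1 \<in> carrier R" "r2 \<in> carrier R" "t1 \<in> carrier S" "t2 \<in> carrier S"
    "h s \<otimes>\<^bsub>S\<^esub> t1 [^]\<^bsub>S\<^esub> q = h r1" "h s \<otimes>\<^bsub>S\<^esub> t2 [^]\<^bsub>S\<^esub> (q::nat) = h r2"
  shows "h (s \<otimes> s) \<otimes>\<^bsub>S\<^esub> (t1 \<otimes>\<^bsub>S\<^esub> t2) [^]\<^bsub>S\<^esub> q = h (r1 \<otimes> r2)"
  using assms by (simp add: S.nat_pow_distrib assms(6,7)[symmetric] S.m_ac)

lemma frac_neg:
  assumes "q \<in> frob S" "s \<in> carrier R" "r \<in> carrier R" "t \<in> carrier S"
    "h s \<otimes>\<^bsub>S\<^esub> t [^]\<^bsub>S\<^esub> q = h r"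
  shows "h s \<otimes>\<^bsub>S\<^esub> (\<ominus>\<^bsub>S\<^esub> t) [^]\<^bsub>S\<^esub> q = h (\<ominus> r)"
  using assms by (simp add: S.frob_minus S.r_minus)

text \<open>Being a subring, the essential image is everything as soon as it contains generators of
  \<open>S\<close>. For the maps into polynomial rings over the tensor product,
  \<open>ess_surj\<close> is verified in this way.\<close>

lemma ess_image_subring: "subring (ess_image R S h) S"
proof (rule S.subringI)
  show "ess_image R S h \<subseteq> carrier S" by (auto simp: ess_image_def)
  show "\<one>\<^bsub>S\<^esub> \<in> ess_image R S h" using image_ess[of \<one>] by simp
  fix x assume x: "x \<in> ess_image R S h"
  then obtain q s r where "q \<in> frob S" "s \<in> carrier R" "h s \<in> Units S" "r \<in> carrier R" "x \<in> carrier S"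
    "h s \<otimes>\<^bsub>S\<^esub> x [^]\<^bsub>S\<^esub> q = h r" by (auto simp: ess_image_def)
  then show "\<ominus>\<^bsub>S\<^esub> x \<in> ess_image R S h"
    using frac_neg[of q s r x] by (intro ess_imageI[of _ q s "\<ominus> r"]) auto
  fix y assume y: "y \<in> ess_image R S h"
  have xy: "x \<in> carrier S" "y \<in> carrier S" using x y by (auto simp: ess_image_def)
  obtain q s r1 r2 where c: "q \<in> frob S" "s \<in> carrier R" "h s \<in> Units S" "r1 \<in> carrier R" "r2 \<in> carrier R"
    "h s \<otimes>\<^bsub>S\<^esub> x [^]\<^bsub>S\<^esub> q = h r1" "h s \<otimes>\<^bsub>S\<^esub> y [^]\<^bsub>S\<^esub> q = h r2"
    using ess_common[OF x y] .
  show "x \<oplus>\<^bsub>S\<^esub> y \<in> ess_image R S h"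
    using frac_add[OF c(1,2,4,5) xy c(6,7)] c xy by (intro ess_imageI[of _ q s "r1 \<oplus> r2"]) auto
  show "x \<otimes>\<^bsub>S\<^esub> y \<in> ess_image R S h"
    using frac_mult[OF c(2,4,5) xy c(6,7)] c xy by (intro ess_imageI[of _ q "s \<otimes> s" "r1 \<otimes> r2"]) auto
qed

end

lemma ess_surjI:
  assumes "ring_hom_cring R S h" "\<And>t. t \<in> carrier S \<Longrightarrow> t \<in> ess_image R S h"
  shows "ess_surj R S h"
  using assms by (auto simp: ess_surj_def ess_image_def)

lemma ess_surjE:
  assumes "ess_surj R S h" "t \<in> carrier S"
  obtains q s r where "q \<in> frob S" "s \<in> carrier R" "h s \<in> Units S" "r \<in> carrier R"
    "h s \<otimes>\<^bsub>S\<^esub> t [^]\<^bsub>S\<^esub> q = h r"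
proof -
  have "t \<in> ess_image R S h" using assms by (simp add: ess_surj_def)
  then show thesis using that unfolding ess_image_def by blast
qed

lemma surj_ess_surj:
  assumes "ring_hom_cring R S h" "carrier S \<subseteq> h ` carrier R"
  shows "ess_surj R S h"
proof (rule ess_surjI[OF assms(1)])
  fix t assume "t \<in> carrier S"
  then obtain r where "r \<in> carrier R" "t = h r" using assms(2) by auto
  then show "t \<in> ess_image R S h" using ring_hom_cring.image_ess[OF assms(1)] by simp
qed

text \<open>A prime contains \<open>t\<close> exactly when it contains
  \<open>h s \<otimes> t [^] q\<close>, a unit multiple of a power of \<open>t\<close>, and this
  element is the image of \<open>r\<close>. So a prime of \<open>S\<close> is determined by its
  contraction.\<close>

lemma ess_contract_mono:
  assumes e: "ess_surj R S h" and P: "P \<in> spec S" "Q \<in> spec S"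
    and le: "contract R h P \<subseteq> contract R h Q"
  shows "P \<subseteq> Q"
proof
  interpret ring_hom_cring R S h using e by (simp add: ess_surj_def)
  interpret P: primeideal P S using P by (simp add: spec_iff)
  interpret Q: primeideal Q S using P by (simp add: spec_iff)
  fix t assume t: "t \<in> P"
  then have tc: "t \<in> carrier S" by (rule P.Icarr)
  obtain q s r where c: "q \<in> frob S" "s \<in> carrier R" "h s \<in> Units S" "r \<in> carrier R" "h s \<otimes>\<^bsub>S\<^esub> t [^]\<^bsub>S\<^esub> q = h r"
    using ess_surjE[OF e tc] .
  have "h r \<in> P" using c t tc by (metis P.Units_mult_in_iff P.pow_in_iff S.frob_pos S.nat_pow_closed)
  then have "r \<in> contract R h Q" using le c by auto
  then have "h s \<otimes>\<^bsub>S\<^esub> t [^]\<^bsub>S\<^esub> q \<in> Q" using c by simp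
  then show "t \<in> Q" using c tc by (metis Q.Units_mult_in_iff Q.pow_in S.nat_pow_closed)
qed

lemma ess_contract_inj:
  assumes e: "ess_surj R S h" and P: "P \<in> spec S" "Q \<in> spec S"
    and le: "contract R h P = contract R h Q"
  shows "P = Q"
  using ess_contract_mono[OF e] P le by blast

text \<open>The lift consists of those \<open>t\<close> for which a numerator \<open>r\<close> in
  \<open>h s \<otimes> t [^] q = h r\<close> lies in \<open>p\<close>. Two numerators of the same
  \<open>t\<close> agree about membership: up to powers and denominators, which \<open>p\<close>
  avoids, they differ by an element of the kernel, which \<open>p\<close> contains.\<close>

lemma ess_lift:
  fixes R (structure)
  assumes e: "ess_surj R S h" and p: "p \<in> spec R"
    and ker: "\<And>r. r \<in> carrier R \<Longrightarrow> h r = \<zero>\<^bsub>S\<^esub> \<Longrightarrow> r \<in> p"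
    and un: "\<And>r. r \<in> p \<Longrightarrow> h r \<notin> Units S"
  obtains P where "P \<in> spec S" "contract R h P = p"
proof -
  interpret ring_hom_cring R S h using e by (simp add: ess_surj_def)
  interpret p: primeideal p R using p by (simp add: spec_iff)
  define rep where "rep t q s r \<longleftrightarrow> q \<in> frob S \<and> s \<in> carrier R \<and> h s \<in> Units S \<and> r \<in> carrier R \<and>
    h s \<otimes>\<^bsub>S\<^esub> t [^]\<^bsub>S\<^esub> q = h r" for t q s r
  have wd: "r' \<in> p" if "t \<in> carrier S" and 1: "rep t q s r" and 2: "rep t q' s' r'" and "r \<in> p" for t q s r q' s' r'
  proof -
    have c1: "q \<in> frob S" "s \<in> carrier R" "h s \<in> Units S" "r \<in> carrier R" "h s \<otimes>\<^bsub>S\<^esub> t [^]\<^bsub>S\<^esub> q = h r"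
      using 1 unfolding rep_def by blast+
    have c2: "q' \<in> frob S" "s' \<in> carrier R" "h s' \<in> Units S" "r' \<in> carrier R" "h s' \<otimes>\<^bsub>S\<^esub> t [^]\<^bsub>S\<^esub> q' = h r'"
      using 2 unfolding rep_def by blast+
    note cc = c1(2,4) c2(2,4)
    have A: "h s [^]\<^bsub>S\<^esub> q' \<otimes>\<^bsub>S\<^esub> t [^]\<^bsub>S\<^esub> (q * q') = h r [^]\<^bsub>S\<^esub> q'"
      using cc that(1) by (simp add: c1(5)[symmetric] S.nat_pow_distrib S.nat_pow_pow)
    have B: "h s' [^]\<^bsub>S\<^esub> q \<otimes>\<^bsub>S\<^esub> t [^]\<^bsub>S\<^esub> (q * q') = h r' [^]\<^bsub>S\<^esub> q"
      using cc that(1) by (simp add: c2(5)[symmetric] S.nat_pow_distrib S.nat_pow_pow mult.commute[of q])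
    define a b c d where "a = s' [^] q" "b = r [^] q'" "c = s [^] q'" "d = r' [^] q"
    note abcd = this
    have abc: "a \<in> carrier R" "b \<in> carrier R" "c \<in> carrier R" "d \<in> carrier R" using cc by (simp_all add: abcd)
    have tc: "t [^]\<^bsub>S\<^esub> (q * q') \<in> carrier S" using that(1) by simp
    have hb: "h b = h c \<otimes>\<^bsub>S\<^esub> t [^]\<^bsub>S\<^esub> (q * q')" and hd: "h d = h a \<otimes>\<^bsub>S\<^esub> t [^]\<^bsub>S\<^esub> (q * q')"
      using A B cc by (simp_all add: abcd hom_npow)
    have "h (a \<otimes> b) = h (c \<otimes> d)"
      using abc tc by (simp add: hb hd S.m_ac)
    then have "h (c \<otimes> d \<ominus> a \<otimes> b) = \<zero>\<^bsub>S\<^esub>"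
      using abc by (simp add: R.minus_eq S.r_neg del: hom_mult)
    then have "c \<otimes> d \<ominus> a \<otimes> b \<in> p" using ker abc by simp
    moreover have "b \<in> p" using p.pow_in_iff[OF c1(4) S.frob_pos[OF c2(1)]] \<open>r \<in> p\<close> abcd by simp
    then have "a \<otimes> b \<in> p" using abc p.mult_in_iff by blast
    ultimately have "c \<otimes> d \<in> p" using p.minus_in_iff[of "c \<otimes> d" "a \<otimes> b"] abc by simp
    moreover have "s \<notin> p" using c1 un by blast
    then have "c \<notin> p" using p.pow_in[OF c1(2)] abcd by blast
    ultimately have "d \<in> p" using abc p.mult_in_iff by blast
    then show ?thesis using p.pow_in[OF c2(4)] abcd by blast
  qed
  define P where "P = {t \<in> carrier S. \<exists>q s r. rep t q s r \<and> r \<in> p}"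
  have Piff: "t \<in> P \<longleftrightarrow> r \<in> p" if "t \<in> carrier S" "rep t q s r" for t q s r
    using that wd unfolding P_def by blast
  have ex: "\<exists>q s r1 r2. rep t1 q s r1 \<and> rep t2 q s r2" if "t1 \<in> carrier S" "t2 \<in> carrier S" for t1 t2
  proof -
    have "t1 \<in> ess_image R S h" "t2 \<in> ess_image R S h" using that e by (simp_all add: ess_surj_def)
    from ess_common[OF this] show ?thesis unfolding rep_def by metis
  qed
  have Pim: "h r \<in> P \<longleftrightarrow> r \<in> p" if "r \<in> carrier R" for r
    by (rule Piff[of _ 1 \<one>]) (use that S.frob_one in \<open>auto simp: rep_def\<close>)
  have radd: "rep (t1 \<oplus>\<^bsub>S\<^esub> t2) q s (r1 \<oplus> r2)" if "rep t1 q s r1" "rep t2 q s r2" "t1 \<in> carrier S" "t2 \<in> carrier S" for t1 t2 q s r1 r2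
    using that frac_add[of q s r1 r2 t1 t2] by (auto simp: rep_def)
  have rmult: "rep (t1 \<otimes>\<^bsub>S\<^esub> t2) q (s \<otimes> s) (r1 \<otimes> r2)" if "rep t1 q s r1" "rep t2 q s r2" "t1 \<in> carrier S" "t2 \<in> carrier S" for t1 t2 q s r1 r2
    using that frac_mult[of s r1 r2 t1 t2 q] by (auto simp: rep_def)
  have rneg: "rep (\<ominus>\<^bsub>S\<^esub> t) q s (\<ominus> r)" if "rep t q s r" "t \<in> carrier S" for t q s r
    using that frac_neg[of q s r t] by (auto simp: rep_def)
  have mult: "t1 \<otimes>\<^bsub>S\<^esub> t2 \<in> P \<longleftrightarrow> t1 \<in> P \<or> t2 \<in> P" if t: "t1 \<in> carrier S" "t2 \<in> carrier S" for t1 t2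
  proof -
    obtain q s r1 r2 where r: "rep t1 q s r1" "rep t2 q s r2" using ex t by blast
    have "r1 \<in> carrier R" "r2 \<in> carrier R" using r by (auto simp: rep_def)
    then show ?thesis
      using Piff[OF t(1) r(1)] Piff[OF t(2) r(2)] Piff[OF _ rmult[OF r t]] t by (simp add: p.mult_in_iff)
  qed
  have "primeideal P S"
  proof (rule primeidealI[OF idealI])
    show "subgroup P (add_monoid S)"
    proof (rule S.add.subgroupI)
      show "P \<subseteq> carrier S" by (auto simp: P_def)
      have "h \<zero> \<in> P"
        using Pim[of \<zero>] additive_subgroup.zero_closed[OF p.is_additive_subgroup] by simp
      then show "P \<noteq> {}" by blast
      fix a assume a: "a \<in> P"
      then have ac: "a \<in> carrier S" by (simp add: P_def)
      obtain q s r where r: "rep a q s r" using ex ac by blast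
      then have "r \<in> p" using Piff a ac by blast
      then show "\<ominus>\<^bsub>S\<^esub> a \<in> P" using Piff[OF _ rneg[OF r ac]] ac p.neg_in by simp
      fix b assume b: "b \<in> P"
      then have bc: "b \<in> carrier S" by (simp add: P_def)
      obtain q s r1 r2 where r: "rep a q s r1" "rep b q s r2" using ex ac bc by blast
      have "r1 \<in> p" "r2 \<in> p" using Piff a b ac bc r by blast+
      then show "a \<oplus>\<^bsub>S\<^esub> b \<in> P" using Piff[OF _ radd[OF r ac bc]] ac bc p.add_in by simp
    qed
    show "carrier S \<noteq> P" using Pim[of \<one>] by auto
  qed (use mult in \<open>auto simp: P_def S.is_cring S.ring_axioms\<close>)
  moreover have "contract R h P = p" using Pim p.Icarr by auto
  ultimately show thesis using that by (simp add: spec_iff)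
qed

text \<open>For surjective \<open>h\<close> the condition on units in \<open>ess_lift\<close> is
  automatic: an inverse of \<open>h r\<close> is some \<open>h s\<close>, so
  \<open>r \<otimes> s \<ominus> \<one>\<close> lies in the kernel and hence in \<open>Q\<close>.
  With \<open>r \<in> Q\<close> this would put \<open>\<one>\<close> into \<open>Q\<close>.\<close>

lemma surj_lift:
  fixes R (structure)
  assumes h: "ring_hom_cring R S h" and surj: "carrier S \<subseteq> h ` carrier R" and Q: "Q \<in> spec R"
    and ker: "\<And>r. r \<in> carrier R \<Longrightarrow> h r = \<zero>\<^bsub>S\<^esub> \<Longrightarrow> r \<in> Q"
  obtains q where "q \<in> spec S" "contract R h q = Q"
proof -
  interpret h: ring_hom_cring R S h by (rule h)
  interpret Q: primeideal Q R using Q by (simp add: spec_iff)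
  have un: "h r \<notin> Units S" if r: "r \<in> Q" for r
  proof
    assume "h r \<in> Units S"
    then obtain y where y: "y \<in> carrier S" "h r \<otimes>\<^bsub>S\<^esub> y = \<one>\<^bsub>S\<^esub>" by (auto simp: Units_def)
    obtain s where s: "s \<in> carrier R" "y = h s" using surj y(1) by (metis imageE subsetD)
    have rc: "r \<in> carrier R" using r by (rule Q.Icarr)
    have "h (r \<otimes> s \<ominus> \<one>) = \<zero>\<^bsub>S\<^esub>"
      using s rc y(2) by (simp add: h.R.minus_eq h.S.r_neg)
    then have "r \<otimes> s \<ominus> \<one> \<in> Q" using s rc by (intro ker) simp_all
    moreover have "r \<otimes> s \<in> Q" by (rule Q.I_r_closed[OF r s(1)])
    ultimately show False using Q.minus_in_iff[of "r \<otimes> s" \<one>] s rc by simp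
  qed
  show thesis by (rule ess_lift[OF surj_ess_surj[OF h surj] Q], erule (1) ker, erule un, erule (1) that)
qed

lemma adjacent_primesD:
  assumes "adjacent_primes R P Q"
  shows "P \<in> spec R" "Q \<in> spec R" "P \<subset> Q" "N \<in> spec R \<Longrightarrow> P \<subseteq> N \<Longrightarrow> N \<subseteq> Q \<Longrightarrow> N = P \<or> N = Q"
  using assms unfolding adjacent_primes_def by blast+

lemma adjacent_primesI:
  assumes "P \<in> spec R" "Q \<in> spec R" "P \<subset> Q" "\<And>N. N \<in> spec R \<Longrightarrow> P \<subseteq> N \<Longrightarrow> N \<subseteq> Q \<Longrightarrow> N = P \<or> N = Q"
  shows "adjacent_primes R P Q"
  using assms unfolding adjacent_primes_def by blast

text \<open>The lower bound supplies the kernel condition of \<open>ess_lift\<close>, the upper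
  bound the condition on units. The contracted primes therefore form a convex set, which is what
  carries adjacency across.\<close>

lemma contract_between:
  assumes e: "ess_surj R S h" and P: "P \<in> spec S" "Q \<in> spec S"
    and N: "N \<in> spec R" "contract R h P \<subseteq> N" "N \<subseteq> contract R h Q"
  obtains N' where "N' \<in> spec S" "contract R h N' = N" "P \<subseteq> N'" "N' \<subseteq> Q"
proof -
  interpret ring_hom_cring R S h using e by (simp add: ess_surj_def)
  interpret P: primeideal P S using P by (simp add: spec_iff)
  interpret Q: primeideal Q S using P by (simp add: spec_iff)
  obtain N' where N': "N' \<in> spec S" "contract R h N' = N"
  proof (rule ess_lift[OF e N(1)])
    show "\<And>r. r \<in> carrier R \<Longrightarrow> h r = \<zero>\<^bsub>S\<^esub> \<Longrightarrow> r \<in> N" using N(2) by auto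
    show "\<And>r. r \<in> N \<Longrightarrow> h r \<notin> Units S" using N(3) Q.Units_notin by auto
  qed
  then show thesis using that ess_contract_mono[OF e] P N by metis
qed

lemma adjacent_contract:
  assumes e: "ess_surj R S h" and a: "adjacent_primes S P Q"
  shows "adjacent_primes R (contract R h P) (contract R h Q)"
proof (rule adjacent_primesI)
  have h: "ring_hom_cring R S h" using e by (simp add: ess_surj_def)
  note P = adjacent_primesD[OF a]
  show "contract R h P \<in> spec R" "contract R h Q \<in> spec R" using contract_spec[OF h] P by blast+
  have "contract R h P \<noteq> contract R h Q" using ess_contract_inj[OF e P(1,2)] P by auto
  then show "contract R h P \<subset> contract R h Q" using P(3) by auto
  fix N assume N: "N \<in> spec R" "contract R h P \<subseteq> N" "N \<subseteq> contract R h Q"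
  obtain N' where "N' \<in> spec S" "contract R h N' = N" "P \<subseteq> N'" "N' \<subseteq> Q"
    using contract_between[OF e P(1,2) N] .
  then show "N = contract R h P \<or> N = contract R h Q" using P(4) by blast
qed

section \<open>Polynomial rings with an arbitrary set of variables\<close>

text \<open>Infinite transcendence bases require infinitely many variables.\<close>

definition MP :: "('a, 'm) ring_scheme \<Rightarrow> 'i set \<Rightarrow> ('i multiset \<Rightarrow> 'a) ring"
  where "MP R I = \<lparr>
    carrier = ring.indexed_pset R I (carrier R),
    monoid.mult = (\<lambda>P Q m. \<Oplus>\<^bsub>R\<^esub>d\<in>{d. d \<subseteq># m}. P d \<otimes>\<^bsub>R\<^esub> Q (m - d)),
    monoid.one = ring.indexed_const R \<one>\<^bsub>R\<^esub>,
    ring.zero = ring.indexed_const R \<zero>\<^bsub>R\<^esub>,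
    ring.add = ring.indexed_padd R\<rparr>"

lemma mpoly_ring_eq: "mpoly_ring R n = MP R {..<n}"
  by (simp add: mpoly_ring_def MP_def)

lemma finite_submultisets [simp]: "finite {d. d \<subseteq># m}"
proof (induct m)
  case (add x m)
  have "d \<in> {d. d \<subseteq># m} \<union> add_mset x ` {d. d \<subseteq># m}" if "d \<subseteq># add_mset x m" for d
  proof (cases "x \<in># d")
    case True
    then obtain d' where "d = add_mset x d'" by (metis mset_add)
    then show ?thesis using that by auto
  next
    case False
    then have "d \<subseteq># m" using that by (metis Diff_eq_empty_iff_mset diff_add_mset_swap diff_single_trivial subset_eq_diff_conv add_mset_add_single minus_add_mset_if_not_in_lhs)
    then show ?thesis by auto
  qed
  then have "{d. d \<subseteq># add_mset x m} \<subseteq> {d. d \<subseteq># m} \<union> add_mset x ` {d. d \<subseteq># m}" by blast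
  then show ?case using add finite_subset by blast
qed simp

lemma MP_simps:
  "carrier (MP R I) = ring.indexed_pset R I (carrier R)"
  "\<one>\<^bsub>MP R I\<^esub> = ring.indexed_const R \<one>\<^bsub>R\<^esub>"
  "\<zero>\<^bsub>MP R I\<^esub> = ring.indexed_const R \<zero>\<^bsub>R\<^esub>"
  "P \<oplus>\<^bsub>MP R I\<^esub> Q = ring.indexed_padd R P Q"
  "P \<otimes>\<^bsub>MP R I\<^esub> Q = (\<lambda>m. \<Oplus>\<^bsub>R\<^esub>d\<in>{d. d \<subseteq># m}. P d \<otimes>\<^bsub>R\<^esub> Q (m - d))"
  by (simp_all add: MP_def)

section \<open>Convolution of coefficient functions and the ring structure of
  \<open>MP\<close>\<close>

context cring
begin

text \<open>The product of \<open>MP\<close>, taken on all coefficient functions. It is compatible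
  with the three constructors of \<open>indexed_pset\<close>, and the ring laws then follow by
  induction over these constructors.\<close>

definition conv :: "('i multiset \<Rightarrow> 'a) \<Rightarrow> ('i multiset \<Rightarrow> 'a) \<Rightarrow> 'i multiset \<Rightarrow> 'a"
  where "conv P Q = (\<lambda>m. \<Oplus>d\<in>{d. d \<subseteq># m}. P d \<otimes> Q (m - d))"

lemma conv_cc: "carrier_coeff P \<Longrightarrow> carrier_coeff Q \<Longrightarrow> carrier_coeff (conv P Q)"
  by (auto simp: carrier_coeff_def conv_def intro!: finsum_closed)

lemma const_cc: "c \<in> carrier R \<Longrightarrow> carrier_coeff (indexed_const c)"
  by (auto simp: carrier_coeff_def indexed_const_def)

lemma conv_comm:
  assumes "carrier_coeff P" "carrier_coeff Q"
  shows "conv P Q = conv Q P"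
proof
  fix m :: "'c multiset"
  have "conv P Q m = (\<Oplus>d\<in>(\<lambda>d. m - d) ` {d. d \<subseteq># m}. P d \<otimes> Q (m - d))"
  proof -
    have "(\<lambda>d. m - d) ` {d. d \<subseteq># m} = {d. d \<subseteq># m}"
    proof
      show "{d. d \<subseteq># m} \<subseteq> (\<lambda>d. m - d) ` {d. d \<subseteq># m}"
      proof
        fix d assume "d \<in> {d. d \<subseteq># m}"
        then have "d = m - (m - d)" "m - d \<subseteq># m" by (simp_all add: multiset_eq_iff subseteq_mset_def)
        then show "d \<in> (\<lambda>d. m - d) ` {d. d \<subseteq># m}" by blast
      qed
    qed auto
    then show ?thesis by (simp add: conv_def)
  qed
  also have "\<dots> = (\<Oplus>d\<in>{d. d \<subseteq># m}. P (m - d) \<otimes> Q (m - (m - d)))"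
    using assms by (intro finsum_reindex)
      (auto simp: carrier_coeff_def inj_on_def multiset_eq_iff subseteq_mset_def, metis diff_diff_cancel)
  also have "\<dots> = conv Q P m"
  proof -
    have "m - (m - d) = d" if "d \<subseteq># m" for d
      using that by (simp add: multiset_eq_iff subseteq_mset_def)
    then show ?thesis using assms unfolding conv_def
      by (intro finsum_cong') (auto simp: carrier_coeff_def m_comm)
  qed
  finally show "conv P Q m = conv Q P m" .
qed

lemma conv_const:
  assumes "c \<in> carrier R" "carrier_coeff Q"
  shows "conv (indexed_const c) Q = (\<lambda>m. c \<otimes> Q m)"
proof
  fix m :: "'c multiset"
  have "conv (indexed_const c) Q m = (\<Oplus>d\<in>{{#}}. indexed_const c d \<otimes> Q (m - d))"
    unfolding conv_def using assms
    by (intro add.finprod_mono_neutral_cong_right) (auto simp: indexed_const_def carrier_coeff_def)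
  also have "\<dots> = c \<otimes> Q m" using assms by (simp add: indexed_const_def carrier_coeff_def)
  finally show "conv (indexed_const c) Q m = c \<otimes> Q m" .
qed

lemma conv_padd:
  assumes "carrier_coeff P" "carrier_coeff P'" "carrier_coeff Q"
  shows "conv (indexed_padd P P') Q = indexed_padd (conv P Q) (conv P' Q)"
  using assms unfolding conv_def indexed_padd_def carrier_coeff_def
  by (auto simp: l_distr Pi_def finsum_addf)

text \<open>Only divisors of \<open>m\<close> that contain \<open>i\<close> contribute, and removing
  one \<open>i\<close> turns them into the divisors of the remaining monomial. Multiplication by a
  variable thus moves past \<open>conv\<close>, as constants and sums do.\<close>

lemma conv_pmult:
  assumes "carrier_coeff P" "carrier_coeff Q"
  shows "conv (indexed_pmult P i) Q = indexed_pmult (conv P Q) i"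
proof
  fix m :: "'c multiset"
  show "conv (indexed_pmult P i) Q m = indexed_pmult (conv P Q) i m"
  proof (cases "i \<in># m")
    case True
    then obtain m' where m: "m = add_mset i m'" by (metis mset_add)
    have "conv (indexed_pmult P i) Q m = (\<Oplus>d\<in>add_mset i ` {d. d \<subseteq># m'}. indexed_pmult P i d \<otimes> Q (m - d))"
      unfolding conv_def
    proof (intro add.finprod_mono_neutral_cong_right)
      fix d assume d: "d \<in> {d. d \<subseteq># m} - add_mset i ` {d. d \<subseteq># m'}"
      have "i \<notin># d"
      proof
        assume "i \<in># d"
        then obtain d' where "d = add_mset i d'" by (metis mset_add)
        then show False using d m by auto
      qed
      then show "indexed_pmult P i d \<otimes> Q (m - d) = \<zero>" using assms by (simp add: indexed_pmult_def carrier_coeff_def)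
    qed (use assms m in \<open>auto simp: carrier_coeff_def indexed_pmult_def\<close>)
    also have "\<dots> = (\<Oplus>d\<in>{d. d \<subseteq># m'}. indexed_pmult P i (add_mset i d) \<otimes> Q (m - add_mset i d))"
      using assms by (intro finsum_reindex) (auto simp: carrier_coeff_def indexed_pmult_def inj_on_def)
    also have "\<dots> = conv P Q m'" using m by (simp add: conv_def indexed_pmult_def)
    finally show ?thesis using m by (simp add: indexed_pmult_def)
  next
    case False
    have "indexed_pmult P i d = \<zero>" if "d \<subseteq># m" for d
      using that False by (auto simp: indexed_pmult_def dest: mset_subset_eqD)
    then have "conv (indexed_pmult P i) Q m = (\<Oplus>d\<in>{d. d \<subseteq># m}. \<zero>)"
      unfolding conv_def using assms by (intro finsum_cong') (auto simp: carrier_coeff_def)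
    then show ?thesis using False by (simp add: indexed_pmult_def)
  qed
qed

abbreviation pset :: "'i set \<Rightarrow> ('i multiset \<Rightarrow> 'a) set"
  where "pset I \<equiv> indexed_pset I (carrier R)"

lemma pset_cc: "P \<in> pset I \<Longrightarrow> carrier_coeff P"
  by (rule indexed_pset_in_carrier[OF subset_refl])

lemma conv_const_const:
  "c \<in> carrier R \<Longrightarrow> d \<in> carrier R \<Longrightarrow> conv (indexed_const c) (indexed_const d) = indexed_const (c \<otimes> d)"
  by (subst conv_const) (auto simp: indexed_const_def carrier_coeff_def)

lemma conv_padd_r:
  assumes "carrier_coeff P" "carrier_coeff P'" "carrier_coeff Q"
  shows "conv Q (indexed_padd P P') = indexed_padd (conv Q P) (conv Q P')"
  using assms by (simp add: conv_comm[of Q] indexed_padd_in_carrier conv_padd)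

lemma conv_pmult_r:
  assumes "carrier_coeff P" "carrier_coeff Q"
  shows "conv Q (indexed_pmult P i) = indexed_pmult (conv Q P) i"
  using assms by (simp add: conv_comm[of Q] indexed_pmult_in_carrier conv_pmult)

lemma conv_const_pset:
  assumes "c \<in> carrier R" "Q \<in> pset I"
  shows "conv (indexed_const c) Q \<in> pset I"
  using assms(2)
proof induct
  case (indexed_const k) then show ?case using assms(1) by (simp add: conv_const_const indexed_pset.indexed_const)
next
  case (indexed_padd P Q)
  then show ?case using assms(1) by (simp add: conv_padd_r pset_cc const_cc indexed_pset.indexed_padd)
next
  case (indexed_pmult P i)
  then show ?case using assms(1) by (simp add: conv_pmult_r pset_cc const_cc indexed_pset.indexed_pmult)
qed

lemma conv_pset:
  assumes "P \<in> pset I" "Q \<in> pset I"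
  shows "conv P Q \<in> pset I"
  using assms(1)
proof induct
  case (indexed_const k) then show ?case using assms(2) by (rule conv_const_pset)
next
  case (indexed_padd P P')
  then show ?case using assms(2) by (simp add: conv_padd pset_cc indexed_pset.indexed_padd)
next
  case (indexed_pmult P i)
  then show ?case using assms(2) by (simp add: conv_pmult pset_cc indexed_pset.indexed_pmult)
qed

text \<open>Constants, sums and multiplication by a variable all pass through \<open>conv\<close> on
  the left, so induction on the first factor alone replaces a rearrangement of triple sums over
  decompositions of a monomial.\<close>

lemma conv_assoc:
  assumes "P \<in> pset I" "Q \<in> pset I" "Z \<in> pset I"
  shows "conv (conv P Q) Z = conv P (conv Q Z)"
  using assms(1)
proof induct
  case (indexed_const k)
  note cc = pset_cc[OF assms(2)] pset_cc[OF assms(3)]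
  show ?case
  proof
    fix m
    have "conv (conv (indexed_const k) Q) Z m = (\<Oplus>d\<in>{d. d \<subseteq># m}. k \<otimes> (Q d \<otimes> Z (m - d)))"
      using indexed_const cc by (auto simp: conv_const conv_def[of "\<lambda>m. k \<otimes> Q m"] carrier_coeff_def m_assoc intro!: finsum_cong')
    also have "\<dots> = k \<otimes> conv Q Z m"
      using indexed_const cc by (simp add: finsum_rdistr Pi_def carrier_coeff_def conv_def)
    finally show "conv (conv (indexed_const k) Q) Z m = conv (indexed_const k) (conv Q Z) m"
      using indexed_const cc by (simp add: conv_const conv_cc)
  qed
next
  case (indexed_padd P P')
  then show ?case using assms(2,3) by (simp add: conv_padd pset_cc conv_cc)
next
  case (indexed_pmult P i)
  then show ?case using assms(2,3) by (simp add: conv_pmult pset_cc conv_cc)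
qed

lemma MP_mult: "P \<otimes>\<^bsub>MP R I\<^esub> Q = conv P Q"
  by (simp add: MP_simps conv_def)

lemma MP_cring: "cring (MP R I)"
proof (rule cringI)
  show "abelian_group (MP R I)"
  proof (rule abelian_groupI)
    fix x assume x: "x \<in> carrier (MP R I)"
    \<comment> \<open>The product with the constant \<open>\<ominus> \<one>\<close> serves as the
      additive inverse; in this form it visibly belongs to \<open>indexed_pset\<close>.\<close>
    have "conv (indexed_const (\<ominus> \<one>)) x \<in> pset I" using x by (simp add: MP_simps conv_const_pset)
    moreover have "indexed_padd (conv (indexed_const (\<ominus> \<one>)) x) x = indexed_const \<zero>"
    proof -
      have c: "carrier_coeff x" using x by (simp add: MP_simps pset_cc)
      then have "indexed_padd (\<lambda>m. \<ominus> \<one> \<otimes> x m) x = indexed_const \<zero>"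
        by (auto simp: indexed_padd_def carrier_coeff_def indexed_const_def l_minus l_neg)
      then show ?thesis using c by (simp add: conv_const)
    qed
    ultimately show "\<exists>y\<in>carrier (MP R I). y \<oplus>\<^bsub>MP R I\<^esub> x = \<zero>\<^bsub>MP R I\<^esub>" by (auto simp: MP_simps)
  qed (auto simp: MP_simps indexed_pset.indexed_padd indexed_pset.indexed_const indexed_padd_zero pset_cc,
       auto dest!: pset_cc simp: indexed_padd_def carrier_coeff_def a_ac)
  show "comm_monoid (MP R I)"
  proof (rule comm_monoidI)
    fix x assume x: "x \<in> carrier (MP R I)"
    then show "\<one>\<^bsub>MP R I\<^esub> \<otimes>\<^bsub>MP R I\<^esub> x = x"
      using pset_cc[of x I] by (simp add: MP_mult MP_simps(1,2) conv_const carrier_coeffE)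
    fix y assume "y \<in> carrier (MP R I)"
    then show "x \<otimes>\<^bsub>MP R I\<^esub> y = y \<otimes>\<^bsub>MP R I\<^esub> x"
      using x by (simp add: MP_mult MP_simps(1) conv_comm pset_cc)
  qed (auto simp: MP_mult MP_simps(1,2) conv_pset indexed_pset.indexed_const conv_assoc)
qed (auto simp: MP_mult MP_simps(1,4) conv_padd pset_cc)

lemma MP_const_hom: "ring_hom_cring R (MP R I) indexed_const"
proof -
  have "indexed_const \<in> ring_hom R (MP R I)"
    by (rule ring_hom_memI) (auto simp: MP_mult MP_simps(1,2,4) indexed_pset.indexed_const conv_const_const indexed_padd_const)
  then show ?thesis by (simp add: MP_cring is_cring ring_hom_cring_def ring_hom_cring_axioms_def)
qed

lemma MP_var_closed: "i \<in> I \<Longrightarrow> indexed_var i \<in> carrier (MP R I)"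
  by (simp add: MP_simps indexed_var_def indexed_pset.indexed_const indexed_pset.indexed_pmult)

lemma MP_const_closed: "c \<in> carrier R \<Longrightarrow> indexed_const c \<in> carrier (MP R I)"
  by (simp add: MP_simps indexed_pset.indexed_const)

lemma pmult_eq_mult_var:
  assumes "P \<in> carrier (MP R I)"
  shows "indexed_pmult P i = P \<otimes>\<^bsub>MP R I\<^esub> indexed_var i"
  using assms pset_cc[of P I]
  by (simp add: MP_mult MP_simps(1) indexed_var_def conv_pmult_r const_cc conv_comm[of P] conv_const carrier_coeffE)

lemma MP_induct [consumes 1, case_names const add mult_var]:
  assumes "P \<in> carrier (MP R I)"
    and "\<And>c. c \<in> carrier R \<Longrightarrow> \<Phi> (indexed_const c)"
    and "\<And>P Q. P \<in> carrier (MP R I) \<Longrightarrow> Q \<in> carrier (MP R I) \<Longrightarrow> \<Phi> P \<Longrightarrow> \<Phi> Q \<Longrightarrow> \<Phi> (P \<oplus>\<^bsub>MP R I\<^esub> Q)"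
    and "\<And>P i. P \<in> carrier (MP R I) \<Longrightarrow> i \<in> I \<Longrightarrow> \<Phi> P \<Longrightarrow> \<Phi> (P \<otimes>\<^bsub>MP R I\<^esub> indexed_var i)"
  shows "\<Phi> P"
proof -
  have "P \<in> pset I" using assms(1) by (simp add: MP_simps)
  then show ?thesis
  proof induct
    case (indexed_padd P Q) then show ?case using assms(3)[of P Q] by (simp add: MP_simps(1,4))
  next
    case (indexed_pmult P i) then show ?case using assms(4)[of P i] pmult_eq_mult_var[of P I i] by (simp add: MP_simps(1))
  qed (rule assms(2))
qed

lemma MP_gen:
  assumes "subring H (MP R I)" "\<And>c. c \<in> carrier R \<Longrightarrow> indexed_const c \<in> H" "\<And>i. i \<in> I \<Longrightarrow> indexed_var i \<in> H"
  shows "H = carrier (MP R I)"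
proof
  show "H \<subseteq> carrier (MP R I)" using assms(1) by (rule subringE(1))
  show "carrier (MP R I) \<subseteq> H"
  proof
    fix P assume "P \<in> carrier (MP R I)"
    then show "P \<in> H" by (induct rule: MP_induct) (auto intro: assms subringE(6,7)[OF assms(1)])
  qed
qed

lemma MP_mono: "I' \<subseteq> I \<Longrightarrow> P \<in> carrier (MP R I') \<Longrightarrow> P \<in> carrier (MP R I)"
proof -
  assume a: "I' \<subseteq> I" "P \<in> carrier (MP R I')"
  have "P \<in> pset I'" using a by (simp add: MP_simps)
  then have "P \<in> pset I" by induct (use a in \<open>auto intro: indexed_pset.intros\<close>)
  then show ?thesis by (simp add: MP_simps)
qed

lemma MP_incl_hom: "I' \<subseteq> I \<Longrightarrow> ring_hom_cring (MP R I') (MP R I) id"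
proof -
  assume "I' \<subseteq> I"
  then have "id \<in> ring_hom (MP R I') (MP R I)"
    by (intro ring_hom_memI) (auto simp: MP_mono MP_simps(2-5))
  then show ?thesis by (simp add: MP_cring ring_hom_cring_def ring_hom_cring_axioms_def)
qed

lemma MP_finite_vars:
  assumes "P \<in> carrier (MP R I)"
  shows "\<exists>I'. finite I' \<and> I' \<subseteq> I \<and> P \<in> carrier (MP R I')"
  using assms
proof (induct rule: MP_induct)
  case (const c) then show ?case by (intro exI[of _ "{}"]) (simp add: MP_const_closed)
next
  case (add P Q)
  then obtain I1 I2 where "finite I1" "I1 \<subseteq> I" "P \<in> carrier (MP R I1)" "finite I2" "I2 \<subseteq> I" "Q \<in> carrier (MP R I2)" by blast
  moreover have "cring (MP R (I1 \<union> I2))" by (rule MP_cring)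
  ultimately show ?case using MP_mono[of I1 "I1 \<union> I2" P] MP_mono[of I2 "I1 \<union> I2" Q] cring.cring_simprules(1)[of "MP R (I1 \<union> I2)" P Q]
    by (intro exI[of _ "I1 \<union> I2"]) (auto simp: MP_simps(4))
next
  case (mult_var P i)
  then obtain I1 where "finite I1" "I1 \<subseteq> I" "P \<in> carrier (MP R I1)" by blast
  moreover have "cring (MP R (insert i I1))" by (rule MP_cring)
  ultimately show ?case using MP_mono[of I1 "insert i I1" P] cring.cring_simprules(5)[of "MP R (insert i I1)" P "indexed_var i"] MP_var_closed[of i "insert i I1"] mult_var
    by (intro exI[of _ "insert i I1"]) (auto simp: MP_simps(5))
qed

lemma MP_finite_support:
  assumes "P \<in> carrier (MP R I)"
  shows "finite {m. P m \<noteq> \<zero>}"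
proof -
  have "P \<in> pset I" using assms by (simp add: MP_simps)
  then show ?thesis
  proof induct
    case (indexed_const k)
    have "{m. indexed_const k m \<noteq> \<zero>} \<subseteq> {{#}}" by (auto simp: indexed_const_def)
    then show ?case using finite_subset by blast
  next
    case (indexed_padd P Q)
    have "{m. indexed_padd P Q m \<noteq> \<zero>} \<subseteq> {m. P m \<noteq> \<zero>} \<union> {m. Q m \<noteq> \<zero>}" by (auto simp: indexed_padd_def)
    then show ?case using indexed_padd finite_subset by blast
  next
    case (indexed_pmult P i)
    have "{m. indexed_pmult P i m \<noteq> \<zero>} \<subseteq> add_mset i ` {m. P m \<noteq> \<zero>}"
      by (auto simp: indexed_pmult_def image_iff split: if_splits intro!: exI[of _ "_ - {#i#}"])
    then show ?case using indexed_pmult finite_subset by blast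
  qed
qed

lemma MP_coeff_closed: "P \<in> carrier (MP R I) \<Longrightarrow> P m \<in> carrier R"
  using pset_cc[of P I] by (simp add: MP_simps carrier_coeffE)

end

section \<open>Evaluation homomorphisms of polynomial rings\<close>

definition mp_mon :: "('b, 'n) ring_scheme \<Rightarrow> ('i \<Rightarrow> 'b) \<Rightarrow> 'i multiset \<Rightarrow> 'b"
  where "mp_mon S v m = (\<Otimes>\<^bsub>S\<^esub>x\<in>set_mset m. v x [^]\<^bsub>S\<^esub> count m x)"

text \<open>The sum over the support copies the shape of \<open>mpoly_value\<close>, which becomes
  the special case where \<open>h\<close> and \<open>v\<close> are the identity.\<close>

definition mp_eval :: "('a, 'm) ring_scheme \<Rightarrow> ('b, 'n) ring_scheme \<Rightarrow> ('a \<Rightarrow> 'b) \<Rightarrow> ('i \<Rightarrow> 'b) \<Rightarrow> ('i multiset \<Rightarrow> 'a) \<Rightarrow> 'b"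
  where "mp_eval R S h v P = (\<Oplus>\<^bsub>S\<^esub>m\<in>{m. P m \<noteq> \<zero>\<^bsub>R\<^esub>}. h (P m) \<otimes>\<^bsub>S\<^esub> mp_mon S v m)"

lemma (in cring) mp_mon_empty: "mp_mon R v {#} = \<one>"
  by (simp add: mp_mon_def)

lemma (in cring) mp_mon_add:
  assumes "\<And>j. j \<in># add_mset i m \<Longrightarrow> v j \<in> carrier R"
  shows "mp_mon R v (add_mset i m) = v i \<otimes> mp_mon R v m"
proof (cases "i \<in># m")
  case True
  then have s: "set_mset (add_mset i m) = insert i (set_mset m - {i})" "set_mset m = insert i (set_mset m - {i})" by auto
  have c: "(\<Otimes>x\<in>set_mset m - {i}. v x [^] count (add_mset i m) x) = (\<Otimes>x\<in>set_mset m - {i}. v x [^] count m x)"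
    using assms by (intro finprod_cong') auto
  have "mp_mon R v (add_mset i m) = v i [^] Suc (count m i) \<otimes> (\<Otimes>x\<in>set_mset m - {i}. v x [^] count m x)"
    unfolding mp_mon_def s(1) using assms c by (subst finprod_insert) auto
  moreover have "mp_mon R v m = v i [^] count m i \<otimes> (\<Otimes>x\<in>set_mset m - {i}. v x [^] count m x)"
    unfolding mp_mon_def by (subst s(2), subst finprod_insert) (use assms in auto)
  moreover have "(\<Otimes>x\<in>set_mset m - {i}. v x [^] count m x) \<in> carrier R" using assms by (auto intro!: finprod_closed)
  ultimately show ?thesis using assms[of i] by (simp add: m_ac)
next
  case False
  have c: "(\<Otimes>x\<in>set_mset m. v x [^] count (add_mset i m) x) = (\<Otimes>x\<in>set_mset m. v x [^] count m x)"
    using assms False by (intro finprod_cong') auto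
  have "mp_mon R v (add_mset i m) = v i [^] count (add_mset i m) i \<otimes> (\<Otimes>x\<in>set_mset m. v x [^] count (add_mset i m) x)"
    unfolding mp_mon_def set_mset_add_mset_insert using False assms by (subst finprod_insert) auto
  also have "\<dots> = v i \<otimes> mp_mon R v m"
    unfolding c using False assms by (simp add: mp_mon_def not_in_iff)
  finally show ?thesis .
qed

lemma (in cring) mp_mon_closed:
  "(\<And>j. j \<in># m \<Longrightarrow> v j \<in> carrier R) \<Longrightarrow> mp_mon R v m \<in> carrier R"
  by (auto simp: mp_mon_def intro!: finprod_closed)

lemma (in cring) MP_support_vars:
  assumes "P \<in> carrier (MP R I)" "P m \<noteq> \<zero>"
  shows "set_mset m \<subseteq> I"
proof -
  have "P \<in> pset I" using assms by (simp add: MP_simps)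
  then show ?thesis using assms(2)
  proof (induct arbitrary: m)
    case (indexed_const k) then show ?case by (auto simp: indexed_const_def split: if_splits)
  next
    case (indexed_padd P Q)
    then have "P m \<noteq> \<zero> \<or> Q m \<noteq> \<zero>" by (auto simp: indexed_padd_def)
    then show ?case using indexed_padd by blast
  next
    case (indexed_pmult P i)
    then have "i \<in># m" "set_mset (m - {#i#}) \<subseteq> I" by (auto simp: indexed_pmult_def split: if_splits)
    then show ?case using indexed_pmult(3) by (metis insert_DiffM insert_subset set_mset_add_mset_insert)
  qed
qed

context ring_hom_cring
begin

text \<open>Different polynomials have different supports; summation over a common finite superset
  is what makes additivity a termwise statement.\<close>

lemma mp_eval_superset:
  assumes P: "P \<in> carrier (MP R I)" and v: "\<And>i. i \<in> I \<Longrightarrow> v i \<in> carrier S"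
    and F: "finite F" "{m. P m \<noteq> \<zero>} \<subseteq> F" "\<And>m. m \<in> F \<Longrightarrow> set_mset m \<subseteq> I"
  shows "mp_eval R S h v P = (\<Oplus>\<^bsub>S\<^esub>m\<in>F. h (P m) \<otimes>\<^bsub>S\<^esub> mp_mon S v m)"
proof -
  have m: "mp_mon S v m \<in> carrier S" if "m \<in> F" for m
    using F(3)[OF that] v by (intro S.mp_mon_closed) auto
  have c: "P m \<in> carrier R" for m by (rule R.MP_coeff_closed[OF P])
  show ?thesis
    unfolding mp_eval_def
    by (rule S.add.finprod_mono_neutral_cong_left) (use F m c in \<open>auto simp: Pi_def\<close>)
qed

lemma MP_term_closed:
  assumes "P \<in> carrier (MP R I)" "\<And>i. i \<in> I \<Longrightarrow> v i \<in> carrier S" "set_mset m \<subseteq> I"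
  shows "h (P m) \<otimes>\<^bsub>S\<^esub> mp_mon S v m \<in> carrier S" "mp_mon S v m \<in> carrier S"
proof -
  show "mp_mon S v m \<in> carrier S" using assms(2,3) by (intro S.mp_mon_closed) blast
  then show "h (P m) \<otimes>\<^bsub>S\<^esub> mp_mon S v m \<in> carrier S" using R.MP_coeff_closed[OF assms(1)] by simp
qed

lemma mp_eval_closed:
  assumes "P \<in> carrier (MP R I)" "\<And>i. i \<in> I \<Longrightarrow> v i \<in> carrier S"
  shows "mp_eval R S h v P \<in> carrier S"
  unfolding mp_eval_def
  by (intro S.finsum_closed) (use MP_term_closed[OF assms] R.MP_support_vars[OF assms(1)] in auto)

lemma mp_eval_const:
  assumes "c \<in> carrier R"
  shows "mp_eval R S h v (R.indexed_const c) = h c"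
proof -
  have "mp_eval R S h v (R.indexed_const c) = (\<Oplus>\<^bsub>S\<^esub>m\<in>{{#}}. h (R.indexed_const c m) \<otimes>\<^bsub>S\<^esub> mp_mon S v m)"
    by (rule mp_eval_superset[where I = "{}"])
      (use assms R.MP_const_closed[OF assms] in \<open>auto simp: R.indexed_const_def\<close>)
  then show ?thesis using assms by (simp add: R.indexed_const_def S.mp_mon_empty)
qed

lemma mp_eval_add:
  assumes P: "P \<in> carrier (MP R I)" and Q: "Q \<in> carrier (MP R I)" and v: "\<And>i. i \<in> I \<Longrightarrow> v i \<in> carrier S"
  shows "mp_eval R S h v (P \<oplus>\<^bsub>MP R I\<^esub> Q) = mp_eval R S h v P \<oplus>\<^bsub>S\<^esub> mp_eval R S h v Q"
proof -
  interpret M: cring "MP R I" by (rule R.MP_cring)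
  let ?F = "{m. P m \<noteq> \<zero>} \<union> {m. Q m \<noteq> \<zero>}"
  have f: "finite ?F" using R.MP_finite_support P Q by auto
  have I: "\<And>m. m \<in> ?F \<Longrightarrow> set_mset m \<subseteq> I" using R.MP_support_vars P Q by blast
  have cf: "P m \<in> carrier R" "Q m \<in> carrier R" for m using R.MP_coeff_closed P Q by blast+
  have 1: "mp_eval R S h v P = (\<Oplus>\<^bsub>S\<^esub>m\<in>?F. h (P m) \<otimes>\<^bsub>S\<^esub> mp_mon S v m)"
    by (rule mp_eval_superset[OF P v f _ I]) auto
  have 2: "mp_eval R S h v Q = (\<Oplus>\<^bsub>S\<^esub>m\<in>?F. h (Q m) \<otimes>\<^bsub>S\<^esub> mp_mon S v m)"
    by (rule mp_eval_superset[OF Q v f _ I]) auto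
  have 3: "mp_eval R S h v (P \<oplus>\<^bsub>MP R I\<^esub> Q) = (\<Oplus>\<^bsub>S\<^esub>m\<in>?F. h ((P \<oplus>\<^bsub>MP R I\<^esub> Q) m) \<otimes>\<^bsub>S\<^esub> mp_mon S v m)"
    by (rule mp_eval_superset[OF M.a_closed[OF P Q] v f _ I]) (auto simp: MP_simps(4) R.indexed_padd_def)
  have mc: "mp_mon S v m \<in> carrier S" if "m \<in> ?F" for m using MP_term_closed(2)[where v = v, OF P v I[OF that]] by blast
  have "mp_eval R S h v (P \<oplus>\<^bsub>MP R I\<^esub> Q) = (\<Oplus>\<^bsub>S\<^esub>m\<in>?F. h (P m) \<otimes>\<^bsub>S\<^esub> mp_mon S v m \<oplus>\<^bsub>S\<^esub> h (Q m) \<otimes>\<^bsub>S\<^esub> mp_mon S v m)"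
    unfolding 3 by (rule S.finsum_cong') (use mc cf in \<open>auto simp: MP_simps(4) R.indexed_padd_def S.l_distr\<close>)
  also have "\<dots> = mp_eval R S h v P \<oplus>\<^bsub>S\<^esub> mp_eval R S h v Q"
    unfolding 1 2 by (rule S.finsum_addf) (use mc cf in auto)
  finally show ?thesis .
qed

lemma mp_eval_pmult:
  assumes P: "P \<in> carrier (MP R I)" and i: "i \<in> I" and v: "\<And>i. i \<in> I \<Longrightarrow> v i \<in> carrier S"
  shows "mp_eval R S h v (R.indexed_pmult P i) = mp_eval R S h v P \<otimes>\<^bsub>S\<^esub> v i"
proof -
  let ?F = "{m. P m \<noteq> \<zero>}"
  have f: "finite ?F" using R.MP_finite_support P by auto
  have I: "set_mset m \<subseteq> I" if "m \<in> ?F" for m using R.MP_support_vars[OF P] that by blast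
  have cf: "P m \<in> carrier R" for m using R.MP_coeff_closed P by blast
  have PI: "R.indexed_pmult P i \<in> carrier (MP R I)"
    using P i by (simp add: MP_simps R.indexed_pset.indexed_pmult)
  have mc: "mp_mon S v m \<in> carrier S" if "m \<in> ?F" for m using MP_term_closed(2)[where v = v, OF P v I[OF that]] by blast
  have ma: "mp_mon S v (add_mset i m) = v i \<otimes>\<^bsub>S\<^esub> mp_mon S v m" if "m \<in> ?F" for m
    using I[OF that] i v by (intro S.mp_mon_add) auto
  have sub: "{m. R.indexed_pmult P i m \<noteq> \<zero>} \<subseteq> add_mset i ` ?F"
    by (auto simp: R.indexed_pmult_def image_iff split: if_splits intro!: exI[of _ "_ - {#i#}"])
  have "mp_eval R S h v (R.indexed_pmult P i) = (\<Oplus>\<^bsub>S\<^esub>m\<in>add_mset i ` ?F. h (R.indexed_pmult P i m) \<otimes>\<^bsub>S\<^esub> mp_mon S v m)"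
    by (rule mp_eval_superset[OF PI v _ sub]) (use f i in \<open>auto dest!: I[unfolded mem_Collect_eq]\<close>)
  also have "\<dots> = (\<Oplus>\<^bsub>S\<^esub>m\<in>?F. h (P m) \<otimes>\<^bsub>S\<^esub> mp_mon S v (add_mset i m))"
    by (subst S.finsum_reindex) (use cf ma mc v i in \<open>auto simp: R.indexed_pmult_def inj_on_def\<close>)
  also have "\<dots> = (\<Oplus>\<^bsub>S\<^esub>m\<in>?F. (h (P m) \<otimes>\<^bsub>S\<^esub> mp_mon S v m) \<otimes>\<^bsub>S\<^esub> v i)"
    by (rule S.finsum_cong') (use cf ma mc v i in \<open>auto simp: S.m_ac\<close>)
  also have "\<dots> = mp_eval R S h v P \<otimes>\<^bsub>S\<^esub> v i"
    unfolding mp_eval_def by (rule S.finsum_ldistr[symmetric]) (use f cf mc v i in auto)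
  finally show ?thesis .
qed

lemma mp_eval_hom:
  assumes v: "\<And>i. i \<in> I \<Longrightarrow> v i \<in> carrier S"
  shows "ring_hom_cring (MP R I) S (mp_eval R S h v)"
proof -
  interpret M: cring "MP R I" by (rule R.MP_cring)
  have hadd: "mp_eval R S h v (P \<oplus>\<^bsub>MP R I\<^esub> Q) = mp_eval R S h v P \<oplus>\<^bsub>S\<^esub> mp_eval R S h v Q"
    if "P \<in> carrier (MP R I)" "Q \<in> carrier (MP R I)" for P Q using mp_eval_add[OF that v] .
  have cl: "mp_eval R S h v P \<in> carrier S" if "P \<in> carrier (MP R I)" for P using mp_eval_closed[OF that v] .
  have var: "mp_eval R S h v (P \<otimes>\<^bsub>MP R I\<^esub> R.indexed_var i) = mp_eval R S h v P \<otimes>\<^bsub>S\<^esub> v i"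
    if "P \<in> carrier (MP R I)" "i \<in> I" for P i
    using mp_eval_pmult[OF that v] R.pmult_eq_mult_var[OF that(1)] by simp
  have cc: "mp_eval R S h v (R.indexed_const c \<otimes>\<^bsub>MP R I\<^esub> R.indexed_const d) = h c \<otimes>\<^bsub>S\<^esub> h d"
    if "c \<in> carrier R" "d \<in> carrier R" for c d
    using that by (simp add: R.MP_mult R.conv_const_const mp_eval_const)
  \<comment> \<open>Multiplicativity against constants comes from induction over the second factor.
    It is the base case of the induction over the first factor that gives the general
    statement.\<close>
  have cm: "mp_eval R S h v (R.indexed_const c \<otimes>\<^bsub>MP R I\<^esub> Q) = h c \<otimes>\<^bsub>S\<^esub> mp_eval R S h v Q"
    if c: "c \<in> carrier R" and Q: "Q \<in> carrier (MP R I)" for c Q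
    using Q
  proof (induct rule: R.MP_induct)
    case (const d) then show ?case using c by (simp add: cc mp_eval_const)
  next
    case (add P Q)
    then show ?case using c by (simp add: M.r_distr assms hadd S.r_distr cl R.MP_const_closed)
  next
    case (mult_var P i)
    have "mp_eval R S h v (R.indexed_const c \<otimes>\<^bsub>MP R I\<^esub> (P \<otimes>\<^bsub>MP R I\<^esub> R.indexed_var i))
      = mp_eval R S h v ((R.indexed_const c \<otimes>\<^bsub>MP R I\<^esub> P) \<otimes>\<^bsub>MP R I\<^esub> R.indexed_var i)"
      using mult_var c by (simp add: M.m_assoc R.MP_const_closed R.MP_var_closed)
    then show ?case using mult_var c v by (simp add: var R.MP_const_closed cl S.m_assoc)
  qed
  have "mp_eval R S h v \<in> ring_hom (MP R I) S"
  proof (rule ring_hom_memI)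
    show "mp_eval R S h v \<one>\<^bsub>MP R I\<^esub> = \<one>\<^bsub>S\<^esub>" by (simp add: MP_simps(2) mp_eval_const)
    fix P Q assume P: "P \<in> carrier (MP R I)" and Q: "Q \<in> carrier (MP R I)"
    show "mp_eval R S h v (P \<otimes>\<^bsub>MP R I\<^esub> Q) = mp_eval R S h v P \<otimes>\<^bsub>S\<^esub> mp_eval R S h v Q"
      using P
    proof (induct rule: R.MP_induct)
      case (const c) then show ?case using Q by (simp add: cm mp_eval_const)
    next
      case (add P P')
      then show ?case using Q by (simp add: M.l_distr assms mp_eval_add[OF _ _ v] S.l_distr cl)
    next
      case (mult_var P i)
      have "(P \<otimes>\<^bsub>MP R I\<^esub> R.indexed_var i) \<otimes>\<^bsub>MP R I\<^esub> Q = (P \<otimes>\<^bsub>MP R I\<^esub> Q) \<otimes>\<^bsub>MP R I\<^esub> R.indexed_var i"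
        using mult_var Q by (simp add: M.m_ac R.MP_var_closed)
      then show ?case using mult_var Q v by (simp add: var cl S.m_ac)
    qed
  qed (auto simp: cl hadd)
  then show ?thesis by (simp add: ring_hom_cring_def ring_hom_cring_axioms_def R.MP_cring S.is_cring)
qed

lemma mp_eval_var:
  assumes "i \<in> I" and v: "\<And>i. i \<in> I \<Longrightarrow> v i \<in> carrier S"
  shows "mp_eval R S h v (R.indexed_var i) = v i"
  unfolding R.indexed_var_def using assms
  by (subst mp_eval_pmult[where I=I]) (auto simp: R.MP_const_closed mp_eval_const)

text \<open>Applied to an evaluation that returns the polynomial itself, this shows that an ideal
  containing all coefficients contains the polynomial. In this way extended primes turn out to be
  the least ones.\<close>

lemma mp_eval_in_ideal:
  assumes P: "P \<in> carrier (MP R I)" and v: "\<And>i. i \<in> I \<Longrightarrow> v i \<in> carrier S"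
    and J: "ideal J S" and c: "\<And>m. h (P m) \<in> J"
  shows "mp_eval R S h v P \<in> J"
proof -
  interpret J: ideal J S by (rule J)
  have fin: "finite F \<Longrightarrow> F \<subseteq> {m. P m \<noteq> \<zero>} \<Longrightarrow> (\<Oplus>\<^bsub>S\<^esub>m\<in>F. h (P m) \<otimes>\<^bsub>S\<^esub> mp_mon S v m) \<in> J" for F
  proof (induct F rule: finite_induct)
    case (insert m F)
    have t: "h (P x) \<otimes>\<^bsub>S\<^esub> mp_mon S v x \<in> carrier S" "mp_mon S v x \<in> carrier S" if "x \<in> insert m F" for x
    proof -
      have "P x \<noteq> \<zero>" using insert(4) that by blast
      then have "set_mset x \<subseteq> I" by (rule R.MP_support_vars[OF P])
      from MP_term_closed[where v = v, OF P v this]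
      show "h (P x) \<otimes>\<^bsub>S\<^esub> mp_mon S v x \<in> carrier S" "mp_mon S v x \<in> carrier S" by blast+
    qed
    have "h (P m) \<otimes>\<^bsub>S\<^esub> mp_mon S v m \<in> J"
      using J.I_r_closed[OF c t(2)] by simp
    moreover have "(\<lambda>m. h (P m) \<otimes>\<^bsub>S\<^esub> mp_mon S v m) \<in> F \<rightarrow> carrier S"
      using t by auto
    moreover have "(\<Oplus>\<^bsub>S\<^esub>m\<in>F. h (P m) \<otimes>\<^bsub>S\<^esub> mp_mon S v m) \<in> J" using insert by blast
    ultimately show ?case using insert(1,2) t additive_subgroup.a_closed[OF J.is_additive_subgroup] by simp
  qed (use additive_subgroup.zero_closed[OF J.is_additive_subgroup] in simp)
  show ?thesis unfolding mp_eval_def using fin R.MP_finite_support[OF P] by blast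
qed

end

lemma (in cring) MP_hom_unique:
  assumes f: "ring_hom_cring (MP R I) S f" and g: "ring_hom_cring (MP R I) S g"
    and c: "\<And>c. c \<in> carrier R \<Longrightarrow> f (indexed_const c) = g (indexed_const c)"
    and v: "\<And>i. i \<in> I \<Longrightarrow> f (indexed_var i) = g (indexed_var i)"
    and P: "P \<in> carrier (MP R I)"
  shows "f P = g P"
proof -
  interpret f: ring_hom_cring "MP R I" S f by (rule f)
  interpret g: ring_hom_cring "MP R I" S g by (rule g)
  show ?thesis using P by (induct rule: MP_induct) (auto simp: c v MP_var_closed)
qed

subsection \<open>Extension of prime ideals\<close>

lemma finite_total_max:
  assumes "finite A" "A \<noteq> {}" "trans s" "total s"
  shows "\<exists>m\<in>A. \<forall>x\<in>A. x = m \<or> (x, m) \<in> s"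
  using assms(1,2)
proof (induct rule: finite_ne_induct)
  case (insert y F)
  then obtain m where m: "m \<in> F" "\<forall>x\<in>F. x = m \<or> (x, m) \<in> s" by blast
  show ?case
  proof (cases "y = m \<or> (y, m) \<in> s")
    case True then show ?thesis using m by auto
  next
    case False
    then have "(m, y) \<in> s" using assms(4) by (auto simp: total_on_def)
    then show ?thesis using m assms(3) by (metis insert_iff transD)
  qed
qed auto

text \<open>A well-order of the variables induces the multiset order on monomials, which is total,
  and cancellation makes it compatible with multiplication. This gives leading monomials for any
  number of variables.\<close>

lemma monomial_order:
  "\<exists>s :: 'i multiset rel. trans s \<and> total s \<and> irrefl s \<and> (\<forall>x y z. (x + z, y + z) \<in> s \<longleftrightarrow> (x, y) \<in> s)"
proof -
  obtain r :: "'i rel" where r: "well_order_on UNIV r" using well_order_on by blast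
  define t where "t = r - Id"
  have tr: "trans t" "total t" "irrefl t"
    using r unfolding t_def
    by (auto simp: well_order_on_def linear_order_on_def partial_order_on_def preorder_on_def trans_diff_Id total_on_diff_Id irrefl_diff_Id)
  have "(x + z, y + z) \<in> mult t \<longleftrightarrow> (x, y) \<in> mult t" for x y z
    using tr by (intro mult_cancel) (auto simp: irrefl_on_def irrefl_def)
  then show ?thesis using tr by (intro exI[of _ "mult t"]) (simp add: trans_mult total_mult irrefl_mult)
qed

text \<open>The extension of \<open>p\<close> to the polynomial ring, described through
  coefficients.\<close>

definition ext_prime :: "('a, 'm) ring_scheme \<Rightarrow> 'i set \<Rightarrow> 'a set \<Rightarrow> ('i multiset \<Rightarrow> 'a) set"
  where "ext_prime R I p = {f \<in> carrier (MP R I). \<forall>m. f m \<in> p}"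

text \<open>Leading terms modulo \<open>p\<close> multiply: among the monomials of \<open>f\<close>
  and of \<open>g\<close> whose coefficients lie outside \<open>p\<close>, take the largest ones
  \<open>m1\<close> and \<open>m2\<close>. The coefficient of the product at \<open>m1 + m2\<close>
  is \<open>f m1 \<otimes> g m2\<close> modulo \<open>p\<close>, hence outside
  \<open>p\<close>.\<close>

lemma ext_prime_spec:
  fixes R (structure) and I :: "'i set"
  assumes p: "p \<in> spec R"
  shows "ext_prime R I p \<in> spec (MP R I)"
proof -
  interpret p: primeideal p R using p by (simp add: spec_iff)
  interpret M: cring "MP R I" by (rule p.MP_cring)
  have cf: "f m \<in> carrier R" if "f \<in> carrier (MP R I)" for f m using p.MP_coeff_closed[OF that] .
  note p0 = additive_subgroup.zero_closed[OF p.is_additive_subgroup]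
  let ?E = "ext_prime R I p"
  have l: "x \<otimes>\<^bsub>MP R I\<^esub> a \<in> ?E" if "a \<in> ?E" "x \<in> carrier (MP R I)" for a x
  proof -
    have "p.conv x a m \<in> p" for m
      unfolding p.conv_def by (rule p.finsum_in) (use that cf in \<open>auto simp: ext_prime_def p.I_l_closed\<close>)
    then show ?thesis using that M.m_closed[of x a] by (auto simp: ext_prime_def p.MP_mult)
  qed
  have "primeideal ?E (MP R I)"
  proof (rule primeidealI[OF idealI])
    show "subgroup ?E (add_monoid (MP R I))"
    proof (rule M.add.subgroupI)
      show "?E \<subseteq> carrier (MP R I)" by (auto simp: ext_prime_def)
      have "\<zero>\<^bsub>MP R I\<^esub> \<in> ?E" using p0 M.zero_closed by (auto simp: ext_prime_def MP_simps(3) p.indexed_const_def)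
      then show "?E \<noteq> {}" by blast
      fix a assume a: "a \<in> ?E"
      then have ac: "a \<in> carrier (MP R I)" by (auto simp: ext_prime_def)
      have "\<ominus>\<^bsub>MP R I\<^esub> a = (\<ominus>\<^bsub>MP R I\<^esub> \<one>\<^bsub>MP R I\<^esub>) \<otimes>\<^bsub>MP R I\<^esub> a" using ac by (simp add: M.l_minus)
      then show "\<ominus>\<^bsub>MP R I\<^esub> a \<in> ?E" using l[OF a] M.one_closed M.a_inv_closed by metis
      fix b assume b: "b \<in> ?E"
      then show "a \<oplus>\<^bsub>MP R I\<^esub> b \<in> ?E" using a M.a_closed[of a b]
        by (auto simp: ext_prime_def MP_simps(4) p.indexed_padd_def p.add_in)
    qed
    have "\<one>\<^bsub>MP R I\<^esub> \<notin> ?E" using p.one_notin by (auto simp: ext_prime_def MP_simps(2) p.indexed_const_def dest: spec[of _ "{#}"])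
    then show "carrier (MP R I) \<noteq> ?E" using M.one_closed by metis
    show "x \<otimes>\<^bsub>MP R I\<^esub> a \<in> ?E" if "a \<in> ?E" "x \<in> carrier (MP R I)" for a x using l that .
    show "a \<otimes>\<^bsub>MP R I\<^esub> x \<in> ?E" if "a \<in> ?E" "x \<in> carrier (MP R I)" for a x
    proof -
      have "a \<in> carrier (MP R I)" using that(1) by (simp add: ext_prime_def)
      then show ?thesis using l[OF that] that(2) M.m_comm[of a x] by simp
    qed
    fix f g assume f: "f \<in> carrier (MP R I)" and g: "g \<in> carrier (MP R I)" and fg: "f \<otimes>\<^bsub>MP R I\<^esub> g \<in> ?E"
    show "f \<in> ?E \<or> g \<in> ?E"
    proof (rule ccontr)
      assume "\<not> (f \<in> ?E \<or> g \<in> ?E)"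
      then have ne: "{m. f m \<notin> p} \<noteq> {}" "{m. g m \<notin> p} \<noteq> {}" using f g by (auto simp: ext_prime_def)
      obtain s :: "'i multiset rel" where s: "trans s" "total s" "irrefl s"
        "\<And>x y z. (x + z, y + z) \<in> s \<longleftrightarrow> (x, y) \<in> s" using monomial_order by metis
      have "{m. f m \<notin> p} \<subseteq> {m. f m \<noteq> \<zero>}" "{m. g m \<notin> p} \<subseteq> {m. g m \<noteq> \<zero>}" using p0 by auto
      then have fin: "finite {m. f m \<notin> p}" "finite {m. g m \<notin> p}"
        using p.MP_finite_support[OF f] p.MP_finite_support[OF g] finite_subset by blast+
      obtain m1 where m1: "f m1 \<notin> p" "\<And>x. f x \<notin> p \<Longrightarrow> x = m1 \<or> (x, m1) \<in> s"
        using finite_total_max[OF fin(1) ne(1) s(1,2)] by blast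
      obtain m2 where m2: "g m2 \<notin> p" "\<And>x. g x \<notin> p \<Longrightarrow> x = m2 \<or> (x, m2) \<in> s"
        using finite_total_max[OF fin(2) ne(2) s(1,2)] by blast
      let ?m = "m1 + m2" and ?t = "\<lambda>d. f d \<otimes> g (m1 + m2 - d)"
      \<comment> \<open>If both coefficients lay outside \<open>p\<close>, then
        \<open>d < m1\<close>, and the complementary monomial \<open>e\<close> would satisfy
        \<open>e < m2\<close>. Then \<open>d + e\<close>, which equals \<open>m1 + m2\<close>, would
        be smaller than itself.\<close>
      have other: "?t d \<in> p" if d: "d \<subseteq># ?m" "d \<noteq> m1" for d
      proof (rule ccontr)
        assume "?t d \<notin> p"
        then have nd: "f d \<notin> p" "g (?m - d) \<notin> p" using cf f g by (auto simp: p.mult_in_iff)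
        obtain e where e: "?m = d + e" using d(1) by (metis subset_mset.add_diff_inverse)
        have "(d, m1) \<in> s" using m1(2) nd(1) d(2) by blast
        then have a: "(d + e, m1 + e) \<in> s" using s(4) by blast
        have "e \<noteq> m2" using e d(2) by auto
        then have "(e, m2) \<in> s" using m2(2) nd(2) e by auto
        then have b: "(e + m1, m2 + m1) \<in> s" using s(4) by blast
        have "(?m, ?m) \<in> s" using a b e s(1) by (metis add.commute transD)
        then show False using s(3) by (simp add: irrefl_def)
      qed
      have "(f \<otimes>\<^bsub>MP R I\<^esub> g) ?m = (\<Oplus>d\<in>insert m1 ({d. d \<subseteq># ?m} - {m1}). ?t d)"
        by (simp add: p.MP_mult p.conv_def insert_absorb)
      also have "\<dots> = f m1 \<otimes> g m2 \<oplus> (\<Oplus>d\<in>{d. d \<subseteq># ?m} - {m1}. ?t d)"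
        by (subst p.finsum_insert) (use cf f g in auto)
      finally have "f m1 \<otimes> g m2 \<oplus> (\<Oplus>d\<in>{d. d \<subseteq># ?m} - {m1}. ?t d) \<in> p"
        using fg by (auto simp: ext_prime_def dest!: spec[of _ ?m])
      moreover have "(\<Oplus>d\<in>{d. d \<subseteq># ?m} - {m1}. ?t d) \<in> p" by (rule p.finsum_in) (use other in auto)
      ultimately have "f m1 \<otimes> g m2 \<in> p" using cf f g p.add_in_iff by simp
      then show False using m1(1) m2(1) cf f g by (simp add: p.mult_in_iff)
    qed
  qed (use M.ring_axioms M.is_cring in auto)
  then show ?thesis by (simp add: spec_iff)
qed

text \<open>\<open>MP A I\<close> is a polynomial ring in the variables \<open>I - I'\<close> over
  \<open>MP A I'\<close>: \<open>\<psi>\<close> regroups the variables and \<open>\<chi>\<close>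
  undoes this. The extension of \<open>N\<close> by coefficients is prime, and it is contained in
  every ideal that contains \<open>N\<close>. This leastness later places the extension between two
  given primes.\<close>

lemma MP_extend_prime:
  fixes A :: "('a, 'm) ring_scheme" (structure) and I :: "'i set"
  assumes A: "cring A" and I: "I' \<subseteq> I" and N: "N \<in> spec (MP A I')"
  obtains E where "E \<in> spec (MP A I)" "\<And>f. f \<in> carrier (MP A I') \<Longrightarrow> f \<in> E \<longleftrightarrow> f \<in> N"
    "\<And>J. ideal J (MP A I) \<Longrightarrow> N \<subseteq> J \<Longrightarrow> E \<subseteq> J"
proof -
  interpret A: cring A by (rule A)
  interpret C': cring "MP A I'" by (rule A.MP_cring)
  interpret C: cring "MP A I" by (rule A.MP_cring)
  interpret N: primeideal N "MP A I'" using N by (simp add: spec_iff)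
  define D where "D = MP (MP A I') (I - I')"
  interpret D: cring D unfolding D_def by (rule C'.MP_cring)
  have cD: "ring_hom_cring (MP A I') D C'.indexed_const" unfolding D_def by (rule C'.MP_const_hom)
  then interpret cD: ring_hom_cring "MP A I'" D C'.indexed_const .
  interpret cA: ring_hom_cring A "MP A I'" A.indexed_const by (rule A.MP_const_hom)
  define h :: "'a \<Rightarrow> 'i multiset \<Rightarrow> 'i multiset \<Rightarrow> 'a" where "h = C'.indexed_const \<circ> A.indexed_const"
  have "h \<in> ring_hom A D" unfolding h_def by (rule ring_hom_trans[OF cA.homh cD.homh])
  then interpret h: ring_hom_cring A D h by (simp add: ring_hom_cring_def ring_hom_cring_axioms_def A.is_cring D.is_cring)
  define v where "v i = (if i \<in> I' then C'.indexed_const (A.indexed_var i) else C'.indexed_var i)" for i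
  have v: "v i \<in> carrier D" if "i \<in> I" for i
    using that I unfolding v_def D_def by (auto simp: C'.MP_var_closed C'.MP_const_closed A.MP_var_closed)
  define \<psi> where "\<psi> = mp_eval A D h v"
  have psi: "ring_hom_cring (MP A I) D \<psi>" unfolding \<psi>_def by (rule h.mp_eval_hom[OF v])
  then interpret psi: ring_hom_cring "MP A I" D \<psi> .
  interpret incl: ring_hom_cring "MP A I'" "MP A I" id by (rule A.MP_incl_hom[OF I])
  define \<chi> where "\<chi> = mp_eval (MP A I') (MP A I) id A.indexed_var"
  have chi: "ring_hom_cring D (MP A I) \<chi>" unfolding \<chi>_def D_def
    by (rule incl.mp_eval_hom) (auto simp: A.MP_var_closed)
  then interpret chi: ring_hom_cring D "MP A I" \<chi> .
  have psi_c: "\<psi> (A.indexed_const c) = h c" if "c \<in> carrier A" for c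
    unfolding \<psi>_def by (rule h.mp_eval_const[OF that])
  have psi_v: "\<psi> (A.indexed_var i) = v i" if "i \<in> I" for i
    unfolding \<psi>_def by (rule h.mp_eval_var[OF that v])
  have psi_incl: "\<psi> f = C'.indexed_const f" if "f \<in> carrier (MP A I')" for f
  proof -
    have "(\<psi> \<circ> id) f = C'.indexed_const f"
    proof (rule A.MP_hom_unique[OF _ cD _ _ that])
      have "\<psi> \<circ> id \<in> ring_hom (MP A I') D" by (rule ring_hom_trans[OF incl.homh psi.homh])
      then show "ring_hom_cring (MP A I') D (\<psi> \<circ> id)"
        by (simp add: ring_hom_cring_def ring_hom_cring_axioms_def C'.is_cring D.is_cring)
    qed (use I psi_c psi_v in \<open>auto simp: h_def v_def\<close>)
    then show ?thesis by simp
  qed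
  have chi_psi: "\<chi> (\<psi> f) = f" if "f \<in> carrier (MP A I)" for f
  proof -
    have "(\<chi> \<circ> \<psi>) f = id f"
    proof (rule A.MP_hom_unique[OF _ _ _ _ that])
      have "\<chi> \<circ> \<psi> \<in> ring_hom (MP A I) (MP A I)" by (rule ring_hom_trans[OF psi.homh chi.homh])
      then show "ring_hom_cring (MP A I) (MP A I) (\<chi> \<circ> \<psi>)"
        by (simp add: ring_hom_cring_def ring_hom_cring_axioms_def C.is_cring)
      show "ring_hom_cring (MP A I) (MP A I) id"
        by (simp add: ring_hom_cring_def ring_hom_cring_axioms_def C.is_cring)
      show "(\<chi> \<circ> \<psi>) (A.indexed_const c) = id (A.indexed_const c)" if "c \<in> carrier A" for c
        using that by (simp add: psi_c h_def \<chi>_def incl.mp_eval_const A.MP_const_closed)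
      show "(\<chi> \<circ> \<psi>) (A.indexed_var i) = id (A.indexed_var i)" if "i \<in> I" for i
        using that incl.mp_eval_var[of i "I - I'" A.indexed_var]
        by (auto simp: psi_v v_def \<chi>_def incl.mp_eval_const A.MP_var_closed)
    qed
    then show ?thesis by simp
  qed
  define E where "E = contract (MP A I) \<psi> (ext_prime (MP A I') (I - I') N)"
  show thesis
  proof (rule that)
    show "E \<in> spec (MP A I)" unfolding E_def
      by (rule contract_spec[OF psi]) (simp add: D_def ext_prime_spec[OF N])
    show "f \<in> E \<longleftrightarrow> f \<in> N" if f: "f \<in> carrier (MP A I')" for f
    proof -
      have n0: "\<zero>\<^bsub>MP A I'\<^esub> \<in> N" by (rule additive_subgroup.zero_closed[OF N.is_additive_subgroup])
      have "f \<in> E \<longleftrightarrow> C'.indexed_const f \<in> ext_prime (MP A I') (I - I') N"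
        using f A.MP_mono[OF I f] by (simp add: E_def psi_incl)
      also have "\<dots> \<longleftrightarrow> (\<forall>m::'i multiset. C'.indexed_const f m \<in> N)"
        using C'.MP_const_closed[OF f] by (auto simp: ext_prime_def)
      also have "\<dots> \<longleftrightarrow> f \<in> N" using n0 by (auto simp: C'.indexed_const_def)
      finally show ?thesis .
    qed
    \<comment> \<open>\<open>\<chi>\<close> recovers \<open>f\<close> from \<open>\<psi> f\<close>,
      whose coefficients lie in \<open>N\<close> and hence in \<open>J\<close>.\<close>
    show "E \<subseteq> J" if J: "ideal J (MP A I)" "N \<subseteq> J" for J
    proof
      fix f assume "f \<in> E"
      then have f: "f \<in> carrier (MP A I)" "\<psi> f \<in> ext_prime (MP A I') (I - I') N" by (auto simp: E_def)
      have "mp_eval (MP A I') (MP A I) id A.indexed_var (\<psi> f) \<in> J"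
        by (rule incl.mp_eval_in_ideal[OF _ _ J(1), where I = "I - I'"])
          (use f(2) J(2) in \<open>auto simp: ext_prime_def A.MP_var_closed\<close>)
      then show "f \<in> J" using chi_psi[OF f(1)] by (simp add: \<chi>_def)
    qed
  qed
qed

text \<open>The hypotheses on \<open>A\<close> concern the variables \<open>{..<N}\<close>. Renaming
  along a bijection gives a surjection onto the polynomials in any finite set of variables, and
  surjectivity suffices to contract adjacent primes to adjacent primes.\<close>

lemma MP_reindex:
  fixes A (structure)
  assumes A: "cring A" and fin: "finite I'"
  obtains \<psi> where "ring_hom_cring (mpoly_ring A (card I')) (MP A I') \<psi>"
    "\<psi> ` carrier (mpoly_ring A (card I')) = carrier (MP A I')"
proof -
  interpret A: cring A by (rule A)
  obtain e where e: "bij_betw e {..<card I'} I'" using ex_bij_betw_nat_finite[OF fin] by (auto simp: atLeast0LessThan)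
  interpret cA: ring_hom_cring A "MP A I'" A.indexed_const by (rule A.MP_const_hom)
  have v: "\<And>i. i \<in> {..<card I'} \<Longrightarrow> A.indexed_var (e i) \<in> carrier (MP A I')"
    using e by (auto intro!: A.MP_var_closed simp: bij_betw_def)
  define \<psi> where "\<psi> = mp_eval A (MP A I') A.indexed_const (\<lambda>i. A.indexed_var (e i))"
  have psi: "ring_hom_cring (MP A {..<card I'}) (MP A I') \<psi>"
    unfolding \<psi>_def by (rule cA.mp_eval_hom[OF v])
  then interpret psi: ring_hom_cring "MP A {..<card I'}" "MP A I'" \<psi> .
  have "\<psi> ` carrier (MP A {..<card I'}) = carrier (MP A I')"
  proof (rule A.MP_gen)
    show "subring (\<psi> ` carrier (MP A {..<card I'})) (MP A I')"
      by (rule psi.ring.img_is_subring[OF psi.R.carrier_is_subring])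
    show "A.indexed_const c \<in> \<psi> ` carrier (MP A {..<card I'})" if "c \<in> carrier A" for c
      using cA.mp_eval_const[OF that] A.MP_const_closed[OF that] unfolding \<psi>_def by (metis imageI)
    show "A.indexed_var i \<in> \<psi> ` carrier (MP A {..<card I'})" if "i \<in> I'" for i
    proof -
      obtain j where j: "j \<in> {..<card I'}" "i = e j" using e \<open>i \<in> I'\<close> by (auto simp: bij_betw_def)
      have "\<psi> (A.indexed_var j) = A.indexed_var i"
        using cA.mp_eval_var[OF j(1) v] j(2) unfolding \<psi>_def by simp
      then show ?thesis using A.MP_var_closed[OF j(1)] by (metis imageI)
    qed
  qed
  then show thesis using that psi by (simp add: mpoly_ring_eq)
qed

section \<open>Rings of fractions and heights\<close>

locale mult_subset = cring R for R (structure) + fixes S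
  assumes S_sub: "S \<subseteq> carrier R" and one_in_S: "\<one> \<in> S"
    and mult_in_S: "\<And>s t. s \<in> S \<Longrightarrow> t \<in> S \<Longrightarrow> s \<otimes> t \<in> S"
begin

lemma S_closed [simp]: "s \<in> S \<Longrightarrow> s \<in> carrier R"
  using S_sub by blast

lemma frac_rel_iff:
  "((a, s), (b, t)) \<in> frac_rel R S \<longleftrightarrow> a \<in> carrier R \<and> s \<in> S \<and> b \<in> carrier R \<and> t \<in> S \<and>
    (\<exists>u\<in>S. u \<otimes> (a \<otimes> t) = u \<otimes> (b \<otimes> s))"
  by (auto simp: frac_rel_def)

lemma frac_rel_equiv: "equiv (carrier R \<times> S) (frac_rel R S)"
proof (rule equivI)
  show "refl_on (carrier R \<times> S) (frac_rel R S)"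
    using one_in_S by (auto simp: refl_on_def frac_rel_iff)
  show "frac_rel R S \<subseteq> (carrier R \<times> S) \<times> (carrier R \<times> S)"
    by (auto simp: frac_rel_def)
  show "sym (frac_rel R S)"
    by (rule symI) (auto simp: frac_rel_def, metis)
  show "trans (frac_rel R S)"
  proof (rule transI)
    fix x y z assume xy: "(x, y) \<in> frac_rel R S" "(y, z) \<in> frac_rel R S"
    obtain a s b t c w where e: "x = (a, s)" "y = (b, t)" "z = (c, w)" by (metis surj_pair)
    obtain u where u: "u \<in> S" "u \<otimes> (a \<otimes> t) = u \<otimes> (b \<otimes> s)" using xy(1) by (auto simp: e frac_rel_iff)
    obtain v where v: "v \<in> S" "v \<otimes> (b \<otimes> w) = v \<otimes> (c \<otimes> t)" using xy(2) by (auto simp: e frac_rel_iff)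
    have c: "a \<in> carrier R" "b \<in> carrier R" "c \<in> carrier R" "s \<in> S" "t \<in> S" "w \<in> S"
      using xy by (auto simp: e frac_rel_iff)
    note cc = c u(1) v(1)
    have "(u \<otimes> v \<otimes> t) \<otimes> (a \<otimes> w) = (v \<otimes> w) \<otimes> (u \<otimes> (a \<otimes> t))" using cc by (simp add: m_ac)
    also have "\<dots> = (u \<otimes> s) \<otimes> (v \<otimes> (b \<otimes> w))" using cc by (simp add: u m_ac)
    also have "\<dots> = (u \<otimes> v \<otimes> t) \<otimes> (c \<otimes> s)" unfolding v(2) using cc by (simp add: m_ac)
    finally show "(x, z) \<in> frac_rel R S" using cc mult_in_S by (auto simp: e frac_rel_iff intro!: bexI[of _ "u \<otimes> v \<otimes> t"])
  qed
qed

lemma fraction_eq_iff: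
  assumes "a \<in> carrier R" "s \<in> S" "b \<in> carrier R" "t \<in> S"
  shows "fraction R S a s = fraction R S b t \<longleftrightarrow> (\<exists>u\<in>S. u \<otimes> (a \<otimes> t) = u \<otimes> (b \<otimes> s))"
  unfolding fraction_def using eq_equiv_class_iff[OF frac_rel_equiv, of "(a, s)" "(b, t)"] assms
  by (simp add: frac_rel_iff)

lemma fraction_eqI:
  assumes "a \<in> carrier R" "s \<in> S" "b \<in> carrier R" "t \<in> S" "a \<otimes> t = b \<otimes> s"
  shows "fraction R S a s = fraction R S b t"
  using assms one_in_S by (auto simp: fraction_eq_iff)

lemma fraction_carrier: "a \<in> carrier R \<Longrightarrow> s \<in> S \<Longrightarrow> fraction R S a s \<in> carrier (fraction_ring R S)"
  by (auto simp: fraction_ring_def fraction_def intro: quotientI)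

lemma fraction_cases:
  assumes "x \<in> carrier (fraction_ring R S)"
  obtains a s where "a \<in> carrier R" "s \<in> S" "x = fraction R S a s"
  using assms by (auto simp: fraction_ring_def fraction_def elim!: quotientE)

lemma fraction_mem:
  assumes "x \<in> fraction R S a s"
  shows "fst x \<in> carrier R" "snd x \<in> S" "fraction R S (fst x) (snd x) = fraction R S a s"
proof -
  have r: "((a, s), x) \<in> frac_rel R S" using assms by (simp add: fraction_def)
  show "fst x \<in> carrier R" "snd x \<in> S" using r by (cases x, simp add: frac_rel_iff)+
  show "fraction R S (fst x) (snd x) = fraction R S a s"
    using equiv_class_eq[OF frac_rel_equiv r] by (simp add: fraction_def)
qed

lemma fraction_self: "a \<in> carrier R \<Longrightarrow> s \<in> S \<Longrightarrow> (a, s) \<in> fraction R S a s"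
  using equiv_class_self[OF frac_rel_equiv] by (auto simp: fraction_def)

text \<open>Operations on fractions are unions over all pairs of representatives. Once the result is
  independent of the representatives, the union of these equal sets over nonempty classes is that
  result.\<close>

lemma UN2_const:
  assumes "U \<noteq> {}" "V \<noteq> {}" "\<And>x y. x \<in> U \<Longrightarrow> y \<in> V \<Longrightarrow> f (fst x) (snd x) (fst y) (snd y) = F"
  shows "(\<Union>(a, s)\<in>U. \<Union>(b, t)\<in>V. f a s b t) = F"
  using assms by (fastforce simp: split_beta)

lemma fraction_mult:
  assumes "a \<in> carrier R" "s \<in> S" "b \<in> carrier R" "t \<in> S"
  shows "fraction R S a s \<otimes>\<^bsub>fraction_ring R S\<^esub> fraction R S b t = fraction R S (a \<otimes> b) (s \<otimes> t)"
proof -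
  have "fraction R S (fst x \<otimes> fst y) (snd x \<otimes> snd y) = fraction R S (a \<otimes> b) (s \<otimes> t)"
    if x: "x \<in> fraction R S a s" and y: "y \<in> fraction R S b t" for x y
  proof -
    obtain a' s' b' t' where e: "x = (a', s')" "y = (b', t')" by (metis surj_pair)
    note mx = fraction_mem[OF x, unfolded e fst_conv snd_conv] and my = fraction_mem[OF y, unfolded e fst_conv snd_conv]
    obtain u where u: "u \<in> S" "u \<otimes> (a' \<otimes> s) = u \<otimes> (a \<otimes> s')" using mx assms by (auto simp: fraction_eq_iff)
    obtain v where v: "v \<in> S" "v \<otimes> (b' \<otimes> t) = v \<otimes> (b \<otimes> t')" using my assms by (auto simp: fraction_eq_iff)
    note c = assms mx(1,2) my(1,2) u(1) v(1)
    have "(u \<otimes> v) \<otimes> ((a' \<otimes> b') \<otimes> (s \<otimes> t)) = (u \<otimes> (a' \<otimes> s)) \<otimes> (v \<otimes> (b' \<otimes> t))" using c by (simp add: m_ac)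
    also have "\<dots> = (u \<otimes> v) \<otimes> ((a \<otimes> b) \<otimes> (s' \<otimes> t'))" unfolding u(2) v(2) using c by (simp add: m_ac)
    finally show ?thesis using c mult_in_S by (auto simp: e fraction_eq_iff intro!: bexI[of _ "u \<otimes> v"])
  qed
  then show ?thesis using fraction_self assms unfolding fraction_ring_def
    by (simp, intro UN2_const) blast+
qed

lemma fraction_add:
  assumes "a \<in> carrier R" "s \<in> S" "b \<in> carrier R" "t \<in> S"
  shows "fraction R S a s \<oplus>\<^bsub>fraction_ring R S\<^esub> fraction R S b t = fraction R S (a \<otimes> t \<oplus> b \<otimes> s) (s \<otimes> t)"
proof -
  have "fraction R S (fst x \<otimes> snd y \<oplus> fst y \<otimes> snd x) (snd x \<otimes> snd y) = fraction R S (a \<otimes> t \<oplus> b \<otimes> s) (s \<otimes> t)"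
    if x: "x \<in> fraction R S a s" and y: "y \<in> fraction R S b t" for x y
  proof -
    obtain a' s' b' t' where e: "x = (a', s')" "y = (b', t')" by (metis surj_pair)
    note mx = fraction_mem[OF x, unfolded e fst_conv snd_conv] and my = fraction_mem[OF y, unfolded e fst_conv snd_conv]
    obtain u where u: "u \<in> S" "u \<otimes> (a' \<otimes> s) = u \<otimes> (a \<otimes> s')" using mx assms by (auto simp: fraction_eq_iff)
    obtain v where v: "v \<in> S" "v \<otimes> (b' \<otimes> t) = v \<otimes> (b \<otimes> t')" using my assms by (auto simp: fraction_eq_iff)
    note c = assms mx(1,2) my(1,2) u(1) v(1)
    have "(u \<otimes> v) \<otimes> ((a' \<otimes> t' \<oplus> b' \<otimes> s') \<otimes> (s \<otimes> t)) = (u \<otimes> (a' \<otimes> s)) \<otimes> (v \<otimes> t \<otimes> t') \<oplus> (v \<otimes> (b' \<otimes> t)) \<otimes> (u \<otimes> s \<otimes> s')"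
      using c by (simp add: m_ac l_distr r_distr)
    also have "\<dots> = (u \<otimes> v) \<otimes> ((a \<otimes> t \<oplus> b \<otimes> s) \<otimes> (s' \<otimes> t'))" unfolding u(2) v(2)
      using c by (simp add: m_ac l_distr r_distr)
    finally show ?thesis using c mult_in_S by (auto simp: e fraction_eq_iff intro!: bexI[of _ "u \<otimes> v"])
  qed
  then show ?thesis using fraction_self assms unfolding fraction_ring_def
    by (simp, intro UN2_const) blast+
qed

lemma fraction_one: "\<one>\<^bsub>fraction_ring R S\<^esub> = fraction R S \<one> \<one>"
  and fraction_zero: "\<zero>\<^bsub>fraction_ring R S\<^esub> = fraction R S \<zero> \<one>"
  by (simp_all add: fraction_ring_def)

lemma fraction_ring_cring: "cring (fraction_ring R S)"
proof (rule cringI)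
  let ?F = "fraction_ring R S"
  note [simp] = fraction_mult fraction_add fraction_one fraction_zero one_in_S mult_in_S fraction_carrier
  show "abelian_group ?F"
  proof (rule abelian_groupI)
    fix x y assume x: "x \<in> carrier ?F" and y: "y \<in> carrier ?F"
    from x obtain a s where xa: "a \<in> carrier R" "s \<in> S" "x = fraction R S a s" by (rule fraction_cases)
    from y obtain b t where yb: "b \<in> carrier R" "t \<in> S" "y = fraction R S b t" by (rule fraction_cases)
    show "x \<oplus>\<^bsub>?F\<^esub> y \<in> carrier ?F" using xa yb by simp
    show "x \<oplus>\<^bsub>?F\<^esub> y = y \<oplus>\<^bsub>?F\<^esub> x" using xa yb by (simp add: a_comm m_comm)
    fix z assume "z \<in> carrier ?F"
    then obtain c w where zc: "c \<in> carrier R" "w \<in> S" "z = fraction R S c w" by (rule fraction_cases)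
    show "x \<oplus>\<^bsub>?F\<^esub> y \<oplus>\<^bsub>?F\<^esub> z = x \<oplus>\<^bsub>?F\<^esub> (y \<oplus>\<^bsub>?F\<^esub> z)"
      using xa yb zc by (simp, intro fraction_eqI) (auto simp: m_ac l_distr r_distr a_ac)
  next
    fix x assume x: "x \<in> carrier ?F"
    from x obtain a s where xa: "a \<in> carrier R" "s \<in> S" "x = fraction R S a s" by (rule fraction_cases)
    show "\<zero>\<^bsub>?F\<^esub> \<oplus>\<^bsub>?F\<^esub> x = x" using xa by simp
    have "fraction R S (\<ominus> a) s \<oplus>\<^bsub>?F\<^esub> x = \<zero>\<^bsub>?F\<^esub>"
      using xa by (simp, intro fraction_eqI) (auto simp: l_minus l_neg)
    then show "\<exists>y\<in>carrier ?F. y \<oplus>\<^bsub>?F\<^esub> x = \<zero>\<^bsub>?F\<^esub>" using xa by (metis fraction_carrier a_inv_closed)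
  qed simp
  show "comm_monoid ?F"
  proof (rule comm_monoidI)
    fix x y assume x: "x \<in> carrier ?F" and y: "y \<in> carrier ?F"
    from x obtain a s where xa: "a \<in> carrier R" "s \<in> S" "x = fraction R S a s" by (rule fraction_cases)
    from y obtain b t where yb: "b \<in> carrier R" "t \<in> S" "y = fraction R S b t" by (rule fraction_cases)
    show "x \<otimes>\<^bsub>?F\<^esub> y \<in> carrier ?F" using xa yb by simp
    show "x \<otimes>\<^bsub>?F\<^esub> y = y \<otimes>\<^bsub>?F\<^esub> x" using xa yb by (simp add: m_comm)
    fix z assume "z \<in> carrier ?F"
    then obtain c w where zc: "c \<in> carrier R" "w \<in> S" "z = fraction R S c w" by (rule fraction_cases)
    show "x \<otimes>\<^bsub>?F\<^esub> y \<otimes>\<^bsub>?F\<^esub> z = x \<otimes>\<^bsub>?F\<^esub> (y \<otimes>\<^bsub>?F\<^esub> z)" using xa yb zc by (simp add: m_assoc)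
  next
    fix x assume x: "x \<in> carrier ?F"
    from x obtain a s where xa: "a \<in> carrier R" "s \<in> S" "x = fraction R S a s" by (rule fraction_cases)
    show "\<one>\<^bsub>?F\<^esub> \<otimes>\<^bsub>?F\<^esub> x = x" using xa by simp
  qed simp
  fix x y z assume x: "x \<in> carrier ?F" and y: "y \<in> carrier ?F" and z: "z \<in> carrier ?F"
  from x obtain a s where xa: "a \<in> carrier R" "s \<in> S" "x = fraction R S a s" by (rule fraction_cases)
  from y obtain b t where yb: "b \<in> carrier R" "t \<in> S" "y = fraction R S b t" by (rule fraction_cases)
  from z obtain c w where zc: "c \<in> carrier R" "w \<in> S" "z = fraction R S c w" by (rule fraction_cases)
  show "(x \<oplus>\<^bsub>?F\<^esub> y) \<otimes>\<^bsub>?F\<^esub> z = x \<otimes>\<^bsub>?F\<^esub> z \<oplus>\<^bsub>?F\<^esub> y \<otimes>\<^bsub>?F\<^esub> z"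
    using xa yb zc by (simp, intro fraction_eqI) (auto simp: m_ac l_distr r_distr)
qed

lemma fraction_hom: "ring_hom_cring R (fraction_ring R S) (\<lambda>a. fraction R S a \<one>)"
proof -
  have "(\<lambda>a. fraction R S a \<one>) \<in> ring_hom R (fraction_ring R S)"
    by (rule ring_hom_memI) (auto simp: fraction_carrier fraction_mult fraction_add fraction_one one_in_S)
  then show ?thesis by (simp add: ring_hom_cring_def ring_hom_cring_axioms_def fraction_ring_cring is_cring)
qed

lemma fraction_unit: "s \<in> S \<Longrightarrow> fraction R S s \<one> \<in> Units (fraction_ring R S)"
proof -
  assume s: "s \<in> S"
  interpret F: cring "fraction_ring R S" by (rule fraction_ring_cring)
  have "fraction R S s \<one> \<otimes>\<^bsub>fraction_ring R S\<^esub> fraction R S \<one> s = \<one>\<^bsub>fraction_ring R S\<^esub>"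
    using s one_in_S mult_in_S by (simp add: fraction_mult fraction_one) (intro fraction_eqI, auto)
  moreover have "fraction R S s \<one> \<in> carrier (fraction_ring R S)" "fraction R S \<one> s \<in> carrier (fraction_ring R S)"
    using s one_in_S by (auto intro!: fraction_carrier)
  ultimately show ?thesis unfolding Units_def using F.m_comm by fastforce
qed

text \<open>In a localization only denominators occur, with exponent 1; the correspondence of primes
  for \<open>ess_surj\<close> therefore covers it.\<close>

lemma fraction_ess: "ess_surj R (fraction_ring R S) (\<lambda>a. fraction R S a \<one>)"
proof (rule ess_surjI[OF fraction_hom])
  fix x assume "x \<in> carrier (fraction_ring R S)"
  then obtain a s where xa: "a \<in> carrier R" "s \<in> S" "x = fraction R S a s" by (rule fraction_cases)
  interpret h: ring_hom_cring R "fraction_ring R S" "\<lambda>a. fraction R S a \<one>" by (rule fraction_hom)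
  have "fraction R S s \<one> \<otimes>\<^bsub>fraction_ring R S\<^esub> x = fraction R S a \<one>"
    using xa one_in_S mult_in_S by (simp add: fraction_mult) (intro fraction_eqI, auto simp: m_comm)
  then show "x \<in> ess_image R (fraction_ring R S) (\<lambda>a. fraction R S a \<one>)"
    using xa by (intro h.ess_imageI[of _ 1 s a]) (use h.S.frob_one in \<open>auto simp: fraction_carrier fraction_unit\<close>)
qed

end

lemma (in cring) mult_subset_prime: "primeideal p R \<Longrightarrow> mult_subset R (carrier R - p)"
proof -
  assume "primeideal p R"
  then interpret p: primeideal p R .
  show ?thesis by unfold_locales (auto simp: p.mult_in_iff)
qed

section \<open>Chains of primes, heights and localization\<close>

lemma prime_chainD: "prime_chain R n c \<Longrightarrow> i \<le> n \<Longrightarrow> c i \<in> spec R"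
  by (simp add: prime_chain_def)

lemma prime_chain_mono:
  assumes "prime_chain R n c" "i \<le> j" "j \<le> n"
  shows "c i \<subseteq> c j"
  using assms(2,3)
proof (induct rule: dec_induct)
  case (step k)
  moreover have "c k \<subset> c (Suc k)" using step assms(1) by (simp add: prime_chain_def)
  ultimately show ?case using step by auto
qed auto

lemma prime_chain_strict:
  assumes "prime_chain R n c" "i < j" "j \<le> n"
  shows "c i \<subset> c j"
proof -
  have "c i \<subset> c (Suc i)" using assms by (simp add: prime_chain_def)
  also have "c (Suc i) \<subseteq> c j" using assms by (intro prime_chain_mono[OF assms(1)]) auto
  finally show ?thesis .
qed

text \<open>Primes of the localization correspond to the primes inside \<open>p\<close>. This turns
  LFD into finiteness of all heights, the form in which it is used.\<close>

lemma krull_dim_localization: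
  fixes R (structure)
  assumes "cring R" "p \<in> spec R"
  shows "krull_dim (localization_at R p) = prime_height R p"
proof -
  interpret cring R by fact
  interpret p: primeideal p R using assms by (simp add: spec_iff)
  interpret mult_subset R "carrier R - p" by (rule mult_subset_prime[OF p.primeideal])
  let ?S = "carrier R - p"
  let ?F = "fraction_ring R ?S" and ?h = "\<lambda>a. fraction R ?S a \<one>"
  interpret h: ring_hom_cring R ?F ?h by (rule fraction_hom)
  have "(\<exists>c. prime_chain ?F n c) \<longleftrightarrow> (\<exists>c. prime_chain R n c \<and> c n = p)" for n
  proof
    assume "\<exists>c. prime_chain ?F n c"
    then obtain c where c: "prime_chain ?F n c" by blast
    \<comment> \<open>The contracted chain ends inside \<open>p\<close> but not necessarily at
      \<open>p\<close>, while the height counts chains that end at \<open>p\<close>. Replacing the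
      last member keeps the inclusions strict.\<close>
    define d where "d i = (if i = n then p else contract R ?h (c i))" for i
    have ci: "contract R ?h (c i) \<in> spec R" "contract R ?h (c i) \<subseteq> p" if "i \<le> n" for i
    proof -
      show "contract R ?h (c i) \<in> spec R" by (rule contract_spec[OF h.ring_hom_cring_axioms prime_chainD[OF c that]])
      interpret P: primeideal "c i" ?F using prime_chainD[OF c that] by (simp add: spec_iff)
      show "contract R ?h (c i) \<subseteq> p" using fraction_unit P.Units_notin by fastforce
    qed
    have "contract R ?h (c i) \<subset> contract R ?h (c (Suc i))" if "i < n" for i
      using c that ess_contract_mono[OF fraction_ess prime_chainD[OF c] prime_chainD[OF c], of "Suc i" i]
      by (fastforce simp: prime_chain_def)
    then have st: "contract R ?h (c i) \<subset> contract R ?h (c (Suc i))" if "i < n" for i using that .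
    have "d i \<subset> d (Suc i)" if "i < n" for i
    proof -
      have "d i = contract R ?h (c i)" using that by (simp add: d_def)
      moreover have "contract R ?h (c (Suc i)) \<subseteq> d (Suc i)" using ci(2)[of "Suc i"] that by (auto simp: d_def)
      ultimately show ?thesis using st[OF that] by blast
    qed
    moreover have "d i \<in> spec R" if "i \<le> n" for i using ci(1)[OF that] assms(2) by (simp add: d_def)
    ultimately have "prime_chain R n d" by (simp add: prime_chain_def)
    then show "\<exists>c. prime_chain R n c \<and> c n = p" by (intro exI[of _ d]) (simp add: d_def)
  next
    assume "\<exists>c. prime_chain R n c \<and> c n = p"
    then obtain c where c: "prime_chain R n c" "c n = p" by blast
    have "\<exists>P. P \<in> spec ?F \<and> contract R ?h P = c i" if i: "i \<le> n" for i
    proof -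
      have ci: "c i \<in> spec R" "c i \<subseteq> p" using prime_chainD[OF c(1) i] prime_chain_mono[OF c(1) i] c(2) by auto
      interpret P: primeideal "c i" R using ci by (simp add: spec_iff)
      have z: "r \<in> c i" if "r \<in> carrier R" "?h r = \<zero>\<^bsub>?F\<^esub>" for r
      proof -
        have "\<exists>u\<in>?S. u \<otimes> (r \<otimes> \<one>) = u \<otimes> (\<zero> \<otimes> \<one>)"
          using that(2) unfolding fraction_zero fraction_eq_iff[OF that(1) one_in_S zero_closed one_in_S] .
        then obtain u where "u \<in> ?S" "u \<otimes> (r \<otimes> \<one>) = u \<otimes> (\<zero> \<otimes> \<one>)" by blast
        then have u: "u \<otimes> r = \<zero>" "u \<in> carrier R" "u \<notin> p" using that(1) by simp_all
        have "u \<otimes> r \<in> c i" unfolding u(1) by (rule additive_subgroup.zero_closed[OF P.is_additive_subgroup])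
        then show ?thesis using P.I_prime[OF u(2) that(1)] u(3) ci(2) by auto
      qed
      have un: "?h r \<notin> Units ?F" if r: "r \<in> c i" for r
      proof
        assume "?h r \<in> Units ?F"
        then obtain y where y: "y \<in> carrier ?F" "?h r \<otimes>\<^bsub>?F\<^esub> y = \<one>\<^bsub>?F\<^esub>" by (auto simp: Units_def)
        obtain b t where b: "b \<in> carrier R" "t \<in> ?S" "y = fraction R ?S b t" using y(1) by (rule fraction_cases)
        have rc: "r \<in> carrier R" using r by (rule P.Icarr)
        have "fraction R ?S (r \<otimes> b) (\<one> \<otimes> t) = fraction R ?S \<one> \<one>"
          using y(2) unfolding b(3) fraction_mult[OF rc one_in_S b(1,2)] fraction_one .
        then have "\<exists>u\<in>?S. u \<otimes> ((r \<otimes> b) \<otimes> \<one>) = u \<otimes> (\<one> \<otimes> (\<one> \<otimes> t))"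
          by (rule iffD1[OF fraction_eq_iff[OF m_closed[OF rc b(1)] mult_in_S[OF one_in_S b(2)] one_closed one_in_S]])
        then obtain u where u: "u \<in> ?S" "u \<otimes> ((r \<otimes> b) \<otimes> \<one>) = u \<otimes> (\<one> \<otimes> (\<one> \<otimes> t))" by blast
        have uc: "u \<in> carrier R" "u \<notin> p" "t \<in> carrier R" "t \<notin> p" using u(1) b(2) by blast+
        have e: "u \<otimes> (r \<otimes> b) = u \<otimes> t" using u(2) b(1) rc uc by simp
        have "r \<otimes> b \<in> c i" using P.I_r_closed[OF r b(1)] .
        then have "u \<otimes> (r \<otimes> b) \<in> c i" using P.I_l_closed uc(1) by blast
        then have "u \<otimes> t \<in> p" using ci(2) e by auto
        then show False using uc p.I_prime by blast
      qed
      show ?thesis using ess_lift[OF fraction_ess ci(1) z un] by metis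
    qed
    then obtain d where d: "\<And>i. i \<le> n \<Longrightarrow> d i \<in> spec ?F \<and> contract R ?h (d i) = c i" by metis
    have "d i \<subset> d (Suc i)" if "i < n" for i
    proof -
      have "c i \<subset> c (Suc i)" using c that by (simp add: prime_chain_def)
      then show ?thesis using d[of i] d[of "Suc i"] that ess_contract_mono[OF fraction_ess, of "d i" "d (Suc i)"] by auto
    qed
    then show "\<exists>c. prime_chain ?F n c" using d by (auto simp: prime_chain_def)
  qed
  then show ?thesis by (simp add: krull_dim_def prime_height_def localization_at_def)
qed

lemma LFD_iff: "cring R \<Longrightarrow> LFD R \<longleftrightarrow> (\<forall>p\<in>spec R. prime_height R p < \<infinity>)"
  by (simp add: LFD_def krull_dim_localization)

lemma chain_le_height: "prime_chain R n c \<Longrightarrow> enat n \<le> prime_height R (c n)"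
  unfolding prime_height_def by (rule SUP_upper) blast

lemma prime_height_mono:
  assumes "p \<in> spec R" "q \<subseteq> p"
  shows "prime_height R q \<le> prime_height R p"
  unfolding prime_height_def
proof (rule SUP_least)
  fix n assume "n \<in> {n. \<exists>c. prime_chain R n c \<and> c n = q}"
  then obtain c where c: "prime_chain R n c" "c n = q" by blast
  have "prime_chain R n (c(n := p))"
    unfolding prime_chain_def
  proof (intro conjI allI impI)
    fix i assume "i < n"
    then have "c i \<subset> c (Suc i)" "Suc i \<le> n" using c by (auto simp: prime_chain_def)
    moreover have "c (Suc i) \<subseteq> (c(n := p)) (Suc i)" using c(2) assms(2) by auto
    ultimately show "(c(n := p)) i \<subset> (c(n := p)) (Suc i)" using \<open>i < n\<close> by auto
  qed (use c assms in \<open>auto simp: prime_chain_def\<close>)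
  then show "enat n \<le> (SUP n\<in>{n. \<exists>c. prime_chain R n c \<and> c n = p}. enat n)"
    by (intro SUP_upper) (auto intro!: exI[of _ "c(n := p)"])
qed

lemma height_le:
  assumes "\<And>n c. prime_chain R n c \<Longrightarrow> c n = p \<Longrightarrow> n \<le> N"
  shows "prime_height R p \<le> enat N"
  unfolding prime_height_def by (rule SUP_least) (use assms in auto)

lemma height_attained:
  assumes "prime_height R p < \<infinity>" "p \<in> spec R"
  obtains n c where "prime_chain R n c" "c n = p" "prime_height R p = enat n"
proof -
  let ?A = "{n. \<exists>c. prime_chain R n c \<and> c n = p}"
  obtain N where N: "prime_height R p = enat N" using assms(1) by auto
  have b: "n \<le> N" if "n \<in> ?A" for n using that chain_le_height N by fastforce
  have "0 \<in> ?A" using assms(2) by (auto simp: prime_chain_def intro!: exI[of _ "\<lambda>_. p"])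
  moreover have fin: "finite ?A" using b by (meson finite_nat_set_iff_bounded_le)
  ultimately have "Max ?A \<in> ?A" using Max_in by blast
  then obtain c where c: "prime_chain R (Max ?A) c" "c (Max ?A) = p" by blast
  have "prime_height R p \<le> enat (Max ?A)"
    by (rule height_le) (rule Max_ge[OF fin], blast)
  then have "prime_height R p = enat (Max ?A)" using chain_le_height[OF c(1)] c(2) by (simp add: antisym)
  then show thesis using that c by blast
qed

section \<open>Strong S-rings\<close>

lemma UP_cring_intro: "cring R \<Longrightarrow> UP_cring R"
  by (simp add: UP_cring_def)

definition UP_map :: "('a \<Rightarrow> 'b) \<Rightarrow> (nat \<Rightarrow> 'a) \<Rightarrow> nat \<Rightarrow> 'b"
  where "UP_map h f = (\<lambda>n. h (f n))"

text \<open>The counterpart of \<open>ext_prime\<close> for the univariate polynomials in the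
  definition of an S-domain. For prime \<open>p\<close> it coincides with
  \<open>extended_ideal\<close>, by \<open>extended_ideal_eq\<close>.\<close>

definition UP_ext :: "('a, 'm) ring_scheme \<Rightarrow> 'a set \<Rightarrow> (nat \<Rightarrow> 'a) set"
  where "UP_ext R p = {f \<in> carrier (UP R). \<forall>n. f n \<in> p}"

lemma UP_coeff: "f \<in> carrier (UP R) \<Longrightarrow> up_ring.coeff (UP R) f n = f n"
  by (simp add: UP_def)

lemma UP_carrier: "f \<in> carrier (UP R) \<longleftrightarrow> (\<forall>n. f n \<in> carrier R) \<and> (\<exists>n. \<forall>m>n. f m = \<zero>\<^bsub>R\<^esub>)"
  by (auto simp: UP_def up_def bound_def)

context cring
begin

lemma UP_is_cring: "cring (UP R)"
proof -
  interpret U: UP_cring R "UP R" by (simp add: UP_cring_intro is_cring)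
  show ?thesis by (rule U.P.is_cring)
qed

lemma UP_mult_coeff: "f \<in> carrier (UP R) \<Longrightarrow> g \<in> carrier (UP R) \<Longrightarrow>
    (f \<otimes>\<^bsub>UP R\<^esub> g) n = (\<Oplus>i\<in>{..n}. f i \<otimes> g (n - i))"
  by (simp add: UP_def)

lemma UP_add_coeff: "f \<in> carrier (UP R) \<Longrightarrow> g \<in> carrier (UP R) \<Longrightarrow>
    (f \<oplus>\<^bsub>UP R\<^esub> g) n = f n \<oplus> g n"
  by (simp add: UP_def)

lemma UP_one_coeff: "\<one>\<^bsub>UP R\<^esub> n = (if n = 0 then \<one> else \<zero>)"
  by (simp add: UP_def)

lemma UP_zero_coeff: "\<zero>\<^bsub>UP R\<^esub> n = \<zero>"
  by (simp add: UP_def)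

lemma UP_monom_coeff: "a \<in> carrier R \<Longrightarrow> up_ring.monom (UP R) a n m = (if m = n then a else \<zero>)"
  by (simp add: UP_def)

lemma UP_repr:
  assumes "f \<in> carrier (UP R)"
  shows "\<exists>n. f = (\<Oplus>\<^bsub>UP R\<^esub>i\<in>{..n}. up_ring.monom (UP R) (f i) 0 \<otimes>\<^bsub>UP R\<^esub> up_ring.monom (UP R) \<one> i)"
proof -
  interpret U: UP_cring R "UP R" by (simp add: UP_cring_intro is_cring)
  have "f = (\<Oplus>\<^bsub>UP R\<^esub>i\<in>{..deg R f}. up_ring.monom (UP R) (up_ring.coeff (UP R) f i) i)"
    using U.up_repr[OF assms] by simp
  also have "\<dots> = (\<Oplus>\<^bsub>UP R\<^esub>i\<in>{..deg R f}. up_ring.monom (UP R) (f i) 0 \<otimes>\<^bsub>UP R\<^esub> up_ring.monom (UP R) \<one> i)"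
  proof (rule U.P.finsum_cong')
    fix i
    have "f i \<in> carrier R" using assms by (simp add: UP_carrier)
    then show "up_ring.monom (UP R) (up_ring.coeff (UP R) f i) i = up_ring.monom (UP R) (f i) 0 \<otimes>\<^bsub>UP R\<^esub> up_ring.monom (UP R) \<one> i"
      using U.monom_mult[of "f i" \<one> 0 i] by (simp add: UP_coeff[OF assms])
  qed (use assms in \<open>auto simp: UP_carrier[of f]\<close>)
  finally show ?thesis by blast
qed

lemma UP_monom_pow: "up_ring.monom (UP R) \<one> i = up_ring.monom (UP R) \<one> 1 [^]\<^bsub>UP R\<^esub> (i::nat)"
proof -
  interpret U: UP_cring R "UP R" by (simp add: UP_cring_intro is_cring)
  show ?thesis
  proof (induct i)
    case (Suc i)
    then show ?case using U.monom_mult[of \<one> \<one> i 1] by simp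
  qed simp
qed

lemma UP_gen:
  assumes H: "subring H (UP R)" and c: "\<And>a. a \<in> carrier R \<Longrightarrow> up_ring.monom (UP R) a 0 \<in> H"
    and X: "up_ring.monom (UP R) \<one> 1 \<in> H"
  shows "H = carrier (UP R)"
proof
  interpret U: UP_cring R "UP R" by (simp add: UP_cring_intro is_cring)
  show "H \<subseteq> carrier (UP R)" using H by (rule subringE(1))
  have p: "up_ring.monom (UP R) \<one> i \<in> H" for i
    unfolding UP_monom_pow[of i] by (induct i) (use X in \<open>auto intro: subringE(3,6)[OF H]\<close>)
  show "carrier (UP R) \<subseteq> H"
  proof
    fix f assume f: "f \<in> carrier (UP R)"
    obtain n where n: "f = (\<Oplus>\<^bsub>UP R\<^esub>i\<in>{..n}. up_ring.monom (UP R) (f i) 0 \<otimes>\<^bsub>UP R\<^esub> up_ring.monom (UP R) \<one> i)"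
      using UP_repr[OF f] by blast
    have t: "up_ring.monom (UP R) (f i) 0 \<otimes>\<^bsub>UP R\<^esub> up_ring.monom (UP R) \<one> i \<in> H" for i
      using f by (intro subringE(6)[OF H] c p) (simp add: UP_carrier)
    then have tc: "up_ring.monom (UP R) (f i) 0 \<otimes>\<^bsub>UP R\<^esub> up_ring.monom (UP R) \<one> i \<in> carrier (UP R)" for i
      using subringE(1)[OF H] by blast
    have "(\<Oplus>\<^bsub>UP R\<^esub>i\<in>{..n}. up_ring.monom (UP R) (f i) 0 \<otimes>\<^bsub>UP R\<^esub> up_ring.monom (UP R) \<one> i) \<in> H"
    proof (induct n)
      case (Suc n) then show ?case using t tc subringE(7)[OF H] by (simp add: Pi_def)
    next
      case 0 show ?case using tc[of 0] by (subst U.P.finsum_0) (use t[of 0] in \<open>simp_all add: Pi_def\<close>)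
    qed
    then show "f \<in> H" using n by simp
  qed
qed

end

context ring_hom_cring
begin

lemma UP_map_hom: "ring_hom_cring (UP R) (UP S) (UP_map h)"
proof -
  have cl: "UP_map h f \<in> carrier (UP S)" if "f \<in> carrier (UP R)" for f
    using that by (fastforce simp: UP_carrier UP_map_def)
  have "UP_map h \<in> ring_hom (UP R) (UP S)"
  proof (rule ring_hom_memI)
    interpret UR: cring "UP R" by (rule R.UP_is_cring)
    fix f g assume f: "f \<in> carrier (UP R)" and g: "g \<in> carrier (UP R)"
    have fc: "f i \<in> carrier R" "g i \<in> carrier R" for i using f g by (simp_all add: UP_carrier)
    show "UP_map h f \<in> carrier (UP S)" using cl f .
    show "UP_map h (f \<oplus>\<^bsub>UP R\<^esub> g) = UP_map h f \<oplus>\<^bsub>UP S\<^esub> UP_map h g"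
      using f g fc cl by (intro ext) (simp add: R.UP_add_coeff S.UP_add_coeff UP_map_def[of h "f \<oplus>\<^bsub>UP R\<^esub> g"], simp add: UP_map_def)
    show "UP_map h (f \<otimes>\<^bsub>UP R\<^esub> g) = UP_map h f \<otimes>\<^bsub>UP S\<^esub> UP_map h g"
    proof
      fix n
      have "UP_map h (f \<otimes>\<^bsub>UP R\<^esub> g) n = (\<Oplus>\<^bsub>S\<^esub>i\<in>{..n}. h (f i \<otimes> g (n - i)))"
        using f g fc by (simp add: R.UP_mult_coeff UP_map_def comp_def)
      also have "\<dots> = (UP_map h f \<otimes>\<^bsub>UP S\<^esub> UP_map h g) n"
        using f g fc cl by (simp add: S.UP_mult_coeff) (simp add: UP_map_def)
      finally show "UP_map h (f \<otimes>\<^bsub>UP R\<^esub> g) n = (UP_map h f \<otimes>\<^bsub>UP S\<^esub> UP_map h g) n" .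
    qed
  next
    show "UP_map h \<one>\<^bsub>UP R\<^esub> = \<one>\<^bsub>UP S\<^esub>"
      by (rule ext) (simp add: UP_map_def R.UP_one_coeff S.UP_one_coeff)
  qed
  then show ?thesis by (simp add: ring_hom_cring_def ring_hom_cring_axioms_def R.UP_is_cring S.UP_is_cring)
qed

lemma UP_map_lift:
  assumes f: "f \<in> carrier (UP S)" and im: "\<And>n. f n \<in> h ` carrier R"
  shows "\<exists>g\<in>carrier (UP R). UP_map h g = f"
proof -
  \<comment> \<open>Zero coefficients are lifted to zero, so that the lift still has finite
    degree.\<close>
  define g where "g n = (if f n = \<zero>\<^bsub>S\<^esub> then \<zero> else (SOME r. r \<in> carrier R \<and> h r = f n))" for n
  have g: "g n \<in> carrier R \<and> h (g n) = f n" for n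
  proof (cases "f n = \<zero>\<^bsub>S\<^esub>")
    case False
    have "\<exists>r. r \<in> carrier R \<and> h r = f n" using im[of n] by auto
    then show ?thesis using someI_ex[of "\<lambda>r. r \<in> carrier R \<and> h r = f n"] False by (simp add: g_def)
  qed (simp add: g_def)
  obtain N where "\<And>m. m > N \<Longrightarrow> f m = \<zero>\<^bsub>S\<^esub>" using f by (auto simp: UP_carrier)
  then have "g m = \<zero>" if "m > N" for m using that by (simp add: g_def)
  then have "g \<in> carrier (UP R)" using g by (auto simp: UP_carrier)
  moreover have "UP_map h g = f" using g by (simp add: UP_map_def)
  ultimately show ?thesis by blast
qed

lemma UP_map_surj:
  assumes "carrier S \<subseteq> h ` carrier R"
  shows "carrier (UP S) \<subseteq> UP_map h ` carrier (UP R)"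
proof
  fix f assume f: "f \<in> carrier (UP S)"
  have "f n \<in> h ` carrier R" for n using f assms by (auto simp: UP_carrier)
  then have "\<exists>g\<in>carrier (UP R). UP_map h g = f" by (rule UP_map_lift[OF f])
  then obtain g where "g \<in> carrier (UP R)" "UP_map h g = f" by (rule bexE)
  then show "f \<in> UP_map h ` carrier (UP R)" by (intro image_eqI[of _ _ g]) simp_all
qed

lemma contract_UP_ext: "contract (UP R) (UP_map h) (UP_ext S P) = UP_ext R (contract R h P)"
proof -
  interpret U: ring_hom_cring "UP R" "UP S" "UP_map h" by (rule UP_map_hom)
  show ?thesis using U.hom_closed by (auto simp: UP_ext_def UP_map_def contract_def UP_carrier[of _ R])
qed

end

lemma UP_monom_ext:
  assumes "p \<in> spec R" "x \<in> p"
  shows "up_ring.monom (UP R) x 0 \<in> UP_ext R p"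
proof -
  interpret p: primeideal p R using assms by (simp add: spec_iff)
  interpret U: UP_cring R "UP R" by (simp add: UP_cring_intro p.is_cring)
  have xc: "x \<in> carrier R" using assms(2) by (rule p.Icarr)
  show ?thesis
    using assms(2) xc additive_subgroup.zero_closed[OF p.is_additive_subgroup] by (auto simp: UP_ext_def p.UP_monom_coeff)
qed

lemma UP_ext_mono_iff:
  fixes R (structure)
  assumes "P \<in> spec R" "Q \<in> spec R"
  shows "UP_ext R P \<subseteq> UP_ext R Q \<longleftrightarrow> P \<subseteq> Q"
proof
  interpret P: primeideal P R using assms by (simp add: spec_iff)
  interpret Q: primeideal Q R using assms by (simp add: spec_iff)
  interpret U: UP_cring R "UP R" by (simp add: UP_cring_intro P.is_cring)
  assume le: "UP_ext R P \<subseteq> UP_ext R Q"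
  show "P \<subseteq> Q"
  proof
    fix x assume x: "x \<in> P"
    then have xc: "x \<in> carrier R" by (rule P.Icarr)
    have "up_ring.monom (UP R) x 0 \<in> UP_ext R P"
      by (rule UP_monom_ext[OF assms(1) x])
    then have "up_ring.monom (UP R) x 0 \<in> UP_ext R Q" using le by blast
    then show "x \<in> Q" using xc by (auto simp: UP_ext_def P.UP_monom_coeff dest: spec[of _ 0])
  qed
qed (auto simp: UP_ext_def)

text \<open>Take the lowest coefficients of \<open>f\<close> and \<open>g\<close> outside
  \<open>p\<close>, at positions \<open>a\<close> and \<open>b\<close>. In the coefficient of the
  product at \<open>a + b\<close> all other terms lie in \<open>p\<close>.\<close>

lemma UP_ext_spec:
  fixes R (structure)
  assumes p: "p \<in> spec R"
  shows "UP_ext R p \<in> spec (UP R)"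
proof -
  interpret p: primeideal p R using p by (simp add: spec_iff)
  interpret M: cring "UP R" by (rule p.UP_is_cring)
  have cf: "f m \<in> carrier R" if "f \<in> carrier (UP R)" for f m using that by (simp add: UP_carrier)
  note p0 = additive_subgroup.zero_closed[OF p.is_additive_subgroup]
  let ?E = "UP_ext R p"
  have l: "x \<otimes>\<^bsub>UP R\<^esub> a \<in> ?E" if a: "a \<in> ?E" and x: "x \<in> carrier (UP R)" for a x
  proof -
    have ac: "a \<in> carrier (UP R)" using a by (simp add: UP_ext_def)
    have "(x \<otimes>\<^bsub>UP R\<^esub> a) m \<in> p" for m
      unfolding p.UP_mult_coeff[OF x ac] by (rule p.finsum_in) (use a x cf in \<open>auto simp: UP_ext_def p.I_l_closed\<close>)
    then show ?thesis using x ac by (simp add: UP_ext_def)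
  qed
  have "primeideal ?E (UP R)"
  proof (rule primeidealI[OF idealI])
    show "subgroup ?E (add_monoid (UP R))"
    proof (rule M.add.subgroupI)
      show "?E \<subseteq> carrier (UP R)" by (auto simp: UP_ext_def)
      have "\<zero>\<^bsub>UP R\<^esub> \<in> ?E" using p0 M.zero_closed by (auto simp: UP_ext_def p.UP_zero_coeff)
      then show "?E \<noteq> {}" by blast
      fix a assume a: "a \<in> ?E"
      then have ac: "a \<in> carrier (UP R)" by (auto simp: UP_ext_def)
      have "\<ominus>\<^bsub>UP R\<^esub> a = (\<ominus>\<^bsub>UP R\<^esub> \<one>\<^bsub>UP R\<^esub>) \<otimes>\<^bsub>UP R\<^esub> a" using ac by (simp add: M.l_minus)
      then show "\<ominus>\<^bsub>UP R\<^esub> a \<in> ?E" using l[OF a] M.one_closed M.a_inv_closed by metis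
      fix b assume b: "b \<in> ?E"
      then show "a \<oplus>\<^bsub>UP R\<^esub> b \<in> ?E" using a M.a_closed[of a b]
        by (auto simp: UP_ext_def p.UP_add_coeff p.add_in)
    qed
    have "\<one>\<^bsub>UP R\<^esub> \<notin> ?E" using p.one_notin by (auto simp: UP_ext_def p.UP_one_coeff dest: spec[of _ 0])
    then show "carrier (UP R) \<noteq> ?E" using M.one_closed by metis
    show "x \<otimes>\<^bsub>UP R\<^esub> a \<in> ?E" if "a \<in> ?E" "x \<in> carrier (UP R)" for a x using l that .
    show "a \<otimes>\<^bsub>UP R\<^esub> x \<in> ?E" if "a \<in> ?E" "x \<in> carrier (UP R)" for a x
    proof -
      have "a \<in> carrier (UP R)" using that(1) by (simp add: UP_ext_def)
      then show ?thesis using l[OF that] that(2) M.m_comm[of a x] by simp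
    qed
    fix f g assume f: "f \<in> carrier (UP R)" and g: "g \<in> carrier (UP R)" and fg: "f \<otimes>\<^bsub>UP R\<^esub> g \<in> ?E"
    show "f \<in> ?E \<or> g \<in> ?E"
    proof (rule ccontr)
      assume "\<not> (f \<in> ?E \<or> g \<in> ?E)"
      then have ne: "\<exists>m. f m \<notin> p" "\<exists>m. g m \<notin> p" using f g by (auto simp: UP_ext_def)
      define a where "a = (LEAST m. f m \<notin> p)"
      define b where "b = (LEAST m. g m \<notin> p)"
      have a: "f a \<notin> p" "\<And>i. i < a \<Longrightarrow> f i \<in> p" using LeastI_ex[OF ne(1)] not_less_Least unfolding a_def by blast+
      have b: "g b \<notin> p" "\<And>i. i < b \<Longrightarrow> g i \<in> p" using LeastI_ex[OF ne(2)] not_less_Least unfolding b_def by blast+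
      let ?t = "\<lambda>i. f i \<otimes> g (a + b - i)"
      have other: "?t i \<in> p" if "i \<le> a + b" "i \<noteq> a" for i
      proof (cases "i < a")
        case True then show ?thesis using a(2) cf[OF g] by (simp add: p.I_r_closed)
      next
        case False then have "a + b - i < b" using that by auto
        then show ?thesis using b(2) cf[OF f] by (simp add: p.I_l_closed)
      qed
      have "(f \<otimes>\<^bsub>UP R\<^esub> g) (a + b) = (\<Oplus>i\<in>insert a ({..a + b} - {a}). ?t i)"
        by (simp add: p.UP_mult_coeff[OF f g] insert_absorb)
      also have "\<dots> = f a \<otimes> g b \<oplus> (\<Oplus>i\<in>{..a + b} - {a}. ?t i)"
        by (subst p.finsum_insert) (use cf f g in auto)
      finally have "f a \<otimes> g b \<oplus> (\<Oplus>i\<in>{..a + b} - {a}. ?t i) \<in> p"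
        using fg by (auto simp: UP_ext_def dest!: spec[of _ "a + b"])
      moreover have "(\<Oplus>i\<in>{..a + b} - {a}. ?t i) \<in> p" by (rule p.finsum_in) (use other in auto)
      ultimately have "f a \<otimes> g b \<in> p" using cf f g p.add_in_iff by simp
      then show False using a(1) b(1) cf f g by (simp add: p.mult_in_iff)
    qed
  qed (use M.ring_axioms M.is_cring in auto)
  then show ?thesis by (simp add: spec_iff)
qed

lemma extended_ideal_eq:
  fixes R (structure)
  assumes p: "p \<in> spec R"
  shows "extended_ideal R p = UP_ext R p"
proof
  interpret p: primeideal p R using p by (simp add: spec_iff)
  interpret U: UP_cring R "UP R" by (simp add: UP_cring_intro p.is_cring)
  interpret E: primeideal "UP_ext R p" "UP R" using UP_ext_spec[OF p] by (simp add: spec_iff)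
  note p0 = additive_subgroup.zero_closed[OF p.is_additive_subgroup]
  let ?G = "(\<lambda>a. up_ring.monom (UP R) a 0) ` p"
  have G: "?G \<subseteq> carrier (UP R)" using p.Icarr by auto
  show "extended_ideal R p \<subseteq> UP_ext R p" unfolding extended_ideal_def
    by (rule U.P.genideal_minimal[OF E.is_ideal], rule image_subsetI, rule UP_monom_ext[OF p])
  interpret I: ideal "extended_ideal R p" "UP R" unfolding extended_ideal_def by (rule U.P.genideal_ideal[OF G])
  show "UP_ext R p \<subseteq> extended_ideal R p"
  proof
    fix f assume f: "f \<in> UP_ext R p"
    then have fc: "f \<in> carrier (UP R)" "\<And>i. f i \<in> p" unfolding UP_ext_def by blast+
    obtain n where n: "f = (\<Oplus>\<^bsub>UP R\<^esub>i\<in>{..n}. up_ring.monom (UP R) (f i) 0 \<otimes>\<^bsub>UP R\<^esub> up_ring.monom (UP R) \<one> i)"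
      using p.UP_repr[OF fc(1)] by blast
    have t: "up_ring.monom (UP R) (f i) 0 \<otimes>\<^bsub>UP R\<^esub> up_ring.monom (UP R) \<one> i \<in> extended_ideal R p" for i
    proof (rule I.I_r_closed)
      show "up_ring.monom (UP R) (f i) 0 \<in> extended_ideal R p"
        using U.P.genideal_self[OF G] fc(2)[of i] unfolding extended_ideal_def by blast
    qed simp
    have "(\<Oplus>\<^bsub>UP R\<^esub>i\<in>{..n}. up_ring.monom (UP R) (f i) 0 \<otimes>\<^bsub>UP R\<^esub> up_ring.monom (UP R) \<one> i) \<in> extended_ideal R p"
    proof (induct n)
      case (Suc n) then show ?case using t I.Icarr[OF t] additive_subgroup.a_closed[OF I.is_additive_subgroup] by (simp add: Pi_def)
    next
      case 0 show ?case using I.Icarr[OF t[of 0]] by (subst U.P.finsum_0) (use t[of 0] in \<open>simp_all add: Pi_def\<close>)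
    qed
    then show "f \<in> extended_ideal R p" using n by simp
  qed
qed

section \<open>The S-property as a condition on adjacent primes\<close>

lemma height_one_iff:
  fixes D (structure)
  assumes D: "domain D" and q: "q \<in> spec D"
  shows "prime_height D q = 1 \<longleftrightarrow> adjacent_primes D {\<zero>} q"
proof -
  interpret domain D by fact
  have z: "{\<zero>} \<in> spec D" using zeroprimeideal by (simp add: spec_iff)
  have zle: "{\<zero>} \<subseteq> p" if "p \<in> spec D" for p
    using that additive_subgroup.zero_closed[of p D] by (auto simp: spec_iff primeideal_def ideal_def)
  show ?thesis
  proof
    assume h: "prime_height D q = 1"
    then have "prime_height D q < \<infinity>" by (simp add: one_enat_def)
    then obtain n c where c: "prime_chain D n c" "c n = q" "prime_height D q = enat n"
      using height_attained q by blast
    then have n: "n = 1" using h by (simp add: one_enat_def)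
    have "c 0 \<in> spec D" "c 0 \<subset> q" using c n by (auto simp: prime_chain_def)
    then have zq: "{\<zero>} \<subset> q" using zle[of "c 0"] by blast
    show "adjacent_primes D {\<zero>} q"
    proof (rule ccontr)
      assume "\<not> adjacent_primes D {\<zero>} q"
      then obtain N where N: "N \<in> spec D" "{\<zero>} \<subset> N" "N \<subset> q" using z q zq by (auto simp: adjacent_primes_def)
      define d where "d i = (if i = 0 then {\<zero>} else if i = 1 then N else q)" for i :: nat
      have "prime_chain D 2 d" using z N q by (auto simp: prime_chain_def d_def less_2_cases_iff)
      then have "enat 2 \<le> prime_height D (d 2)" by (rule chain_le_height)
      then show False using h by (simp add: d_def one_enat_def)
    qed
  next
    assume a: "adjacent_primes D {\<zero>} q"
    have zq: "{\<zero>} \<subset> q" using adjacent_primesD[OF a] by blast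
    define d where "d i = (if i = 0 then {\<zero>} else q)" for i :: nat
    have "prime_chain D 1 d" using z q zq by (auto simp: prime_chain_def d_def)
    then have ge: "enat 1 \<le> prime_height D q" using chain_le_height[of D 1 d] by (simp add: d_def)
    have "prime_height D q \<le> enat 1"
    proof (rule height_le)
      fix n c assume c: "prime_chain D n c" "c n = q"
      show "n \<le> 1"
      proof (rule ccontr)
        assume "\<not> n \<le> 1"
        then have "c 0 \<subset> c 1" "c 1 \<subset> c n" "c 1 \<in> spec D" "c 0 \<in> spec D"
          using prime_chain_strict[OF c(1)] prime_chainD[OF c(1)] by auto
        then show False using adjacent_primesD(4)[OF a, of "c 1"] zle c(2) by blast
      qed
    qed
    then show "prime_height D q = 1" using ge by (simp add: one_enat_def antisym)
  qed
qed

text \<open>The S-property for a single step from \<open>P\<close> to \<open>Q\<close>, stated in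
  the polynomial ring over \<open>R\<close> instead of over \<open>R Quot P\<close>. In this form it
  can be compared along homomorphisms.\<close>

definition SS_between :: "('a, 'm) ring_scheme \<Rightarrow> 'a set \<Rightarrow> 'a set \<Rightarrow> bool"
  where "SS_between R P Q \<longleftrightarrow> \<not> (\<exists>N\<in>spec (UP R). UP_ext R P \<subset> N \<and> N \<subset> UP_ext R Q)"

text \<open>Both heights in the definition are heights of primes in domains, since
  \<open>extended_ideal D q\<close> is itself prime. In a domain, height one means adjacency to the
  zero ideal.\<close>

lemma S_domain_iff:
  fixes D (structure)
  assumes D: "domain D"
  shows "S_domain D \<longleftrightarrow> (\<forall>q. adjacent_primes D {\<zero>} q \<longrightarrow> SS_between D {\<zero>} q)"
proof -
  interpret domain D by fact
  have z: "{\<zero>} \<in> spec D" using zeroprimeideal by (simp add: spec_iff)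
  interpret U: UP_domain D "UP D" by (simp add: UP_domain_def D)
  have U0: "UP_ext D {\<zero>} = {\<zero>\<^bsub>UP D\<^esub>}"
    by (auto simp: UP_ext_def fun_eq_iff UP_zero_coeff)
  have "ideal_height (UP D) (extended_ideal D q) = 1 \<longleftrightarrow> SS_between D {\<zero>} q" if a: "adjacent_primes D {\<zero>} q" for q
  proof -
    note q = adjacent_primesD[OF a]
    have E: "UP_ext D q \<in> spec (UP D)" by (rule UP_ext_spec[OF q(2)])
    have "ideal_height (UP D) (extended_ideal D q) = prime_height (UP D) (UP_ext D q)"
      unfolding ideal_height_def extended_ideal_eq[OF q(2)]
      by (intro antisym INF_lower INF_greatest) (use E prime_height_mono in auto)
    moreover have "prime_height (UP D) (UP_ext D q) = 1 \<longleftrightarrow> adjacent_primes (UP D) (UP_ext D {\<zero>}) (UP_ext D q)"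
      unfolding U0 by (rule height_one_iff[OF U.domain_axioms E])
    moreover have "adjacent_primes (UP D) (UP_ext D {\<zero>}) (UP_ext D q) \<longleftrightarrow> SS_between D {\<zero>} q"
      using UP_ext_spec[OF z] E UP_ext_mono_iff[OF z q(2)] UP_ext_mono_iff[OF q(2) z] q(3)
      unfolding adjacent_primes_def SS_between_def by blast
    ultimately show ?thesis by simp
  qed
  moreover have "S_domain D \<longleftrightarrow> (\<forall>q. adjacent_primes D {\<zero>} q \<longrightarrow> ideal_height (UP D) (extended_ideal D q) = 1)"
    using D height_one_iff[OF D] adjacent_primesD(2)[of D "{\<zero>}"] unfolding S_domain_def by blast
  ultimately show ?thesis by blast
qed

lemma contract_adjacent_iff:
  assumes e: "ess_surj R S h" and P: "P \<in> spec S" "Q \<in> spec S"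
  shows "adjacent_primes S P Q \<longleftrightarrow> adjacent_primes R (contract R h P) (contract R h Q)"
proof
  assume a: "adjacent_primes R (contract R h P) (contract R h Q)"
  have h: "ring_hom_cring R S h" using e by (simp add: ess_surj_def)
  note d = adjacent_primesD[OF a]
  show "adjacent_primes S P Q"
  proof (rule adjacent_primesI[OF P])
    show "P \<subset> Q" using ess_contract_mono[OF e P] d(3) by blast
    fix N assume N: "N \<in> spec S" "P \<subseteq> N" "N \<subseteq> Q"
    have "contract R h N = contract R h P \<or> contract R h N = contract R h Q"
      by (rule d(4)[OF contract_spec[OF h N(1)]]) (use N in auto)
    then show "N = P \<or> N = Q" using ess_contract_inj[OF e N(1)] P by blast
  qed
qed (rule adjacent_contract[OF e])

lemma FactRing_zero_iff:
  assumes "ideal p R" "r \<in> carrier R"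
  shows "p +>\<^bsub>R\<^esub> r = \<zero>\<^bsub>R Quot p\<^esub> \<longleftrightarrow> r \<in> p"
proof -
  have "\<zero>\<^bsub>R Quot p\<^esub> = p" by (simp add: FactRing_def)
  then show ?thesis using ideal.rcos_const_imp_mem[OF assms] ring.a_rcos_zero[of R p r] assms by (auto simp: ideal_def)
qed

lemma FactRing_surj: "carrier (R Quot p) \<subseteq> (+>\<^bsub>R\<^esub>) p ` carrier R"
  by (auto simp: FactRing_def A_RCOSETS_def')

text \<open>Contraction along the map from \<open>R\<close> to \<open>R Quot p\<close>, and along
  the induced map of polynomial rings, identifies primes of the quotients with primes above
  \<open>p\<close> and above \<open>UP_ext R p\<close>. The quotients disappear from the definition,
  and a condition on adjacent primes of \<open>R\<close> remains.\<close>

lemma strong_S_ring_iff: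
  fixes R (structure)
  shows "strong_S_ring R \<longleftrightarrow> nonzero_cring R \<and> (\<forall>P Q. adjacent_primes R P Q \<longrightarrow> SS_between R P Q)"
proof -
  have "S_domain (R Quot p) \<longleftrightarrow> (\<forall>Q. adjacent_primes R p Q \<longrightarrow> SS_between R p Q)"
    if R: "nonzero_cring R" and p: "p \<in> spec R" for p
  proof -
    interpret cring R using R by (simp add: nonzero_cring_def)
    interpret p: primeideal p R using p by (simp add: spec_iff)
    let ?D = "R Quot p" and ?\<pi> = "(+>) p"
    interpret D: domain ?D by (rule p.quotient_is_domain)
    interpret h: ring_hom_cring R ?D ?\<pi> by (rule p.rcos_ring_hom_cring)
    have surj: "carrier ?D \<subseteq> ?\<pi> ` carrier R" by (rule FactRing_surj)
    have e: "ess_surj R ?D ?\<pi>" by (rule surj_ess_surj[OF h.ring_hom_cring_axioms surj])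
    have eU: "ess_surj (UP R) (UP ?D) (UP_map ?\<pi>)"
      by (rule surj_ess_surj[OF h.UP_map_hom h.UP_map_surj[OF surj]])
    have z: "{\<zero>\<^bsub>?D\<^esub>} \<in> spec ?D" using D.zeroprimeideal by (simp add: spec_iff)
    have ker: "?\<pi> r = \<zero>\<^bsub>?D\<^esub> \<longleftrightarrow> r \<in> p" if "r \<in> carrier R" for r
    proof -
      show ?thesis by (rule FactRing_zero_iff[OF p.is_ideal that])
    qed
    have c0: "contract R ?\<pi> {\<zero>\<^bsub>?D\<^esub>} = p" using ker p.Icarr by auto
    have lift: "\<exists>q\<in>spec ?D. contract R ?\<pi> q = Q" if Q: "Q \<in> spec R" "p \<subseteq> Q" for Q
      by (rule surj_lift[OF h.ring_hom_cring_axioms surj Q(1)]) (use ker Q(2) in auto)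
    have SS: "SS_between ?D {\<zero>\<^bsub>?D\<^esub>} q \<longleftrightarrow> SS_between R p (contract R ?\<pi> q)" if q: "q \<in> spec ?D" for q
    proof -
      note cU = h.contract_UP_ext
      have c: "UP_ext R p = contract (UP R) (UP_map ?\<pi>) (UP_ext ?D {\<zero>\<^bsub>?D\<^esub>})" unfolding cU c0 ..
      note E = UP_ext_spec[OF z] UP_ext_spec[OF q]
      have "(\<exists>N\<in>spec (UP ?D). UP_ext ?D {\<zero>\<^bsub>?D\<^esub>} \<subset> N \<and> N \<subset> UP_ext ?D q) \<longleftrightarrow>
        (\<exists>N\<in>spec (UP R). UP_ext R p \<subset> N \<and> N \<subset> UP_ext R (contract R ?\<pi> q))"
      proof
        assume "\<exists>N\<in>spec (UP ?D). UP_ext ?D {\<zero>\<^bsub>?D\<^esub>} \<subset> N \<and> N \<subset> UP_ext ?D q"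
        then obtain N where N: "N \<in> spec (UP ?D)" "UP_ext ?D {\<zero>\<^bsub>?D\<^esub>} \<subset> N" "N \<subset> UP_ext ?D q" by blast
        have "contract (UP R) (UP_map ?\<pi>) N \<in> spec (UP R)" by (rule contract_spec[OF h.UP_map_hom N(1)])
        moreover have "UP_ext R p \<subset> contract (UP R) (UP_map ?\<pi>) N"
          unfolding c using ess_contract_mono[OF eU N(1) E(1)] N(2) by auto
        moreover have "contract (UP R) (UP_map ?\<pi>) N \<subset> UP_ext R (contract R ?\<pi> q)"
          unfolding cU[symmetric] using ess_contract_mono[OF eU E(2) N(1)] N(3) by auto
        ultimately show "\<exists>N\<in>spec (UP R). UP_ext R p \<subset> N \<and> N \<subset> UP_ext R (contract R ?\<pi> q)" by blast
      next
        assume "\<exists>N\<in>spec (UP R). UP_ext R p \<subset> N \<and> N \<subset> UP_ext R (contract R ?\<pi> q)"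
        then obtain N where N: "N \<in> spec (UP R)" "UP_ext R p \<subset> N" "N \<subset> UP_ext R (contract R ?\<pi> q)" by blast
        have a: "contract (UP R) (UP_map ?\<pi>) (UP_ext ?D {\<zero>\<^bsub>?D\<^esub>}) \<subset> N" unfolding c[symmetric] by (rule N(2))
        have b: "N \<subset> contract (UP R) (UP_map ?\<pi>) (UP_ext ?D q)" unfolding cU by (rule N(3))
        obtain N' where N': "N' \<in> spec (UP ?D)" "contract (UP R) (UP_map ?\<pi>) N' = N" "UP_ext ?D {\<zero>\<^bsub>?D\<^esub>} \<subseteq> N'" "N' \<subseteq> UP_ext ?D q"
          by (rule contract_between[OF eU E N(1) psubset_imp_subset[OF a] psubset_imp_subset[OF b]])
        have "N' \<noteq> UP_ext ?D {\<zero>\<^bsub>?D\<^esub>}" "N' \<noteq> UP_ext ?D q" using a b N'(2) by auto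
        then show "\<exists>N\<in>spec (UP ?D). UP_ext ?D {\<zero>\<^bsub>?D\<^esub>} \<subset> N \<and> N \<subset> UP_ext ?D q"
          using N'(1,3,4) by blast
      qed
      then show ?thesis by (simp add: SS_between_def)
    qed
    have adj: "adjacent_primes ?D {\<zero>\<^bsub>?D\<^esub>} q \<longleftrightarrow> adjacent_primes R p (contract R ?\<pi> q)" if "q \<in> spec ?D" for q
      using contract_adjacent_iff[OF e z that] c0 by simp
    show ?thesis
      unfolding S_domain_iff[OF D.domain_axioms]
    proof (intro iffI allI impI)
      fix Q assume H: "\<forall>q. adjacent_primes ?D {\<zero>\<^bsub>?D\<^esub>} q \<longrightarrow> SS_between ?D {\<zero>\<^bsub>?D\<^esub>} q" and a: "adjacent_primes R p Q"
      obtain q where q: "q \<in> spec ?D" "contract R ?\<pi> q = Q"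
        using lift[of Q] adjacent_primesD(2,3)[OF a] by auto
      have "adjacent_primes ?D {\<zero>\<^bsub>?D\<^esub>} q" using adj[OF q(1)] q(2) a by simp
      then have "SS_between ?D {\<zero>\<^bsub>?D\<^esub>} q" using H by simp
      then show "SS_between R p Q" using SS[OF q(1)] q(2) by simp
    next
      fix q assume H: "\<forall>Q. adjacent_primes R p Q \<longrightarrow> SS_between R p Q" and a: "adjacent_primes ?D {\<zero>\<^bsub>?D\<^esub>} q"
      have q: "q \<in> spec ?D" by (rule adjacent_primesD(2)[OF a])
      have "adjacent_primes R p (contract R ?\<pi> q)" using adj[OF q] a by simp
      then have "SS_between R p (contract R ?\<pi> q)" using H by simp
      then show "SS_between ?D {\<zero>\<^bsub>?D\<^esub>} q" using SS[OF q] by simp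
    qed
  qed
  then show ?thesis unfolding strong_S_ring_def using adjacent_primesD(1) by blast
qed

section \<open>Chains of primes in a fibre\<close>

text \<open>Over the fraction field of \<open>D\<close> this says that a nonzero prime of a
  principal ideal domain is maximal. The proof stays in \<open>UP D\<close>: pseudo-division by an
  element of least degree in \<open>N\<close> replaces division by a generator, and powers of its
  leading coefficient do no harm because they lie outside \<open>N\<close>.\<close>

lemma UP_domain_prime_eq:
  fixes D (structure)
  assumes D: "domain D" and Q: "Q \<in> spec (UP D)" and N: "N \<in> spec (UP D)" and le: "Q \<subseteq> N"
    and N0: "\<And>a. a \<in> carrier D \<Longrightarrow> up_ring.monom (UP D) a 0 \<in> N \<Longrightarrow> a = \<zero>"
    and Q0: "Q \<noteq> {\<zero>\<^bsub>UP D\<^esub>}"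
  shows "Q = N"
proof -
  interpret domain D by fact
  interpret U: UP_domain D "UP D" by (simp add: UP_domain_def D)
  interpret Q: primeideal Q "UP D" using Q by (simp add: spec_iff)
  interpret N: primeideal N "UP D" using N by (simp add: spec_iff)
  have zQ: "\<zero>\<^bsub>UP D\<^esub> \<in> Q" by (rule additive_subgroup.zero_closed[OF Q.is_additive_subgroup])
  then obtain f0 where f0: "f0 \<in> Q" "f0 \<noteq> \<zero>\<^bsub>UP D\<^esub>" using Q0 by blast
  \<comment> \<open>Nonzero elements of least degree in \<open>Q\<close> and in \<open>N\<close>;
    over the fraction field, \<open>g\<close> would generate the extension of
    \<open>N\<close>.\<close>
  define f where "f = arg_min (deg D) (\<lambda>f. f \<in> Q \<and> f \<noteq> \<zero>\<^bsub>UP D\<^esub>)"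
  define g where "g = arg_min (deg D) (\<lambda>f. f \<in> N \<and> f \<noteq> \<zero>\<^bsub>UP D\<^esub>)"
  have f: "f \<in> Q \<and> f \<noteq> \<zero>\<^bsub>UP D\<^esub>" unfolding f_def by (rule arg_min_natI[of _ f0]) (use f0 in blast)
  have fmin: "deg D f \<le> deg D x" if "x \<in> Q" "x \<noteq> \<zero>\<^bsub>UP D\<^esub>" for x
    using arg_min_nat_le[of "\<lambda>f. f \<in> Q \<and> f \<noteq> \<zero>\<^bsub>UP D\<^esub>" x "deg D"] that unfolding f_def by blast
  have g: "g \<in> N \<and> g \<noteq> \<zero>\<^bsub>UP D\<^esub>" unfolding g_def by (rule arg_min_natI[of _ f0]) (use f0 le in blast)
  have gmin: "deg D g \<le> deg D x" if "x \<in> N" "x \<noteq> \<zero>\<^bsub>UP D\<^esub>" for x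
    using arg_min_nat_le[of "\<lambda>f. f \<in> N \<and> f \<noteq> \<zero>\<^bsub>UP D\<^esub>" x "deg D"] that unfolding g_def by blast
  have fc: "f \<in> carrier (UP D)" using f Q.Icarr by blast
  have gc: "g \<in> carrier (UP D)" using g N.Icarr by blast
  define c where "c = up_ring.coeff (UP D) g (deg D g)"
  have c: "c \<in> carrier D" "c \<noteq> \<zero>" unfolding c_def using U.lcoeff_nonzero2[OF gc] g gc by simp_all
  have ck: "c [^] (k::nat) \<in> carrier D" "c [^] k \<noteq> \<zero>" for k
  proof -
    show "c [^] k \<in> carrier D" using c(1) by simp
    show "c [^] k \<noteq> \<zero>" by (induct k) (use c in \<open>auto simp: integral_iff\<close>)
  qed
  have mN: "up_ring.monom (UP D) (c [^] (k::nat)) 0 \<notin> N" for k using N0[OF ck(1)] ck(2) by blast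
  \<comment> \<open>The remainder of the pseudo-division lies in \<open>N\<close> and is zero or of
    smaller degree than \<open>g\<close>, so it is zero.\<close>
  have div: "\<exists>k w. w \<in> carrier (UP D) \<and> up_ring.monom (UP D) (c [^] (k::nat)) 0 \<otimes>\<^bsub>UP D\<^esub> h = g \<otimes>\<^bsub>UP D\<^esub> w"
    if h: "h \<in> N" for h
  proof -
    have hc: "h \<in> carrier (UP D)" using h by (rule N.Icarr)
    obtain w r k where w: "w \<in> carrier (UP D)" "r \<in> carrier (UP D)"
      "c [^] (k::nat) \<odot>\<^bsub>UP D\<^esub> h = g \<otimes>\<^bsub>UP D\<^esub> w \<oplus>\<^bsub>UP D\<^esub> r" "r = \<zero>\<^bsub>UP D\<^esub> \<or> deg D r < deg D g"
      using U.long_div_theorem[OF gc hc] g unfolding c_def by metis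
    have e: "up_ring.monom (UP D) (c [^] k) 0 \<otimes>\<^bsub>UP D\<^esub> h = g \<otimes>\<^bsub>UP D\<^esub> w \<oplus>\<^bsub>UP D\<^esub> r"
      using U.monom_mult_is_smult[OF ck(1) hc] w(3) by simp
    have "up_ring.monom (UP D) (c [^] k) 0 \<otimes>\<^bsub>UP D\<^esub> h \<in> N"
      by (rule N.I_l_closed[OF h]) (simp add: ck(1))
    moreover have gw: "g \<otimes>\<^bsub>UP D\<^esub> w \<in> N" using N.I_r_closed g w(1) by blast
    moreover have "r \<oplus>\<^bsub>UP D\<^esub> (g \<otimes>\<^bsub>UP D\<^esub> w) = up_ring.monom (UP D) (c [^] k) 0 \<otimes>\<^bsub>UP D\<^esub> h"
      unfolding e using w gc by (simp add: U.P.a_comm)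
    ultimately have "r \<in> N" using N.add_in_iff[OF w(2) gw] by simp
    then have r0: "r = \<zero>\<^bsub>UP D\<^esub>" using w(4) gmin[of r] by linarith
    have "up_ring.monom (UP D) (c [^] k) 0 \<otimes>\<^bsub>UP D\<^esub> h = g \<otimes>\<^bsub>UP D\<^esub> w"
      unfolding e r0 using gc w(1) by simp
    then show ?thesis using w(1) by blast
  qed
  have dg: "deg D g > 0"
  proof (rule ccontr)
    assume "\<not> deg D g > 0"
    then have d: "deg D g = 0" by simp
    have "g = up_ring.monom (UP D) (up_ring.coeff (UP D) g 0) 0" using U.deg_zero_impl_monom[OF gc d] .
    then have "up_ring.monom (UP D) c 0 \<in> N" using g unfolding c_def d by metis
    then show False using N0[OF c(1)] c(2) by blast
  qed
  \<comment> \<open>Otherwise \<open>w\<close> lies in \<open>Q\<close>, because the product with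
    \<open>g\<close> does. Comparing degrees then makes \<open>w\<close> an element of
    \<open>Q\<close> of smaller degree than \<open>f\<close>, as \<open>g\<close> is not
    constant.\<close>
  have "g \<in> Q"
  proof (rule ccontr)
    assume gQ: "g \<notin> Q"
    obtain k w where w: "w \<in> carrier (UP D)" "up_ring.monom (UP D) (c [^] (k::nat)) 0 \<otimes>\<^bsub>UP D\<^esub> f = g \<otimes>\<^bsub>UP D\<^esub> w"
      using div[of f] f le by blast
    have "g \<otimes>\<^bsub>UP D\<^esub> w \<in> Q" unfolding w(2)[symmetric]
      by (rule Q.I_l_closed) (use f ck(1) in simp_all)
    then have wQ: "w \<in> Q" using Q.I_prime[OF gc w(1)] gQ by blast
    have sm: "up_ring.monom (UP D) (c [^] k) 0 \<otimes>\<^bsub>UP D\<^esub> f = c [^] k \<odot>\<^bsub>UP D\<^esub> f"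
      by (rule U.monom_mult_is_smult[OF ck(1) fc])
    have m0: "up_ring.monom (UP D) (c [^] k) 0 \<noteq> \<zero>\<^bsub>UP D\<^esub>"
    proof
      assume "up_ring.monom (UP D) (c [^] k) 0 = \<zero>\<^bsub>UP D\<^esub>"
      then have "up_ring.monom (UP D) (c [^] k) 0 \<in> N"
        using additive_subgroup.zero_closed[OF N.is_additive_subgroup] by simp
      then show False using mN by blast
    qed
    have w0: "w \<noteq> \<zero>\<^bsub>UP D\<^esub>"
    proof
      assume "w = \<zero>\<^bsub>UP D\<^esub>"
      then have "up_ring.monom (UP D) (c [^] k) 0 \<otimes>\<^bsub>UP D\<^esub> f = \<zero>\<^bsub>UP D\<^esub>" using w(2) gc by simp
      then show False using U.integral[of "up_ring.monom (UP D) (c [^] k) 0" f] m0 f fc ck(1) by simp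
    qed
    have "deg D f = deg D (c [^] k \<odot>\<^bsub>UP D\<^esub> f)" using U.deg_smult[OF ck(1) fc] ck(2) by simp
    also have "\<dots> = deg D (g \<otimes>\<^bsub>UP D\<^esub> w)" using w(2) sm by simp
    also have "\<dots> = deg D g + deg D w" using U.deg_mult[of g w] g w0 gc w(1) by blast
    finally show False using dg fmin[OF wQ w0] by linarith
  qed
  have "h \<in> Q" if h: "h \<in> N" for h
  proof -
    have hc: "h \<in> carrier (UP D)" using h by (rule N.Icarr)
    obtain k w where w: "w \<in> carrier (UP D)" "up_ring.monom (UP D) (c [^] (k::nat)) 0 \<otimes>\<^bsub>UP D\<^esub> h = g \<otimes>\<^bsub>UP D\<^esub> w"
      using div[OF h] by blast
    have "up_ring.monom (UP D) (c [^] k) 0 \<otimes>\<^bsub>UP D\<^esub> h \<in> Q"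
      unfolding w(2) by (rule Q.I_r_closed[OF \<open>g \<in> Q\<close> w(1)])
    moreover have "up_ring.monom (UP D) (c [^] k) 0 \<notin> Q" using mN le by blast
    ultimately show ?thesis using Q.I_prime[of "up_ring.monom (UP D) (c [^] k) 0" h] hc ck(1) by simp
  qed
  then show ?thesis using le by blast
qed

text \<open>Modulo \<open>rr\<close> the prime \<open>P1\<close> becomes nonzero, because it differs
  from the extension of \<open>rr\<close>, and \<open>P2\<close> meets the constants in zero; the
  case of a domain applies. So a chain of primes over \<open>rr\<close> has at most two members, and
  if it has two, the lower one is \<open>UP_ext R rr\<close>.\<close>

lemma UP_prime_eq:
  fixes R (structure)
  assumes R: "cring R" and r: "rr \<in> spec R" and P: "P1 \<in> spec (UP R)" "P2 \<in> spec (UP R)" "P1 \<subseteq> P2"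
    and c1: "\<And>a. a \<in> rr \<Longrightarrow> up_ring.monom (UP R) a 0 \<in> P1"
    and c2: "\<And>a. a \<in> carrier R \<Longrightarrow> up_ring.monom (UP R) a 0 \<in> P2 \<Longrightarrow> a \<in> rr"
    and ne: "P1 \<noteq> UP_ext R rr"
  shows "P1 = P2"
proof -
  interpret R: cring R by (rule R)
  interpret rr: primeideal rr R using r by (simp add: spec_iff)
  interpret P1: primeideal P1 "UP R" using P by (simp add: spec_iff)
  let ?D = "R Quot rr" and ?\<pi> = "(+>) rr"
  have D: "domain ?D" by (rule rr.quotient_is_domain)
  then interpret D: domain ?D .
  interpret h: ring_hom_cring R ?D ?\<pi> by (rule rr.rcos_ring_hom_cring)
  have Us: "carrier (UP ?D) \<subseteq> UP_map ?\<pi> ` carrier (UP R)" by (rule h.UP_map_surj[OF FactRing_surj])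
  have Uh: "ring_hom_cring (UP R) (UP ?D) (UP_map ?\<pi>)" by (rule h.UP_map_hom)
  have eU: "ess_surj (UP R) (UP ?D) (UP_map ?\<pi>)" by (rule surj_ess_surj[OF Uh Us])
  have le: "UP_ext R rr \<subseteq> P1"
    unfolding extended_ideal_eq[OF r, symmetric] extended_ideal_def
    by (rule ring.genideal_minimal[OF cring.axioms(1)[OF R.UP_is_cring] P1.is_ideal]) (use c1 in blast)
  have ker0: "UP_map ?\<pi> f = \<zero>\<^bsub>UP ?D\<^esub> \<longleftrightarrow> f \<in> UP_ext R rr" if f: "f \<in> carrier (UP R)" for f
  proof -
    have fc: "f n \<in> carrier R" for n using f by (simp add: UP_carrier)
    have "UP_map ?\<pi> f = \<zero>\<^bsub>UP ?D\<^esub> \<longleftrightarrow> (\<forall>n. ?\<pi> (f n) = \<zero>\<^bsub>?D\<^esub>)"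
      by (simp only: fun_eq_iff D.UP_zero_coeff UP_map_def)
    also have "\<dots> \<longleftrightarrow> (\<forall>n. f n \<in> rr)" using FactRing_zero_iff[OF rr.is_ideal fc] by simp
    finally show ?thesis using f unfolding UP_ext_def by blast
  qed
  have ker1: "f \<in> P1" if "f \<in> carrier (UP R)" "UP_map ?\<pi> f = \<zero>\<^bsub>UP ?D\<^esub>" for f
    using ker0[OF that(1)] that(2) le by blast
  have ker2: "f \<in> P2" if "f \<in> carrier (UP R)" "UP_map ?\<pi> f = \<zero>\<^bsub>UP ?D\<^esub>" for f
    using ker1[OF that] P(3) by blast
  obtain Q where Q: "Q \<in> spec (UP ?D)" "contract (UP R) (UP_map ?\<pi>) Q = P1"
    by (rule surj_lift[OF Uh Us P(1) ker1])
  obtain N where N: "N \<in> spec (UP ?D)" "contract (UP R) (UP_map ?\<pi>) N = P2"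
    by (rule surj_lift[OF Uh Us P(2) ker2])
  have "Q = N"
  proof (rule UP_domain_prime_eq[OF D Q(1) N(1)])
    show "Q \<subseteq> N" by (rule ess_contract_mono[OF eU Q(1) N(1)]) (simp only: Q(2) N(2) P(3))
    show "a = \<zero>\<^bsub>?D\<^esub>" if a: "a \<in> carrier ?D" "up_ring.monom (UP ?D) a 0 \<in> N" for a
    proof -
      obtain b where b: "b \<in> carrier R" "a = ?\<pi> b" using FactRing_surj a(1) by (metis imageE subsetD)
      interpret U: UP_cring R "UP R" by (simp add: UP_cring_intro R)
      have "UP_map ?\<pi> (up_ring.monom (UP R) b 0) = up_ring.monom (UP ?D) a 0"
        using b a(1) by (auto simp: fun_eq_iff UP_map_def R.UP_monom_coeff D.UP_monom_coeff)
      then have "up_ring.monom (UP R) b 0 \<in> contract (UP R) (UP_map ?\<pi>) N"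
        using a(2) U.monom_closed[OF b(1)] by simp
      then have "b \<in> rr" using c2[OF b(1)] unfolding N(2) by blast
      then show ?thesis using FactRing_zero_iff[OF rr.is_ideal b(1)] b(2) by simp
    qed
    show "Q \<noteq> {\<zero>\<^bsub>UP ?D\<^esub>}"
    proof
      assume "Q = {\<zero>\<^bsub>UP ?D\<^esub>}"
      then have "P1 = {f \<in> carrier (UP R). UP_map ?\<pi> f = \<zero>\<^bsub>UP ?D\<^esub>}" using Q(2) by (simp add: contract_def)
      also have "\<dots> = UP_ext R rr" using ker0 unfolding UP_ext_def by blast
      finally show False using ne by blast
    qed
  qed
  then show ?thesis using Q N by blast
qed

section \<open>Primes that agree on a subring, and the length of chains over a fixed
  contraction\<close>

context cring
begin

lemma sub_cring: "subring G R \<Longrightarrow> cring (R\<lparr>carrier := G\<rparr>)"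
  using subcringI' subcring_iff[of G] subringE(1) by blast

lemma sub_incl_hom: "subring G R \<Longrightarrow> ring_hom_cring (R\<lparr>carrier := G\<rparr>) R id"
  using subringE(1)[of G R] sub_cring[of G]
  by (auto simp: ring_hom_cring_def ring_hom_cring_axioms_def is_cring intro!: ring_hom_memI)

text \<open>The ring generated by \<open>G\<close> and \<open>x\<close> is an image of the
  polynomial ring over \<open>G\<close>, so that \<open>UP_prime_eq\<close> can be applied to it.
  The last clause evaluates explicit coefficient functions, the form in which algebraic relations
  are given.\<close>

lemma sub_eval:
  assumes G: "subring G R" and x: "x \<in> carrier R"
  obtains ev where "ring_hom_cring (UP (R\<lparr>carrier := G\<rparr>)) R ev"
    "\<And>a. a \<in> G \<Longrightarrow> ev (up_ring.monom (UP (R\<lparr>carrier := G\<rparr>)) a 0) = a"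
    "generate_ring R (insert x G) \<subseteq> ev ` carrier (UP (R\<lparr>carrier := G\<rparr>))"
    "\<And>m c. (\<And>j. j \<le> m \<Longrightarrow> c j \<in> G) \<Longrightarrow> (\<lambda>j. if j \<le> m then c j else \<zero>) \<in> carrier (UP (R\<lparr>carrier := G\<rparr>)) \<and>
       ev (\<lambda>j. if j \<le> m then c j else \<zero>) = (\<Oplus>j\<in>{..m::nat}. c j \<otimes> x [^] j)"
proof -
  let ?G = "R\<lparr>carrier := G\<rparr>"
  interpret G: cring ?G by (rule sub_cring[OF G])
  interpret i: ring_hom_cring ?G R id by (rule sub_incl_hom[OF G])
  interpret U: UP_cring ?G "UP ?G" by (simp add: UP_cring_intro G.is_cring)
  interpret E: UP_pre_univ_prop ?G R id "UP ?G"
    by (simp add: UP_pre_univ_prop_def i.ring_hom_cring_axioms U.UP_cring_axioms)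
  define ev where "ev = UnivPoly.eval ?G R id x"
  have GR: "G \<subseteq> carrier R" by (rule subringE(1)[OF G])
  have z: "\<zero> \<in> G" by (rule subringE(2)[OF G])
  have eh: "ev \<in> ring_hom (UP ?G) R" unfolding ev_def by (rule E.eval_ring_hom[OF x])
  then have hom: "ring_hom_cring (UP ?G) R ev"
    by (simp add: ring_hom_cring_def ring_hom_cring_axioms_def U.P.is_cring is_cring)
  then interpret ev: ring_hom_cring "UP ?G" R ev .
  have sum: "(\<lambda>j. if j \<le> m then c j else \<zero>) \<in> carrier (UP ?G) \<and>
       ev (\<lambda>j. if j \<le> m then c j else \<zero>) = (\<Oplus>j\<in>{..m}. c j \<otimes> x [^] j)"
    if c: "\<And>j. j \<le> m \<Longrightarrow> c j \<in> G" for m c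
  proof
    let ?f = "\<lambda>j. if j \<le> m then c j else \<zero>"
    show f: "?f \<in> carrier (UP ?G)" using c z by (auto simp: UP_carrier intro!: exI[of _ m])
    have d: "deg ?G ?f \<le> m" by (rule U.deg_aboveI[OF _ f]) (simp add: UP_coeff[OF f])
    have cf: "?f j \<in> carrier R" for j using c z GR by auto
    have "ev ?f = (\<Oplus>i\<in>{..deg ?G ?f}. ?f i \<otimes> x [^] i)"
      unfolding ev_def U.eval_on_carrier[OF f] using f by (simp add: UP_coeff)
    also have "\<dots> = (\<Oplus>i\<in>{..m}. ?f i \<otimes> x [^] i)"
    proof (rule add.finprod_mono_neutral_cong_left)
      fix i assume "i \<in> {..m} - {..deg ?G ?f}"
      then have "?f i = \<zero>" using U.deg_aboveD[of ?f i] f by (simp add: UP_coeff[OF f])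
      then show "?f i \<otimes> x [^] i = \<zero>" using x by simp
    qed (use d cf x in auto)
    also have "\<dots> = (\<Oplus>j\<in>{..m}. c j \<otimes> x [^] j)"
      by (rule finsum_cong') (use c GR x in auto)
    finally show "ev ?f = (\<Oplus>j\<in>{..m}. c j \<otimes> x [^] j)" .
  qed
  have const: "ev (up_ring.monom (UP ?G) a 0) = a" if "a \<in> G" for a
    unfolding ev_def using E.eval_const[OF x, of a] that by simp
  have "subring (ev ` carrier (UP ?G)) R" by (rule ev.ring.img_is_subring[OF U.P.carrier_is_subring])
  moreover have "G \<subseteq> ev ` carrier (UP ?G)"
  proof
    fix a assume a: "a \<in> G"
    have "up_ring.monom (UP ?G) a 0 \<in> carrier (UP ?G)" using a by simp
    then show "a \<in> ev ` carrier (UP ?G)" using const[OF a] by (metis imageI)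
  qed
  moreover have "x \<in> ev ` carrier (UP ?G)"
  proof -
    have "(\<Oplus>j\<in>{..1::nat}. (if j = 1 then \<one> else \<zero>) \<otimes> x [^] j) = x"
      using x by (simp add: Pi_def)
    moreover have "\<one> \<in> G" by (rule subringE(3)[OF G])
    ultimately show ?thesis using sum[of 1 "\<lambda>j. if j = 1 then \<one> else \<zero>"] z by (metis (no_types, lifting) imageI)
  qed
  ultimately have "generate_ring R (insert x G) \<subseteq> ev ` carrier (UP ?G)"
    by (intro generate_ring_min_subring1) auto
  then show thesis using that hom const sum by blast
qed

text \<open>Equality of contractions to \<open>G\<close>, in elementwise form, which also makes
  sense for a mere subset.\<close>

definition agree :: "'a set \<Rightarrow> 'a set \<Rightarrow> 'a set \<Rightarrow> bool"
  where "agree G P Q \<longleftrightarrow> (\<forall>x\<in>G. x \<in> P \<longleftrightarrow> x \<in> Q)"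

text \<open>Assumption \<open>ne\<close> says that \<open>x\<close> is algebraic over
  \<open>G\<close> modulo \<open>P\<close>. By \<open>UP_prime_eq\<close> the preimages of
  \<open>P\<close> and \<open>Q\<close> in the polynomial ring over \<open>G\<close> then coincide,
  and \<open>ev\<close> reaches every element of the larger ring.\<close>

lemma agree_contract:
  assumes G: "subring G R" and x: "x \<in> carrier R"
    and P: "P \<in> spec R" "Q \<in> spec R" "P \<subseteq> Q" and ag: "agree G P Q"
    and hom: "ring_hom_cring (UP (R\<lparr>carrier := G\<rparr>)) R ev"
    and const: "\<And>a. a \<in> G \<Longrightarrow> ev (up_ring.monom (UP (R\<lparr>carrier := G\<rparr>)) a 0) = a"
    and gen: "generate_ring R (insert x G) \<subseteq> ev ` carrier (UP (R\<lparr>carrier := G\<rparr>))"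
    and ne: "contract (UP (R\<lparr>carrier := G\<rparr>)) ev P \<noteq> UP_ext (R\<lparr>carrier := G\<rparr>) (G \<inter> P)"
  shows "agree (generate_ring R (insert x G)) P Q"
proof -
  let ?G = "R\<lparr>carrier := G\<rparr>"
  have c: "cring ?G" by (rule sub_cring[OF G])
  interpret U: UP_cring ?G "UP ?G" by (simp add: UP_cring_intro c)
  have "contract ?G id P \<in> spec ?G" by (rule contract_spec[OF sub_incl_hom[OF G] P(1)])
  moreover have "contract ?G id P = G \<inter> P" by auto
  ultimately have r: "G \<inter> P \<in> spec ?G" by simp
  have "contract (UP ?G) ev P = contract (UP ?G) ev Q"
  proof (rule UP_prime_eq[OF c r contract_spec[OF hom P(1)] contract_spec[OF hom P(2)] _ _ _ ne])
    show "contract (UP ?G) ev P \<subseteq> contract (UP ?G) ev Q" using P(3) by auto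
    show "up_ring.monom (UP ?G) a 0 \<in> contract (UP ?G) ev P" if "a \<in> G \<inter> P" for a
      using that const[of a] by simp
    show "a \<in> G \<inter> P" if "a \<in> carrier ?G" "up_ring.monom (UP ?G) a 0 \<in> contract (UP ?G) ev Q" for a
      using that const[of a] ag by (auto simp: agree_def)
  qed
  then have "ev f \<in> P \<longleftrightarrow> ev f \<in> Q" if "f \<in> carrier (UP ?G)" for f
    using that unfolding set_eq_iff contract_iff by blast
  then show ?thesis using gen unfolding agree_def by blast
qed

lemma agree_algebraic:
  assumes G: "subring G R" and x: "x \<in> carrier R"
    and P: "P \<in> spec R" "Q \<in> spec R" "P \<subseteq> Q" and ag: "agree G P Q"
    and c: "\<And>j. j \<le> m \<Longrightarrow> c j \<in> G" and cs: "(\<Oplus>j\<in>{..m::nat}. c j \<otimes> x [^] j) \<in> P" and nz: "\<exists>j\<le>m. c j \<notin> P"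
  shows "agree (generate_ring R (insert x G)) P Q"
proof -
  let ?G = "R\<lparr>carrier := G\<rparr>" and ?f = "\<lambda>j. if j \<le> m then c j else \<zero>"
  show ?thesis
  proof (rule sub_eval[OF G x])
    fix ev
    assume ev: "ring_hom_cring (UP ?G) R ev"
      "\<And>a. a \<in> G \<Longrightarrow> ev (up_ring.monom (UP ?G) a 0) = a"
      "generate_ring R (insert x G) \<subseteq> ev ` carrier (UP ?G)"
      "\<And>m c. (\<And>j. j \<le> m \<Longrightarrow> c j \<in> G) \<Longrightarrow> (\<lambda>j. if j \<le> m then c j else \<zero>) \<in> carrier (UP ?G) \<and>
       ev (\<lambda>j. if j \<le> m then c j else \<zero>) = (\<Oplus>j\<in>{..m::nat}. c j \<otimes> x [^] j)"
    show ?thesis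
    proof (rule agree_contract[OF G x P ag ev(1-3)])
      have "?f \<in> contract (UP ?G) ev P" using ev(4)[of m c, OF c] cs by simp
      moreover have "?f \<notin> UP_ext ?G (G \<inter> P)" using nz by (auto simp: UP_ext_def)
      ultimately show "contract (UP ?G) ev P \<noteq> UP_ext ?G (G \<inter> P)" by blast
    qed
  qed
qed

text \<open>If the preimages of \<open>P\<close> and \<open>Q\<close> are both the extension of the
  common contraction, they coincide. If one of them is not, it coincides with the preimage of the
  next prime by \<open>agree_contract\<close>.\<close>

lemma agree_three:
  assumes G: "subring G R" and x: "x \<in> carrier R"
    and P: "P \<in> spec R" "Q \<in> spec R" "N \<in> spec R" "P \<subseteq> Q" "Q \<subseteq> N" and ag: "agree G P N"
  shows "agree (generate_ring R (insert x G)) P Q \<or> agree (generate_ring R (insert x G)) Q N"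
proof -
  let ?G = "R\<lparr>carrier := G\<rparr>"
  have ag1: "agree G P Q" and ag2: "agree G Q N" using ag P(4,5) unfolding agree_def by blast+
  have GQ: "G \<inter> Q = G \<inter> P" using ag1 unfolding agree_def by blast
  show ?thesis
  proof (rule sub_eval[OF G x])
    fix ev
    assume ev: "ring_hom_cring (UP ?G) R ev"
      "\<And>a. a \<in> G \<Longrightarrow> ev (up_ring.monom (UP ?G) a 0) = a"
      "generate_ring R (insert x G) \<subseteq> ev ` carrier (UP ?G)"
    have c: "cring ?G" by (rule sub_cring[OF G])
    interpret ev: ring_hom_cring "UP ?G" R ev by (rule ev(1))
    show ?thesis
    proof (cases "contract (UP ?G) ev P = UP_ext ?G (G \<inter> P)")
      case False
      then show ?thesis using agree_contract[OF G x P(1,2,4) ag1 ev(1-3)] by blast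
    next
      case True
      show ?thesis
      proof (cases "contract (UP ?G) ev Q = UP_ext ?G (G \<inter> Q)")
        case False
        then show ?thesis using agree_contract[OF G x P(2,3,5) ag2 ev(1-3)] by blast
      next
        case T2: True
        then have "contract (UP ?G) ev P = contract (UP ?G) ev Q" using True GQ by simp
        then have "ev f \<in> P \<longleftrightarrow> ev f \<in> Q" if "f \<in> carrier (UP ?G)" for f
          using that unfolding set_eq_iff contract_iff by blast
        then show ?thesis using ev(3) unfolding agree_def by blast
      qed
    qed
  qed
qed

lemma generate_ring_finite:
  assumes "y \<in> generate_ring R (G \<union> Z)" "G \<subseteq> carrier R" "Z \<subseteq> carrier R"
  shows "\<exists>Y. finite Y \<and> Y \<subseteq> Z \<and> y \<in> generate_ring R (G \<union> Y)"
  using assms(1)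
proof induct
  case one then show ?case using generate_ring.one by (intro exI[of _ "{}"]) auto
next
  case (incl h) then show ?case by (intro exI[of _ "{h} \<inter> Z"]) (auto intro: generate_ring.incl)
next
  case (a_inv h) then show ?case using generate_ring.a_inv by metis
next
  case (eng_add h1 h2)
  then obtain Y1 Y2 where Y: "finite Y1" "Y1 \<subseteq> Z" "h1 \<in> generate_ring R (G \<union> Y1)" "finite Y2" "Y2 \<subseteq> Z" "h2 \<in> generate_ring R (G \<union> Y2)" by blast
  have m: "generate_ring R (G \<union> Y1) \<subseteq> generate_ring R (G \<union> (Y1 \<union> Y2))" "generate_ring R (G \<union> Y2) \<subseteq> generate_ring R (G \<union> (Y1 \<union> Y2))"
    by (rule mono_generate_ring, use Y assms in blast, use Y assms in blast)+
  then have "h1 \<oplus> h2 \<in> generate_ring R (G \<union> (Y1 \<union> Y2))" using Y by (intro generate_ring.eng_add) auto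
  then show ?case using Y by (intro exI[of _ "Y1 \<union> Y2"]) auto
next
  case (eng_mult h1 h2)
  then obtain Y1 Y2 where Y: "finite Y1" "Y1 \<subseteq> Z" "h1 \<in> generate_ring R (G \<union> Y1)" "finite Y2" "Y2 \<subseteq> Z" "h2 \<in> generate_ring R (G \<union> Y2)" by blast
  have m: "generate_ring R (G \<union> Y1) \<subseteq> generate_ring R (G \<union> (Y1 \<union> Y2))" "generate_ring R (G \<union> Y2) \<subseteq> generate_ring R (G \<union> (Y1 \<union> Y2))"
    by (rule mono_generate_ring, use Y assms in blast, use Y assms in blast)+
  then have "h1 \<otimes> h2 \<in> generate_ring R (G \<union> (Y1 \<union> Y2))" using Y by (intro generate_ring.eng_mult) auto
  then show ?case using Y by (intro exI[of _ "Y1 \<union> Y2"]) auto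
qed

lemma generate_ring_insert:
  assumes "G \<subseteq> carrier R" "x \<in> carrier R"
  shows "generate_ring R (insert x G) \<subseteq> generate_ring R (insert x (generate_ring R G))"
  using assms generate_ring_in_carrier[OF assms(1)] generate_ring.incl[of _ G R]
  by (intro mono_generate_ring) blast+

lemma agree_subset: "agree G P Q \<Longrightarrow> G' \<subseteq> G \<Longrightarrow> agree G' P Q"
  unfolding agree_def by blast

text \<open>Each element of the generated ring involves only finitely many members of
  \<open>Z\<close>, and these are adjoined one at a time. The relations have coefficients in
  \<open>G\<close>, so they remain valid over every intermediate ring.\<close>

lemma agree_generated:
  assumes G: "subring G R" and Z: "Z \<subseteq> carrier R"
    and P: "P \<in> spec R" "Q \<in> spec R" "P \<subseteq> Q" and ag: "agree G P Q"
    and alg: "\<And>z. z \<in> Z \<Longrightarrow> \<exists>m c. (\<forall>j\<le>m. c j \<in> G) \<and> (\<Oplus>j\<in>{..m::nat}. c j \<otimes> z [^] j) \<in> P \<and> (\<exists>j\<le>m. c j \<notin> P)"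
  shows "agree (generate_ring R (G \<union> Z)) P Q"
proof -
  have GR: "G \<subseteq> carrier R" by (rule subringE(1)[OF G])
  have fin: "agree (generate_ring R (G \<union> Y)) P Q" if "finite Y" "Y \<subseteq> Z" for Y
    using that
  proof (induct Y)
    case empty
    have "generate_ring R (G \<union> {}) \<subseteq> G" using generate_ring_min_subring1[OF GR G] by simp
    then show ?case using agree_subset[OF ag] by blast
  next
    case (insert y Y)
    let ?H = "generate_ring R (G \<union> Y)"
    have GY: "G \<union> Y \<subseteq> carrier R" using GR Z insert by blast
    have H: "subring ?H R" by (rule generate_ring_is_subring[OF GY])
    have y: "y \<in> carrier R" "y \<in> Z" using Z insert by blast+
    obtain m c where c: "\<forall>j\<le>m. c j \<in> G" "(\<Oplus>j\<in>{..m::nat}. c j \<otimes> y [^] j) \<in> P" "\<exists>j\<le>m. c j \<notin> P" using alg[OF y(2)] by blast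
    have "agree (generate_ring R (insert y ?H)) P Q"
    proof (rule agree_algebraic[OF H y(1) P _ _ c(2,3)])
      show "agree ?H P Q" using insert by blast
      show "c j \<in> ?H" if "j \<le> m" for j using c(1) that by (intro generate_ring.incl) blast
    qed
    moreover have "generate_ring R (G \<union> insert y Y) \<subseteq> generate_ring R (insert y ?H)"
      using generate_ring_insert[OF GY y(1)] by simp
    ultimately show ?case using agree_subset by blast
  qed
  show ?thesis unfolding agree_def
  proof
    fix y assume "y \<in> generate_ring R (G \<union> Z)"
    then obtain Y where "finite Y" "Y \<subseteq> Z" "y \<in> generate_ring R (G \<union> Y)" using generate_ring_finite[OF _ GR Z] by blast
    then show "y \<in> P \<longleftrightarrow> y \<in> Q" using fin unfolding agree_def by blast
  qed
qed

text \<open>In \<open>G[x]\<close> at most two primes of a chain share their contraction to \<open>G\<close>,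
  so every second prime survives the removal of a generator.\<close>

definition sep_chain :: "'a set \<Rightarrow> nat \<Rightarrow> (nat \<Rightarrow> 'a set) \<Rightarrow> bool"
  where "sep_chain G l e \<longleftrightarrow> (\<forall>i\<le>l. e i \<in> spec R) \<and> (\<forall>i<l. e i \<subseteq> e (Suc i) \<and> \<not> agree G (e i) (e (Suc i)))"

lemma sep_chain_halve:
  assumes G: "subring G R" and x: "x \<in> carrier R" and s: "sep_chain (generate_ring R (insert x G)) l e"
  shows "sep_chain G (l div 2) (\<lambda>i. e (2 * i))"
  unfolding sep_chain_def
proof (intro conjI allI impI)
  show "e (2 * i) \<in> spec R" if "i \<le> l div 2" for i using s that by (simp add: sep_chain_def)
  fix i assume i: "i < l div 2"
  then have l: "2 * i < l" "Suc (2 * i) < l" by linarith+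
  have sp: "e (2 * i) \<in> spec R" "e (Suc (2 * i)) \<in> spec R" "e (Suc (Suc (2 * i))) \<in> spec R"
    using s l by (simp_all add: sep_chain_def)
  have le: "e (2 * i) \<subseteq> e (Suc (2 * i))" "e (Suc (2 * i)) \<subseteq> e (Suc (Suc (2 * i)))"
    using s l by (simp_all add: sep_chain_def)
  then show "e (2 * i) \<subseteq> e (2 * Suc i)" by simp
  show "\<not> agree G (e (2 * i)) (e (2 * Suc i))"
    using agree_three[OF G x sp le] s l by (auto simp: sep_chain_def)
qed

lemma sep_chain_generators:
  assumes "finite V" "V \<subseteq> carrier R" "R0 \<subseteq> carrier R" "sep_chain (generate_ring R (R0 \<union> V)) l e"
  shows "sep_chain (generate_ring R R0) (l div 2 ^ card V) (\<lambda>i. e (2 ^ card V * i))"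
  using assms(1,2,4)
proof (induct V arbitrary: l e)
  case empty then show ?case by simp
next
  case (insert x V)
  have GX: "R0 \<union> V \<subseteq> carrier R" using insert assms(3) by blast
  have x: "x \<in> carrier R" using insert by blast
  have "sep_chain (generate_ring R (insert x (generate_ring R (R0 \<union> V)))) l e"
    using insert(5) generate_ring_insert[OF GX x] agree_subset unfolding sep_chain_def Un_insert_right by metis
  then have "sep_chain (generate_ring R (R0 \<union> V)) (l div 2) (\<lambda>i. e (2 * i))"
    by (rule sep_chain_halve[OF generate_ring_is_subring[OF GX] x])
  from insert(3)[OF _ this] have "sep_chain (generate_ring R R0) (l div 2 div 2 ^ card V) (\<lambda>i. e (2 * (2 ^ card V * i)))"
    using insert(4) by blast
  then show ?case using insert(1,2) by (simp add: div_mult2_eq mult.assoc)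
qed

text \<open>A relation that lies in \<open>e 0\<close> and has a coefficient outside
  \<open>e l\<close> is nontrivial modulo every member of the chain. By
  \<open>agree_generated\<close> consecutive primes therefore differ already on the ring generated
  by \<open>R0\<close> and \<open>V\<close>. If \<open>l\<close> were at least
  \<open>2 ^ card V\<close>, halving once for each element of \<open>V\<close> would leave a step
  that is separated on the ring generated by \<open>R0\<close>, against \<open>ag\<close>.\<close>

lemma fibre_chain_bound:
  assumes V: "finite V" "V \<subseteq> carrier R" and R0: "R0 \<subseteq> carrier R" and Z: "Z \<subseteq> carrier R"
    and gen: "carrier R \<subseteq> generate_ring R (generate_ring R (R0 \<union> V) \<union> Z)"
    and e: "prime_chain R l e"
    and ag: "\<And>i. i \<le> l \<Longrightarrow> agree (generate_ring R R0) (e 0) (e i)"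
    and alg: "\<And>z. z \<in> Z \<Longrightarrow> \<exists>m c. (\<forall>j\<le>m. c j \<in> generate_ring R (R0 \<union> V)) \<and>
       (\<Oplus>j\<in>{..m::nat}. c j \<otimes> z [^] j) \<in> e 0 \<and> (\<exists>j\<le>m. c j \<notin> e l)"
  shows "l < 2 ^ card V"
proof -
  let ?G = "generate_ring R (R0 \<union> V)"
  have G: "subring ?G R" using V R0 by (intro generate_ring_is_subring) blast
  have "\<not> agree ?G (e i) (e (Suc i))" if i: "i < l" for i
  proof
    assume a: "agree ?G (e i) (e (Suc i))"
    have sp: "e i \<in> spec R" "e (Suc i) \<in> spec R" using e i by (auto simp: prime_chain_def)
    have lt: "e i \<subset> e (Suc i)" using e i by (simp add: prime_chain_def)
    have e0: "e 0 \<subseteq> e i" "e i \<subseteq> e l" using prime_chain_mono[OF e] i by simp_all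
    have "agree (generate_ring R (?G \<union> Z)) (e i) (e (Suc i))"
    proof (rule agree_generated[OF G Z sp psubset_imp_subset[OF lt] a])
      fix z assume "z \<in> Z"
      then obtain m c where "\<forall>j\<le>m. c j \<in> ?G" "(\<Oplus>j\<in>{..m::nat}. c j \<otimes> z [^] j) \<in> e 0" "\<exists>j\<le>m. c j \<notin> e l"
        using alg by blast
      then show "\<exists>m c. (\<forall>j\<le>m. c j \<in> ?G) \<and> (\<Oplus>j\<in>{..m::nat}. c j \<otimes> z [^] j) \<in> e i \<and> (\<exists>j\<le>m. c j \<notin> e i)"
        using e0 by blast
    qed
    then have "agree (carrier R) (e i) (e (Suc i))" using agree_subset gen by blast
    moreover have "e (Suc i) \<subseteq> carrier R"
    proof -
      interpret p: primeideal "e (Suc i)" R using sp by (simp add: spec_iff)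
      show ?thesis using p.Icarr by blast
    qed
    ultimately show False using lt unfolding agree_def by blast
  qed
  then have "sep_chain ?G l e" using e unfolding sep_chain_def prime_chain_def by blast
  then have f: "sep_chain (generate_ring R R0) (l div 2 ^ card V) (\<lambda>i. e (2 ^ card V * i))"
    by (rule sep_chain_generators[OF V R0])
  have "l div 2 ^ card V = 0"
  proof (rule ccontr)
    assume p: "l div 2 ^ card V \<noteq> 0"
    then have "\<not> agree (generate_ring R R0) (e 0) (e (2 ^ card V))" using f by (auto simp: sep_chain_def)
    moreover have "2 ^ card V \<le> l" using p by (metis div_less not_le)
    ultimately show False using ag by blast
  qed
  then show ?thesis by (simp add: div_eq_0_iff)
qed

end

section \<open>Transcendence bases\<close>

text \<open>For a prime \<open>P\<close> this means that the class of \<open>x\<close> modulo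
  \<open>P\<close> is algebraic over the image of \<open>G\<close>; for \<open>P = {\<zero>}\<close>
  it is algebraicity itself. Any coefficient outside \<open>P\<close> may witness nontriviality, not
  just the leading one, so relations survive reduction and lifting without renormalization.\<close>

definition alg_rel :: "('a, 'm) ring_scheme \<Rightarrow> 'a set \<Rightarrow> 'a set \<Rightarrow> 'a \<Rightarrow> bool"
  where "alg_rel R G P x \<longleftrightarrow> (\<exists>m c. (\<forall>j\<le>m. c j \<in> G) \<and>
    (\<Oplus>\<^bsub>R\<^esub>j\<in>{..m::nat}. c j \<otimes>\<^bsub>R\<^esub> x [^]\<^bsub>R\<^esub> j) \<in> P \<and> (\<exists>j\<le>m. c j \<notin> P))"

lemma (in ring) eval_map_upt:
  assumes "x \<in> carrier R" "\<And>j. j < n \<Longrightarrow> c j \<in> carrier R"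
  shows "eval (map c (rev [0..<n])) x = (\<Oplus>j\<in>{..<n}. c j \<otimes> x [^] j)"
  using assms(2)
proof (induct n)
  case (Suc n)
  have "eval (map c (rev [0..<Suc n])) x = c n \<otimes> x [^] n \<oplus> (\<Oplus>j\<in>{..<n}. c j \<otimes> x [^] j)"
    using Suc by simp
  also have "\<dots> = (\<Oplus>j\<in>insert n {..<n}. c j \<otimes> x [^] j)"
    using Suc assms(1) by (subst finsum_insert) auto
  also have "insert n {..<n} = {..<Suc n}" by auto
  finally show ?case .
qed simp

lemma (in ring) normalize_Nil_iff: "normalize p = [] \<longleftrightarrow> set p \<subseteq> {\<zero>}"
  by (induct p) auto

lemma (in domain) algebraic_iff_alg_rel:
  assumes E: "subring E R" and x: "x \<in> carrier R"
  shows "(algebraic over E) x \<longleftrightarrow> alg_rel R E {\<zero>} x"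
proof
  have ER: "E \<subseteq> carrier R" by (rule subringE(1)[OF E])
  {
    assume "(algebraic over E) x"
    then obtain p where p: "p \<in> carrier (E[X])" "p \<noteq> []" "eval p x = \<zero>" using algebraicE[OF E x] by blast
    have pp: "polynomial E p" using p(1) by (simp add: univ_poly_def)
    then have pE: "set p \<subseteq> E" and l: "hd p \<noteq> \<zero>" using p(2) by (auto simp: polynomial_def)
    obtain m where m: "length p = Suc m" using p(2) by (cases p) auto
    have c: "coeff p j \<in> E" if "j \<le> m" for j
      using coeff_img_restrict[of p] pE m that by (metis imageI le_imp_less_Suc lessThan_iff subsetD)
    have "coeff p m \<noteq> \<zero>" using lead_coeff_simp[OF p(2)] l m by simp
    moreover have "(\<Oplus>j\<in>{..m}. coeff p j \<otimes> x [^] j) = \<zero>"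
    proof -
      have "eval (map (coeff p) (rev [0..<Suc m])) x = (\<Oplus>j\<in>{..<Suc m}. coeff p j \<otimes> x [^] j)"
        by (rule eval_map_upt[OF x]) (use c ER in \<open>auto simp: less_Suc_eq_le\<close>)
      then show ?thesis using p(3) unfolding m[symmetric] coeff_list by (simp add: m lessThan_Suc_atMost)
    qed
    ultimately show "alg_rel R E {\<zero>} x" unfolding alg_rel_def using c by blast
  }
  assume "alg_rel R E {\<zero>} x"
  then obtain m c where c: "\<forall>j\<le>m. c j \<in> E" "(\<Oplus>j\<in>{..m::nat}. c j \<otimes> x [^] j) = \<zero>" "\<exists>j\<le>m. c j \<noteq> \<zero>"
    unfolding alg_rel_def by blast
  let ?p = "map c (rev [0..<Suc m])"
  have sp: "set ?p \<subseteq> E" using c(1) by auto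
  have "eval ?p x = \<zero>" using eval_map_upt[OF x, of "Suc m" c] c(1,2) ER by (auto simp: less_Suc_eq_le lessThan_Suc_atMost)
  then have "eval (normalize ?p) x = \<zero>" using eval_normalize[of ?p x] sp ER x by auto
  moreover have "normalize ?p \<in> carrier (E[X])" using normalize_gives_polynomial[OF sp] by (simp add: univ_poly_def)
  moreover have "normalize ?p \<noteq> []" using c(3) unfolding normalize_Nil_iff by (auto simp: image_subset_iff less_Suc_eq_le simp del: upt_Suc)
  ultimately show "(algebraic over E) x" by (intro algebraicI[of "normalize ?p"])
qed

text \<open>Fractions with numerator and denominator in \<open>T\<close> are closed under all field
  operations. The members of \<open>H\<close> are only assumed to be such fractions, which allows
  \<open>H\<close> to be a transcendence basis of a quotient field while \<open>T\<close> comes from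
  the domain.\<close>

lemma (in field) generate_field_frac:
  assumes T: "subring T R" and H: "\<And>h. h \<in> H \<Longrightarrow> h \<in> carrier R \<and> (\<exists>u\<in>T. \<exists>v\<in>T. v \<noteq> \<zero> \<and> v \<otimes> h = u)"
    and x: "x \<in> generate_field R H"
  shows "x \<in> carrier R \<and> (\<exists>u\<in>T. \<exists>v\<in>T. v \<noteq> \<zero> \<and> v \<otimes> x = u)"
  using x
proof induct
  note TR = subringE(1)[OF T] and T0 = subringE(2)[OF T] and T1 = subringE(3)[OF T] and Tn = subringE(5)[OF T]
    and Tm = subringE(6)[OF T] and Ta = subringE(7)[OF T]
  {
    case one show ?case using T1 by (auto intro!: bexI[of _ \<one>])
  next
    case (incl h) then show ?case by (rule H)
  next
    case (a_inv h)
    then obtain u v where uv: "u \<in> T" "v \<in> T" "v \<noteq> \<zero>" "v \<otimes> h = u" "h \<in> carrier R" by blast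
    have "v \<otimes> (\<ominus> h) = \<ominus> u" using uv TR by (auto simp: r_minus)
    then show ?case using uv Tn by (metis add.inv_closed)
  next
    case (m_inv h)
    then obtain u v where uv: "u \<in> T" "v \<in> T" "v \<noteq> \<zero>" "v \<otimes> h = u" "h \<in> carrier R" by blast
    have vc: "v \<in> carrier R" using uv TR by blast
    have hU: "h \<in> Units R" using m_inv(3) uv(5) by (simp add: field_Units)
    have "u \<noteq> \<zero>" using uv vc m_inv(3) integral by blast
    moreover have "u \<otimes> inv h = v"
    proof -
      have "u \<otimes> inv h = v \<otimes> (h \<otimes> inv h)" unfolding uv(4)[symmetric] using vc uv(5) hU by (simp add: m_assoc)
      then show ?thesis using hU vc by simp
    qed
    ultimately show ?case using uv hU by blast
  next
    case (eng_add h1 h2)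
    then obtain u1 v1 where 1: "u1 \<in> T" "v1 \<in> T" "v1 \<noteq> \<zero>" "v1 \<otimes> h1 = u1" "h1 \<in> carrier R" by blast
    from eng_add obtain u2 v2 where 2: "u2 \<in> T" "v2 \<in> T" "v2 \<noteq> \<zero>" "v2 \<otimes> h2 = u2" "h2 \<in> carrier R" by blast
    have c: "v1 \<in> carrier R" "v2 \<in> carrier R" using 1 2 TR by blast+
    have "(v1 \<otimes> v2) \<otimes> (h1 \<oplus> h2) = v2 \<otimes> u1 \<oplus> v1 \<otimes> u2"
      unfolding 1(4)[symmetric] 2(4)[symmetric] using c 1(5) 2(5) by (simp add: r_distr m_ac)
    moreover have "v1 \<otimes> v2 \<noteq> \<zero>" using c 1(3) 2(3) integral by blast
    moreover have "v2 \<otimes> u1 \<oplus> v1 \<otimes> u2 \<in> T" "v1 \<otimes> v2 \<in> T" using 1 2 Ta Tm by blast+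
    ultimately show ?case using 1(5) 2(5) by blast
  next
    case (eng_mult h1 h2)
    then obtain u1 v1 where 1: "u1 \<in> T" "v1 \<in> T" "v1 \<noteq> \<zero>" "v1 \<otimes> h1 = u1" "h1 \<in> carrier R" by blast
    from eng_mult obtain u2 v2 where 2: "u2 \<in> T" "v2 \<in> T" "v2 \<noteq> \<zero>" "v2 \<otimes> h2 = u2" "h2 \<in> carrier R" by blast
    have c: "v1 \<in> carrier R" "v2 \<in> carrier R" using 1 2 TR by blast+
    have "(v1 \<otimes> v2) \<otimes> (h1 \<otimes> h2) = u1 \<otimes> u2"
      unfolding 1(4)[symmetric] 2(4)[symmetric] using c 1(5) 2(5) by (simp add: m_ac)
    moreover have "v1 \<otimes> v2 \<noteq> \<zero>" using c 1(3) 2(3) integral by blast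
    moreover have "u1 \<otimes> u2 \<in> T" "v1 \<otimes> v2 \<in> T" using 1 2 Tm by blast+
    ultimately show ?case using 1(5) 2(5) by blast
  }
qed

text \<open>The finitely many coefficients of a relation over the generated field have a common
  denominator in \<open>T\<close>, and multiplying by it moves all of them into
  \<open>T\<close>.\<close>

lemma (in field) generate_field_alg_rel:
  assumes T: "subring T R" and H: "\<And>h. h \<in> H \<Longrightarrow> h \<in> carrier R \<and> (\<exists>u\<in>T. \<exists>v\<in>T. v \<noteq> \<zero> \<and> v \<otimes> h = u)"
    and x: "x \<in> carrier R" and alg: "(algebraic over generate_field R H) x"
  shows "alg_rel R T {\<zero>} x"
proof -
  note TR = subringE(1)[OF T] and Tm = subringE(6)[OF T]
  have HR: "H \<subseteq> carrier R" using H by blast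
  have "subring (generate_field R H) R" by (rule subfieldE(1)[OF generate_field_is_subfield[OF HR]])
  then obtain m c where c: "\<forall>j\<le>m. c j \<in> generate_field R H" "(\<Oplus>j\<in>{..m::nat}. c j \<otimes> x [^] j) = \<zero>" "\<exists>j\<le>m. c j \<noteq> \<zero>"
    using alg algebraic_iff_alg_rel[OF _ x] unfolding alg_rel_def by blast
  have cf: "c j \<in> carrier R \<and> (\<exists>u\<in>T. \<exists>v\<in>T. v \<noteq> \<zero> \<and> v \<otimes> c j = u)" if "j \<le> m" for j
    using generate_field_frac[OF T H] c(1) that by blast
  have "n \<le> m \<Longrightarrow> \<exists>v\<in>T. v \<noteq> \<zero> \<and> (\<forall>j\<le>n. v \<otimes> c j \<in> T)" for n
  proof (induct n)
    case 0 then show ?case using cf[of 0] by auto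
  next
    case (Suc n)
    then obtain v where v: "v \<in> T" "v \<noteq> \<zero>" "\<forall>j\<le>n. v \<otimes> c j \<in> T" by auto
    obtain w where w: "w \<in> T" "w \<noteq> \<zero>" "w \<otimes> c (Suc n) \<in> T" using cf[OF Suc(2)] by blast
    have vw: "v \<in> carrier R" "w \<in> carrier R" using v w TR by blast+
    have "(v \<otimes> w) \<otimes> c j \<in> T" if j: "j \<le> Suc n" for j
    proof (cases "j = Suc n")
      case True
      have "(v \<otimes> w) \<otimes> c j = v \<otimes> (w \<otimes> c (Suc n))" using vw cf[OF Suc(2)] True by (simp add: m_assoc)
      then show ?thesis using Tm v(1) w(3) by simp
    next
      case False
      then have jn: "j \<le> n" using j by simp
      have "(v \<otimes> w) \<otimes> c j = w \<otimes> (v \<otimes> c j)" using vw cf[of j] jn Suc(2) by (simp add: m_ac)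
      then show ?thesis using Tm w(1) v(3) jn by simp
    qed
    moreover have "v \<otimes> w \<noteq> \<zero>" using vw v(2) w(2) integral by blast
    moreover have "v \<otimes> w \<in> T" using Tm v(1) w(1) by blast
    ultimately show ?case by blast
  qed
  then obtain v where v: "v \<in> T" "v \<noteq> \<zero>" "\<forall>j\<le>m. v \<otimes> c j \<in> T" by blast
  have vc: "v \<in> carrier R" using v TR by blast
  have cc: "c j \<in> carrier R" if "j \<le> m" for j using cf that by blast
  have "(\<Oplus>j\<in>{..m}. (v \<otimes> c j) \<otimes> x [^] j) = (\<Oplus>j\<in>{..m}. v \<otimes> (c j \<otimes> x [^] j))"
    by (rule finsum_cong') (use vc cc x in \<open>auto simp: m_assoc\<close>)
  also have "\<dots> = v \<otimes> (\<Oplus>j\<in>{..m}. c j \<otimes> x [^] j)"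
    by (rule finsum_rdistr[symmetric]) (use vc cc x in auto)
  also have "\<dots> = \<zero>" using c(2) vc by simp
  finally have "(\<Oplus>j\<in>{..m}. (v \<otimes> c j) \<otimes> x [^] j) \<in> {\<zero>}" by blast
  moreover have "\<exists>j\<le>m. v \<otimes> c j \<notin> {\<zero>}"
  proof -
    obtain j where "j \<le> m" "c j \<noteq> \<zero>" using c(3) by blast
    then show ?thesis using integral[of v "c j"] vc cc v(2) by blast
  qed
  ultimately show ?thesis unfolding alg_rel_def using v(3) by (intro exI[of _ m] exI[of _ "\<lambda>j. v \<otimes> c j"]) blast
qed

section \<open>Algebraic independence and existence of transcendence bases\<close>

lemma mpoly_value_eq_eval: "mpoly_value L P = mp_eval L L id id P"
  by (simp add: mpoly_value_def mp_eval_def monomial_value_def mp_mon_def)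

context cring
begin

lemma id_hom: "ring_hom_cring R R id"
  by (simp add: ring_hom_cring_def ring_hom_cring_axioms_def is_cring)

lemma pset_MP: "F \<subseteq> carrier R \<Longrightarrow> P \<in> indexed_pset I F \<Longrightarrow> P \<in> carrier (MP R I)"
proof -
  assume F: "F \<subseteq> carrier R" and P: "P \<in> indexed_pset I F"
  from P have "P \<in> pset I" by induct (use F in \<open>auto intro: indexed_pset.intros\<close>)
  then show ?thesis by (simp add: MP_simps)
qed

lemma value_const: "c \<in> carrier R \<Longrightarrow> mpoly_value R (indexed_const c) = c"
  unfolding mpoly_value_eq_eval using ring_hom_cring.mp_eval_const[OF id_hom, of c id] by simp

lemma value_padd:
  assumes "F \<subseteq> carrier R" "B \<subseteq> carrier R" "P \<in> indexed_pset B F" "Q \<in> indexed_pset B F"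
  shows "mpoly_value R (indexed_padd P Q) = mpoly_value R P \<oplus> mpoly_value R Q"
  unfolding mpoly_value_eq_eval
  using ring_hom_cring.mp_eval_add[OF id_hom pset_MP[OF assms(1,3)] pset_MP[OF assms(1,4)], of id] assms(2)
  by (auto simp: MP_simps(4))

lemma value_pmult:
  assumes "F \<subseteq> carrier R" "B \<subseteq> carrier R" "P \<in> indexed_pset B F" "b \<in> B"
  shows "mpoly_value R (indexed_pmult P b) = mpoly_value R P \<otimes> b"
  unfolding mpoly_value_eq_eval
  using ring_hom_cring.mp_eval_pmult[OF id_hom pset_MP[OF assms(1,3)] assms(4), of id] assms(2) by auto

lemma value_generate:
  assumes F: "F \<subseteq> carrier R" and B: "B \<subseteq> carrier R" and P: "P \<in> indexed_pset B F"
  shows "mpoly_value R P \<in> generate_ring R (F \<union> B)"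
  using P
proof induct
  case (indexed_const k)
  then have "k \<in> carrier R" using F by blast
  then show ?case using indexed_const by (simp add: value_const generate_ring.incl)
next
  case (indexed_padd P Q)
  then show ?case by (simp only: value_padd[OF F B] generate_ring.eng_add)
next
  case (indexed_pmult P i)
  then show ?case using generate_ring.eng_mult[OF indexed_pmult(2) generate_ring.incl[of i]] by (simp only: value_pmult[OF F B]) blast
qed

text \<open>The coefficient of the \<open>j\<close>-th power of \<open>x\<close> in
  \<open>P\<close>, as a polynomial in the remaining variables; monomials still containing
  \<open>x\<close> are given the coefficient zero.\<close>

definition slice :: "'a \<Rightarrow> nat \<Rightarrow> ('a multiset \<Rightarrow> 'a) \<Rightarrow> 'a multiset \<Rightarrow> 'a"
  where "slice x j P = (\<lambda>m. if x \<in># m then \<zero> else P (m + replicate_mset j x))"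

lemma slice_const: "slice x j (indexed_const k) = (if j = 0 then indexed_const k else indexed_const \<zero>)"
  by (auto simp: slice_def indexed_const_def fun_eq_iff)

lemma slice_padd: "slice x j (indexed_padd P Q) = indexed_padd (slice x j P) (slice x j Q)"
  by (auto simp: slice_def indexed_padd_def fun_eq_iff)

lemma slice_pmult_other: "i \<noteq> x \<Longrightarrow> slice x j (indexed_pmult P i) = indexed_pmult (slice x j P) i"
proof
  fix m assume i: "i \<noteq> x"
  show "slice x j (indexed_pmult P i) m = indexed_pmult (slice x j P) i m"
  proof (cases "x \<in># m")
    case True
    then have "x \<in># m - {#i#}" using i by (metis in_diff_count count_single diff_zero count_greater_zero_iff)
    then show ?thesis using True by (simp add: slice_def indexed_pmult_def)
  next
    case False
    then have "x \<notin># m - {#i#}" by (meson in_diffD)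
    moreover have "i \<in># m \<Longrightarrow> m + replicate_mset j x - {#i#} = m - {#i#} + replicate_mset j x"
      by (simp add: multiset_eq_iff)
    ultimately show ?thesis using False i by (auto simp: slice_def indexed_pmult_def)
  qed
qed

lemma slice_pmult_0: "slice x 0 (indexed_pmult P x) = indexed_const \<zero>"
  by (auto simp: slice_def indexed_pmult_def indexed_const_def fun_eq_iff)

lemma slice_pmult_Suc: "slice x (Suc j) (indexed_pmult P x) = slice x j P"
  by (auto simp: slice_def indexed_pmult_def fun_eq_iff)

lemma slice_pset:
  assumes F: "\<zero> \<in> F" and P: "P \<in> indexed_pset (insert x B) F"
  shows "slice x j P \<in> indexed_pset B F"
  using P
proof (induct arbitrary: j)
  case (indexed_const k) then show ?case using F by (simp add: slice_const indexed_pset.indexed_const)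
next
  case (indexed_padd P Q) then show ?case by (simp add: slice_padd indexed_pset.indexed_padd)
next
  case (indexed_pmult P i)
  show ?case
  proof (cases "i = x")
    case True
    then show ?thesis using indexed_pmult F
      by (cases j) (simp_all add: slice_pmult_0 slice_pmult_Suc indexed_pset.indexed_const)
  next
    case False
    then show ?thesis using indexed_pmult by (simp add: slice_pmult_other indexed_pset.indexed_pmult)
  qed
qed

text \<open>The expansion is claimed for all large \<open>n\<close>, so that the induction can merge
  the bounds of two summands and absorb the shift caused by a factor \<open>x\<close>.\<close>

lemma value_slices:
  assumes F: "F \<subseteq> carrier R" "\<zero> \<in> F" and B: "insert x B \<subseteq> carrier R" and P: "P \<in> indexed_pset (insert x B) F"
  shows "\<exists>N. \<forall>n\<ge>N. mpoly_value R P = (\<Oplus>j\<in>{..n}. mpoly_value R (slice x j P) \<otimes> x [^] j)"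
  using P
proof induct
  have x: "x \<in> carrier R" and B': "B \<subseteq> carrier R" using B by auto
  have vc: "mpoly_value R (slice x j P) \<in> carrier R" if "P \<in> indexed_pset (insert x B) F" for j P
    using value_generate[OF F(1) B' slice_pset[OF F(2) that]] generate_ring_in_carrier[of "F \<union> B"] F B' by auto
  {
    case (indexed_const k)
    then have k: "k \<in> carrier R" using F by blast
    have "mpoly_value R (indexed_const k) = (\<Oplus>j\<in>{..n}. mpoly_value R (slice x j (indexed_const k)) \<otimes> x [^] j)" for n
    proof -
      have "(\<Oplus>j\<in>{..n}. mpoly_value R (slice x j (indexed_const k)) \<otimes> x [^] j) = (\<Oplus>j\<in>{..n}. if 0 = j then k \<otimes> x [^] j else \<zero>)"
        by (rule finsum_cong') (use k x in \<open>auto simp: slice_const value_const\<close>)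
      also have "\<dots> = k \<otimes> x [^] (0::nat)" by (rule finsum_singleton) (use k x in auto)
      finally show ?thesis using k by (simp add: value_const)
    qed
    then show ?case by blast
  next
    case (indexed_padd P Q)
    then obtain N1 N2 where N: "\<forall>n\<ge>N1. mpoly_value R P = (\<Oplus>j\<in>{..n}. mpoly_value R (slice x j P) \<otimes> x [^] j)"
      "\<forall>n\<ge>N2. mpoly_value R Q = (\<Oplus>j\<in>{..n}. mpoly_value R (slice x j Q) \<otimes> x [^] j)" by blast
    have "mpoly_value R (indexed_padd P Q) = (\<Oplus>j\<in>{..n}. mpoly_value R (slice x j (indexed_padd P Q)) \<otimes> x [^] j)"
      if n: "n \<ge> max N1 N2" for n
    proof -
      have "(\<Oplus>j\<in>{..n}. mpoly_value R (slice x j (indexed_padd P Q)) \<otimes> x [^] j)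
        = (\<Oplus>j\<in>{..n}. mpoly_value R (slice x j P) \<otimes> x [^] j \<oplus> mpoly_value R (slice x j Q) \<otimes> x [^] j)"
        using vc[OF indexed_padd(1)] vc[OF indexed_padd(3)] x
        by (simp add: slice_padd value_padd[OF F(1) B' slice_pset[OF F(2) indexed_padd(1)] slice_pset[OF F(2) indexed_padd(3)]] l_distr)
      also have "\<dots> = (\<Oplus>j\<in>{..n}. mpoly_value R (slice x j P) \<otimes> x [^] j) \<oplus> (\<Oplus>j\<in>{..n}. mpoly_value R (slice x j Q) \<otimes> x [^] j)"
        by (rule finsum_addf) (use vc[OF indexed_padd(1)] vc[OF indexed_padd(3)] x in auto)
      also have "\<dots> = mpoly_value R (indexed_padd P Q)"
      proof -
        have n12: "N1 \<le> n" "N2 \<le> n" using n by simp_all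
        show ?thesis
          unfolding N(1)[rule_format, OF n12(1), symmetric] N(2)[rule_format, OF n12(2), symmetric]
          by (rule value_padd[OF F(1) B indexed_padd(1,3), symmetric])
      qed
      finally show ?thesis by simp
    qed
    then show ?case by blast
  next
    case (indexed_pmult P i)
    then obtain N where N: "\<forall>n\<ge>N. mpoly_value R P = (\<Oplus>j\<in>{..n}. mpoly_value R (slice x j P) \<otimes> x [^] j)" by blast
    have i: "i \<in> carrier R" using indexed_pmult B by blast
    have v: "mpoly_value R (indexed_pmult P i) = mpoly_value R P \<otimes> i" by (rule value_pmult[OF F(1) B indexed_pmult(1,3)])
    show ?case
    proof (cases "i = x")
      case True
      have "mpoly_value R (indexed_pmult P i) = (\<Oplus>j\<in>{..n}. mpoly_value R (slice x j (indexed_pmult P i)) \<otimes> x [^] j)"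
        if n: "n \<ge> Suc N" for n
      proof -
        obtain n' where n': "n = Suc n'" "n' \<ge> N" using n by (cases n) auto
        have "(\<Oplus>j\<in>{..n}. mpoly_value R (slice x j (indexed_pmult P x)) \<otimes> x [^] j)
          = (\<Oplus>j\<in>{..n'}. mpoly_value R (slice x (Suc j) (indexed_pmult P x)) \<otimes> x [^] Suc j) \<oplus> mpoly_value R (slice x 0 (indexed_pmult P x)) \<otimes> x [^] (0::nat)"
          unfolding n'(1)
        proof (rule finsum_Suc2)
          show "(\<lambda>j. mpoly_value R (slice x j (indexed_pmult P x)) \<otimes> x [^] j) \<in> {..Suc n'} \<rightarrow> carrier R"
          proof
            fix j
            show "mpoly_value R (slice x j (indexed_pmult P x)) \<otimes> x [^] j \<in> carrier R"
              using vc[OF indexed_pset.indexed_pmult[OF indexed_pmult(1), of x]] x by simp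
          qed
        qed
        also have "\<dots> = (\<Oplus>j\<in>{..n'}. (mpoly_value R (slice x j P) \<otimes> x [^] j) \<otimes> x)"
          using vc[OF indexed_pmult(1)] x by (simp add: slice_pmult_0 slice_pmult_Suc value_const m_assoc Pi_def)
        also have "\<dots> = mpoly_value R P \<otimes> x"

          unfolding N[rule_format, OF n'(2)] using vc[OF indexed_pmult(1)] x
          by (intro finsum_ldistr[symmetric]) auto
        finally show ?thesis using v True by simp
      qed
      then show ?thesis by blast
    next
      case False
      then have iB: "i \<in> B" using indexed_pmult by blast
      have "mpoly_value R (indexed_pmult P i) = (\<Oplus>j\<in>{..n}. mpoly_value R (slice x j (indexed_pmult P i)) \<otimes> x [^] j)"
        if n: "n \<ge> N" for n
      proof -
        have "(\<Oplus>j\<in>{..n}. mpoly_value R (slice x j (indexed_pmult P i)) \<otimes> x [^] j) = (\<Oplus>j\<in>{..n}. (mpoly_value R (slice x j P) \<otimes> x [^] j) \<otimes> i)"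
          using vc[OF indexed_pmult(1)] x i
          by (intro finsum_cong') (auto simp: slice_pmult_other[OF False] value_pmult[OF F(1) B' slice_pset[OF F(2) indexed_pmult(1)] iB] m_ac)
        also have "\<dots> = mpoly_value R P \<otimes> i"

          unfolding N[rule_format, OF n] using vc[OF indexed_pmult(1)] x i
          by (intro finsum_ldistr[symmetric]) auto
        finally show ?thesis using v by simp
      qed
      then show ?thesis by blast
    qed
  }
qed

lemma slice_nonzero:
  assumes "P m \<noteq> \<zero>"
  shows "\<exists>j. slice x j P \<noteq> indexed_const \<zero>"
proof -
  let ?j = "count m x" and ?m = "filter_mset (\<lambda>y. y \<noteq> x) m"
  have "m = ?m + replicate_mset ?j x" by (simp add: multiset_eq_iff)
  then have "slice x ?j P ?m = P m" by (simp add: slice_def)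
  then have "slice x ?j P ?m \<noteq> indexed_const \<zero> ?m" using assms by (simp add: indexed_const_def)
  then show ?thesis by metis
qed

end

text \<open>A polynomial involves finitely many variables, so unions of chains of independent sets
  are independent and Zorn's lemma gives a maximal \<open>B\<close>. If \<open>x\<close> were
  transcendental over \<open>k(B)\<close>, then \<open>insert x B\<close> would be independent as
  well: a nonzero polynomial relation has a nonzero slice, whose value is nonzero by independence of
  \<open>B\<close>, and would make \<open>x\<close> algebraic.\<close>

lemma (in field) exists_transcendence_basis:
  assumes k: "subfield k R"
  shows "\<exists>B. transcendence_basis R k B"
proof -
  have kR: "k \<subseteq> carrier R" by (rule subfieldE(3)[OF k])
  have k0: "\<zero> \<in> k" by (rule subringE(2)[OF subfieldE(1)[OF k]])
  let ?I = "{B. algebraically_independent R k B}"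
  have c0: "algebraically_independent R k {}"
    unfolding algebraically_independent_def
  proof (intro conjI ballI impI)
    fix P assume P: "P \<in> indexed_pset ({}::'a set) k" "mpoly_value R P = \<zero>"
    have "\<exists>c\<in>k. P = indexed_const c" using P(1)
    proof induct
      case (indexed_padd P Q)
      then show ?case using subringE(7)[OF subfieldE(1)[OF k]] by (auto simp: indexed_padd_const)
    qed auto
    then obtain c where "c \<in> k" "P = indexed_const c" by blast
    then show "P = indexed_const \<zero>" using P(2) kR by (auto simp: value_const)
  qed simp
  have "\<exists>M\<in>?I. \<forall>U\<in>?I. M \<subseteq> U \<longrightarrow> U = M"
  proof (rule subset_Zorn_nonempty)
    show "?I \<noteq> {}" using c0 by blast
    fix C assume C: "C \<noteq> {}" "subset.chain ?I C"
    have ch: "U \<subseteq> Y \<or> Y \<subseteq> U" if "U \<in> C" "Y \<in> C" for U Y using C(2) that by (auto simp: subset_chain_def)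
    have ind: "algebraically_independent R k U" if "U \<in> C" for U using C(2) that by (auto simp: subset_chain_def)
    have "algebraically_independent R k (\<Union>C)"
      unfolding algebraically_independent_def
    proof (intro conjI ballI impI)
      show "\<Union>C \<subseteq> carrier R" using ind unfolding algebraically_independent_def by blast
      fix P assume P: "P \<in> indexed_pset (\<Union>C) k" "mpoly_value R P = \<zero>"
      have mono: "P \<in> indexed_pset Y k" if "P \<in> indexed_pset U k" "U \<subseteq> Y" for P :: "'a multiset \<Rightarrow> 'a" and U Y
        using that by (induct rule: indexed_pset.induct) (auto intro: indexed_pset.intros)
      have "\<exists>U\<in>C. P \<in> indexed_pset U k" using P(1)
      proof induct
        case (indexed_const c) then show ?case using C(1) indexed_pset.indexed_const[OF indexed_const] by (auto simp: ex_in_conv[symmetric])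
      next
        case (indexed_padd P Q)
        then obtain U Y where XY: "U \<in> C" "Y \<in> C" "P \<in> indexed_pset U k" "Q \<in> indexed_pset Y k" by (elim bexE) (rule that)
        show ?case using ch[OF XY(1,2)]
        proof
          assume le: "U \<subseteq> Y"
          show ?thesis by (rule bexI[OF _ XY(2)]) (rule indexed_pset.indexed_padd[OF mono[OF XY(3) le] XY(4)])
        next
          assume le: "Y \<subseteq> U"
          show ?thesis by (rule bexI[OF _ XY(1)]) (rule indexed_pset.indexed_padd[OF XY(3) mono[OF XY(4) le]])
        qed
      next
        case (indexed_pmult P i)
        then obtain U where U: "U \<in> C" "P \<in> indexed_pset U k" by (elim bexE) (rule that)
        obtain Y where Y: "Y \<in> C" "i \<in> Y" using indexed_pmult(3) by (rule UnionE)
        show ?case using ch[OF U(1) Y(1)]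
        proof
          assume le: "U \<subseteq> Y"
          show ?thesis by (rule bexI[OF _ Y(1)]) (rule indexed_pset.indexed_pmult[OF mono[OF U(2) le] Y(2)])
        next
          assume le: "Y \<subseteq> U"
          show ?thesis by (rule bexI[OF _ U(1)]) (rule indexed_pset.indexed_pmult[OF U(2) subsetD[OF le Y(2)]])
        qed
      qed
      then obtain U where U: "U \<in> C" "P \<in> indexed_pset U k" by blast
      then show "P = indexed_const \<zero>" using ind[OF U(1)] P(2) unfolding algebraically_independent_def by blast
    qed
    then show "\<Union>C \<in> ?I" by blast
  qed
  then obtain B where B: "algebraically_independent R k B" and max: "\<And>U. algebraically_independent R k U \<Longrightarrow> B \<subseteq> U \<Longrightarrow> U = B" by blast
  have BR: "B \<subseteq> carrier R" using B by (simp add: algebraically_independent_def)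
  have kB: "k \<union> B \<subseteq> carrier R" using kR BR by blast
  let ?E = "generate_field R (k \<union> B)"
  have E: "subring ?E R" by (rule subfieldE(1)[OF generate_field_is_subfield[OF kB]])
  have "(algebraic over ?E) x" if x: "x \<in> carrier R" for x
  proof (rule ccontr)
    assume na: "\<not> (algebraic over ?E) x"
    have xB: "x \<notin> B"
    proof
      assume "x \<in> B"
      then have "x \<in> ?E" by (intro generate_field.incl) blast
      then show False using na algebraic_self[OF E] by blast
    qed
    have iR: "insert x B \<subseteq> carrier R" using x BR by blast
    have "algebraically_independent R k (insert x B)"
      unfolding algebraically_independent_def
    proof (intro conjI ballI impI)
      show "insert x B \<subseteq> carrier R" by (rule iR)
      fix P assume P: "P \<in> indexed_pset (insert x B) k" "mpoly_value R P = \<zero>"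
      show "P = indexed_const \<zero>"
      proof (rule ccontr)
        assume "P \<noteq> indexed_const \<zero>"
        then obtain m where "P m \<noteq> \<zero>" by (auto simp: indexed_const_def fun_eq_iff)
        then obtain j where j: "slice x j P \<noteq> indexed_const \<zero>" using slice_nonzero by blast
        obtain N where N: "\<forall>n\<ge>N. mpoly_value R P = (\<Oplus>j\<in>{..n}. mpoly_value R (slice x j P) \<otimes> x [^] j)"
          using value_slices[OF kR k0 iR P(1)] by blast
        have sl: "slice x i P \<in> indexed_pset B k" for i by (rule slice_pset[OF k0 P(1)])
        have nz: "mpoly_value R (slice x j P) \<noteq> \<zero>" using B sl[of j] j unfolding algebraically_independent_def by blast
        have sub: "generate_ring R (k \<union> B) \<subseteq> ?E"
          by (rule generate_ring_min_subring1[OF kB E subsetI]) (rule generate_field.incl)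
        have vE: "mpoly_value R (slice x i P) \<in> ?E" for i by (rule subsetD[OF sub value_generate[OF kR BR sl]])
        have "(\<Oplus>i\<in>{..max N j}. mpoly_value R (slice x i P) \<otimes> x [^] i) = \<zero>"
          unfolding N[rule_format, OF max.cobounded1, symmetric] by (rule P(2))
        then have "(\<forall>i\<le>max N j. mpoly_value R (slice x i P) \<in> ?E) \<and>
          (\<Oplus>i\<in>{..max N j}. mpoly_value R (slice x i P) \<otimes> x [^] i) \<in> {\<zero>} \<and> (\<exists>i\<le>max N j. mpoly_value R (slice x i P) \<notin> {\<zero>})"
          using vE nz by (intro conjI allI impI exI[of _ j]) simp_all
        then have "alg_rel R ?E {\<zero>} x"
          unfolding alg_rel_def by (intro exI)
        then show False using na algebraic_iff_alg_rel[OF E x] by blast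
      qed
    qed
    then show False using max[of "insert x B"] xB by blast
  qed
  then show ?thesis using B unfolding transcendence_basis_def by blast
qed

section \<open>Quotient fields and the transcendence degree of residue rings\<close>

context domain
begin

lemma quotient_field_field: "field (quotient_field R)"
  and to_quotient_field_hom: "ring_hom_cring R (quotient_field R) (to_quotient_field R)"
  and to_quotient_field_eq_zero: "a \<in> carrier R \<Longrightarrow> to_quotient_field R a = \<zero>\<^bsub>quotient_field R\<^esub> \<Longrightarrow> a = \<zero>"
  and quotient_field_cases: "x \<in> carrier (quotient_field R) \<Longrightarrow>
    \<exists>a\<in>carrier R. \<exists>s\<in>carrier R. s \<noteq> \<zero> \<and> to_quotient_field R s \<otimes>\<^bsub>quotient_field R\<^esub> x = to_quotient_field R a"
proof -
  let ?S = "carrier R - {\<zero>}"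
  interpret M: mult_subset R ?S
    by unfold_locales (auto simp: integral_iff)
  let ?F = "fraction_ring R ?S"
  note h = M.fraction_hom
  have qF: "quotient_field R = ?F" "to_quotient_field R = (\<lambda>a. fraction R ?S a \<one>)"
    by (auto simp: quotient_field_def to_quotient_field_def fun_eq_iff)
  show "ring_hom_cring R (quotient_field R) (to_quotient_field R)" unfolding qF by (rule h)
  interpret h: ring_hom_cring R ?F "\<lambda>a. fraction R ?S a \<one>" by (rule h)
  have z: "a = \<zero>" if a: "a \<in> carrier R" "fraction R ?S a \<one> = \<zero>\<^bsub>?F\<^esub>" for a
  proof -
    have "\<exists>u\<in>?S. u \<otimes> (a \<otimes> \<one>) = u \<otimes> (\<zero> \<otimes> \<one>)"
      using a(2) unfolding M.fraction_zero M.fraction_eq_iff[OF a(1) M.one_in_S zero_closed M.one_in_S] .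
    then obtain u where u: "u \<in> carrier R" "u \<noteq> \<zero>" "u \<otimes> a = \<zero>" using a(1) by auto
    then show ?thesis using integral[OF u(3,1) a(1)] by blast
  qed
  show "a = \<zero>" if "a \<in> carrier R" "to_quotient_field R a = \<zero>\<^bsub>quotient_field R\<^esub>" for a
    using z that unfolding qF by blast
  have cases: "\<exists>a\<in>carrier R. \<exists>s\<in>carrier R. s \<noteq> \<zero> \<and> fraction R ?S s \<one> \<otimes>\<^bsub>?F\<^esub> x = fraction R ?S a \<one>"
    if x: "x \<in> carrier ?F" for x
  proof -
    obtain a s where a: "a \<in> carrier R" "s \<in> ?S" "x = fraction R ?S a s" using x by (rule M.fraction_cases)
    have "fraction R ?S s \<one> \<otimes>\<^bsub>?F\<^esub> x = fraction R ?S (s \<otimes> a) (\<one> \<otimes> s)"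
      unfolding a(3) by (rule M.fraction_mult) (use a M.one_in_S in blast)+
    also have "\<dots> = fraction R ?S a \<one>"
      by (rule M.fraction_eqI) (use a M.one_in_S in \<open>auto simp: m_comm\<close>)
    finally show ?thesis using a by blast
  qed
  show "\<exists>a\<in>carrier R. \<exists>s\<in>carrier R. s \<noteq> \<zero> \<and> to_quotient_field R s \<otimes>\<^bsub>quotient_field R\<^esub> x = to_quotient_field R a"
    if "x \<in> carrier (quotient_field R)" for x
    using cases[of x] that unfolding qF .
  show "field (quotient_field R)" unfolding qF
  proof (rule h.S.cring_fieldI2)
    show "\<zero>\<^bsub>?F\<^esub> \<noteq> \<one>\<^bsub>?F\<^esub>" using z[of \<one>] h.hom_one one_closed zero_not_one by metis
    fix x assume x: "x \<in> carrier ?F" "x \<noteq> \<zero>\<^bsub>?F\<^esub>"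
    obtain a s where a: "a \<in> carrier R" "s \<in> carrier R" "s \<noteq> \<zero>" "fraction R ?S s \<one> \<otimes>\<^bsub>?F\<^esub> x = fraction R ?S a \<one>"
      using cases[OF x(1)] by blast
    have sU: "fraction R ?S s \<one> \<in> Units ?F" using M.fraction_unit a(2,3) by blast
    have "a \<noteq> \<zero>"
    proof
      assume "a = \<zero>"
      then have "fraction R ?S s \<one> \<otimes>\<^bsub>?F\<^esub> x = \<zero>\<^bsub>?F\<^esub>"
        unfolding a(4) by (simp only: M.fraction_zero)
      also have "\<dots> = fraction R ?S s \<one> \<otimes>\<^bsub>?F\<^esub> \<zero>\<^bsub>?F\<^esub>"
        by (rule h.S.r_null[OF h.S.Units_closed[OF sU], symmetric])
      finally have e: "fraction R ?S s \<one> \<otimes>\<^bsub>?F\<^esub> x = fraction R ?S s \<one> \<otimes>\<^bsub>?F\<^esub> \<zero>\<^bsub>?F\<^esub>" .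
      have "x = \<zero>\<^bsub>?F\<^esub>" using iffD1[OF h.S.Units_l_cancel[OF sU x(1) h.S.zero_closed] e] .
      then show False using x(2) by blast
    qed
    then have aU: "fraction R ?S a \<one> \<in> Units ?F" using M.fraction_unit a(1) by blast
    then have yc: "inv\<^bsub>?F\<^esub> (fraction R ?S a \<one>) \<in> carrier ?F" by (rule h.S.Units_inv_closed)
    have "x \<otimes>\<^bsub>?F\<^esub> (fraction R ?S s \<one> \<otimes>\<^bsub>?F\<^esub> inv\<^bsub>?F\<^esub> (fraction R ?S a \<one>)) = (fraction R ?S s \<one> \<otimes>\<^bsub>?F\<^esub> x) \<otimes>\<^bsub>?F\<^esub> inv\<^bsub>?F\<^esub> (fraction R ?S a \<one>)"

      unfolding h.S.m_lcomm[OF x(1) h.S.Units_closed[OF sU] yc] h.S.m_assoc[OF h.S.Units_closed[OF sU] x(1) yc] ..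
    also have "\<dots> = \<one>\<^bsub>?F\<^esub>" unfolding a(4) by (rule h.S.Units_r_inv[OF aU])
    finally show "\<exists>b\<in>carrier ?F. x \<otimes>\<^bsub>?F\<^esub> b = \<one>\<^bsub>?F\<^esub>"
      using yc h.S.Units_closed[OF sU] h.S.m_closed by blast
  qed
qed

end

lemma subfield_image:
  assumes h: "ring_hom_cring R F h" and F: "field F" and k: "subring k R"
    and inv: "\<And>c. c \<in> k \<Longrightarrow> h c \<noteq> \<zero>\<^bsub>F\<^esub> \<Longrightarrow> \<exists>d\<in>k. c \<otimes>\<^bsub>R\<^esub> d = \<one>\<^bsub>R\<^esub>"
  shows "subfield (h ` k) F"
proof -
  interpret h: ring_hom_cring R F h by (rule h)
  interpret F: field F by (rule F)
  have kR: "k \<subseteq> carrier R" by (rule subringE(1)[OF k])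
  show ?thesis
  proof (rule F.subfieldI')
    show "subring (h ` k) F" by (rule h.ring.img_is_subring[OF k])
    fix y assume y: "y \<in> h ` k - {\<zero>\<^bsub>F\<^esub>}"
    then obtain c where c: "c \<in> k" "y = h c" "h c \<noteq> \<zero>\<^bsub>F\<^esub>" by blast
    obtain d where d: "d \<in> k" "c \<otimes>\<^bsub>R\<^esub> d = \<one>\<^bsub>R\<^esub>" using inv[OF c(1,3)] by blast
    have cd: "c \<in> carrier R" "d \<in> carrier R" using c d kR by blast+
    have "h c \<otimes>\<^bsub>F\<^esub> h d = \<one>\<^bsub>F\<^esub>" using h.hom_mult[OF cd] d(2) by simp
    then have "inv\<^bsub>F\<^esub> y = h d" unfolding c(2) using comm_monoid.comm_inv_char[OF cring.axioms(2)[OF fieldE(1)[OF F]] h.hom_closed[OF cd(1)] h.hom_closed[OF cd(2)]] by blast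
    then show "inv\<^bsub>F\<^esub> y \<in> h ` k" using d(1) by blast
  qed
qed

text \<open>The factor two comes from fractions: each of the at most \<open>M\<close> elements of a
  transcendence basis of the quotient field of \<open>A Quot p\<close> contributes a numerator and a
  denominator, lifted to \<open>A\<close>. Clearing denominators in a relation over the generated
  field and lifting its coefficients gives \<open>alg_rel\<close> modulo \<open>p\<close>.\<close>

lemma domain_trdeg_bound:
  fixes A (structure)
  assumes A: "cring A" and k: "subring k1 A" and inv: "\<And>c. c \<in> k1 \<Longrightarrow> c \<noteq> \<zero> \<Longrightarrow> \<exists>d\<in>k1. c \<otimes> d = \<one>"
    and p: "p \<in> spec A" and td: "domain_trdeg (A Quot p) ((\<lambda>c. p +> c) ` k1) \<le> enat M"
  shows "\<exists>V. finite V \<and> card V \<le> 2 * M \<and> V \<subseteq> carrier A \<and>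
    (\<forall>a\<in>carrier A. alg_rel A (generate_ring A (k1 \<union> V)) p a)"
proof -
  interpret A: cring A by (rule A)
  interpret p: primeideal p A using p by (simp add: spec_iff)
  let ?D = "A Quot p"
  interpret D: domain ?D by (rule p.quotient_is_domain)
  interpret h: ring_hom_cring A ?D "(+>) p" by (rule p.rcos_ring_hom_cring)
  let ?F = "quotient_field ?D" and ?t = "to_quotient_field ?D"
  interpret F: field ?F by (rule D.quotient_field_field)
  interpret t: ring_hom_cring ?D ?F ?t by (rule D.to_quotient_field_hom)
  define l where "l = ?t \<circ> (+>) p"
  have l: "ring_hom_cring A ?F l"
    unfolding l_def using ring_hom_trans[OF h.homh t.homh] by (simp add: ring_hom_cring_def ring_hom_cring_axioms_def A F.is_cring)
  then interpret l: ring_hom_cring A ?F l .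
  have l0: "a \<in> p" if "a \<in> carrier A" "l a = \<zero>\<^bsub>?F\<^esub>" for a
    using D.to_quotient_field_eq_zero[of "p +> a"] that FactRing_zero_iff[OF p.is_ideal that(1)] h.hom_closed[OF that(1)] by (simp add: l_def)
  have l1: "l a = \<zero>\<^bsub>?F\<^esub>" if "a \<in> p" for a
    using FactRing_zero_iff[OF p.is_ideal p.Icarr[OF that]] that t.hom_zero by (simp add: l_def)
  have k1A: "k1 \<subseteq> carrier A" by (rule subringE(1)[OF k])
  have kF: "subfield (l ` k1) ?F"
  proof (rule subfield_image[OF l F.field_axioms k])
    fix c assume c: "c \<in> k1" "l c \<noteq> \<zero>\<^bsub>?F\<^esub>"
    then have "c \<noteq> \<zero>" using l.hom_zero by auto
    then show "\<exists>d\<in>k1. c \<otimes> d = \<one>" using inv c(1) by blast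
  qed
  obtain B where B: "transcendence_basis ?F (l ` k1) B" using F.exists_transcendence_basis[OF kF] by blast
  have "ecard B \<le> field_trdeg ?F (l ` k1)" unfolding field_trdeg_def by (rule SUP_upper) (use B in blast)
  also have "l ` k1 = ?t ` ((\<lambda>c. p +> c) ` k1)" by (simp add: l_def image_comp)
  finally have "ecard B \<le> enat M" using td unfolding domain_trdeg_def by (rule order_trans)
  then have fB: "finite B" and cB: "card B \<le> M" by (auto simp: ecard_def split: if_splits)
  have BF: "B \<subseteq> carrier ?F" using B by (simp add: transcendence_basis_def algebraically_independent_def)
  have "\<exists>a s. a \<in> carrier A \<and> s \<in> carrier A \<and> l s \<noteq> \<zero>\<^bsub>?F\<^esub> \<and> l s \<otimes>\<^bsub>?F\<^esub> b = l a" if b: "b \<in> B" for b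
  proof -
    have bF: "b \<in> carrier ?F" by (rule subsetD[OF BF b])
    from D.quotient_field_cases[OF bF] obtain a s where as: "a \<in> carrier ?D" "s \<in> carrier ?D" "s \<noteq> \<zero>\<^bsub>?D\<^esub>" "?t s \<otimes>\<^bsub>?F\<^esub> b = ?t a"
      by (elim bexE conjE) (rule that)
    from subsetD[OF FactRing_surj as(1)] obtain a' where a': "a = p +> a'" "a' \<in> carrier A" by (rule imageE)
    from subsetD[OF FactRing_surj as(2)] obtain s' where s': "s = p +> s'" "s' \<in> carrier A" by (rule imageE)
    note e = a'(2) a'(1) s'(2) s'(1)
    have "l s' = ?t s" "l a' = ?t a" unfolding l_def e by simp_all
    moreover have "?t s \<noteq> \<zero>\<^bsub>?F\<^esub>" using D.to_quotient_field_eq_zero[OF as(2)] as(3) by (rule contrapos_nn[rotated])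
    ultimately have "a' \<in> carrier A \<and> s' \<in> carrier A \<and> l s' \<noteq> \<zero>\<^bsub>?F\<^esub> \<and> l s' \<otimes>\<^bsub>?F\<^esub> b = l a'"
      using as(4) e by simp
    then show ?thesis by (intro exI)
  qed
  then obtain fa fs where fas: "\<And>b. b \<in> B \<Longrightarrow> fa b \<in> carrier A \<and> fs b \<in> carrier A \<and> l (fs b) \<noteq> \<zero>\<^bsub>?F\<^esub> \<and> l (fs b) \<otimes>\<^bsub>?F\<^esub> b = l (fa b)"
    by metis
  define V where "V = fa ` B \<union> fs ` B"
  have VA: "V \<subseteq> carrier A" using fas by (auto simp: V_def)
  have fV: "finite V" using fB by (simp add: V_def)
  have "card V \<le> card (fa ` B) + card (fs ` B)" unfolding V_def by (rule card_Un_le)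
  also have "\<dots> \<le> 2 * M" using card_image_le[OF fB, of fa] card_image_le[OF fB, of fs] cB by linarith
  finally have cV: "card V \<le> 2 * M" .
  let ?G = "generate_ring A (k1 \<union> V)"
  have GA: "k1 \<union> V \<subseteq> carrier A" using VA k1A by blast
  have G: "subring ?G A" by (rule A.generate_ring_is_subring[OF GA])
  have T: "subring (l ` ?G) ?F" by (rule l.ring.img_is_subring[OF G])
  have GV: "x \<in> ?G" if "x \<in> k1 \<union> V" for x using that by (rule generate_ring.incl)
  have HT: "h \<in> carrier ?F \<and> (\<exists>u\<in>l ` ?G. \<exists>v\<in>l ` ?G. v \<noteq> \<zero>\<^bsub>?F\<^esub> \<and> v \<otimes>\<^bsub>?F\<^esub> h = u)" if hh: "h \<in> l ` k1 \<union> B" for h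
    using hh
  proof
    assume "h \<in> l ` k1"
    then obtain c where c: "c \<in> k1" "h = l c" by blast
    have hc: "h \<in> carrier ?F" using c k1A by auto
    have "h \<in> l ` ?G" using c GV by blast
    moreover have "\<one>\<^bsub>?F\<^esub> \<in> l ` ?G" by (rule subringE(3)[OF T])
    moreover have "\<one>\<^bsub>?F\<^esub> \<noteq> \<zero>\<^bsub>?F\<^esub>" using F.zero_not_one by metis
    ultimately show ?thesis using hc F.l_one[OF hc] by blast
  next
    assume b: "h \<in> B"
    have V: "fa h \<in> k1 \<union> V" "fs h \<in> k1 \<union> V" using b unfolding V_def by blast+
    have "fa h \<in> ?G" "fs h \<in> ?G" by (rule GV[OF V(1)], rule GV[OF V(2)])
    then show ?thesis using fas[OF b] b BF by blast
  qed
  have "alg_rel A ?G p a" if a: "a \<in> carrier A" for a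
  proof -
    have la: "l a \<in> carrier ?F" using a by simp
    have al: "(F.algebraic over generate_field ?F (l ` k1 \<union> B)) (l a)" using B la by (simp add: transcendence_basis_def)
    have "alg_rel ?F (l ` ?G) {\<zero>\<^bsub>?F\<^esub>} (l a)"
    proof (rule F.generate_field_alg_rel[where H = "l ` k1 \<union> B", OF T _ la al])
      fix h assume hh: "h \<in> l ` k1 \<union> B"
      show "h \<in> carrier ?F \<and> (\<exists>u\<in>l ` ?G. \<exists>v\<in>l ` ?G. v \<noteq> \<zero>\<^bsub>?F\<^esub> \<and> v \<otimes>\<^bsub>?F\<^esub> h = u)" by (rule HT[OF hh])
    qed
    then obtain m c where c: "\<forall>j\<le>m. c j \<in> l ` ?G" "(\<Oplus>\<^bsub>?F\<^esub>j\<in>{..m::nat}. c j \<otimes>\<^bsub>?F\<^esub> l a [^]\<^bsub>?F\<^esub> j) \<in> {\<zero>\<^bsub>?F\<^esub>}" "\<exists>j\<le>m. c j \<notin> {\<zero>\<^bsub>?F\<^esub>}"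
      unfolding alg_rel_def by (elim exE conjE) (rule that, assumption, assumption, intro exI conjI)
    define d where "d j = (SOME r. r \<in> ?G \<and> l r = c j)" for j
    have d: "d j \<in> ?G \<and> l (d j) = c j" if "j \<le> m" for j
    proof -
      have "c j \<in> l ` ?G" using c(1) that by simp
      then have "\<exists>r. r \<in> ?G \<and> l r = c j" by (rule imageE) (rule exI, simp)
      then show ?thesis unfolding d_def by (rule someI_ex)
    qed
    have dA: "d j \<in> carrier A" if "j \<le> m" for j using d[OF that] subringE(1)[OF G] by blast
    have "l (\<Oplus>j\<in>{..m}. d j \<otimes> a [^] j) = (\<Oplus>\<^bsub>?F\<^esub>j\<in>{..m}. c j \<otimes>\<^bsub>?F\<^esub> l a [^]\<^bsub>?F\<^esub> j)"
    proof -
      have "l (\<Oplus>j\<in>{..m}. d j \<otimes> a [^] j) = (\<Oplus>\<^bsub>?F\<^esub>j\<in>{..m}. (l \<circ> (\<lambda>j. d j \<otimes> a [^] j)) j)"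
        by (rule l.hom_finsum) (use dA a in auto)
      also have "\<dots> = (\<Oplus>\<^bsub>?F\<^esub>j\<in>{..m}. c j \<otimes>\<^bsub>?F\<^esub> l a [^]\<^bsub>?F\<^esub> j)"
      proof (rule F.finsum_cong')
        show "(\<lambda>j. c j \<otimes>\<^bsub>?F\<^esub> l a [^]\<^bsub>?F\<^esub> j) \<in> {..m} \<rightarrow> carrier ?F"
        proof
          fix j assume "j \<in> {..m}"
          then have "c j \<in> carrier ?F" using c(1) subringE(1)[OF T] by blast
          then show "c j \<otimes>\<^bsub>?F\<^esub> l a [^]\<^bsub>?F\<^esub> j \<in> carrier ?F" using la by simp
        qed
        fix j assume "j \<in> {..m}"
        then show "(l \<circ> (\<lambda>j. d j \<otimes> a [^] j)) j = c j \<otimes>\<^bsub>?F\<^esub> l a [^]\<^bsub>?F\<^esub> j"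
          using d[of j] dA[of j] a by (simp add: l.hom_npow)
      qed simp
      finally show ?thesis .
    qed
    then have "l (\<Oplus>j\<in>{..m}. d j \<otimes> a [^] j) = \<zero>\<^bsub>?F\<^esub>" using c(2) by (simp only: singleton_iff)
    moreover have "(\<Oplus>j\<in>{..m}. d j \<otimes> a [^] j) \<in> carrier A"
      by (rule A.finsum_closed) (use dA a in auto)
    ultimately have sp: "(\<Oplus>j\<in>{..m}. d j \<otimes> a [^] j) \<in> p" by (intro l0)
    obtain j where j: "j \<le> m" "c j \<noteq> \<zero>\<^bsub>?F\<^esub>" using c(3) unfolding singleton_iff by (elim exE conjE) (rule that)
    have "d j \<notin> p"
    proof
      assume "d j \<in> p"
      then have "l (d j) = \<zero>\<^bsub>?F\<^esub>" by (rule l1)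
      then show False using d[OF j(1)] j(2) by simp
    qed
    then have "(\<forall>j\<le>m. d j \<in> ?G) \<and> (\<Oplus>j\<in>{..m}. d j \<otimes> a [^] j) \<in> p \<and> (\<exists>j\<le>m. d j \<notin> p)"
      using d sp j(1) by (intro conjI allI impI exI[of _ j]) simp_all
    then show ?thesis unfolding alg_rel_def by (intro exI)
  qed
  then show ?thesis using fV cV VA by blast
qed

section \<open>The tensor product\<close>

text \<open>A complement of \<open>k\<close> in \<open>K\<close> gives a \<open>k\<close>-linear retraction of \<open>K\<close> onto \<open>k\<close>.\<close>

lemma (in field) exists_retraction:
  assumes k: "subfield k R"
  obtains \<phi> where "\<And>x. x \<in> carrier R \<Longrightarrow> \<phi> x \<in> k" "\<phi> \<one> = \<one>"
    "\<And>x y. x \<in> carrier R \<Longrightarrow> y \<in> carrier R \<Longrightarrow> \<phi> (x \<oplus> y) = \<phi> x \<oplus> \<phi> y"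
    "\<And>x c. x \<in> carrier R \<Longrightarrow> c \<in> k \<Longrightarrow> \<phi> (x \<otimes> c) = \<phi> x \<otimes> c"
proof -
  have kR: "k \<subseteq> carrier R" by (rule subfieldE(3)[OF k])
  have ks: "subring k R" by (rule subfieldE(1)[OF k])
  note k0 = subringE(2)[OF ks] and k1 = subringE(3)[OF ks] and kn = subringE(5)[OF ks]
    and km = subringE(6)[OF ks] and ka = subringE(7)[OF ks]
  have kinv: "inv c \<in> k" "c \<otimes> inv c = \<one>" if "c \<in> k" "c \<noteq> \<zero>" for c
    using subfield_m_inv[OF k, of c] that by auto
  \<comment> \<open>These are the \<open>k\<close>-subspaces of the field that avoid
    \<open>\<one>\<close>; a maximal one is a complement of \<open>k\<close>.\<close>
  define lin where "lin V \<longleftrightarrow> V \<subseteq> carrier R \<and> \<zero> \<in> V \<and> (\<forall>x\<in>V. \<forall>y\<in>V. x \<oplus> y \<in> V) \<and> (\<forall>x\<in>V. \<forall>c\<in>k. x \<otimes> c \<in> V) \<and> \<one> \<notin> V" for V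
  have "\<exists>M\<in>{V. lin V}. \<forall>V\<in>{V. lin V}. M \<subseteq> V \<longrightarrow> V = M"
  proof (rule subset_Zorn_nonempty)
    have "lin {\<zero>}" using kR by (auto simp: lin_def)
    then show "{V. lin V} \<noteq> {}" by blast
    fix C assume C: "C \<noteq> {}" "subset.chain {V. lin V} C"
    have l: "lin V" if "V \<in> C" for V using C(2) that by (auto simp: subset_chain_def)
    have ch: "V \<subseteq> W \<or> W \<subseteq> V" if "V \<in> C" "W \<in> C" for V W using C(2) that by (auto simp: subset_chain_def)
    have "x \<oplus> y \<in> \<Union>C" if xy: "x \<in> \<Union>C" "y \<in> \<Union>C" for x y
    proof -
      obtain V W where VW: "V \<in> C" "x \<in> V" "W \<in> C" "y \<in> W" using xy by (elim UnionE) (rule that)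
      show ?thesis using ch[OF VW(1,3)]
      proof
        assume "V \<subseteq> W"
        then have "x \<oplus> y \<in> W" using l[OF VW(3)] VW by (simp add: lin_def subset_iff)
        then show ?thesis by (rule UnionI[OF VW(3)])
      next
        assume "W \<subseteq> V"
        then have "x \<oplus> y \<in> V" using l[OF VW(1)] VW by (simp add: lin_def subset_iff)
        then show ?thesis by (rule UnionI[OF VW(1)])
      qed
    qed
    moreover have "x \<otimes> c \<in> \<Union>C" if xc: "x \<in> \<Union>C" "c \<in> k" for x c
    proof -
      obtain V where V: "V \<in> C" "x \<in> V" using xc(1) by (rule UnionE)
      have "x \<otimes> c \<in> V" using l[OF V(1)] V xc(2) by (simp add: lin_def)
      then show ?thesis by (rule UnionI[OF V(1)])
    qed
    moreover have "\<Union>C \<subseteq> carrier R" "\<one> \<notin> \<Union>C" "\<zero> \<in> \<Union>C" using l C(1) unfolding lin_def by blast+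
    ultimately show "\<Union>C \<in> {V. lin V}" by (simp add: lin_def)
  qed
  then obtain V where V: "lin V" and max: "\<And>W. lin W \<Longrightarrow> V \<subseteq> W \<Longrightarrow> W = V" by blast
  have VR: "V \<subseteq> carrier R" and V0: "\<zero> \<in> V" and V1: "\<one> \<notin> V" using V by (simp_all add: lin_def)
  have Va: "x \<oplus> y \<in> V" if "x \<in> V" "y \<in> V" for x y using V that by (simp add: lin_def)
  have Vm: "x \<otimes> c \<in> V" if "x \<in> V" "c \<in> k" for x c using V that by (simp add: lin_def)
  have Vn: "\<ominus> x \<in> V" if x: "x \<in> V" for x
  proof -
    have "x \<otimes> (\<ominus> \<one>) \<in> V" by (rule Vm[OF x kn[OF k1]])
    moreover have "x \<in> carrier R" using VR x by (rule subsetD)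
    ultimately show ?thesis by (simp add: r_minus)
  qed
  have ex: "\<exists>c. c \<in> k \<and> x \<ominus> c \<in> V" if x: "x \<in> carrier R" for x
  proof (cases "x \<in> V")
    case True
    have "x \<ominus> \<zero> = x" using x by (simp add: minus_eq)
    then show ?thesis using True k0 by (intro exI[of _ \<zero>]) simp
  next
    case False
    define W where "W = {v \<oplus> x \<otimes> c | v c. v \<in> V \<and> c \<in> k}"
    have WI: "v \<oplus> x \<otimes> c \<in> W" if "v \<in> V" "c \<in> k" for v c using that unfolding W_def by blast
    have VW: "V \<subseteq> W"
    proof
      fix v assume v: "v \<in> V"
      then have "v \<in> carrier R" using VR by blast
      then have "v \<oplus> x \<otimes> \<zero> = v" using x by simp
      then show "v \<in> W" using WI[OF v k0] by simp
    qed
    have "\<zero> \<oplus> x \<otimes> \<one> = x" using x by simp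
    then have xW: "x \<in> W" using WI[OF V0 k1] by simp
    then have "W \<noteq> V" using False by blast
    then have nl: "\<not> lin W" using max[OF _ VW] by blast
    \<comment> \<open>\<open>W\<close> is the subspace spanned by \<open>V\<close> and
      \<open>x\<close>. By maximality of \<open>V\<close> it contains
      \<open>\<one> = v \<oplus> x \<otimes> c\<close>; here \<open>c\<close> is nonzero since
      \<open>\<one> \<notin> V\<close>, and dividing by \<open>c\<close> shows that \<open>x\<close>
      differs from \<open>inv c\<close> by an element of \<open>V\<close>.\<close>
    have "\<one> \<in> W"
    proof (rule ccontr)
      assume n1: "\<one> \<notin> W"
      have "lin W" unfolding lin_def
      proof (intro conjI ballI)
        show "W \<subseteq> carrier R"
        proof
          fix w assume "w \<in> W"
          then obtain v c where "w = v \<oplus> x \<otimes> c" "v \<in> V" "c \<in> k" unfolding W_def by blast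
          moreover have "v \<in> carrier R" "c \<in> carrier R" using calculation VR kR by blast+
          ultimately show "w \<in> carrier R" using x by simp
        qed
        show "\<zero> \<in> W" using VW V0 by blast
        show "\<one> \<notin> W" by (rule n1)
        fix w assume "w \<in> W"
        then obtain v c where w: "w = v \<oplus> x \<otimes> c" "v \<in> V" "c \<in> k" unfolding W_def by blast
        have wc: "v \<in> carrier R" "c \<in> carrier R" using w VR kR by blast+
        {
          fix w' assume "w' \<in> W"
          then obtain v' c' where w': "w' = v' \<oplus> x \<otimes> c'" "v' \<in> V" "c' \<in> k" unfolding W_def by blast
          have wc': "v' \<in> carrier R" "c' \<in> carrier R" using w' VR kR by blast+
          have "w \<oplus> w' = (v \<oplus> v') \<oplus> x \<otimes> (c \<oplus> c')"
            unfolding w w' using wc wc' x by (simp add: r_distr a_ac)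
          then show "w \<oplus> w' \<in> W" using WI[OF Va[OF w(2) w'(2)] ka[OF w(3) w'(3)]] by simp
        next
          fix d assume d: "d \<in> k"
          then have dc: "d \<in> carrier R" using kR by blast
          have "w \<otimes> d = v \<otimes> d \<oplus> x \<otimes> (c \<otimes> d)" unfolding w using wc dc x by (simp add: l_distr m_assoc)
          then show "w \<otimes> d \<in> W" using WI[OF Vm[OF w(2) d] km[OF w(3) d]] by simp
        }
      qed
      then show False using nl by blast
    qed
    then obtain v c where vc: "\<one> = v \<oplus> x \<otimes> c" "v \<in> V" "c \<in> k" unfolding W_def by blast
    have vcc: "v \<in> carrier R" "c \<in> carrier R" using vc VR kR by blast+
    have c0: "c \<noteq> \<zero>"
    proof
      assume "c = \<zero>"
      then have "\<one> = v" using vc(1) vcc x by simp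
      then show False using V1 vc(2) by simp
    qed
    let ?d = "inv c"
    have d: "?d \<in> k" "c \<otimes> ?d = \<one>" using kinv[OF vc(3) c0] by blast+
    have dc: "?d \<in> carrier R" using d(1) kR by blast
    have "?d = (v \<oplus> x \<otimes> c) \<otimes> ?d" unfolding vc(1)[symmetric] using dc by simp
    also have "\<dots> = v \<otimes> ?d \<oplus> x \<otimes> (c \<otimes> ?d)" using vcc dc x by (simp add: l_distr m_assoc)
    also have "\<dots> = v \<otimes> ?d \<oplus> x" using d(2) x by simp
    finally have e: "?d = v \<otimes> ?d \<oplus> x" .
    have "x \<ominus> ?d = \<ominus> (v \<otimes> ?d)"
    proof -
      have "x \<ominus> (v \<otimes> ?d \<oplus> x) = \<ominus> (v \<otimes> ?d)" using x vcc dc by algebra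
      then show ?thesis using e by simp
    qed
    then show ?thesis using Vn[OF Vm[OF vc(2) d(1)]] d(1) by (intro exI[of _ ?d]) simp
  qed
  have uniq: "c = c'" if "x \<in> carrier R" "c \<in> k" "c' \<in> k" "x \<ominus> c \<in> V" "x \<ominus> c' \<in> V" for x c c'
  proof (rule ccontr)
    assume ne: "c \<noteq> c'"
    have cc: "c \<in> carrier R" "c' \<in> carrier R" using that kR by blast+
    let ?e = "c' \<ominus> c"
    have "?e = (x \<ominus> c) \<oplus> \<ominus> (x \<ominus> c')" using cc that(1) by algebra
    then have eV: "?e \<in> V" using Va[OF that(4) Vn[OF that(5)]] by simp
    have ek: "?e \<in> k" unfolding minus_eq using ka kn that(2,3) by blast
    have e0: "?e \<noteq> \<zero>"
    proof
      assume "?e = \<zero>"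
      then have "c' = c" using r_right_minus_eq[OF cc(2,1)] by simp
      then show False using ne by simp
    qed
    have "?e \<otimes> inv ?e \<in> V" by (rule Vm[OF eV kinv(1)[OF ek e0]])
    then show False using kinv(2)[OF ek e0] V1 by simp
  qed
  define \<phi> where "\<phi> x = (SOME c. c \<in> k \<and> x \<ominus> c \<in> V)" for x
  have \<phi>: "\<phi> x \<in> k \<and> x \<ominus> \<phi> x \<in> V" if "x \<in> carrier R" for x
    unfolding \<phi>_def by (rule someI_ex[OF ex[OF that]])
  have \<phi>c: "\<phi> x \<in> carrier R" if "x \<in> carrier R" for x using \<phi>[OF that] kR by blast
  show thesis
  proof (rule that)
    show "\<phi> x \<in> k" if "x \<in> carrier R" for x using \<phi>[OF that] by blast
    have "\<one> \<ominus> \<one> \<in> V" using V0 by (simp add: minus_eq r_neg)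
    then show "\<phi> \<one> = \<one>" using uniq[OF one_closed _ k1] \<phi>[OF one_closed] by blast
    show "\<phi> (x \<oplus> y) = \<phi> x \<oplus> \<phi> y" if x: "x \<in> carrier R" and y: "y \<in> carrier R" for x y
    proof (rule uniq[of "x \<oplus> y"])
      have "(x \<oplus> y) \<ominus> (\<phi> x \<oplus> \<phi> y) = (x \<ominus> \<phi> x) \<oplus> (y \<ominus> \<phi> y)" using x y \<phi>c[OF x] \<phi>c[OF y] by algebra
      then show "(x \<oplus> y) \<ominus> (\<phi> x \<oplus> \<phi> y) \<in> V" using Va \<phi>[OF x] \<phi>[OF y] by simp
    qed (use x y \<phi> ka in auto)
    show "\<phi> (x \<otimes> c) = \<phi> x \<otimes> c" if x: "x \<in> carrier R" and c: "c \<in> k" for x c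
    proof (rule uniq[of "x \<otimes> c"])
      have cc: "c \<in> carrier R" using c kR by blast
      have "(x \<otimes> c) \<ominus> (\<phi> x \<otimes> c) = (x \<ominus> \<phi> x) \<otimes> c" using x cc \<phi>c[OF x] by algebra
      then show "(x \<otimes> c) \<ominus> (\<phi> x \<otimes> c) \<in> V" using Vm[OF _ c] \<phi>[OF x] by simp
      show "x \<otimes> c \<in> carrier R" using x cc by simp
      show "\<phi> x \<otimes> c \<in> k" using \<phi>[OF x] km c by blast
      show "\<phi> (x \<otimes> c) \<in> k" "x \<otimes> c \<ominus> \<phi> (x \<otimes> c) \<in> V" using \<phi>[of "x \<otimes> c"] x cc by simp_all
    qed
  qed
qed

section \<open>The free abelian group on pairs as a ring\<close>

locale pairs = K?: cring K + A?: cring A for K (structure) and A (structure)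
begin

text \<open>\<open>pair_ring\<close> is the integral monoid ring of the multiplicative monoid
  \<open>carrier K \<times> carrier A\<close>. Since \<open>pm\<close> is additive in both
  arguments, the ring laws reduce to generators.\<close>

definition pm where "pm f g = frag_extend (\<lambda>(x, a). frag_extend (\<lambda>(y, b). frag_of (x \<otimes>\<^bsub>K\<^esub> y, a \<otimes>\<^bsub>A\<^esub> b)) g) f"

abbreviation "G \<equiv> carrier K \<times> carrier A"

lemma pair_simps:
  "carrier (pair_ring K A) = {f. Poly_Mapping.keys f \<subseteq> G}"
  "f \<otimes>\<^bsub>pair_ring K A\<^esub> g = pm f g" "\<one>\<^bsub>pair_ring K A\<^esub> = frag_of (\<one>\<^bsub>K\<^esub>, \<one>\<^bsub>A\<^esub>)"
  "\<zero>\<^bsub>pair_ring K A\<^esub> = 0" "f \<oplus>\<^bsub>pair_ring K A\<^esub> g = f + g"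
  by (simp_all add: pair_ring_def pm_def)

lemma pm_of: "pm (frag_of (x, a)) (frag_of (y, b)) = frag_of (x \<otimes>\<^bsub>K\<^esub> y, a \<otimes>\<^bsub>A\<^esub> b)"
  by (simp add: pm_def)

lemma pm_diff_l: "pm (f - g) h = pm f h - pm g h"
  by (simp add: pm_def frag_extend_diff)

lemma pm_0_l: "pm 0 h = 0"
  by (simp add: pm_def)

lemma pm_0_r: "pm f 0 = 0"
  by (simp add: pm_def frag_extend_eq_0 split_beta)

lemma pm_diff_r: "pm f (g - h) = pm f g - pm f h"
  using subset_UNIV[of "Poly_Mapping.keys f"]
proof (induction f rule: frag_induction)
  case (one x) then show ?case by (cases x) (simp add: pm_def frag_extend_diff)
qed (simp_all add: pm_diff_l pm_0_l)

lemma pm_add_l: "pm (f + g) h = pm f h + pm g h"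
  by (simp add: pm_def frag_extend_add)

lemma keys_diffI: "Poly_Mapping.keys a \<subseteq> S \<Longrightarrow> Poly_Mapping.keys b \<subseteq> S \<Longrightarrow> Poly_Mapping.keys (a - b) \<subseteq> S"
  by (rule order_trans[OF keys_diff]) simp

lemma pm_closed: "Poly_Mapping.keys f \<subseteq> G \<Longrightarrow> Poly_Mapping.keys g \<subseteq> G \<Longrightarrow> Poly_Mapping.keys (pm f g) \<subseteq> G"
proof (induction f rule: frag_induction)
  case (one x)
  obtain x1 a where x: "x = (x1, a)" "x1 \<in> carrier K" "a \<in> carrier A" using one by (cases x) auto
  show ?case using one(2)
  proof (induction g rule: frag_induction)
    case (one y)
    then show ?case using x by (cases y) (simp add: pm_of keys_frag_of)
  next
    case (diff a b) show ?case unfolding pm_diff_r by (rule keys_diffI[OF diff(1,2)])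
  qed (simp add: pm_0_r)
next
  case (diff a b) then show ?case unfolding pm_diff_l by (intro keys_diffI) simp_all
qed (simp add: pm_0_l)

lemma pm_comm: "Poly_Mapping.keys f \<subseteq> G \<Longrightarrow> Poly_Mapping.keys g \<subseteq> G \<Longrightarrow> pm f g = pm g f"
proof (induction f rule: frag_induction)
  case (one x)
  obtain x1 a where x: "x = (x1, a)" "x1 \<in> carrier K" "a \<in> carrier A" using one by (cases x) auto
  show ?case using one(2)
  proof (induction g rule: frag_induction)
    case (one y)
    then show ?case using x by (cases y) (simp add: pm_of K.m_comm A.m_comm)
  qed (simp_all add: pm_0_r pm_0_l pm_diff_r pm_diff_l)
qed (simp_all add: pm_0_r pm_0_l pm_diff_r pm_diff_l)

lemma pm_assoc: "Poly_Mapping.keys f \<subseteq> G \<Longrightarrow> Poly_Mapping.keys g \<subseteq> G \<Longrightarrow> Poly_Mapping.keys h \<subseteq> G \<Longrightarrow>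
    pm (pm f g) h = pm f (pm g h)"
proof (induction f rule: frag_induction)
  case (one x)
  obtain x1 a where x: "x = (x1, a)" "x1 \<in> carrier K" "a \<in> carrier A" using one by (cases x) auto
  show ?case using one(2,3)
  proof (induction g rule: frag_induction)
    case (one y)
    obtain y1 b where y: "y = (y1, b)" "y1 \<in> carrier K" "b \<in> carrier A" using one by (cases y) auto
    show ?case using one(2)
    proof (induction h rule: frag_induction)
      case (one z)
      then show ?case using x y by (cases z) (simp add: pm_of K.m_assoc A.m_assoc)
    qed (simp_all add: pm_0_r pm_0_l pm_diff_r pm_diff_l)
  qed (simp_all add: pm_0_r pm_0_l pm_diff_r pm_diff_l)
qed (simp_all add: pm_0_r pm_0_l pm_diff_r pm_diff_l)

lemma pm_one: "Poly_Mapping.keys f \<subseteq> G \<Longrightarrow> pm (frag_of (\<one>\<^bsub>K\<^esub>, \<one>\<^bsub>A\<^esub>)) f = f"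
proof (induction f rule: frag_induction)
  case (one x)
  then show ?case by (cases x) (simp add: pm_of)
qed (simp_all add: pm_0_r pm_diff_r)

lemma pair_cring: "cring (pair_ring K A)"
proof (rule cringI)
  show "abelian_group (pair_ring K A)"
  proof (rule abelian_groupI)
    fix f assume f: "f \<in> carrier (pair_ring K A)"
    show "\<exists>y\<in>carrier (pair_ring K A). y \<oplus>\<^bsub>pair_ring K A\<^esub> f = \<zero>\<^bsub>pair_ring K A\<^esub>"
      by (rule bexI[of _ "- f"]) (use f in \<open>auto simp: pair_simps\<close>)
    fix g assume g: "g \<in> carrier (pair_ring K A)"
    show "f \<oplus>\<^bsub>pair_ring K A\<^esub> g \<in> carrier (pair_ring K A)"
      using f g order_trans[OF keys_add[of f g]] unfolding pair_simps by simp
  qed (auto simp: pair_simps)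
  show "comm_monoid (pair_ring K A)"
    by (rule comm_monoidI) (simp_all add: pair_simps pm_closed pm_assoc pm_one keys_frag_of, rule pm_comm)
qed (simp add: pair_simps pm_add_l)

end

text \<open>The later argument sees the tensor product only through these properties. The one that
  takes work is \<open>\<one> \<noteq> \<zero>\<close>: with \<open>\<phi>\<close> a retraction of
  \<open>K\<close> onto \<open>k\<close>, the additive map sending \<open>(x, a)\<close> to
  \<open>\<phi> x \<odot> a\<close> kills the ideal of relations but sends the unit of the pair ring
  to the nonzero unit of \<open>A\<close>.\<close>

lemma tensor_product_properties:
  fixes K (structure) and A (structure)
  assumes K: "field K" and k: "subfield k K" and alg: "algebra (K\<lparr>carrier := k\<rparr>) A" and A: "nonzero_cring A"
  obtains \<iota> \<kappa> where "nonzero_cring (tensor_product k K A)"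
    "ring_hom_cring K (tensor_product k K A) \<iota>" "ring_hom_cring A (tensor_product k K A) \<kappa>"
    "\<And>c. c \<in> k \<Longrightarrow> \<iota> c = \<kappa> (c \<odot>\<^bsub>A\<^esub> \<one>\<^bsub>A\<^esub>)"
    "\<And>H. subring H (tensor_product k K A) \<Longrightarrow> \<iota> ` carrier K \<subseteq> H \<Longrightarrow> \<kappa> ` carrier A \<subseteq> H \<Longrightarrow> H = carrier (tensor_product k K A)"
proof -
  interpret F: field K by (rule K)
  interpret A: nonzero_cring A by (rule A)
  interpret alg: algebra "K\<lparr>carrier := k\<rparr>" A by (rule alg)
  interpret P: pairs K A by (simp add: pairs_def fieldE(1)[OF K] A.is_cring)
  define R where "R = pair_ring K A"
  have R: "cring R" unfolding R_def by (rule P.pair_cring)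
  then interpret R: cring R .
  note Rs = P.pair_simps[folded R_def]
  define J where "J = Idl\<^bsub>R\<^esub> (tensor_relations k K A)"
  define T where "T = R Quot J"
  have T: "tensor_product k K A = T" by (simp add: tensor_product_def T_def J_def R_def)
  have kK: "k \<subseteq> carrier K" by (rule subfieldE(3)[OF k])
  have smc: "c \<odot>\<^bsub>A\<^esub> a \<in> carrier A" if "c \<in> k" "a \<in> carrier A" for c a
    using alg.smult_closed[of c a] that by simp
  have kf: "Poly_Mapping.keys (frag_of (x, a)) \<subseteq> P.G" if "x \<in> carrier K" "a \<in> carrier A" for x a
    using that by (simp add: keys_frag_of)
  have kd: "Poly_Mapping.keys (f - g) \<subseteq> P.G" if "Poly_Mapping.keys f \<subseteq> P.G" "Poly_Mapping.keys g \<subseteq> P.G" for f g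
    using that by (rule P.keys_diffI)
  have rel_sub: "tensor_relations k K A \<subseteq> carrier R"
  proof
    fix f assume "f \<in> tensor_relations k K A"
    then consider (1) x y a where "f = frag_of (x \<oplus>\<^bsub>K\<^esub> y, a) - frag_of (x, a) - frag_of (y, a)" "x \<in> carrier K" "y \<in> carrier K" "a \<in> carrier A"
      | (2) x a b where "f = frag_of (x, a \<oplus>\<^bsub>A\<^esub> b) - frag_of (x, a) - frag_of (x, b)" "x \<in> carrier K" "a \<in> carrier A" "b \<in> carrier A"
      | (3) x c a where "f = frag_of (x \<otimes>\<^bsub>K\<^esub> c, a) - frag_of (x, c \<odot>\<^bsub>A\<^esub> a)" "x \<in> carrier K" "c \<in> k" "a \<in> carrier A"
      unfolding tensor_relations_def by blast
    then have "Poly_Mapping.keys f \<subseteq> P.G"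
    proof cases
      case 1 show ?thesis unfolding 1(1) by (intro kd kf) (use 1 in simp_all)
    next
      case 2 show ?thesis unfolding 2(1) by (intro kd kf) (use 2 in simp_all)
    next
      case 3
      then have "c \<in> carrier K" using kK by blast
      then show ?thesis unfolding 3(1) by (intro kd kf) (use 3 smc in simp_all)
    qed
    then show "f \<in> carrier R" by (simp add: Rs)
  qed
  have Ji: "ideal J R" unfolding J_def by (rule R.genideal_ideal[OF rel_sub])
  have relJ: "r \<in> J" if "r \<in> tensor_relations k K A" for r
    using R.genideal_self[OF rel_sub] that unfolding J_def by blast
  have Tc: "cring T" unfolding T_def by (rule ideal.quotient_is_cring[OF Ji R])
  then interpret T: cring T .
  define p where "p = (+>\<^bsub>R\<^esub>) J"
  have ph: "ring_hom_cring R T p" unfolding T_def p_def by (rule ideal.rcos_ring_hom_cring[OF Ji R])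
  then interpret p: ring_hom_cring R T p .
  have p0: "p r = \<zero>\<^bsub>T\<^esub> \<longleftrightarrow> r \<in> J" if "r \<in> carrier R" for r
    unfolding p_def T_def by (rule FactRing_zero_iff[OF Ji that])
  have psurj: "carrier T \<subseteq> p ` carrier R" unfolding p_def T_def by (rule FactRing_surj)
  have Rmin: "f \<ominus>\<^bsub>R\<^esub> g = f - g" if "f \<in> carrier R" "g \<in> carrier R" for f g
  proof -
    have "- g \<in> carrier R" using that by (simp add: Rs)
    moreover have "- g \<oplus>\<^bsub>R\<^esub> g = \<zero>\<^bsub>R\<^esub>" by (simp add: Rs)
    ultimately have "\<ominus>\<^bsub>R\<^esub> g = - g" using R.minus_equality that(2) by blast
    then show ?thesis by (simp add: R.minus_eq Rs)
  qed
  have pdiff: "p (f - g) = p f \<ominus>\<^bsub>T\<^esub> p g" if "f \<in> carrier R" "g \<in> carrier R" for f g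
    unfolding Rmin[OF that, symmetric] R.minus_eq T.minus_eq using that by simp
  have peq: "p f = p g" if "f - g \<in> J" "f \<in> carrier R" "g \<in> carrier R" for f g
  proof -
    have "f - g \<in> carrier R" using Rmin[OF that(2,3)] that R.minus_closed by metis
    then have "p (f - g) = \<zero>\<^bsub>T\<^esub>" by (rule iffD2[OF p0 that(1)])
    then have "p f \<ominus>\<^bsub>T\<^esub> p g = \<zero>\<^bsub>T\<^esub>" unfolding pdiff[OF that(2,3)] .
    then show ?thesis using that(2,3) by (simp add: T.r_right_minus_eq)
  qed
  have fR: "frag_of (x, a) \<in> carrier R" if "x \<in> carrier K" "a \<in> carrier A" for x a
    using kf[OF that] by (simp add: Rs)
  define \<iota> where "\<iota> x = p (frag_of (x, \<one>\<^bsub>A\<^esub>))" for x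
  define \<kappa> where "\<kappa> a = p (frag_of (\<one>\<^bsub>K\<^esub>, a))" for a
  have padd: "p (frag_of (x \<oplus>\<^bsub>K\<^esub> y, a)) = p (frag_of (x, a)) \<oplus>\<^bsub>T\<^esub> p (frag_of (y, a))"
    if "x \<in> carrier K" "y \<in> carrier K" "a \<in> carrier A" for x y a
  proof -
    have "frag_of (x \<oplus>\<^bsub>K\<^esub> y, a) - frag_of (x, a) - frag_of (y, a) \<in> tensor_relations k K A"
      unfolding tensor_relations_def using that by blast
    then have "frag_of (x \<oplus>\<^bsub>K\<^esub> y, a) - (frag_of (x, a) \<oplus>\<^bsub>R\<^esub> frag_of (y, a)) \<in> J"
      using relJ by (simp add: Rs diff_diff_eq)
    then have "p (frag_of (x \<oplus>\<^bsub>K\<^esub> y, a)) = p (frag_of (x, a) \<oplus>\<^bsub>R\<^esub> frag_of (y, a))"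
      by (rule peq) (use that fR in simp_all)
    then show ?thesis using that fR by simp
  qed
  have padd': "p (frag_of (x, a \<oplus>\<^bsub>A\<^esub> b)) = p (frag_of (x, a)) \<oplus>\<^bsub>T\<^esub> p (frag_of (x, b))"
    if "x \<in> carrier K" "b \<in> carrier A" "a \<in> carrier A" for x b a
  proof -
    have "frag_of (x, a \<oplus>\<^bsub>A\<^esub> b) - frag_of (x, a) - frag_of (x, b) \<in> tensor_relations k K A"
      unfolding tensor_relations_def using that by blast
    then have "frag_of (x, a \<oplus>\<^bsub>A\<^esub> b) - (frag_of (x, a) \<oplus>\<^bsub>R\<^esub> frag_of (x, b)) \<in> J"
      using relJ by (simp add: Rs diff_diff_eq)
    then have "p (frag_of (x, a \<oplus>\<^bsub>A\<^esub> b)) = p (frag_of (x, a) \<oplus>\<^bsub>R\<^esub> frag_of (x, b))"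
      by (rule peq) (use that fR in simp_all)
    then show ?thesis using that fR by simp
  qed
  have pmult: "p (frag_of (x \<otimes>\<^bsub>K\<^esub> y, a \<otimes>\<^bsub>A\<^esub> b)) = p (frag_of (x, a)) \<otimes>\<^bsub>T\<^esub> p (frag_of (y, b))"
    if "x \<in> carrier K" "y \<in> carrier K" "a \<in> carrier A" "b \<in> carrier A" for x y a b
    using p.hom_mult[OF fR[OF that(1,3)] fR[OF that(2,4)]] by (simp add: Rs P.pm_of)
  have i: "\<iota> \<in> ring_hom K T"
  proof (rule ring_hom_memI)
    show "\<iota> \<one>\<^bsub>K\<^esub> = \<one>\<^bsub>T\<^esub>" using p.hom_one by (simp add: \<iota>_def Rs)
    fix x y assume xy: "x \<in> carrier K" "y \<in> carrier K"
    show "\<iota> x \<in> carrier T" unfolding \<iota>_def using fR xy by simp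
    show "\<iota> (x \<otimes>\<^bsub>K\<^esub> y) = \<iota> x \<otimes>\<^bsub>T\<^esub> \<iota> y" using pmult[OF xy A.one_closed A.one_closed] by (simp add: \<iota>_def)
    show "\<iota> (x \<oplus>\<^bsub>K\<^esub> y) = \<iota> x \<oplus>\<^bsub>T\<^esub> \<iota> y" unfolding \<iota>_def by (rule padd[OF xy A.one_closed])
  qed
  have j: "\<kappa> \<in> ring_hom A T"
  proof (rule ring_hom_memI)
    show "\<kappa> \<one>\<^bsub>A\<^esub> = \<one>\<^bsub>T\<^esub>" using p.hom_one by (simp add: \<kappa>_def Rs)
    fix x y assume xy: "x \<in> carrier A" "y \<in> carrier A"
    show "\<kappa> x \<in> carrier T" unfolding \<kappa>_def using fR xy by simp
    show "\<kappa> (x \<otimes>\<^bsub>A\<^esub> y) = \<kappa> x \<otimes>\<^bsub>T\<^esub> \<kappa> y" using pmult[OF F.one_closed F.one_closed xy] by (simp add: \<kappa>_def)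
    show "\<kappa> (x \<oplus>\<^bsub>A\<^esub> y) = \<kappa> x \<oplus>\<^bsub>T\<^esub> \<kappa> y" unfolding \<kappa>_def by (rule padd'[OF F.one_closed xy(2,1)])
  qed
  have ck: "\<iota> c = \<kappa> (c \<odot>\<^bsub>A\<^esub> \<one>\<^bsub>A\<^esub>)" if c: "c \<in> k" for c
  proof -
    have cK: "c \<in> carrier K" using c kK by blast
    have "frag_of (\<one>\<^bsub>K\<^esub> \<otimes>\<^bsub>K\<^esub> c, \<one>\<^bsub>A\<^esub>) - frag_of (\<one>\<^bsub>K\<^esub>, c \<odot>\<^bsub>A\<^esub> \<one>\<^bsub>A\<^esub>) \<in> tensor_relations k K A"
      unfolding tensor_relations_def using c F.one_closed A.one_closed by blast
    then have "frag_of (c, \<one>\<^bsub>A\<^esub>) - frag_of (\<one>\<^bsub>K\<^esub>, c \<odot>\<^bsub>A\<^esub> \<one>\<^bsub>A\<^esub>) \<in> J" using relJ cK by simp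
    then show ?thesis unfolding \<iota>_def \<kappa>_def by (rule peq) (use fR cK smc c in simp_all)
  qed
  have gen: "H = carrier T" if H: "subring H T" "\<iota> ` carrier K \<subseteq> H" "\<kappa> ` carrier A \<subseteq> H" for H
  proof
    show "H \<subseteq> carrier T" by (rule subringE(1)[OF H(1)])
    have "p f \<in> H" if "Poly_Mapping.keys f \<subseteq> P.G" for f
    proof -
      have "Poly_Mapping.keys f \<subseteq> P.G \<and> p f \<in> H" using that
      proof (induction f rule: frag_induction)
        case zero
        have "p 0 = \<zero>\<^bsub>T\<^esub>" using p.hom_zero by (simp add: Rs)
        then show ?case using subringE(2)[OF H(1)] by simp
      next
        case (one z)
        then obtain x a where z: "z = (x, a)" "x \<in> carrier K" "a \<in> carrier A" by auto
        have "p (frag_of z) = \<iota> x \<otimes>\<^bsub>T\<^esub> \<kappa> a"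
          using pmult[OF z(2) F.one_closed A.one_closed z(3)] z by (simp add: \<iota>_def \<kappa>_def)
        moreover have "\<iota> x \<in> H" "\<kappa> a \<in> H" using H(2,3) z by blast+
        ultimately show ?case using subringE(6)[OF H(1)] z kf by simp
      next
        case (diff f g)
        have c: "f \<in> carrier R" "g \<in> carrier R" using diff by (simp_all add: Rs)
        have "p f \<oplus>\<^bsub>T\<^esub> \<ominus>\<^bsub>T\<^esub> p g \<in> H" using diff subringE(5,7)[OF H(1)] by blast
        then show ?case using pdiff[OF c] kd[of f g] diff by (simp add: T.minus_eq)
      qed
      then show ?thesis by blast
    qed
    then show "carrier T \<subseteq> H" using psurj by (auto simp: Rs)
  qed
  have one: "\<one>\<^bsub>T\<^esub> \<noteq> \<zero>\<^bsub>T\<^esub>"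
  proof
    assume "\<one>\<^bsub>T\<^esub> = \<zero>\<^bsub>T\<^esub>"
    then have oneJ: "\<one>\<^bsub>R\<^esub> \<in> J" using p0[OF R.one_closed] by simp
    obtain \<phi> where \<phi>: "\<And>x. x \<in> carrier K \<Longrightarrow> \<phi> x \<in> k" "\<phi> \<one>\<^bsub>K\<^esub> = \<one>\<^bsub>K\<^esub>"
      "\<And>x y. x \<in> carrier K \<Longrightarrow> y \<in> carrier K \<Longrightarrow> \<phi> (x \<oplus>\<^bsub>K\<^esub> y) = \<phi> x \<oplus>\<^bsub>K\<^esub> \<phi> y"
      "\<And>x c. x \<in> carrier K \<Longrightarrow> c \<in> k \<Longrightarrow> \<phi> (x \<otimes>\<^bsub>K\<^esub> c) = \<phi> x \<otimes>\<^bsub>K\<^esub> c"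
      using F.exists_retraction[OF k] by metis
    let ?f = "\<lambda>(x, a). \<phi> x \<odot>\<^bsub>A\<^esub> a"
    have fim: "?f ` P.G \<subseteq> carrier (add_monoid A)" using smc \<phi>(1) by auto
    obtain h where h: "h \<in> hom (free_Abelian_group P.G) (add_monoid A)" "\<And>z. z \<in> P.G \<Longrightarrow> h (frag_of z) = ?f z"
      using comm_group.free_Abelian_group_universal[OF A.a_comm_group fim] by metis
    have hc: "h f \<in> carrier A" if "Poly_Mapping.keys f \<subseteq> P.G" for f
      using hom_in_carrier[OF h(1), of f] that by (simp add: free_Abelian_group_def)
    have hadd: "h (f + g) = h f \<oplus>\<^bsub>A\<^esub> h g" if "Poly_Mapping.keys f \<subseteq> P.G" "Poly_Mapping.keys g \<subseteq> P.G" for f g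
      using hom_mult[OF h(1), of f g] that by (simp add: free_Abelian_group_def)
    have hdiff: "h (f - g) = h f \<ominus>\<^bsub>A\<^esub> h g" if "Poly_Mapping.keys f \<subseteq> P.G" "Poly_Mapping.keys g \<subseteq> P.G" for f g
    proof -
      have "h f = h (f - g) \<oplus>\<^bsub>A\<^esub> h g" using hadd[OF kd[OF that] that(2)] by simp
      then show ?thesis using hc[OF kd[OF that]] hc[OF that(2)] A.minus_eq A.a_assoc A.r_neg A.r_zero A.a_inv_closed by metis
    qed
    have hof: "h (frag_of (x, a)) = \<phi> x \<odot>\<^bsub>A\<^esub> a" if "x \<in> carrier K" "a \<in> carrier A" for x a
      using h(2)[of "(x, a)"] that by simp
    have h0: "h 0 = \<zero>\<^bsub>A\<^esub>" using hdiff[of 0 0] hc[of 0] by (simp add: A.minus_eq A.r_neg)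
    \<comment> \<open>The map \<open>h\<close> is only additive, so its kernel need not be an ideal.
      \<open>N\<close> is the largest ideal inside the kernel; it contains the relations because
      they keep their shape when multiplied by generators.\<close>
    define N where "N = {f. Poly_Mapping.keys f \<subseteq> P.G \<and> (\<forall>g. Poly_Mapping.keys g \<subseteq> P.G \<longrightarrow> h (P.pm g f) = \<zero>\<^bsub>A\<^esub>)}"
    have Ni: "ideal N R"
    proof (rule idealI[OF cring.axioms(1)[OF R]])
      have z: "0 \<in> N" by (simp add: N_def P.pm_0_r h0)
      have sub: "f - g \<in> N" if "f \<in> N" "g \<in> N" for f g
      proof -
        have k: "Poly_Mapping.keys f \<subseteq> P.G" "Poly_Mapping.keys g \<subseteq> P.G" using that by (simp_all add: N_def)
        have "h (P.pm g' (f - g)) = \<zero>\<^bsub>A\<^esub>" if g': "Poly_Mapping.keys g' \<subseteq> P.G" for g'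
          using \<open>f \<in> N\<close> \<open>g \<in> N\<close> g' unfolding P.pm_diff_r hdiff[OF P.pm_closed[OF g' k(1)] P.pm_closed[OF g' k(2)]]
          by (simp add: N_def A.minus_eq)
        then show ?thesis using kd[OF k] by (simp add: N_def)
      qed
      show "subgroup N (add_monoid R)"
      proof (rule R.add.subgroupI)
        show "N \<subseteq> carrier R" by (auto simp: N_def Rs)
        show "N \<noteq> {}" using z by blast
        fix f assume f: "f \<in> N"
        then have fc: "f \<in> carrier R" by (auto simp: N_def Rs)
        have nf: "0 - f \<in> N" by (rule sub[OF z f])
        have a: "\<zero>\<^bsub>R\<^esub> \<ominus>\<^bsub>R\<^esub> f = \<ominus>\<^bsub>R\<^esub> f" by (simp only: R.minus_eq R.l_zero[OF R.a_inv_closed[OF fc]])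
        have "\<ominus>\<^bsub>R\<^esub> f = 0 - f" using trans[OF a[symmetric] Rmin[OF R.zero_closed fc]] by (simp only: Rs(4))
        then show "\<ominus>\<^bsub>R\<^esub> f \<in> N" using nf by simp
        fix g assume g: "g \<in> N"
        have "g - (0 - f) \<in> N" by (rule sub[OF g nf])
        moreover have "f \<oplus>\<^bsub>R\<^esub> g = g - (0 - f)" by (simp add: Rs)
        ultimately show "f \<oplus>\<^bsub>R\<^esub> g \<in> N" by simp
      qed
      fix f x assume f: "f \<in> N" and x: "x \<in> carrier R"
      have xk: "Poly_Mapping.keys x \<subseteq> P.G" using x by (simp add: Rs)
      have fk: "Poly_Mapping.keys f \<subseteq> P.G" using f by (simp add: N_def)
      have "h (P.pm g (P.pm x f)) = \<zero>\<^bsub>A\<^esub>" if g: "Poly_Mapping.keys g \<subseteq> P.G" for g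
        unfolding P.pm_assoc[OF g xk fk, symmetric] using f P.pm_closed[OF g xk] by (simp add: N_def)
      then have "P.pm x f \<in> N" using P.pm_closed[OF xk fk] by (simp add: N_def)
      then show "x \<otimes>\<^bsub>R\<^esub> f \<in> N" "f \<otimes>\<^bsub>R\<^esub> x \<in> N" using P.pm_comm[OF xk fk] by (simp_all add: Rs)
    qed
    have NI: "f \<in> N" if fk: "Poly_Mapping.keys f \<subseteq> P.G"
      and z: "\<And>y b. y \<in> carrier K \<Longrightarrow> b \<in> carrier A \<Longrightarrow> h (P.pm (frag_of (y, b)) f) = \<zero>\<^bsub>A\<^esub>" for f
    proof -
      have "Poly_Mapping.keys g \<subseteq> P.G \<and> h (P.pm g f) = \<zero>\<^bsub>A\<^esub>" if "Poly_Mapping.keys g \<subseteq> P.G" for g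
        using that
      proof (induction g rule: frag_induction)
        case zero show ?case by (simp add: P.pm_0_l h0)
      next
        case (one u) then show ?case using z by (cases u) (simp add: keys_frag_of)
      next
        case (diff a b)
        then show ?case using kd[of a b] P.pm_closed[OF _ fk] by (simp add: P.pm_diff_l hdiff A.minus_eq)
      qed
      then show ?thesis using fk by (simp add: N_def)
    qed
    have sm_add: "(c \<oplus>\<^bsub>K\<^esub> d) \<odot>\<^bsub>A\<^esub> a = c \<odot>\<^bsub>A\<^esub> a \<oplus>\<^bsub>A\<^esub> d \<odot>\<^bsub>A\<^esub> a" if "c \<in> k" "d \<in> k" "a \<in> carrier A" for c d a
      using alg.smult_l_distr[of c d a] that by simp
    have sm_add': "c \<odot>\<^bsub>A\<^esub> (a \<oplus>\<^bsub>A\<^esub> b) = c \<odot>\<^bsub>A\<^esub> a \<oplus>\<^bsub>A\<^esub> c \<odot>\<^bsub>A\<^esub> b" if "c \<in> k" "b \<in> carrier A" "a \<in> carrier A" for c b a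
      using alg.smult_r_distr[of c a b] that by simp
    have sm_m: "(c \<otimes>\<^bsub>K\<^esub> d) \<odot>\<^bsub>A\<^esub> a = c \<odot>\<^bsub>A\<^esub> (d \<odot>\<^bsub>A\<^esub> a)" if "c \<in> k" "d \<in> k" "a \<in> carrier A" for c d a
      using alg.smult_assoc1[of c d a] that by simp
    have cancel: "u \<oplus>\<^bsub>A\<^esub> v \<ominus>\<^bsub>A\<^esub> u \<ominus>\<^bsub>A\<^esub> v = \<zero>\<^bsub>A\<^esub>" if "u \<in> carrier A" "v \<in> carrier A" for u v
    proof -
      have "u \<oplus>\<^bsub>A\<^esub> v \<ominus>\<^bsub>A\<^esub> u = v" using that by (simp add: A.minus_eq A.a_comm[of u v] A.a_assoc A.r_neg)
      then show ?thesis using that by (simp add: A.minus_eq A.r_neg)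
    qed
    have "tensor_relations k K A \<subseteq> N"
    proof
      fix f assume f: "f \<in> tensor_relations k K A"
      have fk: "Poly_Mapping.keys f \<subseteq> P.G" using rel_sub f by (auto simp: Rs)
      from f consider (1) x y a where "f = frag_of (x \<oplus>\<^bsub>K\<^esub> y, a) - frag_of (x, a) - frag_of (y, a)" "x \<in> carrier K" "y \<in> carrier K" "a \<in> carrier A"
        | (2) x a b where "f = frag_of (x, a \<oplus>\<^bsub>A\<^esub> b) - frag_of (x, a) - frag_of (x, b)" "x \<in> carrier K" "a \<in> carrier A" "b \<in> carrier A"
        | (3) x c a where "f = frag_of (x \<otimes>\<^bsub>K\<^esub> c, a) - frag_of (x, c \<odot>\<^bsub>A\<^esub> a)" "x \<in> carrier K" "c \<in> k" "a \<in> carrier A"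
        unfolding tensor_relations_def by blast
      then show "f \<in> N"
      proof cases
        case 1
        show ?thesis
        proof (rule NI[OF fk])
          fix y' b assume yb: "y' \<in> carrier K" "b \<in> carrier A"
          have m: "y' \<otimes>\<^bsub>K\<^esub> x \<in> carrier K" "y' \<otimes>\<^bsub>K\<^esub> y \<in> carrier K" "b \<otimes>\<^bsub>A\<^esub> a \<in> carrier A" using 1 yb by simp_all
          have "h (P.pm (frag_of (y', b)) f) = \<phi> (y' \<otimes>\<^bsub>K\<^esub> x \<oplus>\<^bsub>K\<^esub> y' \<otimes>\<^bsub>K\<^esub> y) \<odot>\<^bsub>A\<^esub> (b \<otimes>\<^bsub>A\<^esub> a) \<ominus>\<^bsub>A\<^esub> \<phi> (y' \<otimes>\<^bsub>K\<^esub> x) \<odot>\<^bsub>A\<^esub> (b \<otimes>\<^bsub>A\<^esub> a) \<ominus>\<^bsub>A\<^esub> \<phi> (y' \<otimes>\<^bsub>K\<^esub> y) \<odot>\<^bsub>A\<^esub> (b \<otimes>\<^bsub>A\<^esub> a)"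
            using 1 yb m by (simp add: P.pm_diff_r P.pm_of hdiff kd kf hof F.r_distr)
          then show "h (P.pm (frag_of (y', b)) f) = \<zero>\<^bsub>A\<^esub>"
            using m \<phi>(1) smc by (simp add: \<phi>(3) sm_add cancel)
        qed
      next
        case 2
        show ?thesis
        proof (rule NI[OF fk])
          fix y' b' assume yb: "y' \<in> carrier K" "b' \<in> carrier A"
          have m: "y' \<otimes>\<^bsub>K\<^esub> x \<in> carrier K" "b' \<otimes>\<^bsub>A\<^esub> a \<in> carrier A" "b' \<otimes>\<^bsub>A\<^esub> b \<in> carrier A" using 2 yb by simp_all
          have "h (P.pm (frag_of (y', b')) f) = \<phi> (y' \<otimes>\<^bsub>K\<^esub> x) \<odot>\<^bsub>A\<^esub> (b' \<otimes>\<^bsub>A\<^esub> a \<oplus>\<^bsub>A\<^esub> b' \<otimes>\<^bsub>A\<^esub> b) \<ominus>\<^bsub>A\<^esub> \<phi> (y' \<otimes>\<^bsub>K\<^esub> x) \<odot>\<^bsub>A\<^esub> (b' \<otimes>\<^bsub>A\<^esub> a) \<ominus>\<^bsub>A\<^esub> \<phi> (y' \<otimes>\<^bsub>K\<^esub> x) \<odot>\<^bsub>A\<^esub> (b' \<otimes>\<^bsub>A\<^esub> b)"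
            using 2 yb m by (simp add: P.pm_diff_r P.pm_of hdiff kd kf hof A.r_distr)
          then show "h (P.pm (frag_of (y', b')) f) = \<zero>\<^bsub>A\<^esub>"
            using m \<phi>(1) smc by (simp add: sm_add' cancel)
        qed
      next
        case 3
        have cK: "c \<in> carrier K" using 3 kK by blast
        show ?thesis
        proof (rule NI[OF fk])
          fix y' b' assume yb: "y' \<in> carrier K" "b' \<in> carrier A"
          have m: "y' \<otimes>\<^bsub>K\<^esub> x \<in> carrier K" "b' \<otimes>\<^bsub>A\<^esub> a \<in> carrier A" using 3 yb by simp_all
          have ca: "b' \<otimes>\<^bsub>A\<^esub> (c \<odot>\<^bsub>A\<^esub> a) = c \<odot>\<^bsub>A\<^esub> (b' \<otimes>\<^bsub>A\<^esub> a)"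
            using alg.smult_assoc2[of c a b'] 3 yb smc[of c a] by (simp add: A.m_comm)
          have "y' \<otimes>\<^bsub>K\<^esub> (x \<otimes>\<^bsub>K\<^esub> c) = (y' \<otimes>\<^bsub>K\<^esub> x) \<otimes>\<^bsub>K\<^esub> c" using 3 yb cK by (simp add: F.m_assoc)
          then have "h (P.pm (frag_of (y', b')) f) = (\<phi> (y' \<otimes>\<^bsub>K\<^esub> x) \<otimes>\<^bsub>K\<^esub> c) \<odot>\<^bsub>A\<^esub> (b' \<otimes>\<^bsub>A\<^esub> a) \<ominus>\<^bsub>A\<^esub> \<phi> (y' \<otimes>\<^bsub>K\<^esub> x) \<odot>\<^bsub>A\<^esub> (c \<odot>\<^bsub>A\<^esub> (b' \<otimes>\<^bsub>A\<^esub> a))"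
            using 3 yb m cK smc by (simp add: P.pm_diff_r P.pm_of hdiff kd kf hof ca \<phi>(4))
          then show "h (P.pm (frag_of (y', b')) f) = \<zero>\<^bsub>A\<^esub>"
            using m \<phi>(1) smc 3 by (simp add: sm_m A.minus_eq A.r_neg)
        qed
      qed
    qed
    then have "J \<subseteq> N" unfolding J_def by (rule R.genideal_minimal[OF Ni])
    then have "\<one>\<^bsub>R\<^esub> \<in> N" using oneJ by blast
    then have "h (P.pm (frag_of (\<one>\<^bsub>K\<^esub>, \<one>\<^bsub>A\<^esub>)) (frag_of (\<one>\<^bsub>K\<^esub>, \<one>\<^bsub>A\<^esub>))) = \<zero>\<^bsub>A\<^esub>"
      unfolding N_def using kf[OF F.one_closed A.one_closed] by (simp add: Rs)
    then have "\<one>\<^bsub>K\<^esub> \<odot>\<^bsub>A\<^esub> \<one>\<^bsub>A\<^esub> = \<zero>\<^bsub>A\<^esub>" by (simp add: P.pm_of hof \<phi>(2))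
    then show False using alg.smult_one[of "\<one>\<^bsub>A\<^esub>"] A.one_not_zero by simp
  qed
  show thesis
  proof (rule that)
    show "nonzero_cring (tensor_product k K A)"
      unfolding T by (simp add: nonzero_cring_def nonzero_cring_axioms_def Tc one)
    show "ring_hom_cring K (tensor_product k K A) \<iota>" "ring_hom_cring A (tensor_product k K A) \<kappa>"
      unfolding T by (simp_all add: ring_hom_cring_def ring_hom_cring_axioms_def Tc i j fieldE(1)[OF K] A.is_cring)
    show "\<And>c. c \<in> k \<Longrightarrow> \<iota> c = \<kappa> (c \<odot>\<^bsub>A\<^esub> \<one>\<^bsub>A\<^esub>)" by (rule ck)
    show "\<And>H. subring H (tensor_product k K A) \<Longrightarrow> \<iota> ` carrier K \<subseteq> H \<Longrightarrow> \<kappa> ` carrier A \<subseteq> H \<Longrightarrow> H = carrier (tensor_product k K A)"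
      unfolding T by (rule gen)
  qed
qed

section \<open>The separable closure\<close>

text \<open>The value at \<open>x\<close> of the formal derivative, with coefficients listed from
  the highest degree. For a constant term the truncated exponent \<open>length p - 1\<close> is
  harmless, because the multiple taken is the zeroth.\<close>

primrec deriv_value :: "('a, 'm) ring_scheme \<Rightarrow> 'a \<Rightarrow> 'a list \<Rightarrow> 'a"
  where "deriv_value R x [] = \<zero>\<^bsub>R\<^esub>"
  | "deriv_value R x (c # p) = add_pow R (length p) (c \<otimes>\<^bsub>R\<^esub> x [^]\<^bsub>R\<^esub> (length p - 1)) \<oplus>\<^bsub>R\<^esub> deriv_value R x p"

text \<open>The same derivative as a coefficient list, one entry shorter, which is needed to compare
  degrees; \<open>deriv_value\<close> is the form that follows sums and linear factors.\<close>

primrec deriv_list :: "('a, 'm) ring_scheme \<Rightarrow> 'a list \<Rightarrow> 'a list"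
  where "deriv_list R [] = []"
  | "deriv_list R (c # p) = (if p = [] then [] else add_pow R (length p) c # deriv_list R p)"

lemma length_deriv_list: "length (deriv_list R p) = length p - 1"
  by (induct p) auto

lemma nth_deriv_list: "i < length p - 1 \<Longrightarrow> deriv_list R p ! i = add_pow R (length p - 1 - i) (p ! i)"
proof (induct p arbitrary: i)
  case (Cons c p)
  then show ?case by (cases i) auto
qed simp

context cring
begin

lemma deriv_closed: "set p \<subseteq> carrier R \<Longrightarrow> x \<in> carrier R \<Longrightarrow> deriv_value R x p \<in> carrier R"
  by (induct p) auto

text \<open>The product rule for multiplication by the variable, which on coefficient lists appends
  a zero.\<close>

lemma deriv_append_zero:
  assumes "x \<in> carrier R" "set p \<subseteq> carrier R"
  shows "deriv_value R x (p @ [\<zero>]) = x \<otimes> deriv_value R x p \<oplus> eval p x"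
  using assms(2)
proof (induct p)
  case Nil then show ?case using assms(1) by simp
next
  case (Cons c p)
  let ?l = "length p"
  have c: "c \<in> carrier R" and p: "set p \<subseteq> carrier R" using Cons by auto
  note cl = assms(1) c deriv_closed[OF p assms(1)] eval_in_carrier[OF p assms(1)]
  have e: "x \<otimes> add_pow R ?l (c \<otimes> x [^] (?l - 1)) = add_pow R ?l (c \<otimes> x [^] ?l)"
  proof (cases ?l)
    case 0 then show ?thesis using cl by simp
  next
    case (Suc l)
    have "x \<otimes> (c \<otimes> x [^] l) = c \<otimes> x [^] Suc l" using cl by (simp add: m_ac)
    then show ?thesis using Suc cl by (simp add: add_pow_rdistr del: nat_pow_Suc add.nat_pow_Suc)
  qed
  have "deriv_value R x ((c # p) @ [\<zero>]) = (add_pow R ?l (c \<otimes> x [^] ?l) \<oplus> c \<otimes> x [^] ?l) \<oplus> (x \<otimes> deriv_value R x p \<oplus> eval p x)"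
    using Cons p by simp
  also have "\<dots> = (add_pow R ?l (c \<otimes> x [^] ?l) \<oplus> x \<otimes> deriv_value R x p) \<oplus> (c \<otimes> x [^] ?l \<oplus> eval p x)"
    using cl by (simp add: a_ac)
  also have "\<dots> = x \<otimes> deriv_value R x (c # p) \<oplus> eval (c # p) x"
    unfolding e[symmetric] using cl by (simp add: r_distr)
  finally show ?case .
qed

lemma deriv_scale:
  assumes "x \<in> carrier R" "set p \<subseteq> carrier R" "b \<in> carrier R"
  shows "deriv_value R x (map ((\<otimes>) b) p) = b \<otimes> deriv_value R x p"
  using assms(2)
proof (induct p)
  case (Cons c p)
  have c: "c \<in> carrier R" and p: "set p \<subseteq> carrier R" using Cons by auto
  have "add_pow R (length p) (b \<otimes> c \<otimes> x [^] (length p - 1)) = b \<otimes> add_pow R (length p) (c \<otimes> x [^] (length p - 1))"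
    using assms(1,3) c by (simp add: add_pow_rdistr m_assoc)
  then show ?case using Cons p c assms deriv_closed[OF p assms(1)] by (simp add: r_distr)
qed (use assms in simp)

lemma deriv_normalize:
  assumes "x \<in> carrier R" "set p \<subseteq> carrier R"
  shows "deriv_value R x (normalize p) = deriv_value R x p"
  using assms(2)
proof (induct p)
  case (Cons c p)
  then show ?case using assms(1) deriv_closed[of p x] by (cases "c = \<zero>") auto
qed simp

lemma deriv_zeros:
  assumes "x \<in> carrier R" "set p \<subseteq> carrier R"
  shows "deriv_value R x (replicate n \<zero> @ p) = deriv_value R x p"
  by (induct n) (use assms deriv_closed[of p x] in auto)

lemma deriv_map2:
  assumes "x \<in> carrier R" "length p = length q" "set p \<subseteq> carrier R" "set q \<subseteq> carrier R"
  shows "deriv_value R x (map2 (\<oplus>) p q) = deriv_value R x p \<oplus> deriv_value R x q"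
  using assms(2-4)
proof (induct p q rule: list_induct2)
  case (Cons a p b q)
  have c: "a \<in> carrier R" "b \<in> carrier R" and p: "set p \<subseteq> carrier R" "set q \<subseteq> carrier R" using Cons by auto
  let ?y = "x [^] (length p - 1)"
  have y: "?y \<in> carrier R" using assms(1) by simp
  have "add_pow R (length p) ((a \<oplus> b) \<otimes> ?y) = add_pow R (length p) (a \<otimes> ?y) \<oplus> add_pow R (length p) (b \<otimes> ?y)"
    using c y by (simp add: l_distr add.nat_pow_distrib)
  then show ?case using Cons c p y deriv_closed[OF p(1) assms(1)] deriv_closed[OF p(2) assms(1)]
    by (simp add: a_ac)
qed simp

lemma deriv_poly_add:
  assumes x: "x \<in> carrier R" and p: "set p \<subseteq> carrier R" and q: "set q \<subseteq> carrier R"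
  shows "deriv_value R x (poly_add p q) = deriv_value R x p \<oplus> deriv_value R x q"
proof -
  have aux: "deriv_value R x (poly_add p q) = deriv_value R x p \<oplus> deriv_value R x q"
    if l: "length p \<ge> length q" and p: "set p \<subseteq> carrier R" and q: "set q \<subseteq> carrier R" for p q
  proof -
    let ?q = "replicate (length p - length q) \<zero> @ q"
    have q': "set ?q \<subseteq> carrier R" "length p = length ?q" using q l by auto
    have "set (map2 (\<oplus>) p ?q) \<subseteq> carrier R"
    proof -
      have "a \<oplus> b \<in> carrier R" if "(a, b) \<in> set (zip p ?q)" for a b
        using set_zip_leftD[OF that] set_zip_rightD[OF that] p q'(1) by blast
      then show ?thesis by auto
    qed
    then have "deriv_value R x (poly_add p q) = deriv_value R x (map2 (\<oplus>) p ?q)"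
      using l deriv_normalize[OF x] by simp
    also have "\<dots> = deriv_value R x p \<oplus> deriv_value R x ?q" by (rule deriv_map2[OF x q'(2) p q'(1)])
    finally show ?thesis using deriv_zeros[OF x q] by simp
  qed
  show ?thesis
  proof (cases "length p \<ge> length q")
    case True then show ?thesis using aux p q by blast
  next
    case False
    then have "poly_add p q = poly_add q p" by simp
    moreover have "deriv_value R x (poly_add q p) = deriv_value R x q \<oplus> deriv_value R x p"
      using aux[of p q] False p q by (intro aux) simp_all
    ultimately show ?thesis using deriv_closed[OF p x] deriv_closed[OF q x] by (simp add: a_comm)
  qed
qed

text \<open>By the product rule the derivative of \<open>(X - x) p\<close> is
  \<open>p + (X - x) p'\<close>, and the second summand vanishes at \<open>x\<close>.\<close>

lemma deriv_linear_factor: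
  assumes x: "x \<in> carrier R" and p: "set p \<subseteq> carrier R"
  shows "deriv_value R x (poly_mult [\<one>, \<ominus> x] p) = eval p x"
proof -
  have m: "set (map ((\<otimes>) b) p) \<subseteq> carrier R" if "b \<in> carrier R" for b using p that by auto
  have m1: "map ((\<otimes>) \<one>) p = p" using p by (induct p) auto
  have n: "set (poly_add (map ((\<otimes>) (\<ominus> x)) p) []) \<subseteq> carrier R"
    by (rule poly_add_in_carrier) (use m x in auto)
  have "poly_mult [\<one>, \<ominus> x] p = poly_add (p @ [\<zero>]) (poly_add (map ((\<otimes>) (\<ominus> x)) p) [])"
    by (simp add: m1 del: poly_add.simps)
  then have "deriv_value R x (poly_mult [\<one>, \<ominus> x] p) = deriv_value R x (p @ [\<zero>]) \<oplus> deriv_value R x (poly_add (map ((\<otimes>) (\<ominus> x)) p) [])"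
    using deriv_poly_add[OF x, of "p @ [\<zero>]"] n p by (simp del: poly_add.simps)
  also have "deriv_value R x (poly_add (map ((\<otimes>) (\<ominus> x)) p) []) = (\<ominus> x) \<otimes> deriv_value R x p"
    using deriv_poly_add[OF x m, of "\<ominus> x" "[]"] x deriv_scale[OF x p, of "\<ominus> x"] deriv_closed[OF p x]
    by (simp del: poly_add.simps)
  also have "deriv_value R x (p @ [\<zero>]) = x \<otimes> deriv_value R x p \<oplus> eval p x" by (rule deriv_append_zero[OF x p])
  finally have "deriv_value R x (poly_mult [\<one>, \<ominus> x] p) = x \<otimes> deriv_value R x p \<oplus> eval p x \<oplus> (\<ominus> x) \<otimes> deriv_value R x p" .
  also have "\<dots> = eval p x"
    using x deriv_closed[OF p x] eval_in_carrier[OF p x] by algebra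
  finally show ?thesis .
qed

lemma eval_deriv_list:
  assumes x: "x \<in> carrier R" and p: "set p \<subseteq> carrier R"
  shows "eval (deriv_list R p) x = deriv_value R x p"
  using p
proof (induct p)
  case (Cons c p)
  have c: "c \<in> carrier R" and p: "set p \<subseteq> carrier R" using Cons by auto
  show ?case
  proof (cases "p = []")
    case True then show ?thesis using c x by simp
  next
    case False
    have "add_pow R (length p) c \<otimes> x [^] (length p - 1) = add_pow R (length p) (c \<otimes> x [^] (length p - 1))"
      using c x by (simp add: add_pow_ldistr)
    then show ?thesis using False Cons(1)[OF p] by (simp add: length_deriv_list)
  qed
qed simp

lemma deriv_list_closed: "set p \<subseteq> carrier R \<Longrightarrow> set (deriv_list R p) \<subseteq> carrier R"
  by (induct p) auto

end

lemma (in ring_hom_cring) hom_add_pow: "c \<in> carrier R \<Longrightarrow> h (add_pow R (n::nat) c) = add_pow S n (h c)"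
  by (induct n) simp_all

lemma (in ring_hom_cring) map_deriv_list: "set p \<subseteq> carrier R \<Longrightarrow> map h (deriv_list R p) = deriv_list S (map h p)"
  by (induct p) (simp_all add: hom_add_pow)

section \<open>Multiple roots and inseparable elements\<close>

lemma (in domain) double_root:
  assumes a: "a \<in> carrier R" and f: "f \<in> carrier (poly_ring R)" and m: "\<not> alg_mult f a \<le> 1"
  shows "eval f a = \<zero>" "deriv_value R a f = \<zero>"
proof -
  let ?l = "[\<one>, \<ominus> a]"
  interpret P: domain "poly_ring R" by (rule univ_poly_is_domain[OF carrier_is_subring])
  have f0: "f \<noteq> []" using m by (auto simp: alg_mult_def)
  have lc: "?l \<in> carrier (poly_ring R)" using a by (auto simp: univ_poly_def polynomial_def)
  have "2 \<le> alg_mult f a" using m by simp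
  then have "?l [^]\<^bsub>poly_ring R\<^esub> (2::nat) pdivides f" by (rule le_alg_mult_imp_pdivides[OF a f])
  then obtain g where g: "g \<in> carrier (poly_ring R)" "f = ?l [^]\<^bsub>poly_ring R\<^esub> (2::nat) \<otimes>\<^bsub>poly_ring R\<^esub> g"
    unfolding pdivides_def factor_def by blast
  have "?l [^]\<^bsub>poly_ring R\<^esub> (2::nat) = ?l \<otimes>\<^bsub>poly_ring R\<^esub> ?l" using lc by (simp add: numeral_2_eq_2)
  then have "f = ?l \<otimes>\<^bsub>poly_ring R\<^esub> (?l \<otimes>\<^bsub>poly_ring R\<^esub> g)" using g lc P.m_assoc by simp
  then have fe: "f = poly_mult ?l (poly_mult ?l g)" by (simp add: univ_poly_mult)
  have gs: "set g \<subseteq> carrier R" using g(1) by (simp add: univ_poly_def polynomial_incl)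
  have ls: "set ?l \<subseteq> carrier R" using a by simp
  have lgs: "set (poly_mult ?l g) \<subseteq> carrier R" by (rule poly_mult_in_carrier[OF ls gs])
  have el: "eval ?l a = \<zero>" using a by (simp add: r_neg)
  have e0: "eval (poly_mult ?l h) a = \<zero>" if "set h \<subseteq> carrier R" for h
    using eval_poly_mult[OF ls that a] el eval_in_carrier[OF that a] by simp
  show "eval f a = \<zero>" unfolding fe by (rule e0[OF lgs])
  show "deriv_value R a f = \<zero>" unfolding fe using deriv_linear_factor[OF a lgs] e0[OF gs] by simp
qed

text \<open>The polynomials that vanish at \<open>a\<close> form a prime ideal. It contains the
  ideal generated by the irreducible \<open>f\<close>, which is maximal, so the two are equal. Hence
  \<open>f\<close> divides \<open>D\<close>, which is impossible for a nonzero \<open>D\<close> of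
  smaller degree.\<close>

lemma (in field) common_root_deriv_zero:
  assumes L: "field L" and h: "h \<in> ring_hom R L" and a: "a \<in> carrier L"
    and f: "f \<in> carrier (poly_ring R)" and irr: "pirreducible (carrier R) f"
    and root: "ring.eval L (map h f) a = \<zero>\<^bsub>L\<^esub>" and D: "D \<in> carrier (poly_ring R)"
    and Droot: "ring.eval L (map h D) a = \<zero>\<^bsub>L\<^esub>" and deg: "degree D < degree f"
  shows "D = []"
proof (rule ccontr)
  assume D0: "D \<noteq> []"
  interpret L: field L by (rule L)
  interpret h: ring_hom_cring R L h
    by (simp add: ring_hom_cring_def ring_hom_cring_axioms_def h is_cring fieldE(1)[OF L])
  interpret P: principal_domain "poly_ring R" by (rule univ_poly_is_principal[OF carrier_is_subfield])
  define \<Psi> where "\<Psi> p = L.eval (map h p) a" for p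
  have inc: "set p \<subseteq> carrier R" if "p \<in> carrier (poly_ring R)" for p
    using that by (simp add: univ_poly_def polynomial_incl)
  have hinc: "set (map h p) \<subseteq> carrier L" if "set p \<subseteq> carrier R" for p using that by auto
  have hom: "\<Psi> \<in> ring_hom (poly_ring R) L"
  proof (rule ring_hom_memI)
    show "\<Psi> \<one>\<^bsub>poly_ring R\<^esub> = \<one>\<^bsub>L\<^esub>" using a by (simp add: \<Psi>_def univ_poly_one)
    fix p q assume pq: "p \<in> carrier (poly_ring R)" "q \<in> carrier (poly_ring R)"
    note s = inc[OF pq(1)] inc[OF pq(2)]
    show "\<Psi> p \<in> carrier L" unfolding \<Psi>_def by (rule L.eval_in_carrier[OF hinc[OF s(1)] a])
    have "L.eval (map h (poly_add p q)) a = L.eval (L.normalize (map h (poly_add p q))) a"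
      by (rule L.eval_normalize[OF hinc[OF poly_add_in_carrier[OF s]] a, symmetric])
    also have "\<dots> = \<Psi> p \<oplus>\<^bsub>L\<^esub> \<Psi> q"
      unfolding h.ring.poly_add_hom'[OF s] \<Psi>_def by (rule L.eval_poly_add[OF hinc[OF s(1)] hinc[OF s(2)] a])
    finally show "\<Psi> (p \<oplus>\<^bsub>poly_ring R\<^esub> q) = \<Psi> p \<oplus>\<^bsub>L\<^esub> \<Psi> q" by (simp add: \<Psi>_def univ_poly_add)
    have "L.eval (map h (poly_mult p q)) a = L.eval (L.normalize (map h (poly_mult p q))) a"
      by (rule L.eval_normalize[OF hinc[OF poly_mult_in_carrier[OF s]] a, symmetric])
    also have "\<dots> = \<Psi> p \<otimes>\<^bsub>L\<^esub> \<Psi> q"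
      unfolding h.ring.poly_mult_hom'[OF s] \<Psi>_def by (rule L.eval_poly_mult[OF hinc[OF s(1)] hinc[OF s(2)] a])
    finally show "\<Psi> (p \<otimes>\<^bsub>poly_ring R\<^esub> q) = \<Psi> p \<otimes>\<^bsub>L\<^esub> \<Psi> q" by (simp add: \<Psi>_def univ_poly_mult)
  qed
  interpret \<Psi>: ring_hom_cring "poly_ring R" L \<Psi>
    by (simp add: ring_hom_cring_def ring_hom_cring_axioms_def hom P.is_cring fieldE(1)[OF L])
  define I where "I = contract (poly_ring R) \<Psi> {\<zero>\<^bsub>L\<^esub>}"
  have "I \<in> spec (poly_ring R)" unfolding I_def
    by (rule contract_spec[OF \<Psi>.ring_hom_cring_axioms]) (use L.zeroprimeideal in \<open>simp add: spec_iff\<close>)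
  then interpret I: primeideal I "poly_ring R" by (simp add: spec_iff)
  have fI: "f \<in> I" "D \<in> I" using f D root Droot by (simp_all add: I_def \<Psi>_def)
  have "maximalideal (PIdl\<^bsub>poly_ring R\<^esub> f) (poly_ring R)"
    by (rule P.irreducible_imp_maximalideal[OF f irr])
  then interpret M: maximalideal "PIdl\<^bsub>poly_ring R\<^esub> f" "poly_ring R" .
  have le: "PIdl\<^bsub>poly_ring R\<^esub> f \<subseteq> I" by (rule P.cgenideal_minimal[OF I.is_ideal fI(1)])
  have "I = PIdl\<^bsub>poly_ring R\<^esub> f"
    using M.I_maximal[OF I.is_ideal le] I.Icarr I.I_notcarr by blast
  then have "D \<in> PIdl\<^bsub>poly_ring R\<^esub> f" using fI(2) by simp
  then obtain g where "g \<in> carrier (poly_ring R)" "D = g \<otimes>\<^bsub>poly_ring R\<^esub> f" unfolding cgenideal_def by blast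
  then have "f pdivides D" unfolding pdivides_def factor_def using P.m_comm[OF _ f] by blast
  then have "degree f \<le> degree D" by (rule pdivides_imp_degree_le[OF carrier_is_subring f D D0])
  then show False using deg by simp
qed

text \<open>In a field a product of two multiples of \<open>\<one>\<close> vanishes only if one of
  them does, so splitting off prime factors of \<open>n\<close> ends at a prime that annihilates
  \<open>\<one>\<close>.\<close>

lemma (in field) add_pow_one_prime:
  assumes "n \<ge> 1" "add_pow R (n::nat) \<one> = \<zero>"
  shows "\<exists>p. Factorial_Ring.prime p \<and> p dvd n \<and> add_pow R p \<one> = \<zero>"
  using assms
proof (induct n rule: less_induct)
  case (less n)
  have "n \<noteq> 1" using less(3) by auto
  then obtain p where p: "Factorial_Ring.prime p" "p dvd n" using prime_factor_nat by blast
  obtain m where m: "n = p * m" using p(2) by (rule dvdE)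
  have "add_pow R n \<one> = add_pow R p \<one> \<otimes> add_pow R m \<one>"
    unfolding m by (simp add: add_pow_ldistr add.nat_pow_pow mult.commute)
  then have "add_pow R p \<one> = \<zero> \<or> add_pow R m \<one> = \<zero>" using less(3) integral_iff[of "add_pow R p \<one>" "add_pow R m \<one>"] by simp
  then show ?case
  proof
    assume z: "add_pow R m \<one> = \<zero>"
    have m1: "m \<ge> 1" using m less(2) by (cases m) auto
    moreover have "m < n" using m m1 prime_gt_1_nat[OF p(1)] mult_strict_right_mono[of 1 p m] by simp
    ultimately obtain p' where "Factorial_Ring.prime p'" "p' dvd m" "add_pow R p' \<one> = \<zero>" using less(1) z by blast
    then show ?thesis using m by (intro exI[of _ p']) auto
  qed (use p in blast)
qed

text \<open>Otherwise Bezout's identity would write 1 as a combination of \<open>n\<close> and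
  \<open>p\<close>, both of which annihilate \<open>\<one>\<close>.\<close>

lemma (in field) add_pow_zero_dvd:
  fixes p :: nat
  assumes p: "Factorial_Ring.prime p" "add_pow R p \<one> = \<zero>" and c: "c \<in> carrier R" "c \<noteq> \<zero>" "add_pow R (n::nat) c = \<zero>"
  shows "p dvd n"
proof (rule ccontr)
  assume "\<not> p dvd n"
  then have "coprime p n" using p(1) by (simp add: prime_imp_coprime_nat)
  then have g: "gcd n p = 1" by (simp add: coprime_iff_gcd_eq_1 gcd.commute)
  have n0: "n \<noteq> 0" using \<open>\<not> p dvd n\<close> by (cases n) auto
  obtain u v where uv: "n * u = p * v + gcd n p" using bezout_nat[OF n0] by blast
  have "add_pow R n c = add_pow R n \<one> \<otimes> c" using c by (simp add: add_pow_ldistr)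
  then have n1: "add_pow R n \<one> = \<zero>" using c integral_iff[of "add_pow R n \<one>" c] by simp
  have z: "add_pow R (m * k) \<one> = \<zero>" if "add_pow R m \<one> = \<zero>" for m k :: nat
    using add.nat_pow_pow[of \<one> k m] that by simp
  have "add_pow R (p * v + 1) \<one> = \<one>" using z[OF p(2), of v] by simp
  then show False using z[OF n1, of u] uv g by simp
qed

text \<open>A multiple root of the irreducible \<open>f = Irr E x\<close> is a root of its
  derivative, which has smaller degree and therefore vanishes identically. Then only exponents
  divisible by the characteristic \<open>p\<close> occur in \<open>f\<close>, and replacing
  \<open>X^p\<close> by \<open>X\<close> gives a polynomial of smaller degree with root
  \<open>x [^] p\<close>.\<close>

lemma (in field) inseparable_step:
  assumes E: "subfield E R" and x: "x \<in> carrier R" and alg: "(algebraic over E) x"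
    and ns: "\<not> separable_poly (R\<lparr>carrier := E\<rparr>) (Irr E x)"
  shows "\<exists>p. Factorial_Ring.prime p \<and> add_pow R p \<one> = \<zero> \<and> (algebraic over E) (x [^] (p::nat)) \<and>
    degree (Irr E (x [^] p)) < degree (Irr E x)"
proof -
  let ?F = "R\<lparr>carrier := E\<rparr>"
  have Es: "subring E R" by (rule subfieldE(1)[OF E])
  have ER: "E \<subseteq> carrier R" by (rule subfieldE(3)[OF E])
  have F: "field ?F" using subfield_iff(2)[OF E] .
  interpret F: field ?F by (rule F)
  define f where "f = Irr E x"
  have fE: "f \<in> carrier (E[X])" and firr: "pirreducible E f" and flead: "lead_coeff f = \<one>" and f0: "eval f x = \<zero>"
    unfolding f_def using IrrE[OF E x alg] by blast+
  have con: "E[X] = poly_ring ?F" using univ_poly_consistent[OF Es] by simp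
  have fF: "f \<in> carrier (poly_ring ?F)" using fE con by simp
  have firrF: "ring_irreducible\<^bsub>poly_ring ?F\<^esub> f" using firr unfolding con .
  have deg: "degree f \<ge> 1" by (rule pirreducible_degree[OF E fE firr])
  let ?L = "F.alg_closure" and ?h = "F.indexed_const"
  have L: "field ?L" using F.alg_closureE(1) by (simp add: algebraic_closure_def)
  interpret L: field ?L by (rule L)
  have h: "?h \<in> ring_hom ?F ?L" by (rule F.alg_closureE(2))
  interpret h: ring_hom_cring ?F ?L ?h
    by (simp add: ring_hom_cring_def ring_hom_cring_axioms_def h F.is_cring fieldE(1)[OF L])
  obtain a where a: "a \<in> carrier ?L" "\<not> L.alg_mult (map ?h f) a \<le> 1"
    using ns unfolding separable_poly_def f_def[symmetric] by blast
  have hf: "map ?h f \<in> carrier (poly_ring ?L)" by (rule polynomial_hom[OF h F L fF])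
  note dr = L.double_root[OF a(1) hf a(2)]
  have fs: "set f \<subseteq> carrier ?F" using fF by (simp add: univ_poly_def F.polynomial_incl)
  define D where "D = F.normalize (deriv_list ?F f)"
  have ds: "set (deriv_list ?F f) \<subseteq> carrier ?F" by (rule F.deriv_list_closed[OF fs])
  have DF: "D \<in> carrier (poly_ring ?F)" unfolding D_def using F.normalize_gives_polynomial[OF ds] by (simp add: univ_poly_def)
  have "length D \<le> length f - 1" unfolding D_def using F.normalize_length_le[of "deriv_list ?F f"] by (simp add: length_deriv_list)
  then have dD: "degree D < degree f" using deg by linarith
  have hfs: "set (map ?h f) \<subseteq> carrier ?L" using fs h.hom_closed by auto
  have eval_map_normalize: "L.eval (map ?h (F.normalize p)) a = L.eval (map ?h p) a" if "set p \<subseteq> carrier ?F" for p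
    using that
  proof (induct p)
    case (Cons c p)
    have "set (map ?h p) \<subseteq> carrier ?L" using Cons(2) h.hom_closed by auto
    then have "L.eval (map ?h p) a \<in> carrier ?L" by (rule L.eval_in_carrier[OF _ a(1)])
    then show ?case using Cons a(1) h.hom_zero by (cases "c = \<zero>\<^bsub>?F\<^esub>") simp_all
  qed simp
  have "L.eval (map ?h (deriv_list ?F f)) a = \<zero>\<^bsub>?L\<^esub>"
    unfolding h.map_deriv_list[OF fs] L.eval_deriv_list[OF a(1) hfs] by (rule dr(2))
  moreover have "L.eval (map ?h D) a = L.eval (map ?h (deriv_list ?F f)) a"
    unfolding D_def by (rule eval_map_normalize[OF ds])
  ultimately have Dr: "L.eval (map ?h D) a = \<zero>\<^bsub>?L\<^esub>" by simp
  have "D = []" by (rule F.common_root_deriv_zero[OF L h a(1) fF firrF dr(1) DF Dr dD])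
  then have dz: "set (deriv_list ?F f) \<subseteq> {\<zero>}" unfolding D_def F.normalize_Nil_iff by simp
  have apF: "add_pow ?F n c = add_pow R n c" for n :: nat and c
    by (simp add: add_pow_def nat_pow_def)
  have fl: "length f = Suc (degree f)" using deg by (cases f) auto
  have fR: "set f \<subseteq> carrier R" using fs ER by auto
  have cz: "add_pow R n (coeff f n) = \<zero>" if n: "1 \<le> n" "n \<le> degree f" for n
  proof -
    let ?i = "degree f - n"
    have i: "?i < length f - 1" using n fl by linarith
    then have "deriv_list ?F f ! ?i \<in> set (deriv_list ?F f)" by (simp add: length_deriv_list)
    then have "add_pow R (length f - 1 - ?i) (f ! ?i) = \<zero>" using dz nth_deriv_list[OF i, of ?F] apF by auto
    moreover have "length f - 1 - ?i = n" using n fl by simp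
    moreover have "f ! ?i = coeff f n" using coeff_nth[of n f] n fl by simp
    ultimately show ?thesis by simp
  qed
  have fne: "f \<noteq> []" using deg by auto
  have lc: "coeff f (degree f) = \<one>" using lead_coeff_simp[OF fne] flead by simp
  have "add_pow R (degree f) \<one> = \<zero>" using cz[OF deg order_refl] lc by simp
  \<comment> \<open>The leading coefficient is one, so the vanishing derivative says that
    \<open>degree f\<close> annihilates \<open>\<one>\<close>. This is where the characteristic is
    found, together with its divisibility into the degree.\<close>
  then obtain p where p: "Factorial_Ring.prime p" "p dvd degree f" "add_pow R p \<one> = \<zero>"
    using add_pow_one_prime[OF deg] by blast
  have p0: "p > 1" by (rule prime_gt_1_nat[OF p(1)])
  obtain d where d: "degree f = p * d" using p(2) by (rule dvdE)
  have d0: "d \<ge> 1" using d deg by (cases d) auto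
  have cR: "coeff f n \<in> carrier R" for n using fR by simp
  have cE: "coeff f n \<in> E" for n
  proof (cases "n < length f")
    case True then show ?thesis using coeff_img_restrict[of f] fs by (auto simp: image_subset_iff set_eq_iff)
  next
    case False then show ?thesis using coeff_length[of f n] subringE(2)[OF Es] by simp
  qed
  have cp: "coeff f n = \<zero>" if n: "n \<le> degree f" "\<not> p dvd n" for n
  proof (rule ccontr)
    assume nz: "coeff f n \<noteq> \<zero>"
    have "1 \<le> n" using n(2) by (cases n) auto
    then have "p dvd n" using add_pow_zero_dvd[OF p(1,3) cR nz cz[OF _ n(1)]] by blast
    then show False using n(2) by blast
  qed
  have y: "x [^] p \<in> carrier R" using x by simp
  \<comment> \<open>\<open>f\<close> is \<open>?g\<close> evaluated at the \<open>p\<close>-th power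
    of the variable: all coefficients at exponents not divisible by \<open>p\<close> vanish by
    \<open>cp\<close>.\<close>
  let ?g = "map (\<lambda>i. coeff f (p * i)) (rev [0..<Suc d])"
  have "eval f x = (\<Oplus>j\<in>{..<length f}. coeff f j \<otimes> x [^] j)"
    using eval_map_upt[OF x, of "length f" "coeff f"] cR coeff_list[of f] by simp
  also have "{..<length f} = {..degree f}" by (subst fl) (rule lessThan_Suc_atMost)
  also have "(\<Oplus>j\<in>{..degree f}. coeff f j \<otimes> x [^] j) = (\<Oplus>j\<in>(\<lambda>i. p * i) ` {..<Suc d}. coeff f j \<otimes> x [^] j)"
  proof (rule add.finprod_mono_neutral_cong_right)
    show "(\<lambda>i. p * i) ` {..<Suc d} \<subseteq> {..degree f}" using d by auto
    fix n assume n: "n \<in> {..degree f} - (\<lambda>i. p * i) ` {..<Suc d}"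
    have "\<not> p dvd n"
    proof
      assume "p dvd n"
      then obtain i where i: "n = p * i" by (rule dvdE)
      then have "i \<le> d" using n d p0 by simp
      then show False using n i by auto
    qed
    then show "coeff f n \<otimes> x [^] n = \<zero>" using cp[of n] n x by simp
  qed (use cR x in auto)
  also have "\<dots> = (\<Oplus>i\<in>{..<Suc d}. coeff f (p * i) \<otimes> x [^] (p * i))"
    by (rule finsum_reindex) (use cR x p0 in \<open>auto simp: inj_on_def\<close>)
  also have "\<dots> = (\<Oplus>i\<in>{..<Suc d}. coeff f (p * i) \<otimes> (x [^] p) [^] i)"
    using x by (simp add: nat_pow_pow)
  also have "\<dots> = eval ?g (x [^] p)" by (rule eval_map_upt[OF y, symmetric]) (rule cR)
  finally have ge: "eval ?g (x [^] p) = \<zero>" using f0 by simp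
  have gp: "?g \<in> carrier (E[X])" using cE lc d subringE(3)[OF Es] by (auto simp: univ_poly_def polynomial_def)
  have gne: "?g \<noteq> []" by simp
  have al: "(algebraic over E) (x [^] p)" by (rule algebraicI[OF gp gne ge])
  have "Irr E (x [^] p) pdivides ?g" by (rule Irr_minimal[OF E y al gp ge])
  then have "degree (Irr E (x [^] p)) \<le> degree ?g"
    by (rule pdivides_imp_degree_le[OF Es IrrE(1)[OF E y al] gp gne])
  also have "\<dots> = d" by simp
  also have "d < degree f" using d d0 p0 by simp
  finally show ?thesis using p al unfolding f_def by blast
qed

text \<open>\<open>inseparable_step\<close> is iterated, and the degree of the minimal polynomial
  falls until it is separable. Every step uses the same prime, the characteristic, so the exponents
  multiply to one of its powers.\<close>

lemma (in field) power_in_separable_closure: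
  assumes E: "subfield E R" and x: "x \<in> carrier R" and alg: "(algebraic over E) x"
  shows "\<exists>q. x [^] (q::nat) \<in> separable_closure_in R E \<and>
    (q = 1 \<or> (\<exists>p e. Factorial_Ring.prime p \<and> add_pow R (p::nat) \<one> = \<zero> \<and> q = p ^ e))"
  using x alg
proof (induct "degree (Irr E x)" arbitrary: x rule: less_induct)
  case less
  show ?case
  proof (cases "separable_poly (R\<lparr>carrier := E\<rparr>) (Irr E x)")
    case True
    then have "x [^] (1::nat) \<in> separable_closure_in R E" using less(2,3) by (simp add: separable_closure_in_def)
    then show ?thesis by blast
  next
    case False
    obtain p where p: "Factorial_Ring.prime p" "add_pow R p \<one> = \<zero>" "(algebraic over E) (x [^] (p::nat))"
      "degree (Irr E (x [^] p)) < degree (Irr E x)" using inseparable_step[OF E less(2,3) False] by blast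
    obtain q where q: "(x [^] p) [^] q \<in> separable_closure_in R E"
      "q = 1 \<or> (\<exists>p e. Factorial_Ring.prime p \<and> add_pow R (p::nat) \<one> = \<zero> \<and> q = p ^ e)"
      using less(1)[OF p(4) _ p(3)] less(2) by auto
    have e: "(x [^] p) [^] q = x [^] (p * q)" using less(2) by (simp add: nat_pow_pow)
    \<comment> \<open>Two primes that annihilate \<open>\<one>\<close> are equal, so the exponent
      from the induction hypothesis is a power of the prime of this step.\<close>
    have "\<exists>e. q = p ^ e"
      using q(2)
    proof
      assume "q = 1" then show ?thesis by (intro exI[of _ 0]) simp
    next
      assume "\<exists>p e. Factorial_Ring.prime p \<and> add_pow R (p::nat) \<one> = \<zero> \<and> q = p ^ e"
      then obtain p' e where p': "Factorial_Ring.prime p'" "add_pow R p' \<one> = \<zero>" "q = p' ^ e" by blast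
      have "p dvd p'" by (rule add_pow_zero_dvd[OF p(1,2) one_closed _ p'(2)]) simp
      then have "p = p'" using p(1) p'(1) by (simp add: primes_dvd_imp_eq)
      then show ?thesis using p'(3) by blast
    qed
    then obtain e where "p * q = p ^ Suc e" by auto
    then show ?thesis using q(1) p(1,2) unfolding e by blast
  qed
qed

text \<open>The power map has to be additive on \<open>S\<close> itself, which need not be a field;
  the relation that \<open>p\<close> annihilates \<open>\<one>\<close> is carried there by the
  homomorphism.\<close>

lemma (in ring_hom_cring) frob_of_prime_power:
  assumes "q = 1 \<or> (\<exists>p e. Factorial_Ring.prime p \<and> add_pow R (p::nat) \<one> = \<zero> \<and> q = p ^ e)"
  shows "q \<in> frob S"
  using assms
proof
  assume "\<exists>p e. Factorial_Ring.prime p \<and> add_pow R (p::nat) \<one> = \<zero> \<and> q = p ^ e"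
  then obtain p e where p: "Factorial_Ring.prime p" "add_pow R p \<one> = \<zero>" "q = p ^ e" by blast
  have "add_pow S p \<one>\<^bsub>S\<^esub> = h (add_pow R p \<one>)" by (simp add: hom_add_pow)
  then have "add_pow S p \<one>\<^bsub>S\<^esub> = \<zero>\<^bsub>S\<^esub>" using p(2) by simp
  then show ?thesis unfolding p(3) by (intro S.frob_power S.prime_in_frob p(1))
qed (use S.frob_one in simp)

section \<open>Transfer of prime ideal structure\<close>

lemma subring_vimage:
  assumes "ring_hom_cring R S h" "subring H S"
  shows "subring {r \<in> carrier R. h r \<in> H} R"
proof -
  interpret ring_hom_cring R S h by fact
  show ?thesis
    by (rule R.subringI) (use subringE(3,5,6,7)[OF assms(2)] in auto)
qed

lemma (in cring) MP_nonzero: "\<one> \<noteq> \<zero> \<Longrightarrow> nonzero_cring (MP R I)"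
proof -
  assume "\<one> \<noteq> \<zero>"
  then have "indexed_const \<one> {#} \<noteq> indexed_const \<zero> {#}" by (simp add: indexed_const_def)
  then have "\<one>\<^bsub>MP R I\<^esub> \<noteq> \<zero>\<^bsub>MP R I\<^esub>" unfolding MP_simps by metis
  then show ?thesis by (simp add: nonzero_cring_def nonzero_cring_axioms_def MP_cring)
qed

lemma ess_chain:
  assumes e: "ess_surj R S h" and c: "prime_chain S n c"
  shows "prime_chain R n (\<lambda>i. contract R h (c i))"
proof -
  have h: "ring_hom_cring R S h" using e by (simp add: ess_surj_def)
  have "contract R h (c i) \<subset> contract R h (c (Suc i))" if i: "i < n" for i
  proof -
    have cs: "c i \<in> spec S" "c (Suc i) \<in> spec S" "c i \<subset> c (Suc i)" using c i by (auto simp: prime_chain_def)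
    have "contract R h (c i) \<subseteq> contract R h (c (Suc i))" using cs(3) by auto
    moreover have "contract R h (c i) \<noteq> contract R h (c (Suc i))" using ess_contract_inj[OF e cs(1,2)] cs(3) by blast
    ultimately show ?thesis by blast
  qed
  moreover have "contract R h (c i) \<in> spec R" if "i \<le> n" for i
    by (rule contract_spec[OF h prime_chainD[OF c that]])
  ultimately show ?thesis by (simp add: prime_chain_def)
qed

lemma ess_height_le:
  assumes e: "ess_surj R S h" and P: "P \<in> spec S"
  shows "prime_height S P \<le> prime_height R (contract R h P)"
  unfolding prime_height_def[of S]
proof (rule SUP_least)
  fix n assume "n \<in> {n. \<exists>c. prime_chain S n c \<and> c n = P}"
  then obtain c where c: "prime_chain S n c" "c n = P" by blast
  show "enat n \<le> prime_height R (contract R h P)"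
    using chain_le_height[OF ess_chain[OF e c(1)]] c(2) by simp
qed

lemma contract_comp:
  assumes "\<And>r. r \<in> carrier R \<Longrightarrow> h r \<in> carrier S"
  shows "contract R h (contract S g P) = contract R (\<lambda>r. g (h r)) P"
  using assms by (auto simp: contract_def)

lemma ring_hom_cring_comp:
  assumes "ring_hom_cring R S h" "ring_hom_cring S T g"
  shows "ring_hom_cring R T (\<lambda>r. g (h r))"
proof -
  interpret h: ring_hom_cring R S h by fact
  interpret g: ring_hom_cring S T g by fact
  have "(\<lambda>r. g (h r)) \<in> ring_hom R T" by (rule ring_hom_memI) simp_all
  then show ?thesis by (simp add: ring_hom_cring_def ring_hom_cring_axioms_def h.R.is_cring g.S.is_cring)
qed

lemma ring_hom_cringI':
  "cring R \<Longrightarrow> cring S \<Longrightarrow> h \<in> ring_hom R S \<Longrightarrow> ring_hom_cring R S h"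
  by (simp add: ring_hom_cring_def ring_hom_cring_axioms_def)

lemma hom_Units:
  assumes "ring_hom_cring R S h" "u \<in> Units R"
  shows "h u \<in> Units S"
proof -
  interpret h: ring_hom_cring R S h by fact
  have u: "u \<in> carrier R" "inv\<^bsub>R\<^esub> u \<in> carrier R"
    by (rule h.R.Units_closed[OF assms(2)], rule h.R.Units_inv_closed[OF assms(2)])
  have "h (inv\<^bsub>R\<^esub> u) \<otimes>\<^bsub>S\<^esub> h u = \<one>\<^bsub>S\<^esub>" "h u \<otimes>\<^bsub>S\<^esub> h (inv\<^bsub>R\<^esub> u) = \<one>\<^bsub>S\<^esub>"
    using u assms(2) by (simp_all add: h.hom_mult[symmetric] del: h.hom_mult)
  then show ?thesis unfolding Units_def using u by blast
qed

lemma (in cring) UP_const_hom: "ring_hom_cring R (UP R) (\<lambda>a. up_ring.monom (UP R) a 0)"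
proof -
  interpret U: UP_cring R "UP R" by (simp add: UP_cring_intro is_cring)
  show ?thesis by (rule ring_hom_cringI'[OF is_cring UP_is_cring U.const_ring_hom])
qed

lemma UP_map_monom:
  assumes "ring_hom_cring R S h" "a \<in> carrier R"
  shows "UP_map h (up_ring.monom (UP R) a n) = up_ring.monom (UP S) (h a) n"
proof -
  interpret ring_hom_cring R S h by fact
  show ?thesis using assms(2) by (auto simp: UP_map_def fun_eq_iff R.UP_monom_coeff S.UP_monom_coeff)
qed

subsection \<open>Minimal primes of polynomial rings\<close>

lemma (in cring) MP_eval_self:
  assumes f: "f \<in> carrier (MP R I)"
  shows "mp_eval R (MP R I) indexed_const indexed_var f = f"
proof -
  interpret c: ring_hom_cring R "MP R I" indexed_const by (rule MP_const_hom)
  have h: "ring_hom_cring (MP R I) (MP R I) (mp_eval R (MP R I) indexed_const indexed_var)"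
    by (rule c.mp_eval_hom) (rule MP_var_closed)
  have i: "ring_hom_cring (MP R I) (MP R I) id" by (rule ring_hom_cringI'[OF MP_cring MP_cring id_ring_hom])
  have "mp_eval R (MP R I) indexed_const indexed_var f = id f"
    by (rule MP_hom_unique[OF h i _ _ f]) (simp_all add: c.mp_eval_const c.mp_eval_var[OF _ MP_var_closed])
  then show ?thesis by simp
qed

text \<open>A minimal prime of the polynomial ring contains the extension of its contraction, which
  is prime, and so equals it; this also makes the contraction minimal. Distinct minimal primes thus
  have distinct minimal contractions, and an equation \<open>\<one> = a \<oplus> b\<close> in
  \<open>R\<close> persists in the polynomial ring.\<close>

lemma MPC_MP:
  fixes R (structure)
  assumes R: "cring R" and mpc: "MPC R"
  shows "MPC (MP R I)"
proof -
  interpret R: cring R by (rule R)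
  interpret M: cring "MP R I" by (rule R.MP_cring)
  have c: "ring_hom_cring R (MP R I) R.indexed_const" by (rule R.MP_const_hom)
  interpret c: ring_hom_cring R "MP R I" R.indexed_const by (rule c)
  have ext: "ext_prime R I p \<subseteq> P" if P: "P \<in> spec (MP R I)" and p: "p \<subseteq> contract R R.indexed_const P" for p P
  proof
    interpret P: primeideal P "MP R I" using P by (simp add: spec_iff)
    fix f assume f: "f \<in> ext_prime R I p"
    then have fc: "f \<in> carrier (MP R I)" "\<And>m. f m \<in> p" by (simp_all add: ext_prime_def)
    have "mp_eval R (MP R I) R.indexed_const R.indexed_var f \<in> P"
      by (rule c.mp_eval_in_ideal[OF fc(1) R.MP_var_closed P.is_ideal])
        (use fc(2) p in \<open>simp_all add: subset_iff\<close>)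
    then show "f \<in> P" unfolding R.MP_eval_self[OF fc(1)] .
  qed
  have cext: "contract R R.indexed_const (ext_prime R I p) = p" if p: "p \<in> spec R" for p
  proof -
    interpret p: primeideal p R using p by (simp add: spec_iff)
    have z: "\<zero> \<in> p" by (rule additive_subgroup.zero_closed[OF p.is_additive_subgroup])
    have "R.indexed_const a \<in> ext_prime R I p \<longleftrightarrow> a \<in> p" if a: "a \<in> carrier R" for a
    proof -
      have "R.indexed_const a \<in> ext_prime R I p \<longleftrightarrow> (\<forall>m::'c multiset. R.indexed_const a m \<in> p)"
        unfolding ext_prime_def using R.MP_const_closed[OF a, of I] by blast
      also have "\<dots> \<longleftrightarrow> a \<in> p" using z by (auto simp: R.indexed_const_def)
      finally show ?thesis .
    qed
    then show ?thesis using p.Icarr by auto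
  qed
  have min: "contract R R.indexed_const P \<in> minimal_primes R \<and> P = ext_prime R I (contract R R.indexed_const P)"
    if P: "P \<in> minimal_primes (MP R I)" for P
  proof -
    have Ps: "P \<in> spec (MP R I)" and Pm: "\<And>q. q \<in> spec (MP R I) \<Longrightarrow> q \<subseteq> P \<Longrightarrow> q = P"
      using P by (simp_all add: minimal_primes_def)
    let ?m = "contract R R.indexed_const P"
    have ms: "?m \<in> spec R" by (rule contract_spec[OF c Ps])
    have e: "ext_prime R I q = P" if "q \<in> spec R" "q \<subseteq> ?m" for q
      by (rule Pm[OF ext_prime_spec[OF that(1)] ext[OF Ps that(2)]])
    have "q = ?m" if q: "q \<in> spec R" "q \<subseteq> ?m" for q using cext[OF q(1)] e[OF q] by simp
    then show ?thesis using ms e[OF ms] by (simp add: minimal_primes_def)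
  qed
  show ?thesis unfolding MPC_def
  proof (intro ballI impI)
    fix P Q assume P: "P \<in> minimal_primes (MP R I)" and Q: "Q \<in> minimal_primes (MP R I)" and ne: "P \<noteq> Q"
    let ?m = "contract R R.indexed_const P" and ?n = "contract R R.indexed_const Q"
    interpret P: primeideal P "MP R I" using P by (simp add: minimal_primes_def spec_iff)
    interpret Q: primeideal Q "MP R I" using Q by (simp add: minimal_primes_def spec_iff)
    have "?m \<noteq> ?n" using min[OF P] min[OF Q] ne by metis
    then have "?m <+>\<^bsub>R\<^esub> ?n = carrier R" using mpc min[OF P] min[OF Q] unfolding MPC_def by blast
    then have "\<one> \<in> ?m <+>\<^bsub>R\<^esub> ?n" by simp
    then obtain a b where ab: "a \<in> ?m" "b \<in> ?n" "\<one> = a \<oplus> b" unfolding set_add_def' by blast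
    have abc: "a \<in> carrier R" "b \<in> carrier R" "R.indexed_const a \<in> P" "R.indexed_const b \<in> Q" using ab by simp_all
    have one: "\<one>\<^bsub>MP R I\<^esub> = R.indexed_const a \<oplus>\<^bsub>MP R I\<^esub> R.indexed_const b"
      using c.hom_add[OF abc(1,2)] unfolding ab(3)[symmetric] c.hom_one .
    show "P <+>\<^bsub>MP R I\<^esub> Q = carrier (MP R I)"
    proof
      show "P <+>\<^bsub>MP R I\<^esub> Q \<subseteq> carrier (MP R I)" unfolding set_add_def' using P.Icarr Q.Icarr by auto
      show "carrier (MP R I) \<subseteq> P <+>\<^bsub>MP R I\<^esub> Q"
      proof
        fix x assume x: "x \<in> carrier (MP R I)"
        have "x = (x \<otimes>\<^bsub>MP R I\<^esub> R.indexed_const a) \<oplus>\<^bsub>MP R I\<^esub> (x \<otimes>\<^bsub>MP R I\<^esub> R.indexed_const b)"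
          using x abc M.r_distr[of "R.indexed_const a" "R.indexed_const b" x] one[symmetric] by simp
        moreover have "x \<otimes>\<^bsub>MP R I\<^esub> R.indexed_const a \<in> P" by (rule P.I_l_closed[OF abc(3) x])
        moreover have "x \<otimes>\<^bsub>MP R I\<^esub> R.indexed_const b \<in> Q" by (rule Q.I_l_closed[OF abc(4) x])
        ultimately show "x \<in> P <+>\<^bsub>MP R I\<^esub> Q" unfolding set_add_def' by blast
      qed
    qed
  qed
qed

subsection \<open>The common setting\<close>

text \<open>\<open>sm\<close> is the structure map of the \<open>k\<close>-algebra \<open>A\<close>; \<open>T\<close> stands for \<open>K \<otimes>\<^sub>k A\<close>. Up to
  Frobenius exponents \<open>K\<close> is generated as a field by \<open>k\<close>, \<open>B\<close> and the finite set \<open>\<Theta>\<close>.\<close>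

locale tensor_setting =
  fixes A :: "('a, 'm) ring_scheme" and K :: "('b, 'n) ring_scheme" and T :: "('t, 'u) ring_scheme"
    and k B \<Theta> :: "'b set" and \<iota> :: "'b \<Rightarrow> 't" and \<kappa> :: "'a \<Rightarrow> 't" and sm :: "'b \<Rightarrow> 'a" and n :: nat
  assumes A: "nonzero_cring A" and T: "nonzero_cring T" and K: "field K" and k: "subfield k K"
    and iota: "ring_hom_cring K T \<iota>" and kappa: "ring_hom_cring A T \<kappa>"
    and sm: "ring_hom_cring (K\<lparr>carrier := k\<rparr>) A sm" and iota_k: "\<And>c. c \<in> k \<Longrightarrow> \<iota> c = \<kappa> (sm c)"
    and gen: "\<And>H. subring H T \<Longrightarrow> \<iota> ` carrier K \<subseteq> H \<Longrightarrow> \<kappa> ` carrier A \<subseteq> H \<Longrightarrow> H = carrier T"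
    and indep: "algebraically_independent K k B" and Theta: "finite \<Theta>" "\<Theta> \<subseteq> carrier K"
    and insep: "\<And>x. x \<in> carrier K \<Longrightarrow> \<exists>q.
      (q = 1 \<or> (\<exists>p e. Factorial_Ring.prime p \<and> add_pow K (p::nat) \<one>\<^bsub>K\<^esub> = \<zero>\<^bsub>K\<^esub> \<and> q = p ^ e)) \<and>
      (\<exists>u\<in>generate_ring K (k \<union> (B \<union> \<Theta>)). \<exists>v\<in>generate_ring K (k \<union> (B \<union> \<Theta>)). v \<noteq> \<zero>\<^bsub>K\<^esub> \<and> v \<otimes>\<^bsub>K\<^esub> x [^]\<^bsub>K\<^esub> q = u)"
    and n: "n \<ge> 1"
begin

abbreviation "Tn \<equiv> MP T {..<n}"
text \<open>\<open>Inl j\<close> stands for the variable \<open>X_j\<close>; \<open>Inr y\<close>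
  stands for the variable that \<open>\<phi>\<close> sends to the scalar \<open>y\<close>, with one
  variable for each element of \<open>B \<union> \<Theta>\<close>.\<close>

definition I :: "(nat + 'b) set" where "I = Inl ` {..<n} \<union> Inr ` (B \<union> \<Theta>)"
abbreviation "C \<equiv> MP A I"

sublocale A: nonzero_cring A by (rule A)
sublocale T: nonzero_cring T by (rule T)
sublocale K: field K by (rule K)
sublocale Tn: cring Tn by (rule T.MP_cring)
sublocale C: cring C by (rule A.MP_cring)
sublocale \<iota>: ring_hom_cring K T \<iota> by (rule iota)
sublocale \<kappa>: ring_hom_cring A T \<kappa> by (rule kappa)
sublocale sm: ring_hom_cring "K\<lparr>carrier := k\<rparr>" A sm by (rule sm)
sublocale cT: ring_hom_cring T Tn T.indexed_const by (rule T.MP_const_hom)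
sublocale cA: ring_hom_cring A C A.indexed_const by (rule A.MP_const_hom)

definition v :: "nat + 'b \<Rightarrow> nat multiset \<Rightarrow> 't"
  where "v i = (case i of Inl j \<Rightarrow> T.indexed_var j | Inr y \<Rightarrow> T.indexed_const (\<iota> y))"

lemma BK: "B \<subseteq> carrier K" using indep by (simp add: algebraically_independent_def)
lemma kK: "k \<subseteq> carrier K" by (rule subfieldE(3)[OF k])

lemma v_closed: "i \<in> I \<Longrightarrow> v i \<in> carrier Tn"
  using BK Theta by (auto simp: I_def v_def T.MP_var_closed intro!: cT.hom_closed \<iota>.hom_closed)

lemma base_hom: "ring_hom_cring A Tn (\<lambda>a. T.indexed_const (\<kappa> a))"
  by (rule ring_hom_cring_comp[OF kappa cT.ring_hom_cring_axioms])

lemma iota_hom: "ring_hom_cring K Tn (\<lambda>x. T.indexed_const (\<iota> x))"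
  by (rule ring_hom_cring_comp[OF iota cT.ring_hom_cring_axioms])

definition \<phi> :: "((nat + 'b) multiset \<Rightarrow> 'a) \<Rightarrow> nat multiset \<Rightarrow> 't"
  where "\<phi> = mp_eval A Tn (\<lambda>a. T.indexed_const (\<kappa> a)) v"

lemma phi_hom: "ring_hom_cring C Tn \<phi>"
  unfolding \<phi>_def by (rule ring_hom_cring.mp_eval_hom[OF base_hom v_closed])

sublocale \<phi>: ring_hom_cring C Tn \<phi> by (rule phi_hom)

lemma phi_const: "a \<in> carrier A \<Longrightarrow> \<phi> (A.indexed_const a) = T.indexed_const (\<kappa> a)"
  unfolding \<phi>_def by (rule ring_hom_cring.mp_eval_const[OF base_hom])

lemma phi_var: "i \<in> I \<Longrightarrow> \<phi> (A.indexed_var i) = v i"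
  unfolding \<phi>_def by (rule ring_hom_cring.mp_eval_var[OF base_hom _ v_closed])

lemma phi_generate:
  assumes "y \<in> generate_ring K (k \<union> (B \<union> \<Theta>))"
  shows "\<exists>f\<in>carrier C. \<phi> f = T.indexed_const (\<iota> y)"
proof -
  have img: "subring (\<phi> ` carrier C) Tn" by (rule \<phi>.ring.img_is_subring[OF C.carrier_is_subring])
  have sub: "subring {x \<in> carrier K. T.indexed_const (\<iota> x) \<in> \<phi> ` carrier C} K"
    by (rule subring_vimage[OF iota_hom img])
  have "k \<union> (B \<union> \<Theta>) \<subseteq> {x \<in> carrier K. T.indexed_const (\<iota> x) \<in> \<phi> ` carrier C}"
  proof
    fix x assume x: "x \<in> k \<union> (B \<union> \<Theta>)"
    then have xc: "x \<in> carrier K" using kK BK Theta by blast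
    have "T.indexed_const (\<iota> x) \<in> \<phi> ` carrier C"
    proof (cases "x \<in> k")
      case True
      then have s: "sm x \<in> carrier A" using sm.hom_closed[of x] by simp
      have "\<phi> (A.indexed_const (sm x)) = T.indexed_const (\<iota> x)" using phi_const[OF s] iota_k[OF True] by simp
      then show ?thesis using A.MP_const_closed[OF s] by (metis imageI)
    next
      case False
      then have i: "Inr x \<in> I" using x by (auto simp: I_def)
      have "\<phi> (A.indexed_var (Inr x)) = T.indexed_const (\<iota> x)" using phi_var[OF i] by (simp add: v_def)
      then show ?thesis using A.MP_var_closed[OF i] by (metis imageI)
    qed
    then show "x \<in> {x \<in> carrier K. T.indexed_const (\<iota> x) \<in> \<phi> ` carrier C}" using xc by simp
  qed
  then have "generate_ring K (k \<union> (B \<union> \<Theta>)) \<subseteq> {x \<in> carrier K. T.indexed_const (\<iota> x) \<in> \<phi> ` carrier C}"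
    using kK BK Theta by (intro K.generate_ring_min_subring1[OF _ sub]) auto
  then have "T.indexed_const (\<iota> y) \<in> \<phi> ` carrier C" using assms by (simp add: subset_iff)
  then obtain f where f: "T.indexed_const (\<iota> y) = \<phi> f" "f \<in> carrier C" by (rule imageE)
  then show ?thesis by (intro bexI[of _ f]) (rule sym)
qed

text \<open>The maps \<open>i\<close> and \<open>j\<close> let one argument serve twice: as
  identities for \<open>\<phi>\<close>, and as inclusions of constants for the map between
  univariate polynomial rings. It is enough to reach the generators: elements of \<open>A\<close>
  and the \<open>X_j\<close> are images, and each element of \<open>K\<close> has a power that is a
  fraction of images.\<close>

lemma ess_generic:
  assumes \<Phi>: "ring_hom_cring C' S \<Phi>" and i: "ring_hom_cring C C' i" and j: "ring_hom_cring Tn S j"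
    and com: "\<And>f. f \<in> carrier C \<Longrightarrow> \<Phi> (i f) = j (\<phi> f)"
  shows "j ` carrier Tn \<subseteq> ess_image C' S \<Phi>"
proof -
  interpret \<Phi>: ring_hom_cring C' S \<Phi> by (rule \<Phi>)
  interpret i: ring_hom_cring C C' i by (rule i)
  interpret j: ring_hom_cring Tn S j by (rule j)
  let ?H = "ess_image C' S \<Phi>"
  have H: "subring ?H S" by (rule \<Phi>.ess_image_subring)
  have jc: "ring_hom_cring T S (\<lambda>t. j (T.indexed_const t))" by (rule ring_hom_cring_comp[OF cT.ring_hom_cring_axioms j])
  have jk: "ring_hom_cring K S (\<lambda>x. j (T.indexed_const (\<iota> x)))" by (rule ring_hom_cring_comp[OF iota jc])
  have im: "j (\<phi> f) \<in> ?H" if "f \<in> carrier C" for f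
    unfolding com[OF that, symmetric] by (rule \<Phi>.image_ess) (use that in simp)
  have HT: "subring {t \<in> carrier T. j (T.indexed_const t) \<in> ?H} T" by (rule subring_vimage[OF jc H])
  have "{t \<in> carrier T. j (T.indexed_const t) \<in> ?H} = carrier T"
  proof (rule gen[OF HT])
    show "\<kappa> ` carrier A \<subseteq> {t \<in> carrier T. j (T.indexed_const t) \<in> ?H}"
    proof
      fix t assume "t \<in> \<kappa> ` carrier A"
      then obtain a where a: "a \<in> carrier A" "t = \<kappa> a" by blast
      have "j (\<phi> (A.indexed_const a)) \<in> ?H" by (rule im[OF A.MP_const_closed[OF a(1)]])
      then show "t \<in> {t \<in> carrier T. j (T.indexed_const t) \<in> ?H}" using phi_const[OF a(1)] a by simp
    qed
    show "\<iota> ` carrier K \<subseteq> {t \<in> carrier T. j (T.indexed_const t) \<in> ?H}"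
    proof
      fix t assume "t \<in> \<iota> ` carrier K"
      then obtain x where x: "x \<in> carrier K" "t = \<iota> x" by blast
      let ?j = "\<lambda>x. j (T.indexed_const (\<iota> x))"
      interpret jk: ring_hom_cring K S ?j by (rule jk)
      obtain q u w where q: "q = 1 \<or> (\<exists>p e. Factorial_Ring.prime p \<and> add_pow K (p::nat) \<one>\<^bsub>K\<^esub> = \<zero>\<^bsub>K\<^esub> \<and> q = p ^ e)"
        and u: "u \<in> generate_ring K (k \<union> (B \<union> \<Theta>))" "w \<in> generate_ring K (k \<union> (B \<union> \<Theta>))" "w \<noteq> \<zero>\<^bsub>K\<^esub>" "w \<otimes>\<^bsub>K\<^esub> x [^]\<^bsub>K\<^esub> q = u"
        using insep[OF x(1)] by (elim exE conjE bexE) (rule that)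
      have wc: "w \<in> carrier K" using u(2) K.generate_ring_in_carrier[of "k \<union> (B \<union> \<Theta>)"] kK BK Theta by blast
      obtain f where f: "f \<in> carrier C" "\<phi> f = T.indexed_const (\<iota> u)" using phi_generate[OF u(1)] by (rule bexE)
      obtain g where g: "g \<in> carrier C" "\<phi> g = T.indexed_const (\<iota> w)" using phi_generate[OF u(2)] by (rule bexE)
      have "w \<in> Units K" using wc u(3) K.field_Units by simp
      then have un: "?j w \<in> Units S" by (rule hom_Units[OF jk])
      have "?j w \<otimes>\<^bsub>S\<^esub> ?j x [^]\<^bsub>S\<^esub> q = ?j u"
        unfolding u(4)[symmetric] jk.hom_npow[OF x(1), symmetric] using wc x(1) jk.hom_mult[of w "x [^]\<^bsub>K\<^esub> q"] by simp
      moreover have "\<Phi> (i g) = ?j w" "\<Phi> (i f) = ?j u" using com[OF f(1)] com[OF g(1)] f(2) g(2) by simp_all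
      ultimately have e: "\<Phi> (i g) \<otimes>\<^bsub>S\<^esub> ?j x [^]\<^bsub>S\<^esub> q = \<Phi> (i f)" and un': "\<Phi> (i g) \<in> Units S" using un by simp_all
      \<comment> \<open>The denominator \<open>w\<close> is nonzero in the field \<open>K\<close>,
        so it becomes a unit. The exponent \<open>q\<close> is 1 or a power of the characteristic of
        \<open>K\<close>, hence a Frobenius exponent of \<open>S\<close>.\<close>
      have "?j x \<in> ?H"
        by (rule \<Phi>.ess_imageI[OF jk.hom_closed[OF x(1)] jk.frob_of_prime_power[OF q] i.hom_closed[OF g(1)] i.hom_closed[OF f(1)] un' e])
      then show "t \<in> {t \<in> carrier T. j (T.indexed_const t) \<in> ?H}" using x by simp
    qed
  qed
  then have cH: "j (T.indexed_const t) \<in> ?H" if "t \<in> carrier T" for t using that by blast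
  have "{t \<in> carrier Tn. j t \<in> ?H} = carrier Tn"
  proof (rule T.MP_gen[OF subring_vimage[OF j H]])
    show "T.indexed_const c \<in> {t \<in> carrier Tn. j t \<in> ?H}" if "c \<in> carrier T" for c
      using cH[OF that] T.MP_const_closed[OF that] by simp
    show "T.indexed_var l \<in> {t \<in> carrier Tn. j t \<in> ?H}" if l: "l \<in> {..<n}" for l
    proof -
      have i: "Inl l \<in> I" using l by (auto simp: I_def)
      have "j (\<phi> (A.indexed_var (Inl l))) \<in> ?H" by (rule im[OF A.MP_var_closed[OF i]])
      then show ?thesis using phi_var[OF i] T.MP_var_closed[OF l] by (simp add: v_def)
    qed
  qed
  then show ?thesis by blast
qed

lemma phi_ess: "ess_surj C Tn \<phi>"
proof (rule ess_surjI[OF phi_hom])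
  have i: "ring_hom_cring C C id" by (rule C.id_hom)
  have j: "ring_hom_cring Tn Tn id" by (rule Tn.id_hom)
  have "id ` carrier Tn \<subseteq> ess_image C Tn \<phi>" by (rule ess_generic[OF phi_hom i j]) simp
  then show "t \<in> ess_image C Tn \<phi>" if "t \<in> carrier Tn" for t using that by auto
qed

text \<open>The S-property compares primes after adjoining one more variable, so the correspondence
  of primes is needed there too. The essential image contains the constants by
  \<open>ess_generic\<close> and the variable, which is the image of a variable.\<close>

lemma UP_phi_ess: "ess_surj (UP C) (UP Tn) (UP_map \<phi>)"
proof (rule ess_surjI[OF \<phi>.UP_map_hom])
  let ?H = "ess_image (UP C) (UP Tn) (UP_map \<phi>)"
  interpret U: ring_hom_cring "UP C" "UP Tn" "UP_map \<phi>" by (rule \<phi>.UP_map_hom)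
  interpret UC: UP_cring C "UP C" by (simp add: UP_cring_intro C.is_cring)
  have sub: "(\<lambda>a. up_ring.monom (UP Tn) a 0) ` carrier Tn \<subseteq> ?H"
    by (rule ess_generic[OF \<phi>.UP_map_hom C.UP_const_hom Tn.UP_const_hom]) (rule UP_map_monom[OF phi_hom])
  have "UP_map \<phi> (up_ring.monom (UP C) \<one>\<^bsub>C\<^esub> 1) = up_ring.monom (UP Tn) \<one>\<^bsub>Tn\<^esub> 1"
    using UP_map_monom[OF phi_hom C.one_closed, of 1] by simp
  moreover have "up_ring.monom (UP C) \<one>\<^bsub>C\<^esub> 1 \<in> carrier (UP C)" by (rule UC.monom_closed[OF C.one_closed])
  ultimately have X: "up_ring.monom (UP Tn) \<one>\<^bsub>Tn\<^esub> 1 \<in> ?H" using U.image_ess by metis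
  have "?H = carrier (UP Tn)"
    by (rule Tn.UP_gen[OF U.ess_image_subring _ X]) (use sub in blast)
  then show "t \<in> ?H" if "t \<in> carrier (UP Tn)" for t using that by blast
qed

end

section \<open>Saturated chains and their lengths\<close>

lemma chain_insert:
  assumes c: "prime_chain R n c" and N: "N \<in> spec R" "c i \<subset> N" "N \<subset> c (Suc i)" and i: "i < n"
  shows "prime_chain R (Suc n) (\<lambda>j. if j \<le> i then c j else if j = Suc i then N else c (j - 1))"
    (is "prime_chain R _ ?d")
  unfolding prime_chain_def
proof (intro conjI allI impI)
  have cs: "c j \<in> spec R" if "j \<le> n" for j using c that by (simp add: prime_chain_def)
  have cc: "c j \<subset> c (Suc j)" if "j < n" for j using c that by (simp add: prime_chain_def)
  fix j
  show "?d j \<in> spec R" if "j \<le> Suc n" using that i N(1) cs[of j] cs[of "j - 1"] by auto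
  show "?d j \<subset> ?d (Suc j)" if j: "j < Suc n"
  proof -
    consider "j < i" | "j = i" | "j = Suc i" | "j > Suc i" by linarith
    then show ?thesis
    proof cases
      case 1 then show ?thesis using cc[of j] i by simp
    next
      case 4
      then have "Suc (j - 1) = j" by simp
      then show ?thesis using cc[of "j - 1"] 4 j by simp
    qed (use N in auto)
  qed
qed

lemma chain_prepend:
  assumes c: "prime_chain R n c" and q: "q \<in> spec R" "q \<subset> c 0"
  shows "prime_chain R (Suc n) (case_nat q c)"
  unfolding prime_chain_def
proof (intro conjI allI impI)
  fix j
  show "case_nat q c j \<in> spec R" if "j \<le> Suc n" using that c q by (cases j) (auto simp: prime_chain_def)
  show "case_nat q c j \<subset> case_nat q c (Suc j)" if "j < Suc n" using that c q by (cases j) (auto simp: prime_chain_def)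
qed

lemma chain_append:
  assumes c: "prime_chain R n c" and q: "q \<in> spec R" "c n \<subset> q"
  shows "prime_chain R (Suc n) (c(Suc n := q))"
  using assms by (auto simp: prime_chain_def less_Suc_eq le_Suc_eq)

text \<open>A prime inserted between two members, or put below the first one, would give a chain to
  \<open>c n\<close> longer than its height.\<close>

lemma height_chain_saturated:
  assumes c: "prime_chain R n c" and h: "prime_height R (c n) = enat n"
  shows "\<And>i. i < n \<Longrightarrow> adjacent_primes R (c i) (c (Suc i))" and "c 0 \<in> minimal_primes R"
proof -
  have no: False if "prime_chain R (Suc n) d" "d (Suc n) = c n" for d
    using chain_le_height[OF that(1)] that(2) h by simp
  show "adjacent_primes R (c i) (c (Suc i))" if i: "i < n" for i
  proof -
    have "\<not> (c i \<subset> N \<and> N \<subset> c (Suc i))" if N: "N \<in> spec R" for N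
    proof
      assume b: "c i \<subset> N \<and> N \<subset> c (Suc i)"
      show False by (rule no[OF chain_insert[OF c N _ _ i]]) (use b i in auto)
    qed
    then show ?thesis using c i unfolding adjacent_primes_def prime_chain_def by auto
  qed
  have "q = c 0" if q: "q \<in> spec R" "q \<subseteq> c 0" for q
  proof (rule ccontr)
    assume "q \<noteq> c 0"
    then have s: "q \<subset> c 0" using q by blast
    show False by (rule no[OF chain_prepend[OF c q(1) s]]) simp
  qed
  then show "c 0 \<in> minimal_primes R" using c by (simp add: minimal_primes_def prime_chain_def)
qed

lemma saturated_height:
  assumes "\<And>P Q. adjacent_primes R P Q \<Longrightarrow> prime_height R Q = 1 + prime_height R P"
    and "\<And>i. i < n \<Longrightarrow> adjacent_primes R (c i) (c (Suc i))"
  shows "prime_height R (c n) = prime_height R (c 0) + enat n"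
  using assms(2)
proof (induct n)
  case (Suc n)
  then have "prime_height R (c (Suc n)) = 1 + (prime_height R (c 0) + enat n)" using assms(1)[of "c n" "c (Suc n)"] by simp
  then show ?case by (simp add: eSuc_enat[symmetric] eSuc_plus_1 add_ac)
qed (simp add: zero_enat_def[symmetric])

lemma UP_finite_range:
  assumes "f \<in> carrier (UP R)" shows "finite (range f)"
proof -
  obtain N where "\<And>m. m > N \<Longrightarrow> f m = \<zero>\<^bsub>R\<^esub>" using assms by (auto simp: UP_carrier)
  then have "range f \<subseteq> insert \<zero>\<^bsub>R\<^esub> (f ` {..N})" by (force simp: not_less[symmetric])
  then show ?thesis by (rule finite_subset) simp
qed

lemma generate_ring_hom_image:
  assumes h: "ring_hom_cring R S h" and G: "G \<subseteq> carrier R" and x: "x \<in> generate_ring R G"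
    and G': "\<And>g. g \<in> G \<Longrightarrow> h g \<in> generate_ring S G'"
  shows "h x \<in> generate_ring S G'"
proof -
  interpret h: ring_hom_cring R S h by (rule h)
  have c: "y \<in> carrier R" if "y \<in> generate_ring R G" for y by (rule h.R.generate_ring_in_carrier[OF G that])
  from x show ?thesis
  proof induct
    case one then show ?case by (simp only: h.hom_one generate_ring.one)
  next
    case (incl g) then show ?case by (rule G')
  next
    case (a_inv x)
    then show ?case by (simp only: h.hom_a_inv[OF c] generate_ring.a_inv)
  next
    case (eng_add x y)
    then show ?case by (simp only: h.hom_add[OF c c] generate_ring.eng_add)
  next
    case (eng_mult x y)
    then show ?case by (simp only: h.hom_mult[OF c c] generate_ring.eng_mult)
  qed
qed

lemma contract_id: "contract R id P = P \<inter> carrier R"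
  by (auto simp: contract_def)

lemma contract_cong:
  "(\<And>r. r \<in> carrier R \<Longrightarrow> h r \<in> P \<longleftrightarrow> h r \<in> Q) \<Longrightarrow> contract R h P = contract R h Q"
  by (auto simp: contract_def)

lemma contract_subset: "contract R h P \<subseteq> carrier R"
  unfolding contract_def by (rule Collect_restrict)

lemma spec_ideal: "P \<in> spec R \<Longrightarrow> ideal P R"
  by (simp add: spec_iff primeideal_def)

lemma MP_extend_prime_ex:
  assumes "cring A" "I' \<subseteq> I" "N \<in> spec (MP A I')"
  shows "\<exists>E\<in>spec (MP A I). (\<forall>f\<in>carrier (MP A I'). f \<in> E \<longleftrightarrow> f \<in> N) \<and>
    (\<forall>J. ideal J (MP A I) \<longrightarrow> N \<subseteq> J \<longrightarrow> E \<subseteq> J)"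
  by (rule MP_extend_prime[OF assms]) blast

section \<open>Bounded fibres and the passage to finitely many variables\<close>

context tensor_setting
begin

text \<open>The form in which finite transcendence degree of \<open>A\<close> enters. The bound
  \<open>M\<close> does not depend on \<open>p\<close>, which matters when a chain runs through
  several fibres, as in \<open>height_finite\<close>.\<close>

definition td_bound :: "nat \<Rightarrow> bool"
  where "td_bound M \<longleftrightarrow> (\<forall>p\<in>spec A. \<exists>V. finite V \<and> card V \<le> M \<and> V \<subseteq> carrier A \<and>
    (\<forall>a\<in>carrier A. alg_rel A (generate_ring A (sm ` k \<union> V)) p a))"

abbreviation "Kk \<equiv> K\<lparr>carrier := k\<rparr>"
abbreviation "down P \<equiv> contract C \<phi> P"
abbreviation "base J \<equiv> contract A A.indexed_const J"

text \<open>Generators of the ring of polynomials in the variables of \<open>B\<close> with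
  coefficients in the image of \<open>k\<close>.\<close>

definition R0 :: "((nat + 'b) multiset \<Rightarrow> 'a) set"
  where "R0 = (\<lambda>c. A.indexed_const (sm c)) ` k \<union> (\<lambda>b. A.indexed_var (Inr b)) ` B"

text \<open>Independence of \<open>B\<close> is stated for polynomials over \<open>K\<close> with
  coefficients in \<open>k\<close>, while evaluation homomorphisms start from
  \<open>MP Kk B\<close>; both consist of the same functions.\<close>

lemma Kk_pset:
  assumes "F \<in> carrier (MP Kk B)"
  shows "F \<in> ring.indexed_pset K B k"
proof -
  have "F \<in> ring.indexed_pset Kk B k" using assms by (simp add: MP_simps(1))
  then show ?thesis
  proof (induct rule: sm.R.indexed_pset.induct)
    case (indexed_const c)
    have "ring.indexed_const Kk c = ring.indexed_const K c"
      unfolding sm.R.indexed_const_def K.indexed_const_def by (simp add: fun_eq_iff)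
    show ?case unfolding \<open>ring.indexed_const Kk c = _\<close> by (rule K.indexed_pset.indexed_const[OF indexed_const])
  next
    case (indexed_padd F G)
    have "ring.indexed_padd Kk F G = ring.indexed_padd K F G"
      unfolding sm.R.indexed_padd_def K.indexed_padd_def by simp
    then show ?case using K.indexed_pset.indexed_padd[OF indexed_padd(2,4)] by simp
  next
    case (indexed_pmult F i)
    have "ring.indexed_pmult Kk F i = ring.indexed_pmult K F i"
      unfolding sm.R.indexed_pmult_def K.indexed_pmult_def by (simp add: fun_eq_iff)
    then show ?case using K.indexed_pset.indexed_pmult[OF indexed_pmult(2,3)] by simp
  qed
qed

text \<open>Such an \<open>f\<close> comes from a polynomial \<open>F\<close> over \<open>k\<close>
  in the variables \<open>B\<close>, and \<open>\<phi> f\<close> is the constant given by the value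
  of \<open>F\<close> in \<open>K\<close>. A nonzero value would be a unit and could not lie in a
  prime, so the value is zero, and independence of \<open>B\<close> gives
  \<open>F = 0\<close>.\<close>

lemma R0_lies_over_zero:
  assumes P: "P \<in> spec Tn" and f: "f \<in> generate_ring C R0" and fP: "\<phi> f \<in> P"
  shows "f = \<zero>\<^bsub>C\<^esub>"
proof -
  interpret P: primeideal P Tn using P by (simp add: spec_iff)
  interpret D: cring "MP Kk B" by (rule sm.R.MP_cring)
  let ?ev = "mp_eval Kk C (\<lambda>c. A.indexed_const (sm c)) (\<lambda>b. A.indexed_var (Inr b))"
  let ?val = "mp_eval Kk K id id"
  have sc: "ring_hom_cring Kk C (\<lambda>c. A.indexed_const (sm c))"
    by (rule ring_hom_cring_comp[OF sm cA.ring_hom_cring_axioms])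
  have iI: "Inr b \<in> I" if "b \<in> B" for b using that by (simp add: I_def)
  have vc: "A.indexed_var (Inr b) \<in> carrier C" if "b \<in> B" for b by (rule A.MP_var_closed[OF iI[OF that]])
  have ev: "ring_hom_cring (MP Kk B) C ?ev" by (rule ring_hom_cring.mp_eval_hom[OF sc vc])
  interpret ev: ring_hom_cring "MP Kk B" C ?ev by (rule ev)
  have inc: "ring_hom_cring Kk K id"
    by (rule ring_hom_cringI'[OF sm.R.is_cring K.is_cring]) (use kK in \<open>auto intro!: ring_hom_memI\<close>)
  have bc: "id b \<in> carrier K" if "b \<in> B" for b using BK that by auto
  have val: "ring_hom_cring (MP Kk B) K ?val" by (rule ring_hom_cring.mp_eval_hom[OF inc bc])
  interpret val: ring_hom_cring "MP Kk B" K ?val by (rule val)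
  have com: "\<phi> (?ev F) = T.indexed_const (\<iota> (?val F))" if F: "F \<in> carrier (MP Kk B)" for F
  proof (rule sm.R.MP_hom_unique[OF ring_hom_cring_comp[OF ev phi_hom] ring_hom_cring_comp[OF val iota_hom] _ _ F])
    fix c assume c: "c \<in> carrier Kk"
    then have s: "sm c \<in> carrier A" by (rule sm.hom_closed)
    have "?ev (ring.indexed_const Kk c) = A.indexed_const (sm c)" by (rule ring_hom_cring.mp_eval_const[OF sc c])
    moreover have "?val (ring.indexed_const Kk c) = id c" by (rule ring_hom_cring.mp_eval_const[OF inc c])
    ultimately show "\<phi> (?ev (ring.indexed_const Kk c)) = T.indexed_const (\<iota> (?val (ring.indexed_const Kk c)))"
      using phi_const[OF s] iota_k[of c] c by simp
  next
    fix b assume b: "b \<in> B"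
    have "?ev (ring.indexed_var Kk b) = A.indexed_var (Inr b)" by (rule ring_hom_cring.mp_eval_var[OF sc b vc])
    moreover have "?val (ring.indexed_var Kk b) = id b" by (rule ring_hom_cring.mp_eval_var[OF inc b bc])
    ultimately show "\<phi> (?ev (ring.indexed_var Kk b)) = T.indexed_const (\<iota> (?val (ring.indexed_var Kk b)))"
      using phi_var[OF iI[OF b]] by (simp add: v_def)
  qed
  have img: "subring (?ev ` carrier (MP Kk B)) C" by (rule ev.ring.img_is_subring[OF D.carrier_is_subring])
  have s: "R0 \<subseteq> ?ev ` carrier (MP Kk B)"
  proof
    fix r assume "r \<in> R0"
    then consider c where "c \<in> carrier Kk" "r = A.indexed_const (sm c)" | b where "b \<in> B" "r = A.indexed_var (Inr b)"
      unfolding R0_def by auto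
    then show "r \<in> ?ev ` carrier (MP Kk B)"
    proof cases
      case 1
      have "?ev (ring.indexed_const Kk c) = r" unfolding 1(2) by (rule ring_hom_cring.mp_eval_const[OF sc 1(1)])
      then show ?thesis using sm.R.MP_const_closed[OF 1(1), of B] by (rule rev_image_eqI[OF _ sym, rotated])
    next
      case 2
      have "?ev (ring.indexed_var Kk b) = r" unfolding 2(2) by (rule ring_hom_cring.mp_eval_var[OF sc 2(1) vc])
      then show ?thesis using sm.R.MP_var_closed[OF 2(1)] by (rule rev_image_eqI[OF _ sym, rotated])
    qed
  qed
  have "generate_ring C R0 \<subseteq> ?ev ` carrier (MP Kk B)"
    by (rule C.generate_ring_min_subring1[OF subset_trans[OF s subringE(1)[OF img]] img s])
  then have "f \<in> ?ev ` carrier (MP Kk B)" using f by (rule subsetD)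
  then obtain F where F: "F \<in> carrier (MP Kk B)" "f = ?ev F" by (rule imageE)
  have "?val F = \<zero>\<^bsub>K\<^esub>"
  proof (rule ccontr)
    assume "?val F \<noteq> \<zero>\<^bsub>K\<^esub>"
    then have "?val F \<in> Units K" using val.hom_closed[OF F(1)] K.field_Units by simp
    then have "\<phi> f \<in> Units Tn" unfolding F(2) com[OF F(1)] by (rule hom_Units[OF iota_hom])
    then show False using P.Units_notin fP by blast
  qed
  moreover have "?val F = mpoly_value K F" by (simp add: mpoly_value_eq_eval mp_eval_def)
  ultimately have "F = ring.indexed_const K \<zero>\<^bsub>K\<^esub>"
    using indep Kk_pset[OF F(1)] unfolding algebraically_independent_def by auto
  also have "\<dots> = \<zero>\<^bsub>MP Kk B\<^esub>" unfolding MP_simps(3) sm.R.indexed_const_def K.indexed_const_def by (simp add: fun_eq_iff)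
  finally show ?thesis unfolding F(2) using ev.hom_zero by simp
qed

text \<open>The exponent counts the generators in \<open>?V\<close>: at most \<open>M\<close>
  elements of \<open>A\<close>, the \<open>n\<close> variables \<open>Inl j\<close>, and the
  variables of \<open>\<Theta>\<close>. The contraction to \<open>A\<close> is constant along the
  chain, so the relations of the other elements of \<open>A\<close> are nontrivial modulo each
  member. On the ring generated by \<open>R0\<close> all members contract to zero by
  \<open>R0_lies_over_zero\<close>, however large \<open>B\<close> is.\<close>

lemma fibre_bound:
  assumes M: "td_bound M" and P: "P \<in> spec Tn" and e: "prime_chain C l e" and le: "e l \<subseteq> down P"
    and const: "\<And>i. i \<le> l \<Longrightarrow> base (e i) = base (e 0)"
  shows "l < 2 ^ (M + n + card \<Theta>)"
proof -
  have es: "e i \<in> spec C" if "i \<le> l" for i by (rule prime_chainD[OF e that])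
  have e0: "e 0 \<in> spec C" by (rule es) simp
  have "base (e 0) \<in> spec A" by (rule contract_spec[OF cA.ring_hom_cring_axioms e0])
  from bspec[OF M[unfolded td_bound_def] this]
  obtain V0 where V0: "finite V0" "card V0 \<le> M" "V0 \<subseteq> carrier A"
    "\<forall>a\<in>carrier A. alg_rel A (generate_ring A (sm ` k \<union> V0)) (base (e 0)) a"
    by (elim exE conjE) (rule that)
  let ?X = "A.indexed_var ` Inl ` {..<n} \<union> A.indexed_var ` Inr ` \<Theta>"
  let ?V = "A.indexed_const ` V0 \<union> ?X"
  let ?Z = "A.indexed_const ` carrier A :: ((nat + 'b) multiset \<Rightarrow> 'a) set"
  have Vc: "?V \<subseteq> carrier C"
  proof -
    have "A.indexed_var i \<in> carrier C" if "i \<in> Inl ` {..<n} \<union> Inr ` \<Theta>" for i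
      by (rule A.MP_var_closed) (use that in \<open>auto simp: I_def\<close>)
    moreover have "A.indexed_const a \<in> carrier C" if "a \<in> V0" for a
      by (rule A.MP_const_closed) (use that V0(3) in \<open>simp add: subset_iff\<close>)
    ultimately show ?thesis by auto
  qed
  have R0c: "R0 \<subseteq> carrier C"
  proof -
    have "A.indexed_const (sm c) \<in> carrier C" if "c \<in> k" for c
      by (rule A.MP_const_closed[OF sm.hom_closed]) (use that in simp)
    moreover have "A.indexed_var (Inr b) \<in> carrier C" if "b \<in> B" for b
      by (rule A.MP_var_closed) (use that in \<open>simp add: I_def\<close>)
    ultimately show ?thesis unfolding R0_def by auto
  qed
  have Zc: "?Z \<subseteq> carrier C" using A.MP_const_closed by (rule image_subsetI)
  let ?G = "generate_ring C (R0 \<union> ?V)"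
  have Gc: "?G \<subseteq> carrier C" by (rule C.generate_ring_incl) (use R0c Vc in simp)
  have gen: "generate_ring C (?G \<union> ?Z) = carrier C"
  proof (rule A.MP_gen[OF C.generate_ring_is_subring])
    show "?G \<union> ?Z \<subseteq> carrier C" using Gc Zc by simp
    show "A.indexed_const c \<in> generate_ring C (?G \<union> ?Z)" if "c \<in> carrier A" for c
      by (rule generate_ring.incl) (use that in simp)
    show "A.indexed_var i \<in> generate_ring C (?G \<union> ?Z)" if "i \<in> I" for i
    proof -
      have "A.indexed_var i \<in> R0 \<union> ?V" using that unfolding I_def R0_def by blast
      then have "A.indexed_var i \<in> ?G" by (rule generate_ring.incl)
      then show ?thesis by (intro generate_ring.incl) simp
    qed
  qed
  have Vf: "finite ?V" using V0(1) Theta(1) by simp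
  have ag: "C.agree (generate_ring C R0) (e 0) (e i)" if i: "i \<le> l" for i
  proof -
    have z: "x = \<zero>\<^bsub>C\<^esub>" if x: "x \<in> generate_ring C R0" "x \<in> e j" "j \<le> l" for x j
    proof (rule R0_lies_over_zero[OF P x(1)])
      have "x \<in> down P" using prime_chain_mono[OF e x(3) order_refl] x(2) le by blast
      then show "\<phi> x \<in> P" by simp
    qed
    have z0: "\<zero>\<^bsub>C\<^esub> \<in> e j" if "j \<le> l" for j
      using es[OF that] by (simp add: spec_iff primeideal_def ideal_def additive_subgroup.zero_closed)
    show ?thesis unfolding C.agree_def
    proof
      fix x assume x: "x \<in> generate_ring C R0"
      show "x \<in> e 0 \<longleftrightarrow> x \<in> e i" using z[OF x] z0 i by (metis le0)
    qed
  qed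
  have smc: "sm ` k \<union> V0 \<subseteq> carrier A" using V0(3) sm.hom_closed by auto
  have "l < 2 ^ card ?V"
  proof (rule C.fibre_chain_bound[OF Vf Vc R0c Zc equalityD2[OF gen] e ag])
    fix z assume "z \<in> ?Z"
    then obtain a where a: "z = A.indexed_const a" "a \<in> carrier A" by (rule imageE)
    obtain m c where c': "\<forall>j\<le>m. c j \<in> generate_ring A (sm ` k \<union> V0)"
      and s: "(\<Oplus>\<^bsub>A\<^esub>j\<in>{..m::nat}. c j \<otimes>\<^bsub>A\<^esub> a [^]\<^bsub>A\<^esub> j) \<in> base (e 0)" and nz: "\<exists>j\<le>m. c j \<notin> base (e 0)"
      using bspec[OF V0(4) a(2), unfolded alg_rel_def] by (elim exE conjE) (rule that, assumption, assumption, blast)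
    note c = c'[rule_format]
    have cc: "c j \<in> carrier A" if "j \<le> m" for j by (rule A.generate_ring_in_carrier[OF smc c[OF that]])
    have "A.indexed_const (\<Oplus>\<^bsub>A\<^esub>j\<in>{..m}. c j \<otimes>\<^bsub>A\<^esub> a [^]\<^bsub>A\<^esub> j) = (\<Oplus>\<^bsub>C\<^esub>j\<in>{..m}. A.indexed_const (c j \<otimes>\<^bsub>A\<^esub> a [^]\<^bsub>A\<^esub> j))"
      using cA.hom_finsum[of "\<lambda>j. c j \<otimes>\<^bsub>A\<^esub> a [^]\<^bsub>A\<^esub> j" "{..m}"] cc a(2) by (simp add: comp_def)
    also have "\<dots> = (\<Oplus>\<^bsub>C\<^esub>j\<in>{..m}. A.indexed_const (c j) \<otimes>\<^bsub>C\<^esub> z [^]\<^bsub>C\<^esub> j)"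
    proof (rule C.finsum_cong')
      show "(\<lambda>j. A.indexed_const (c j) \<otimes>\<^bsub>C\<^esub> z [^]\<^bsub>C\<^esub> j) \<in> {..m} \<rightarrow> carrier C"
        unfolding a(1) by (rule Pi_I) (intro C.m_closed C.nat_pow_closed A.MP_const_closed cc a(2), simp)
      show "A.indexed_const (c j \<otimes>\<^bsub>A\<^esub> a [^]\<^bsub>A\<^esub> j) = A.indexed_const (c j) \<otimes>\<^bsub>C\<^esub> z [^]\<^bsub>C\<^esub> j" if "j \<in> {..m}" for j
        unfolding a(1) cA.hom_npow[OF a(2), symmetric] by (rule cA.hom_mult) (use that cc a(2) in simp_all)
    qed simp
    finally have sum: "(\<Oplus>\<^bsub>C\<^esub>j\<in>{..m}. A.indexed_const (c j) \<otimes>\<^bsub>C\<^esub> z [^]\<^bsub>C\<^esub> j) \<in> e 0" using s by simp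
    have "A.indexed_const (c j) \<in> ?G" if "j \<le> m" for j
    proof (rule generate_ring_hom_image[OF cA.ring_hom_cring_axioms smc c[OF that]])
      fix g assume "g \<in> sm ` k \<union> V0"
      then have "A.indexed_const g \<in> R0 \<union> ?V" unfolding R0_def by blast
      then show "A.indexed_const g \<in> ?G" by (rule generate_ring.incl)
    qed
    moreover have "\<exists>j\<le>m. A.indexed_const (c j) \<notin> e l"
    proof -
      obtain j where j: "j \<le> m" "c j \<notin> base (e l)" using nz const[of l] by auto
      then show ?thesis using cc[OF j(1)] by auto
    qed
    ultimately show "\<exists>m d. (\<forall>j\<le>m. d j \<in> ?G) \<and> (\<Oplus>\<^bsub>C\<^esub>j\<in>{..m::nat}. d j \<otimes>\<^bsub>C\<^esub> z [^]\<^bsub>C\<^esub> j) \<in> e 0 \<and> (\<exists>j\<le>m. d j \<notin> e l)"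
      using sum by (intro exI[of _ m] exI[of _ "\<lambda>j. A.indexed_const (c j)"]) simp
  qed
  also have "(2::nat) ^ card ?V \<le> 2 ^ (M + n + card \<Theta>)"
  proof (rule power_increasing)
    have "card (A.indexed_const ` V0 :: ((nat + 'b) multiset \<Rightarrow> 'a) set) \<le> M" using card_image_le[OF V0(1)] V0(2) by (rule le_trans)
    moreover have "card (A.indexed_var ` (Inl ` {..<n} :: (nat + 'b) set)) \<le> n"
      using card_image_le[of "Inl ` {..<n} :: (nat + 'b) set" A.indexed_var] card_image_le[of "{..<n}" "Inl :: nat \<Rightarrow> nat + 'b"] by simp
    moreover have "card (A.indexed_var ` (Inr ` \<Theta> :: (nat + 'b) set)) \<le> card \<Theta>"
      using card_image_le[of "Inr ` \<Theta> :: (nat + 'b) set" A.indexed_var] card_image_le[OF Theta(1), of "Inr :: 'b \<Rightarrow> nat + 'b"] Theta(1) by simp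
    ultimately show "card ?V \<le> M + n + card \<Theta>"
      using card_Un_le[of "A.indexed_const ` V0" ?X] card_Un_le[of "A.indexed_var ` (Inl ` {..<n} :: (nat + 'b) set)" "A.indexed_var ` Inr ` \<Theta>"] by linarith
  qed simp
  finally show ?thesis .
qed

text \<open>\<open>p\<close> is the least prime above its contraction to the variables \<open>I0\<close>. A chain of such least primes
  for growing finite \<open>I0\<close> stays over one prime of \<open>A\<close>, so it becomes stationary at \<open>p\<close> by the fibre bound.\<close>

definition fin_level :: "((nat + 'b) multiset \<Rightarrow> 'a) set \<Rightarrow> (nat + 'b) set \<Rightarrow> bool"
  where "fin_level p I0 \<longleftrightarrow> (\<forall>J\<in>spec C. p \<inter> carrier (MP A I0) \<subseteq> J \<longrightarrow> p \<subseteq> J)"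

lemma fin_level_mono: "fin_level p I0 \<Longrightarrow> I0 \<subseteq> I1 \<Longrightarrow> fin_level p I1"
  unfolding fin_level_def using A.MP_mono[of I0 I1] by (meson IntE IntI subset_iff)

lemma fin_level_exists:
  assumes M: "finite B \<or> td_bound M" and P: "P \<in> spec Tn"
  shows "\<exists>I0. finite I0 \<and> I0 \<subseteq> I \<and> fin_level (down P) I0"
proof (rule ccontr)
  assume no: "\<not> ?thesis"
  let ?p = "down P"
  have p: "?p \<in> spec C" by (rule contract_spec[OF phi_hom P])
  note pc = contract_subset[of C \<phi> P]
  \<comment> \<open>With all variables allowed the condition is trivial. A counterexample therefore
    has infinite \<open>I\<close>, hence infinite \<open>B\<close> as \<open>\<Theta>\<close> is
    finite, and \<open>td_bound\<close> is available.\<close>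
  have "fin_level ?p I" unfolding fin_level_def Int_absorb2[OF pc] by (intro ballI impI)
  then have "infinite I" using no by (meson order_refl)
  then have "infinite B" using Theta(1) by (auto simp: I_def)
  then have M: "td_bound M" using M by simp
  \<comment> \<open>\<open>E\<close> is the extension of the contraction of \<open>?p\<close> to the
    variables \<open>I0\<close>, characterized by its trace there and by its leastness.\<close>
  define ok where "ok I0 E \<longleftrightarrow> E \<in> spec C \<and> (\<forall>f\<in>carrier (MP A I0). f \<in> E \<longleftrightarrow> f \<in> ?p) \<and>
    (\<forall>J. ideal J C \<longrightarrow> ?p \<inter> carrier (MP A I0) \<subseteq> J \<longrightarrow> E \<subseteq> J)" for I0 E
  have "\<exists>E. ok I0 E" if I0: "I0 \<subseteq> I" for I0
  proof -
    have N: "?p \<inter> carrier (MP A I0) \<in> spec (MP A I0)"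
      using contract_spec[OF A.MP_incl_hom[OF I0] p] unfolding contract_id .
    show ?thesis using MP_extend_prime_ex[OF A.is_cring I0 N] unfolding ok_def by (elim bexE conjE) (intro exI conjI, simp_all)
  qed
  then obtain E where E: "\<And>I0. I0 \<subseteq> I \<Longrightarrow> ok I0 (E I0)" by metis
  have "\<exists>e I0. prime_chain C l e \<and> e l = E I0 \<and> finite I0 \<and> I0 \<subseteq> I \<and> (\<forall>i\<le>l. base (e i) = base ?p)" for l
  proof (induct l)
    case 0
    have ok: "ok {} (E {})" by (rule E) simp
    have "base (E {}) = base ?p"
    proof (rule contract_cong)
      fix a assume a: "a \<in> carrier A"
      show "A.indexed_const a \<in> E {} \<longleftrightarrow> A.indexed_const a \<in> ?p"
        using ok A.MP_const_closed[OF a, of "{}"] unfolding ok_def by blast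
    qed
    then show ?case using ok unfolding ok_def prime_chain_def by (intro exI[of _ "\<lambda>_. E {}"] exI[of _ "{}"]) simp
  next
    case (Suc l)
    then obtain e I0 where e: "prime_chain C l e" "e l = E I0" "finite I0" "I0 \<subseteq> I" "\<And>i. i \<le> l \<Longrightarrow> base (e i) = base ?p"
      by blast
    have ok0: "ok I0 (E I0)" by (rule E[OF e(4)])
    \<comment> \<open>Some prime \<open>J\<close> above the contraction misses an element
      \<open>x\<close> of \<open>?p\<close>, and then the smaller \<open>E I0\<close> misses it too.
      Adjoining the variables of \<open>x\<close> makes the extension grow strictly, while its
      contraction to \<open>A\<close> stays that of \<open>?p\<close>.\<close>
    have "\<not> fin_level ?p I0" using no e(3,4) by blast
    then obtain J where J: "J \<in> spec C" "?p \<inter> carrier (MP A I0) \<subseteq> J" "\<not> ?p \<subseteq> J" unfolding fin_level_def by blast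
    have "ideal J C" by (rule spec_ideal[OF J(1)])
    then have "E I0 \<subseteq> J" using ok0 J(2) unfolding ok_def by blast
    then obtain x where x: "x \<in> ?p" "x \<notin> E I0" using J(3) by blast
    obtain I1 where I1: "finite I1" "I1 \<subseteq> I" "x \<in> carrier (MP A I1)" using A.MP_finite_vars[OF subsetD[OF pc x(1)]] by blast
    let ?I = "I0 \<union> I1"
    have I': "?I \<subseteq> I" "finite ?I" using e(3,4) I1(1,2) by simp_all
    have ok1: "ok ?I (E ?I)" by (rule E[OF I'(1)])
    have xc: "x \<in> carrier (MP A ?I)" by (rule A.MP_mono[OF _ I1(3)]) simp
    have xE: "x \<in> E ?I" using ok1 x(1) xc unfolding ok_def by blast
    have c01: "carrier (MP A I0) \<subseteq> carrier (MP A ?I)" using A.MP_mono[of I0 ?I] by (intro subsetI) simp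
    have "?p \<inter> carrier (MP A I0) \<subseteq> E ?I" using ok1 c01 unfolding ok_def by blast
    moreover have "ideal (E ?I) C" using ok1 spec_ideal unfolding ok_def by blast
    ultimately have "E I0 \<subseteq> E ?I" using ok0 unfolding ok_def by blast
    then have s: "e l \<subset> E ?I" using xE x(2) e(2) by blast
    have "E ?I \<in> spec C" using ok1 unfolding ok_def by blast
    then have ch: "prime_chain C (Suc l) (e(Suc l := E ?I))" by (rule chain_append[OF e(1) _ s])
    have "base (E ?I) = base ?p"
    proof (rule contract_cong)
      fix a assume a: "a \<in> carrier A"
      show "A.indexed_const a \<in> E ?I \<longleftrightarrow> A.indexed_const a \<in> ?p"
        using ok1 A.MP_const_closed[OF a, of ?I] unfolding ok_def by blast
    qed
    then have "\<forall>i\<le>Suc l. base ((e(Suc l := E ?I)) i) = base ?p" using e(5) by (simp add: le_Suc_eq)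
    then show ?case by (intro exI[of _ "e(Suc l := E ?I)"] exI[of _ ?I] conjI ch I') simp
  qed
  then obtain e I0 where e: "prime_chain C (2 ^ (M + n + card \<Theta>)) e" "e (2 ^ (M + n + card \<Theta>)) = E I0" "I0 \<subseteq> I"
    "\<And>i. i \<le> 2 ^ (M + n + card \<Theta>) \<Longrightarrow> base (e i) = base ?p" by meson
  have "E I0 \<subseteq> ?p" using E[OF e(3)] spec_ideal[OF p] unfolding ok_def by blast
  then have "e (2 ^ (M + n + card \<Theta>)) \<subseteq> ?p" using e(2) by simp
  from fibre_bound[OF M P e(1) this] e(4) show False by simp
qed

text \<open>The levels of the finitely many primes in \<open>F\<close> and the variables of the
  polynomials in \<open>W\<close> fit into one finite set \<open>I'\<close>. A prime between the
  contractions of adjacent \<open>down P\<close> and \<open>down Q\<close> has a least extension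
  \<open>E\<close> to \<open>C\<close>. It lies below \<open>down Q\<close> by its leastness and
  above \<open>down P\<close> by \<open>fin_level\<close>, so it is one of the two.\<close>

lemma transfer:
  assumes M: "finite B \<or> td_bound M" and F: "finite F" "F \<subseteq> spec Tn" and W: "finite W" "W \<subseteq> carrier C"
  shows "\<exists>N \<psi>. N \<ge> 1 \<and> ring_hom_cring (mpoly_ring A N) C \<psi> \<and> W \<subseteq> \<psi> ` carrier (mpoly_ring A N) \<and>
    (\<forall>P\<in>F. \<forall>Q\<in>F. adjacent_primes Tn P Q \<longrightarrow>
      adjacent_primes (mpoly_ring A N) (contract (mpoly_ring A N) \<psi> (down P)) (contract (mpoly_ring A N) \<psi> (down Q)))"
proof -
  have "\<forall>P\<in>F. \<exists>I0. finite I0 \<and> I0 \<subseteq> I \<and> fin_level (down P) I0" using fin_level_exists[OF M] F(2) by blast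
  then obtain i where i: "\<And>P. P \<in> F \<Longrightarrow> finite (i P) \<and> i P \<subseteq> I \<and> fin_level (down P) (i P)" by metis
  have "\<forall>w\<in>W. \<exists>I'. finite I' \<and> I' \<subseteq> I \<and> w \<in> carrier (MP A I')" using A.MP_finite_vars W(2) by blast
  then obtain j where j: "\<And>w. w \<in> W \<Longrightarrow> finite (j w) \<and> j w \<subseteq> I \<and> w \<in> carrier (MP A (j w))" by metis
  \<comment> \<open>\<open>Inl 0\<close> is included only to make \<open>I'\<close> nonempty, since
    the hypotheses on \<open>A\<close> concern at least one variable; it belongs to \<open>I\<close>
    because \<open>n \<ge> 1\<close>.\<close>
  define I' where "I' = insert (Inl 0) (\<Union> (i ` F) \<union> \<Union> (j ` W))"
  have fin: "finite I'" unfolding I'_def using F(1) W(1) i j by simp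
  have "Inl 0 \<in> I" using n by (simp add: I_def)
  moreover have "\<Union> (i ` F) \<subseteq> I" using i by blast
  moreover have "\<Union> (j ` W) \<subseteq> I" using j by blast
  ultimately have sub: "I' \<subseteq> I" unfolding I'_def by simp
  have iI: "i P \<subseteq> I'" if "P \<in> F" for P unfolding I'_def using that by blast
  have fl: "fin_level (down P) I'" if "P \<in> F" for P using fin_level_mono[OF _ iI[OF that]] i[OF that] by blast
  obtain \<psi> where psi: "ring_hom_cring (mpoly_ring A (card I')) (MP A I') \<psi>"
    "\<psi> ` carrier (mpoly_ring A (card I')) = carrier (MP A I')"
    by (rule MP_reindex[OF A.is_cring fin])
  let ?N = "card I'"
  let ?D = "mpoly_ring A ?N"
  have inc: "ring_hom_cring (MP A I') C id" by (rule A.MP_incl_hom[OF sub])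
  have hom: "ring_hom_cring ?D C \<psi>" using ring_hom_cring_comp[OF psi(1) inc] by simp
  have ess: "ess_surj ?D (MP A I') \<psi>" by (rule surj_ess_surj[OF psi(1)]) (simp add: psi(2))
  have pc: "\<psi> r \<in> carrier (MP A I')" if "r \<in> carrier ?D" for r using psi(2) that by (rule subsetD[OF equalityD1 imageI])
  show ?thesis
  proof (intro exI conjI ballI impI)
    show "ring_hom_cring ?D C \<psi>" by (rule hom)
    have "I' \<noteq> {}" by (simp add: I'_def)
    then show "1 \<le> ?N" using fin by (simp add: Suc_le_eq card_gt_0_iff)
    show "W \<subseteq> \<psi> ` carrier ?D"
    proof
      fix w assume w: "w \<in> W"
      have "j w \<subseteq> I'" unfolding I'_def using w by blast
      then show "w \<in> \<psi> ` carrier ?D" unfolding psi(2) using A.MP_mono j[OF w] by blast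
    qed
    fix P Q assume P: "P \<in> F" and Q: "Q \<in> F" and a: "adjacent_primes Tn P Q"
    have ad: "adjacent_primes C (down P) (down Q)" by (rule adjacent_contract[OF phi_ess a])
    note d = adjacent_primesD[OF ad]
    let ?c = "contract (MP A I') id"
    have cc: "?c J = J \<inter> carrier (MP A I')" for J by (rule contract_id)
    have "adjacent_primes (MP A I') (?c (down P)) (?c (down Q))"
    proof (rule adjacent_primesI)
      show sp: "?c (down P) \<in> spec (MP A I')" "?c (down Q) \<in> spec (MP A I')"
        by (rule contract_spec[OF inc d(1)], rule contract_spec[OF inc d(2)])
      \<comment> \<open>The inclusion stays strict because \<open>down Q\<close> is least over its
        contraction: otherwise it would be contained in \<open>down P\<close>.\<close>
      have "\<not> ?c (down Q) \<subseteq> down P" using fl[OF Q] d(1,3) unfolding fin_level_def cc by blast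
      then show "?c (down P) \<subset> ?c (down Q)" using d(3) unfolding cc by blast
      fix N assume N: "N \<in> spec (MP A I')" "?c (down P) \<subseteq> N" "N \<subseteq> ?c (down Q)"
      obtain E where E: "E \<in> spec C" "\<forall>f\<in>carrier (MP A I'). f \<in> E \<longleftrightarrow> f \<in> N"
        "\<forall>J. ideal J C \<longrightarrow> N \<subseteq> J \<longrightarrow> E \<subseteq> J"
        using MP_extend_prime_ex[OF A.is_cring sub N(1)] by (elim bexE conjE) (rule that)
      have Nc: "N \<subseteq> carrier (MP A I')" using N(3) unfolding cc by blast
      have "ideal (down Q) C" by (rule spec_ideal[OF d(2)])
      then have EQ: "E \<subseteq> down Q" using E(3) N(3) unfolding cc by blast
      have NE: "N \<subseteq> E" using E(2) Nc by blast
      then have "down P \<inter> carrier (MP A I') \<subseteq> E" using N(2) unfolding cc by blast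
      then have PE: "down P \<subseteq> E" using fl[OF P] E(1) unfolding fin_level_def by blast
      have EN: "?c E = N" unfolding cc using E(2) Nc by blast
      have "E = down P \<or> E = down Q" by (rule d(4)[OF E(1) PE EQ])
      then show "N = ?c (down P) \<or> N = ?c (down Q)" using EN by (elim disjE) simp_all
    qed
    from adjacent_contract[OF ess this]
    have "adjacent_primes ?D (contract ?D \<psi> (?c (down P))) (contract ?D \<psi> (?c (down Q)))" .
    moreover have "contract ?D \<psi> (?c J) = contract ?D \<psi> J" for J
      using contract_comp[where R = ?D and h = \<psi> and S = "MP A I'" and g = id and P = J, OF pc] by simp
    ultimately show "adjacent_primes ?D (contract ?D \<psi> (down P)) (contract ?D \<psi> (down Q))"
      by simp
  qed
qed

text \<open>That a prime \<open>N\<close> lies strictly between two extensions is witnessed by two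
  univariate polynomials \<open>f\<close> and \<open>g\<close> over \<open>C\<close>. Their finitely
  many coefficients are put into \<open>W\<close>, so both lift to the polynomial ring in finitely
  many variables and show that the contraction of \<open>N\<close> is still strictly between the
  extensions there. The S-property of that ring excludes this.\<close>

lemma strong_S_transfer:
  assumes M: "finite B \<or> td_bound M" and S: "\<And>N. N \<ge> 1 \<Longrightarrow> strong_S_ring (mpoly_ring A N)"
  shows "strong_S_ring Tn"
  unfolding strong_S_ring_iff
proof (intro conjI allI impI)
  show "nonzero_cring Tn" by (rule T.MP_nonzero[OF T.one_not_zero])
  fix P Q assume a: "adjacent_primes Tn P Q"
  have sp: "P \<in> spec Tn" "Q \<in> spec Tn" using adjacent_primesD[OF a] by simp_all
  show "SS_between Tn P Q"
    unfolding SS_between_def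
  proof
    assume "\<exists>N\<in>spec (UP Tn). UP_ext Tn P \<subset> N \<and> N \<subset> UP_ext Tn Q"
    then obtain N where N: "N \<in> spec (UP Tn)" "UP_ext Tn P \<subset> N" "N \<subset> UP_ext Tn Q" by blast
    let ?c = "contract (UP C) (UP_map \<phi>)"
    have Pc: "?c (UP_ext Tn P) = UP_ext C (down P)" by (rule \<phi>.contract_UP_ext)
    have Qc: "?c (UP_ext Tn Q) = UP_ext C (down Q)" by (rule \<phi>.contract_UP_ext)
    have N1: "?c N \<in> spec (UP C)" by (rule contract_spec[OF \<phi>.UP_map_hom N(1)])
    have "\<not> ?c N \<subseteq> ?c (UP_ext Tn P)" using ess_contract_mono[OF UP_phi_ess N(1) UP_ext_spec[OF sp(1)]] N(2) by blast
    then obtain f where f: "f \<in> ?c N" "f \<notin> UP_ext C (down P)" unfolding Pc by blast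
    have "\<not> ?c (UP_ext Tn Q) \<subseteq> ?c N" using ess_contract_mono[OF UP_phi_ess UP_ext_spec[OF sp(2)] N(1)] N(3) by blast
    then obtain g where g: "g \<in> UP_ext C (down Q)" "g \<notin> ?c N" unfolding Qc by blast
    have le: "UP_ext C (down P) \<subseteq> ?c N" "?c N \<subseteq> UP_ext C (down Q)"
      unfolding Pc[symmetric] Qc[symmetric] using N(2,3) by auto
    have fc: "f \<in> carrier (UP C)" "g \<in> carrier (UP C)" using f(1) g(1) le(2) unfolding UP_ext_def by auto
    have fg: "f m \<in> carrier C" "g m \<in> carrier C" for m using fc unfolding UP_carrier by simp_all
    have W: "finite (range f \<union> range g)" using UP_finite_range[OF fc(1)] UP_finite_range[OF fc(2)] by simp
    have Wc: "range f \<union> range g \<subseteq> carrier C" using fg by (intro Un_least image_subsetI)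
    have F: "finite {P, Q}" "{P, Q} \<subseteq> spec Tn" using sp by simp_all
    obtain L \<psi> where L: "L \<ge> 1" "ring_hom_cring (mpoly_ring A L) C \<psi>" "range f \<union> range g \<subseteq> \<psi> ` carrier (mpoly_ring A L)"
      and tr: "\<forall>P'\<in>{P, Q}. \<forall>Q'\<in>{P, Q}. adjacent_primes Tn P' Q' \<longrightarrow>
        adjacent_primes (mpoly_ring A L) (contract (mpoly_ring A L) \<psi> (down P')) (contract (mpoly_ring A L) \<psi> (down Q'))"
      using transfer[OF M F W Wc] by (elim exE conjE) (rule that)
    let ?D = "mpoly_ring A L"
    have "adjacent_primes ?D (contract ?D \<psi> (down P)) (contract ?D \<psi> (down Q))" using tr a by simp
    then have ss: "SS_between ?D (contract ?D \<psi> (down P)) (contract ?D \<psi> (down Q))"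
      using S[OF L(1)] unfolding strong_S_ring_iff by blast
    have U: "ring_hom_cring (UP ?D) (UP C) (UP_map \<psi>)" by (rule ring_hom_cring.UP_map_hom[OF L(2)])
    let ?d = "contract (UP ?D) (UP_map \<psi>)"
    have N2: "?d (?c N) \<in> spec (UP ?D)" by (rule contract_spec[OF U N1])
    obtain f' where f': "f' \<in> carrier (UP ?D)" "UP_map \<psi> f' = f"
      using ring_hom_cring.UP_map_lift[OF L(2) fc(1)] L(3) by blast
    obtain g' where g': "g' \<in> carrier (UP ?D)" "UP_map \<psi> g' = g"
      using ring_hom_cring.UP_map_lift[OF L(2) fc(2)] L(3) by blast
    have "f' \<in> ?d (?c N)" "f' \<notin> ?d (UP_ext C (down P))" unfolding contract_def[of "UP ?D"] using f f' by simp_all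
    moreover have "g' \<notin> ?d (?c N)" "g' \<in> ?d (UP_ext C (down Q))" unfolding contract_def[of "UP ?D"] using g g' by simp_all
    moreover have "?d (UP_ext C (down P)) \<subseteq> ?d (?c N)" "?d (?c N) \<subseteq> ?d (UP_ext C (down Q))"
      unfolding contract_def[of "UP ?D"] using le by blast+
    ultimately have "?d (UP_ext C (down P)) \<subset> ?d (?c N)" "?d (?c N) \<subset> ?d (UP_ext C (down Q))" by blast+
    then show False using ss N2 unfolding SS_between_def ring_hom_cring.contract_UP_ext[OF L(2)] by blast
  qed
qed

text \<open>For finite \<open>B\<close>, contraction carries chains injectively into a polynomial
  ring in finitely many variables. Otherwise \<open>fibre_bound\<close> forces the contraction to
  \<open>A\<close> to change within any \<open>?W\<close> steps, so a chain of length
  \<open>l\<close> produces one of length \<open>l div ?W\<close> in \<open>A\<close> below the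
  contraction of \<open>P\<close>, whose height is finite.\<close>

lemma height_finite:
  assumes M: "finite B \<or> td_bound M" and A: "LFD A" and D: "\<And>N. N \<ge> 1 \<Longrightarrow> LFD (mpoly_ring A N)"
    and P: "P \<in> spec Tn"
  shows "prime_height Tn P < \<infinity>"
proof (cases "finite B")
  case True
  then have fin: "finite I" using Theta(1) by (simp add: I_def)
  have "Inl 0 \<in> I" using n by (simp add: I_def)
  then have N: "1 \<le> card I" using fin by (auto simp: Suc_le_eq card_gt_0_iff)
  obtain \<psi> where psi: "ring_hom_cring (mpoly_ring A (card I)) C \<psi>" "\<psi> ` carrier (mpoly_ring A (card I)) = carrier C"
    by (rule MP_reindex[OF A.is_cring fin])
  let ?D = "mpoly_ring A (card I)"
  have ess: "ess_surj ?D C \<psi>" by (rule surj_ess_surj[OF psi(1)]) (simp add: psi(2))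
  have p: "down P \<in> spec C" by (rule contract_spec[OF phi_hom P])
  have cD: "cring ?D" unfolding mpoly_ring_eq by (rule A.MP_cring)
  have "prime_height Tn P \<le> prime_height C (down P)" by (rule ess_height_le[OF phi_ess P])
  also have "\<dots> \<le> prime_height ?D (contract ?D \<psi> (down P))" by (rule ess_height_le[OF ess p])
  also have "\<dots> < \<infinity>" using D[OF N] contract_spec[OF psi(1) p] unfolding LFD_iff[OF cD] by blast
  finally show ?thesis .
next
  case False
  then have M: "td_bound M" using M by simp
  let ?W = "2 ^ (M + n + card \<Theta>) :: nat"
  have cA: "ring_hom_cring A C A.indexed_const" by (rule cA.ring_hom_cring_axioms)
  have p: "down P \<in> spec C" by (rule contract_spec[OF phi_hom P])
  have pA: "base (down P) \<in> spec A" by (rule contract_spec[OF cA p])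
  then have "prime_height A (base (down P)) < \<infinity>" using assms(2) unfolding LFD_iff[OF A.is_cring] by blast
  then obtain h where h: "prime_height A (base (down P)) = enat h" by auto
  \<comment> \<open>The quotient \<open>l div ?W\<close> is at most the height \<open>h\<close> in
    \<open>A\<close>; the summand 1 accounts for the remainder of the division.\<close>
  have "prime_height Tn P \<le> enat (?W * (h + 1))"
  proof (rule height_le)
    fix l c assume c: "prime_chain Tn l c" "c l = P"
    define e where "e i = down (c i)" for i
    have e: "prime_chain C l e" unfolding e_def by (rule ess_chain[OF phi_ess c(1)])
    have el: "e l = down P" by (simp add: e_def c(2))
    have mono: "base (e i) \<subseteq> base (e j)" if "i \<le> j" "j \<le> l" for i j
      using prime_chain_mono[OF e that] by auto
    have step: "base (e i) \<subset> base (e (i + ?W))" if i: "i + ?W \<le> l" for i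
    proof -
      have "base (e i) \<noteq> base (e (i + ?W))"
      proof
        assume eq: "base (e i) = base (e (i + ?W))"
        have ch: "prime_chain C ?W (\<lambda>j. e (i + j))" using e i by (simp add: prime_chain_def)
        have "e (i + ?W) \<subseteq> down P" using prime_chain_mono[OF e i order_refl] el by simp
        moreover have "base (e (i + j)) = base (e (i + 0))" if "j \<le> ?W" for j
          using mono[of i "i + j"] mono[of "i + j" "i + ?W"] eq i that by simp
        ultimately show False using fibre_bound[OF M P ch] by blast
      qed
      then show ?thesis using mono[of i "i + ?W"] i by auto
    qed
    let ?d = "l div ?W"
    have dl: "?d * ?W \<le> l" by simp
    have "prime_chain A ?d (\<lambda>j. base (e (j * ?W)))"
      unfolding prime_chain_def
    proof (intro conjI allI impI)
      fix j
      show "base (e (j * ?W)) \<in> spec A" if "j \<le> ?d"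
      proof (rule contract_spec[OF cA prime_chainD[OF e]])
        show "j * ?W \<le> l" using mult_le_mono1[OF that, of ?W] dl by linarith
      qed
      show "base (e (j * ?W)) \<subset> base (e (Suc j * ?W))" if "j < ?d"
      proof -
        have "Suc j * ?W \<le> l" by (rule le_trans[OF mult_le_mono1 dl]) (use that in simp)
        then have "j * ?W + ?W \<le> l" by (simp only: mult_Suc add.commute)
        from step[OF this] show ?thesis by (simp only: mult_Suc add.commute)
      qed
    qed
    then have "enat ?d \<le> prime_height A (base (e (?d * ?W)))" by (rule chain_le_height)
    also have "\<dots> \<le> prime_height A (base (down P))"
      by (rule prime_height_mono[OF pA]) (use mono[OF dl order_refl] el in simp)
    finally have "?d \<le> h" using h by simp
    have "l = ?d * ?W + l mod ?W" by (rule div_mult_mod_eq[symmetric])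
    also have "l mod ?W < ?W" by simp
    then have "?d * ?W + l mod ?W \<le> (?d + 1) * ?W" by simp
    also have "\<dots> \<le> (h + 1) * ?W" using \<open>?d \<le> h\<close> by (intro mult_le_mono1) simp
    finally show "l \<le> ?W * (h + 1)" by (simp add: mult.commute)
  qed
  then show ?thesis using enat_ord_code(4) le_less_trans by blast
qed

text \<open>Longest chains to \<open>P\<close> and to \<open>Q\<close> are saturated and start at
  minimal primes. Both minimal primes lie in \<open>Q\<close>, so MPC identifies them. The members
  of both chains, and the step from \<open>P\<close> to \<open>Q\<close>, become adjacent primes of
  one polynomial ring in finitely many variables, where every adjacent step raises the height by
  one; comparing the two ways to reach \<open>Q\<close> gives \<open>l = 1 + m\<close>.\<close>

lemma catenarian_transfer:
  assumes M: "finite B \<or> td_bound M" and A: "LFD A" and D: "\<And>N. N \<ge> 1 \<Longrightarrow> catenarian (mpoly_ring A N)"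
    and mpc: "MPC T"
  shows "catenarian Tn"
  unfolding catenarian_def
proof (intro conjI allI impI)
  show "nonzero_cring Tn" by (rule T.MP_nonzero[OF T.one_not_zero])
  show mpcn: "MPC Tn" by (rule MPC_MP[OF T.is_cring mpc])
  have LD: "LFD (mpoly_ring A N)" if "N \<ge> 1" for N using D[OF that] by (simp add: catenarian_def)
  have fin: "prime_height Tn P < \<infinity>" if "P \<in> spec Tn" for P by (rule height_finite[OF M A LD that])
  then show "LFD Tn" unfolding LFD_iff[OF Tn.is_cring] by blast
  fix P Q assume a: "adjacent_primes Tn P Q"
  note d = adjacent_primesD[OF a]
  obtain m c where c: "prime_chain Tn m c" "c m = P" "prime_height Tn P = enat m" by (rule height_attained[OF fin[OF d(1)] d(1)])
  obtain l e where e: "prime_chain Tn l e" "e l = Q" "prime_height Tn Q = enat l" by (rule height_attained[OF fin[OF d(2)] d(2)])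
  have hc: "prime_height Tn (c m) = enat m" and he: "prime_height Tn (e l) = enat l" using c e by simp_all
  note cs = height_chain_saturated[OF c(1) hc] and es = height_chain_saturated[OF e(1) he]
  have c0: "c 0 \<subseteq> Q" using prime_chain_mono[OF c(1), of 0 m] c(2) d(3) by auto
  have e0: "e 0 \<subseteq> Q" using prime_chain_mono[OF e(1), of 0 l] e(2) by auto
  have eq: "c 0 = e 0"
  proof (rule ccontr)
    assume "c 0 \<noteq> e 0"
    then have "c 0 <+>\<^bsub>Tn\<^esub> e 0 = carrier Tn" using mpcn cs(2) es(2) unfolding MPC_def by blast
    then have "\<one>\<^bsub>Tn\<^esub> \<in> c 0 <+>\<^bsub>Tn\<^esub> e 0" by simp
    then obtain x y where xy: "x \<in> c 0" "y \<in> e 0" "\<one>\<^bsub>Tn\<^esub> = x \<oplus>\<^bsub>Tn\<^esub> y" unfolding set_add_def' by blast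
    interpret Q: primeideal Q Tn using d(2) by (simp add: spec_iff)
    have "x \<oplus>\<^bsub>Tn\<^esub> y \<in> Q" by (rule Q.add_in) (use xy c0 e0 in auto)
    then show False using xy(3) Q.one_notin by simp
  qed
  define F where "F = c ` {..m} \<union> e ` {..l}"
  have Ff: "finite F" by (simp add: F_def)
  have Fs: "F \<subseteq> spec Tn" unfolding F_def using prime_chainD[OF c(1)] prime_chainD[OF e(1)] by auto
  have PF: "c i \<in> F" if "i \<le> m" for i using that by (simp add: F_def)
  have QF: "e i \<in> F" if "i \<le> l" for i using that by (simp add: F_def)
  obtain N \<psi> where N: "N \<ge> 1" "ring_hom_cring (mpoly_ring A N) C \<psi>"
    and tr': "\<forall>P\<in>F. \<forall>Q\<in>F. adjacent_primes Tn P Q \<longrightarrow>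
      adjacent_primes (mpoly_ring A N) (contract (mpoly_ring A N) \<psi> (down P)) (contract (mpoly_ring A N) \<psi> (down Q))"
    using transfer[OF M Ff Fs finite.emptyI empty_subsetI] by (elim exE conjE) (rule that)
  note tr = tr'[rule_format]
  let ?D = "mpoly_ring A N"
  let ?t = "\<lambda>P. contract ?D \<psi> (down P)"
  have cat: "prime_height ?D Q = 1 + prime_height ?D P" if "adjacent_primes ?D P Q" for P Q
    using D[OF N(1)] that unfolding catenarian_def by blast
  have "prime_height ?D (?t (c m)) = prime_height ?D (?t (c 0)) + enat m"
    using saturated_height[of ?D m "\<lambda>i. ?t (c i)", OF cat tr[OF PF PF cs(1)]] by simp
  moreover have "prime_height ?D (?t (e l)) = prime_height ?D (?t (e 0)) + enat l"
    using saturated_height[of ?D l "\<lambda>i. ?t (e i)", OF cat tr[OF QF QF es(1)]] by simp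
  moreover have "prime_height ?D (?t (e l)) = 1 + prime_height ?D (?t (c m))"
    by (rule cat[OF tr[OF PF QF]]) (use a c(2) e(2) in simp_all)
  ultimately have sum: "prime_height ?D (?t (c 0)) + enat l = 1 + (prime_height ?D (?t (c 0)) + enat m)" using eq by auto
  have "c 0 \<in> spec Tn" using prime_chainD[OF c(1)] by simp
  then have "?t (c 0) \<in> spec ?D" by (intro contract_spec[OF N(2)] contract_spec[OF phi_hom])
  moreover have "cring ?D" unfolding mpoly_ring_eq by (rule A.MP_cring)
  \<comment> \<open>The contraction of the common bottom need not be minimal in \<open>?D\<close>,
    so its height stays in the equation. It can be cancelled in \<open>enat\<close> because LFD
    makes it finite.\<close>
  ultimately have "prime_height ?D (?t (c 0)) < \<infinity>" using LD[OF N(1)] LFD_iff by blast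
  then obtain h where "prime_height ?D (?t (c 0)) = enat h" by auto
  then have "l = 1 + m" using sum by (simp add: one_enat_def)
  then show "prime_height Tn Q = 1 + prime_height Tn P" unfolding c(3) e(3) by (simp add: one_enat_def)
qed

end

section \<open>From the hypotheses on \<open>K\<close>, \<open>B\<close> and \<open>A\<close> to the
  common setting\<close>

lemma (in ring) Span_subset_subring:
  assumes "subring F R" "E \<subseteq> F" "set Us \<subseteq> F"
  shows "Span E Us \<subseteq> F"
  using assms(3)
proof (induct Us)
  case Nil then show ?case using subringE(2)[OF assms(1)] by simp
next
  case (Cons u Us)
  have "x \<in> F" if x: "x \<in> line_extension E u (Span E Us)" for x
  proof -
    obtain e y where "e \<in> E" "y \<in> Span E Us" "x = e \<otimes> u \<oplus> y" using x unfolding line_extension_mem_iff by blast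
    moreover have "Span E Us \<subseteq> F" "u \<in> F" using Cons by simp_all
    ultimately show ?thesis using assms(2) subringE(6,7)[OF assms(1)] by blast
  qed
  then show ?case by auto
qed

lemma algebra_structure_hom:
  fixes A (structure)
  assumes "algebra R A"
  shows "ring_hom_cring R A (\<lambda>c. c \<odot>\<^bsub>A\<^esub> \<one>)"
proof -
  interpret algebra R A by fact
  show ?thesis
  proof (rule ring_hom_cringI'[OF R_cring M_cring ring_hom_memI])
    fix x y assume xy: "x \<in> carrier R" "y \<in> carrier R"
    have "(x \<odot>\<^bsub>A\<^esub> \<one>) \<otimes> (y \<odot>\<^bsub>A\<^esub> \<one>) = x \<odot>\<^bsub>A\<^esub> (\<one> \<otimes> (y \<odot>\<^bsub>A\<^esub> \<one>))"
      using xy by (intro smult_assoc2) simp_all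
    then show "(x \<otimes>\<^bsub>R\<^esub> y) \<odot>\<^bsub>A\<^esub> \<one> = (x \<odot>\<^bsub>A\<^esub> \<one>) \<otimes> (y \<odot>\<^bsub>A\<^esub> \<one>)"
      using xy smult_assoc1[of x y \<one>] by simp
  qed (simp_all add: smult_l_distr)
qed

theorem theorem4p13:
  fixes K :: "('b, 'n) ring_scheme" and k B L :: "'b set"
    and A :: "('b, 'a, 'm) module_scheme"
  assumes "field K" and "subfield k K"
    and "algebra (K\<lparr>carrier := k\<rparr>) A" and "nonzero_cring A" and "LFD A"
    and "algebra_trdeg A k < \<infinity> \<or> field_trdeg K k < \<infinity>"
    and "transcendence_basis K k B"
    and "L = separable_closure_in K (adjoin K k B)"
    and "ring.finite_dimension K (adjoin K k B) L"
  shows "(stably_strong_S_ring A \<longrightarrow> stably_strong_S_ring (tensor_product k K A)) \<and>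
    (universally_catenarian A \<and> MPC (tensor_product k K A) \<longrightarrow>
      universally_catenarian (tensor_product k K A))"
proof -
  interpret F: field K by (rule assms(1))
  have A: "cring A" using assms(4) by (simp add: nonzero_cring_def)
  have kK: "k \<subseteq> carrier K" by (rule subfieldE(3)[OF assms(2)])
  have indep: "algebraically_independent K k B" and alg: "\<And>x. x \<in> carrier K \<Longrightarrow> (F.algebraic over adjoin K k B) x"
    using assms(7) by (simp_all add: transcendence_basis_def)
  have BK: "B \<subseteq> carrier K" using indep by (simp add: algebraically_independent_def)
  have E: "subfield (adjoin K k B) K" by (rule F.generate_field_is_subfield) (use kK BK in simp)
  obtain d where "F.dimension d (adjoin K k B) L" using assms(9) by (rule F.finite_dimensionE')
  \<comment> \<open>A finite list spanning \<open>L\<close> over \<open>k(B)\<close>; its elements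
    form the set \<open>\<Theta>\<close> of the common setting.\<close>
  from F.exists_base[OF E this] obtain Us where Us: "set Us \<subseteq> carrier K" "F.Span (adjoin K k B) Us = L" by auto
  let ?H = "k \<union> (B \<union> set Us)"
  have Hc: "?H \<subseteq> carrier K" using kK BK Us(1) by simp
  have G: "subring (generate_field K ?H) K" by (rule subfieldE(1)[OF F.generate_field_is_subfield[OF Hc]])
  have "adjoin K k B \<subseteq> generate_field K ?H" by (rule F.mono_generate_field[OF _ Hc]) auto
  moreover have "set Us \<subseteq> generate_field K ?H" using generate_field.incl[of _ ?H K] by auto
  ultimately have LG: "L \<subseteq> generate_field K ?H" unfolding Us(2)[symmetric] by (rule F.Span_subset_subring[OF G])
  have R: "subring (generate_ring K ?H) K" by (rule F.generate_ring_is_subring[OF Hc])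
  have insep: "\<exists>q. (q = 1 \<or> (\<exists>p e. Factorial_Ring.prime p \<and> add_pow K (p::nat) \<one>\<^bsub>K\<^esub> = \<zero>\<^bsub>K\<^esub> \<and> q = p ^ e)) \<and>
      (\<exists>u\<in>generate_ring K ?H. \<exists>v\<in>generate_ring K ?H. v \<noteq> \<zero>\<^bsub>K\<^esub> \<and> v \<otimes>\<^bsub>K\<^esub> x [^]\<^bsub>K\<^esub> q = u)"
    if x: "x \<in> carrier K" for x
  proof -
    obtain q where q: "x [^]\<^bsub>K\<^esub> (q::nat) \<in> L"
      "q = 1 \<or> (\<exists>p e. Factorial_Ring.prime p \<and> add_pow K (p::nat) \<one>\<^bsub>K\<^esub> = \<zero>\<^bsub>K\<^esub> \<and> q = p ^ e)"
      using F.power_in_separable_closure[OF E x alg[OF x]] unfolding assms(8) by blast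
    have h: "h \<in> carrier K \<and> (\<exists>u\<in>generate_ring K ?H. \<exists>v\<in>generate_ring K ?H. v \<noteq> \<zero>\<^bsub>K\<^esub> \<and> v \<otimes>\<^bsub>K\<^esub> h = u)"
      if h: "h \<in> ?H" for h
    proof
      show hc: "h \<in> carrier K" using Hc h by blast
      show "\<exists>u\<in>generate_ring K ?H. \<exists>v\<in>generate_ring K ?H. v \<noteq> \<zero>\<^bsub>K\<^esub> \<and> v \<otimes>\<^bsub>K\<^esub> h = u"
        using generate_ring.incl[OF h, of K] generate_ring.one[of K ?H] hc
        by (intro bexI[of _ h] bexI[of _ "\<one>\<^bsub>K\<^esub>"]) simp_all
    qed
    \<comment> \<open>The power lies in \<open>L\<close>, hence in the field generated by
      \<open>?H\<close>, and is therefore a fraction of elements of the ring generated by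
      \<open>?H\<close>.\<close>
    have "x [^]\<^bsub>K\<^esub> q \<in> generate_field K ?H" using LG q(1) by (rule subsetD)
    from F.generate_field_frac[OF R h this] q(2) show ?thesis by blast
  qed
  let ?sm = "\<lambda>c. c \<odot>\<^bsub>A\<^esub> \<one>\<^bsub>A\<^esub>" and ?T = "tensor_product k K A"
  have sm: "ring_hom_cring (K\<lparr>carrier := k\<rparr>) A ?sm" by (rule algebra_structure_hom[OF assms(3)])
  interpret sm: ring_hom_cring "K\<lparr>carrier := k\<rparr>" A ?sm by (rule sm)
  have "\<exists>\<iota> \<kappa>. nonzero_cring ?T \<and> ring_hom_cring K ?T \<iota> \<and> ring_hom_cring A ?T \<kappa> \<and> (\<forall>c\<in>k. \<iota> c = \<kappa> (?sm c)) \<and>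
      (\<forall>H. subring H ?T \<longrightarrow> \<iota> ` carrier K \<subseteq> H \<longrightarrow> \<kappa> ` carrier A \<subseteq> H \<longrightarrow> H = carrier ?T)"
    by (rule tensor_product_properties[OF assms(1-4)]) blast
  then obtain \<iota> \<kappa> where T: "nonzero_cring ?T" and hom: "ring_hom_cring K ?T \<iota>" "ring_hom_cring A ?T \<kappa>"
    and com': "\<forall>c\<in>k. \<iota> c = \<kappa> (?sm c)"
    and gen': "\<forall>H. subring H ?T \<longrightarrow> \<iota> ` carrier K \<subseteq> H \<longrightarrow> \<kappa> ` carrier A \<subseteq> H \<longrightarrow> H = carrier ?T"
    by (elim exE conjE) (rule that)
  note com = com'[rule_format] and gen = gen'[rule_format]
  have ts: "tensor_setting A K ?T k B (set Us) \<iota> \<kappa> ?sm n" if "n \<ge> 1" for n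
    by (rule tensor_setting.intro[OF assms(4) T assms(1,2) hom sm com gen indep finite_set Us(1) insep that])
  \<comment> \<open>If \<open>K\<close> has finite transcendence degree, \<open>B\<close> is finite,
    being one of the bases in the supremum. If \<open>A\<close> has, every residue domain is bounded
    by the same \<open>m\<close>, and the resulting number \<open>2 * m\<close> of elements is
    uniform in the prime.\<close>
  have td: "finite B \<or> (\<exists>M. \<forall>n\<ge>1. tensor_setting.td_bound A k ?sm M)"
    using assms(6)
  proof
    assume "field_trdeg K k < \<infinity>"
    moreover have "ecard B \<le> field_trdeg K k"
      unfolding field_trdeg_def by (rule SUP_upper) (use assms(7) in simp)
    ultimately have "ecard B < \<infinity>" by (rule le_less_trans[rotated])
    then show ?thesis by (auto simp: ecard_def split: if_splits)
  next
    assume "algebra_trdeg A k < \<infinity>"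
    then obtain m where m: "algebra_trdeg A k = enat m" by auto
    have sub: "subring (?sm ` k) A" using sm.ring.img_is_subring[OF sm.R.carrier_is_subring] by simp
    have inv: "\<exists>e\<in>?sm ` k. c \<otimes>\<^bsub>A\<^esub> e = \<one>\<^bsub>A\<^esub>" if c: "c \<in> ?sm ` k" "c \<noteq> \<zero>\<^bsub>A\<^esub>" for c
    proof -
      obtain x where x: "x \<in> k" "c = ?sm x" using c(1) by blast
      have "?sm \<zero>\<^bsub>K\<^esub> = \<zero>\<^bsub>A\<^esub>" using sm.hom_zero by simp
      then have "x \<in> k - {\<zero>\<^bsub>K\<^esub>}" using x c(2) by auto
      note i = F.subfield_m_inv[OF assms(2) this]
      have "c \<otimes>\<^bsub>A\<^esub> ?sm (inv\<^bsub>K\<^esub> x) = ?sm (x \<otimes>\<^bsub>K\<^esub> inv\<^bsub>K\<^esub> x)"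
        using sm.hom_mult[of x "inv\<^bsub>K\<^esub> x"] x i(1) by simp
      also have "\<dots> = \<one>\<^bsub>A\<^esub>" unfolding i(2) using sm.hom_one by simp
      finally show ?thesis using i(1) by blast
    qed
    have "\<exists>V. finite V \<and> card V \<le> 2 * m \<and> V \<subseteq> carrier A \<and>
        (\<forall>a\<in>carrier A. alg_rel A (generate_ring A (?sm ` k \<union> V)) p a)" if p: "p \<in> spec A" for p
    proof (rule domain_trdeg_bound[OF A sub inv p])
      have "domain_trdeg (A Quot p) ((\<lambda>c. p +>\<^bsub>A\<^esub> ?sm c) ` k) \<le> enat m"
        unfolding m[symmetric] algebra_trdeg_def by (rule SUP_upper[OF p])
      then show "domain_trdeg (A Quot p) ((\<lambda>c. p +>\<^bsub>A\<^esub> c) ` ?sm ` k) \<le> enat m" by (simp add: image_image)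
    qed
    \<comment> \<open>\<open>td_bound\<close> does not mention the number \<open>n\<close> of
      variables; the instance with \<open>n = 1\<close> serves to unfold its definition.\<close>
    then have "tensor_setting.td_bound A k ?sm (2 * m)"
      unfolding tensor_setting.td_bound_def[OF ts[OF order_refl]] by blast
    then show ?thesis by blast
  qed
  then obtain M where M: "finite B \<or> tensor_setting.td_bound A k ?sm M" by blast
  show ?thesis
  proof (intro conjI impI)
    assume "stably_strong_S_ring A"
    then show "stably_strong_S_ring ?T"
      unfolding stably_strong_S_ring_def mpoly_ring_eq[of ?T]
      using T tensor_setting.strong_S_transfer[OF ts M] by blast
  next
    assume "universally_catenarian A \<and> MPC ?T"
    then show "universally_catenarian ?T"
      unfolding universally_catenarian_def mpoly_ring_eq[of ?T]
      using T tensor_setting.catenarian_transfer[OF ts M assms(5)] by blast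
  qed
qed

end
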